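(* Let $k$ be a field of characteristic $0$, $n\ge 2$, $\lambda\in k^\times$, and let $\Phi\in \mathrm{Ass}_\lambda(k)$ be even, i.e. $\Phi(-x,-y)=\Phi(x,y)$. Let $k'$ be an extension of $k$ containing square roots $\sqrt{d^2-1}$ for $2\le d\le n-1$ (with $k'\subset\mathbb{R}$ and positive square roots if $k\subset\mathbb{R}$), and let $q=e^{\lambda h}\in k[[h]]$. Let $\rho$ be an infinitesimal representation of the Iwahori–Hecke algebra, i.e. the representation of $\mathfrak{B}_n(k)$ extending a finite-dimensional representation $\rho_0$ of $\mathfrak{S}_n$ over $k$ by $\rho(t_{ij})=2\rho_0((i\ j))$. Write $\rho_0$ as a direct sum of irreducible representations associated with partitions $\alpha_1,\dots,\alpha_m$ of $n$. Then $\widehat\Phi(\rho)$ is isomorphic, over $k'((h))$, to the direct sum of the representations $R_{\alpha_1},\dots,R_{\alpha_m}$ of $B_n$, where $R_\alpha$ is the representation with basis the standard Young tableaux of shape $\alpha$ given, for $1\le r\le n-1$, by: $\sigma_r T=qT$ if $r,r+1$ lie in the same column of $T$; $\sigma_rT=-q^{-1}T$ if $r,r+1$ lie in the same row of $T$; and otherwise, if $T'$ is deduced from $T$ by exchanging $r$ and $r+1$, if the column of $r$ in $T$ precedes that of $r+1$, and if $d$ is the axial distance between $r$ and $r+1$ in $T$, then $\sigma_r$ stabilizes the plane spanned by $T,T'$ and acts on it in the basis $(T,T')$ by the matrix $$M_d^q=\frac{1}{[d]_q}\begin{pmatrix}-q^{-d}&\sqrt{[d+1]_q[d-1]_q}\\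 \sqrt{[d+1]_q[d-1]_q}&q^d\end{pmatrix}.$$ In particular, if $k\subset\mathbb{R}$, these representations are unitary: $R_\alpha(B_n)\subset U_N^{\varepsilon}(k'((h)))$ with $N=\dim R_\alpha$.
   Context: **Associators.** $k\langle\langle x,y\rangle\rangle$ is the algebra of noncommutative formal power series, with its completed Hopf structure for which $x,y$ are primitive; $\mathcal{H}(k)$ is the group of its group-like elements. $\mathcal{T}_n(k)$ is the Lie algebra with generators $t_{ij}$ ($1\le i,j\le n$) and relations $t_{ii}=0$, $t_{ij}=t_{ji}$, $[t_{ij},t_{kl}]=0$ if $\#\{i,j,k,l\}=4$, $[t_{ij},t_{ik}+t_{kj}]=0$ for all $i,j,k$; it is graded by $\deg t_{ij}=1$. For $\lambda\in k$, $\mathrm{Ass}_\lambda(k)$ is the set of $\Phi\in\mathcal{H}(k)$ with $\Phi(y,x)=\Phi(x,y)^{-1}$; $e^{\lambda x/2}\Phi(z,x)e^{\lambda z/2}\Phi(y,z)e^{\lambda y/2}\Phi(x,y)=1$ for $z=-x-y$; and $\Phi(t_{12},t_{23}+t_{24})\Phi(t_{13}+t_{23},t_{34})=\Phi(t_{23},t_{34})\Phi(t_{12}+t_{13},t_{24}+t_{34})\Phi(t_{12},t_{23})$ in the completed enveloping algebra of $\mathcal{T}_4(k)$. **The functor $\widehat\Phi$.** $\mathfrak{B}_n(k)=k\mathfrak{S}_n\ltimes\mathsf{U}\mathcal{T}_n(k)$ with $s\cdot t_{ij}=t_{s(i)s(j)}$; $s_i=(i\ i{+}1)$; $Y_r=t_{1r}+\dots+t_{r-1,r}$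 (so $Y_1=0$). $B_n$ is the braid group with Artin generators $\sigma_1,\dots,\sigma_{n-1}$. For a finite-dimensional representation $\rho:\mathfrak{B}_n(k)\to M_N(k)$ and $\Phi\in\mathrm{Ass}_\lambda(k)$, $\widehat\Phi(\rho):B_n\to GL_N(k[[h]])$ is the representation $$\sigma_i\mapsto \Phi(h\rho(t_{i,i+1}),h\rho(Y_i))\,\rho(s_i)\exp(\lambda h\rho(t_{i,i+1})/2)\,\Phi(h\rho(Y_i),h\rho(t_{i,i+1})).$$ **Tableaux.** The diagram of a partition $\alpha=[\alpha_1\ge\alpha_2\ge\dots]$ has $\alpha_c$ boxes in column $c$; rows are numbered from the bottom, columns from the left; standard tableaux increase from left to right along rows and from bottom to top along columns. The partition $[n]$ (one column) corresponds to the trivial representation of $\mathfrak{S}_n$. If $r$ (resp. $r+1$) lies in column $c$ and row $l$ (resp. column $c'$ and row $l'$) of $T$, the axial distance is $d=l-l'+c'-c$ (it satisfies $d\ge2$ in the situation of the claim). **Other notation.** $[m]_q=(q^m-q^{-m})/(q-q^{-1})$; the square root $\sqrt{[d+1]_q[d-1]_q}$ is the one in $k'[[h]]$ with constant term $\sqrt{d^2-1}$. $\varepsilon$ is the involution $f(h)\mapsto f(-h)$ of $k'((h))$ and $U_N^{\varepsilon}(k'((h)))=\{x\in GL_N(k'((h))) : x^{-1}={}^t\varepsilon(x)\}$. *)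

theory Defs
  imports
    "Jordan_Normal_Form.Matrix"
    "HOL-Algebra.Sym_Groups"
    "HOL-Algebra.QuotRing"
    "HOL-Computational_Algebra.Formal_Laurent_Series"
begin

section \<open>Noncommutative formal power series\<close>

typedef (overloaded) ('g, 'k) ncs = "UNIV :: ('g list \<Rightarrow> 'k) set"
  morphisms ncs_coeff Abs_ncs ..

lemma ncs_coeff_Abs [simp]: "ncs_coeff (Abs_ncs f) = f"
  by (simp add: Abs_ncs_inverse)

lemma ncs_eqI: "(\<And>w. ncs_coeff f w = ncs_coeff g w) \<Longrightarrow> f = g"
  by (metis ext ncs_coeff_inject)

instantiation ncs :: (type, ring_1) ring_1
begin

definition "0 = Abs_ncs (\<lambda>w. 0)"
definition "1 = Abs_ncs (\<lambda>w. if w = [] then 1 else 0)"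
definition "f + g = Abs_ncs (\<lambda>w. ncs_coeff f w + ncs_coeff g w)"
definition "f - g = Abs_ncs (\<lambda>w. ncs_coeff f w - ncs_coeff g w)"
definition "- f = Abs_ncs (\<lambda>w. - ncs_coeff f w)"
definition "f * g =
  Abs_ncs (\<lambda>w. \<Sum>i=0..length w. ncs_coeff f (take i w) * ncs_coeff g (drop i w))"

instance
proof
  fix a b c :: "('a, 'b) ncs"
  note defs = zero_ncs_def one_ncs_def plus_ncs_def minus_ncs_def uminus_ncs_def times_ncs_def
  show "a + b + c = a + (b + c)" "a + b = b + a" "0 + a = a" "- a + a = 0" "a - b = a + - b"
    by (rule ncs_eqI, simp add: defs algebra_simps)+
  show "(0::('a, 'b) ncs) \<noteq> 1"
  proof
    assume "(0::('a, 'b) ncs) = 1"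
    then have "ncs_coeff (0::('a, 'b) ncs) [] = ncs_coeff 1 []" by simp
    then show False by (simp add: defs)
  qed
  show "(a + b) * c = a * c + b * c" "a * (b + c) = a * b + a * c"
    by (rule ncs_eqI, simp add: defs algebra_simps sum.distrib)+
  show "1 * a = a"
  proof (rule ncs_eqI)
    fix w :: "'a list"
    have "(\<Sum>i=0..length w. (if take i w = [] then 1 else 0) * ncs_coeff a (drop i w))
        = (\<Sum>i=0..length w. if i = 0 then ncs_coeff a (drop i w) else 0)"
      by (rule sum.cong) auto
    then show "ncs_coeff (1 * a) w = ncs_coeff a w" by (simp add: defs)
  qed
  show "a * 1 = a"
  proof (rule ncs_eqI)
    fix w :: "'a list"
    have "(\<Sum>i=0..length w. ncs_coeff a (take i w) * (if drop i w = [] then 1 else 0))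
        = (\<Sum>i=0..length w. if i = length w then ncs_coeff a (take i w) else 0)"
      by (rule sum.cong) auto
    then show "ncs_coeff (a * 1) w = ncs_coeff a w" by (simp add: defs)
  qed
  show "a * b * c = a * (b * c)"
  proof (rule ncs_eqI)
    fix w :: "'a list"
    define F where "F i m r = ncs_coeff a (take i w) * (ncs_coeff b (take m (drop i w))
        * ncs_coeff c (drop (length w - r) w))" for i m r
    have "ncs_coeff (a * b * c) w = (\<Sum>j=0..length w. \<Sum>i=0..j. F i (j - i) (length w - j))"
      unfolding defs F_def
      by (auto simp: sum_distrib_right mult.assoc min_def drop_take intro!: sum.cong split: if_splits)
    also have "\<dots> = (\<Sum>j=0..length w. \<Sum>i=0..length w - j. F j i (length w - j - i))"
      by (rule fps_mult_assoc_lemma)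
    also have "\<dots> = ncs_coeff (a * (b * c)) w"
      unfolding defs F_def
      by (auto simp: sum_distrib_left add.commute intro!: sum.cong)
    finally show "ncs_coeff (a * b * c) w = ncs_coeff (a * (b * c)) w" .
  qed
qed

end

definition ncs_gen :: "'g \<Rightarrow> ('g, 'k::ring_1) ncs" where
  "ncs_gen g = Abs_ncs (\<lambda>w. if w = [g] then 1 else 0)"

definition ncs_scale :: "'k::ring_1 \<Rightarrow> ('g, 'k) ncs \<Rightarrow> ('g, 'k) ncs" where
  "ncs_scale c f = Abs_ncs (\<lambda>w. c * ncs_coeff f w)"

text \<open>The exponential of a series with zero constant term: its powers of exponent greater
  than the length of a word do not contribute to the coefficient of that word.\<close>

definition ncs_exp :: "('g, 'k::field_char_0) ncs \<Rightarrow> ('g, 'k) ncs" where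
  "ncs_exp f = Abs_ncs (\<lambda>w. \<Sum>m\<le>length w. ncs_coeff (f ^ m) w / fact m)"

section \<open>Series in two variables and the Hopf structure\<close>

datatype xy = LX | LY

fun sel_xy :: "'a \<Rightarrow> 'a \<Rightarrow> xy \<Rightarrow> 'a" where
  "sel_xy a b LX = a"
| "sel_xy a b LY = b"

text \<open>The substitution \<open>\<Phi>(A,B)\<close> for \<open>A\<close>, \<open>B\<close> with zero constant term.\<close>

definition ncs_subst ::
    "(xy, 'k::field) ncs \<Rightarrow> (xy, 'k) ncs \<Rightarrow> (xy, 'k) ncs \<Rightarrow> (xy, 'k) ncs" where
  "ncs_subst \<Phi> A B = Abs_ncs (\<lambda>w. \<Sum>u | length u \<le> length w.
      ncs_coeff \<Phi> u * ncs_coeff (prod_list (map (sel_xy A B) u)) w)"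

text \<open>The completed tensor square of \<open>k\<langle>\<langle>x,y\<rangle>\<rangle>\<close>: families of coefficients of \<open>u \<otimes> v\<close>.\<close>

type_synonym 'k tens = "xy list \<times> xy list \<Rightarrow> 'k"

definition tens_one :: "'k::field tens" where
  "tens_one = (\<lambda>uv. if uv = ([], []) then 1 else 0)"

definition tens_mult :: "'k::field tens \<Rightarrow> 'k tens \<Rightarrow> 'k tens" where
  "tens_mult F G = (\<lambda>(u, v). \<Sum>i\<le>length u. \<Sum>j\<le>length v.
      F (take i u, take j v) * G (drop i u, drop j v))"

definition tens_prim :: "xy \<Rightarrow> 'k::field tens" where
  "tens_prim a = (\<lambda>uv. if uv = ([a], []) \<or> uv = ([], [a]) then 1 else 0)"

definition coproduct_word :: "xy list \<Rightarrow> 'k::field tens" where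
  "coproduct_word w = foldr (\<lambda>a F. tens_mult (tens_prim a) F) w tens_one"

text \<open>The coproduct of a word is homogeneous of total degree the length of the word.\<close>

definition coproduct :: "(xy, 'k::field) ncs \<Rightarrow> 'k tens" where
  "coproduct \<Phi> = (\<lambda>(u, v). \<Sum>w | length w = length u + length v.
      ncs_coeff \<Phi> w * coproduct_word w (u, v))"

definition group_like :: "(xy, 'k::field) ncs \<Rightarrow> bool" where
  "group_like \<Phi> \<longleftrightarrow> ncs_coeff \<Phi> [] = 1 \<and>
     (\<forall>u v. coproduct \<Phi> (u, v) = ncs_coeff \<Phi> u * ncs_coeff \<Phi> v)"

section \<open>Presented Lie algebras and their enveloping algebras\<close>

datatype ('g, 'k) lie_term =
    LGen 'g
  | LZero
  | LAdd "('g, 'k) lie_term" "('g, 'k) lie_term"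
  | LScale 'k "('g, 'k) lie_term"
  | LBr "('g, 'k) lie_term" "('g, 'k) lie_term"

text \<open>Equality in the Lie algebra over \<open>'k\<close> presented by the relations \<open>R\<close>.\<close>

inductive lie_eq ::
    "(('g, 'k::field) lie_term \<times> ('g, 'k) lie_term) set
      \<Rightarrow> ('g, 'k) lie_term \<Rightarrow> ('g, 'k) lie_term \<Rightarrow> bool"
  for R where
  lie_rel: "(a, b) \<in> R \<Longrightarrow> lie_eq R a b"
| lie_refl: "lie_eq R a a"
| lie_sym: "lie_eq R a b \<Longrightarrow> lie_eq R b a"
| lie_trans: "lie_eq R a b \<Longrightarrow> lie_eq R b c \<Longrightarrow> lie_eq R a c"
| lie_add_cong: "lie_eq R a a' \<Longrightarrow> lie_eq R b b' \<Longrightarrow> lie_eq R (LAdd a b) (LAdd a' b')"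
| lie_scale_cong: "lie_eq R a a' \<Longrightarrow> lie_eq R (LScale s a) (LScale s a')"
| lie_br_cong: "lie_eq R a a' \<Longrightarrow> lie_eq R b b' \<Longrightarrow> lie_eq R (LBr a b) (LBr a' b')"
| lie_add_assoc: "lie_eq R (LAdd (LAdd a b) c) (LAdd a (LAdd b c))"
| lie_add_comm: "lie_eq R (LAdd a b) (LAdd b a)"
| lie_add_zero: "lie_eq R (LAdd a LZero) a"
| lie_add_neg: "lie_eq R (LAdd a (LScale (- 1) a)) LZero"
| lie_scale_add: "lie_eq R (LScale s (LAdd a b)) (LAdd (LScale s a) (LScale s b))"
| lie_add_scale: "lie_eq R (LScale (s + t) a) (LAdd (LScale s a) (LScale t a))"
| lie_scale_scale: "lie_eq R (LScale s (LScale t a)) (LScale (s * t) a)"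
| lie_scale_one: "lie_eq R (LScale 1 a) a"
| lie_br_add_left: "lie_eq R (LBr (LAdd a b) c) (LAdd (LBr a c) (LBr b c))"
| lie_br_add_right: "lie_eq R (LBr a (LAdd b c)) (LAdd (LBr a b) (LBr a c))"
| lie_br_scale_left: "lie_eq R (LBr (LScale s a) b) (LScale s (LBr a b))"
| lie_br_scale_right: "lie_eq R (LBr a (LScale s b)) (LScale s (LBr a b))"
| lie_br_self: "lie_eq R (LBr a a) LZero"
| lie_jacobi: "lie_eq R (LAdd (LBr a (LBr b c)) (LAdd (LBr b (LBr c a)) (LBr c (LBr a b)))) LZero"

definition lie_terms :: "'g set \<Rightarrow> ('g, 'k) lie_term set" where
  "lie_terms X = {a. set1_lie_term a \<subseteq> X}"

text \<open>The free associative algebra on a set of letters.\<close>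

definition free_algebra :: "'g set \<Rightarrow> ('g, 'k::ring_1) ncs ring" where
  "free_algebra X = \<lparr>
     carrier = {f. finite {w. ncs_coeff f w \<noteq> 0} \<and> (\<forall>w. ncs_coeff f w \<noteq> 0 \<longrightarrow> set w \<subseteq> X)},
     mult = (*), one = 1, zero = 0, add = (+)\<rparr>"

lemma ring_free_algebra: "ring (free_algebra X :: ('g, 'k::ring_1) ncs ring)"
proof -
  note defs = zero_ncs_def one_ncs_def plus_ncs_def uminus_ncs_def times_ncs_def
  let ?supp = "\<lambda>f :: ('g, 'k) ncs. {w. ncs_coeff f w \<noteq> 0}"
  define C :: "('g, 'k) ncs set" where "C = {f. finite (?supp f) \<and> ?supp f \<subseteq> lists X}"
  have carr: "carrier (free_algebra X :: ('g, 'k) ncs ring) = C"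
    by (auto simp: free_algebra_def C_def lists_eq_set)
  have "?supp (0 :: ('g, 'k) ncs) = {}" by (auto simp: defs)
  then have C0: "0 \<in> C" by (simp add: C_def)
  have "?supp (1 :: ('g, 'k) ncs) = {[]}" by (auto simp: defs)
  then have C1: "1 \<in> C" by (simp add: C_def)
  have Cadd: "f + g \<in> C" if "f \<in> C" "g \<in> C" for f g
  proof -
    have sub: "?supp (f + g) \<subseteq> ?supp f \<union> ?supp g" by (auto simp: defs)
    have "finite (?supp f \<union> ?supp g)" "?supp f \<union> ?supp g \<subseteq> lists X"
      using that by (auto simp: C_def)
    with sub show ?thesis unfolding C_def by (blast intro: finite_subset)
  qed
  have "?supp (- f) = ?supp f" for f by (auto simp: defs)
  then have Cneg: "- f \<in> C" if "f \<in> C" for f using that by (simp add: C_def)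
  have Cmult: "f * g \<in> C" if "f \<in> C" "g \<in> C" for f g
  proof -
    let ?P = "(\<lambda>(u, v). u @ v) ` (?supp f \<times> ?supp g)"
    have "w \<in> ?P" if w: "w \<in> ?supp (f * g)" for w
    proof -
      have "(\<Sum>i=0..length w. ncs_coeff f (take i w) * ncs_coeff g (drop i w)) \<noteq> 0"
        using w by (simp add: defs)
      then obtain i where "ncs_coeff f (take i w) * ncs_coeff g (drop i w) \<noteq> 0"
        by (rule sum.not_neutral_contains_not_neutral)
      then have "(take i w, drop i w) \<in> ?supp f \<times> ?supp g" by auto
      then show ?thesis by (rule rev_image_eqI) simp
    qed
    then have sub: "?supp (f * g) \<subseteq> ?P" by blast
    have "finite ?P" using that by (simp add: C_def)
    moreover have "?P \<subseteq> lists X" using that by (auto simp: C_def subset_iff lists_eq_set)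
    ultimately show ?thesis using sub unfolding C_def by (blast intro: finite_subset)
  qed
  have inv: "\<exists>g\<in>C. f + g = 0" if "f \<in> C" for f
    using Cneg[OF that] by (intro bexI[of _ "- f"]) simp_all
  show ?thesis
    by (intro ringI abelian_groupI monoidI; unfold carr; simp add: free_algebra_def)
      (simp_all add: C0 C1 Cadd Cmult inv algebra_simps)
qed

text \<open>The enveloping algebra of the Lie algebra \<open>L\<close> with generators \<open>X\<close> and relations \<open>R\<close> is the
  quotient of the free algebra on (representatives of) the elements of \<open>L\<close> by the two-sided ideal
  which makes \<open>ncs_gen\<close> a Lie algebra morphism from \<open>L\<close>.\<close>

definition env_relators ::
    "'g set \<Rightarrow> (('g, 'k::field) lie_term \<times> ('g, 'k) lie_term) set
      \<Rightarrow> (('g, 'k) lie_term, 'k) ncs set" where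
  "env_relators X R =
     {ncs_gen a - ncs_gen b | a b. a \<in> lie_terms X \<and> b \<in> lie_terms X \<and> lie_eq R a b}
   \<union> {ncs_gen (LAdd a b) - (ncs_gen a + ncs_gen b) | a b. a \<in> lie_terms X \<and> b \<in> lie_terms X}
   \<union> {ncs_gen (LScale s a) - ncs_scale s (ncs_gen a) | s a. a \<in> lie_terms X}
   \<union> {ncs_gen (LBr a b) - (ncs_gen a * ncs_gen b - ncs_gen b * ncs_gen a) | a b.
        a \<in> lie_terms X \<and> b \<in> lie_terms X}"

definition env_ideal ::
    "'g set \<Rightarrow> (('g, 'k::field) lie_term \<times> ('g, 'k) lie_term) set
      \<Rightarrow> (('g, 'k) lie_term, 'k) ncs set" where
  "env_ideal X R = genideal (free_algebra (lie_terms X)) (env_relators X R)"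

definition T_gens :: "nat \<Rightarrow> (nat \<times> nat) set" where
  "T_gens n = {1..n} \<times> {1..n}"

definition T_rels ::
    "nat \<Rightarrow> ((nat \<times> nat, 'k::field) lie_term \<times> (nat \<times> nat, 'k) lie_term) set" where
  "T_rels n = (let t = (\<lambda>i j. LGen (i, j)); I = {1..n} in
     {(t i i, LZero) | i. i \<in> I}
   \<union> {(t i j, t j i) | i j. i \<in> I \<and> j \<in> I}
   \<union> {(LBr (t i j) (t k l), LZero) | i j k l.
        i \<in> I \<and> j \<in> I \<and> k \<in> I \<and> l \<in> I \<and> card {i, j, k, l} = 4}
   \<union> {(LBr (t i j) (LAdd (t i k) (t k j)), LZero) | i j k. i \<in> I \<and> j \<in> I \<and> k \<in> I})"

section \<open>Associators\<close>

text \<open>The completion of the graded algebra \<open>U = U(T\<^sub>n)\<close> is the product of its homogeneous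
  components; an element \<open>(u\<^sub>d)\<close> is written as the power series \<open>\<Sum>\<^sub>d u\<^sub>d h\<^sup>d\<close>, with product the Cauchy
  product.  Its coefficients are elements of the free algebra, to be read modulo \<open>env_ideal\<close>.
  For \<open>A\<close>, \<open>B\<close> homogeneous of degree 1, \<open>\<Phi>(A,B)\<close> is then the following series.\<close>

definition graded_subst ::
    "(xy, 'k::field) ncs \<Rightarrow> ('g, 'k) ncs \<Rightarrow> ('g, 'k) ncs \<Rightarrow> ('g, 'k) ncs fps" where
  "graded_subst \<Phi> A B = Abs_fps (\<lambda>d. \<Sum>w | length w = d.
      ncs_scale (ncs_coeff \<Phi> w) (prod_list (map (sel_xy A B) w)))"

definition pentagon :: "(xy, 'k::field) ncs \<Rightarrow> bool" where
  "pentagon \<Phi> \<longleftrightarrow> (let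
       t = (\<lambda>i j. ncs_gen (LGen (i, j)) :: ((nat \<times> nat, 'k) lie_term, 'k) ncs);
       lhs = graded_subst \<Phi> (t 1 2) (t 2 3 + t 2 4) * graded_subst \<Phi> (t 1 3 + t 2 3) (t 3 4);
       rhs = graded_subst \<Phi> (t 2 3) (t 3 4) * graded_subst \<Phi> (t 1 2 + t 1 3) (t 2 4 + t 3 4)
               * graded_subst \<Phi> (t 1 2) (t 2 3)
     in \<forall>d. fps_nth lhs d - fps_nth rhs d \<in> env_ideal (T_gens 4) (T_rels 4))"

definition hexagon :: "'k::field_char_0 \<Rightarrow> (xy, 'k) ncs \<Rightarrow> bool" where
  "hexagon lam \<Phi> \<longleftrightarrow> (let
       x = ncs_gen LX; y = ncs_gen LY; z = - x - y;
       E = (\<lambda>a. ncs_exp (ncs_scale (lam / 2) a))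
     in E x * ncs_subst \<Phi> z x * E z * ncs_subst \<Phi> y z * E y * ncs_subst \<Phi> x y = 1)"

definition Ass :: "'k::field_char_0 \<Rightarrow> (xy, 'k) ncs set" where
  "Ass lam = {\<Phi>. group_like \<Phi>
     \<and> ncs_subst \<Phi> (ncs_gen LY) (ncs_gen LX) * \<Phi> = 1
     \<and> \<Phi> * ncs_subst \<Phi> (ncs_gen LY) (ncs_gen LX) = 1
     \<and> hexagon lam \<Phi> \<and> pentagon \<Phi>}"

definition even_series :: "(xy, 'k::field) ncs \<Rightarrow> bool" where
  "even_series \<Phi> \<longleftrightarrow> ncs_subst \<Phi> (- ncs_gen LX) (- ncs_gen LY) = \<Phi>"

section \<open>Matrix representations\<close>

definition GL :: "nat \<Rightarrow> 'a::semiring_1 mat monoid" where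
  "GL N = units_of (ring_mat TYPE('a) N ())"

definition direct_sum_rep :: "('g \<Rightarrow> 'a::zero mat) list \<Rightarrow> 'g \<Rightarrow> 'a mat" where
  "direct_sum_rep Rs g = diag_block_mat (map (\<lambda>R. R g) Rs)"

definition rep_iso ::
    "('g, 'b) monoid_scheme \<Rightarrow> nat \<Rightarrow> ('g \<Rightarrow> 'a::semiring_1 mat) \<Rightarrow> ('g \<Rightarrow> 'a mat) \<Rightarrow> bool" where
  "rep_iso G N \<rho> \<rho>' \<longleftrightarrow> (\<exists>P \<in> carrier (GL N). \<forall>g \<in> carrier G. P * \<rho> g = \<rho>' g * P)"

section \<open>The braid group\<close>

text \<open>Letters \<open>(i, True)\<close> and \<open>(i, False)\<close> stand for the generator \<open>\<sigma>\<^sub>i\<close> and its inverse.\<close>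

type_synonym braid_word = "(nat \<times> bool) list"

definition braid_words :: "nat \<Rightarrow> braid_word set" where
  "braid_words n = lists ({1..<n} \<times> UNIV)"

inductive braid_eq :: "nat \<Rightarrow> braid_word \<Rightarrow> braid_word \<Rightarrow> bool" for n where
  braid_refl: "u \<in> braid_words n \<Longrightarrow> braid_eq n u u"
| braid_sym: "braid_eq n u v \<Longrightarrow> braid_eq n v u"
| braid_trans: "braid_eq n u v \<Longrightarrow> braid_eq n v w \<Longrightarrow> braid_eq n u w"
| braid_cong: "braid_eq n u u' \<Longrightarrow> braid_eq n v v' \<Longrightarrow> braid_eq n (u @ v) (u' @ v')"
| braid_cancel: "i \<in> {1..<n} \<Longrightarrow> braid_eq n [(i, b), (i, \<not> b)] []"
| braid_far: "i \<in> {1..<n} \<Longrightarrow> j \<in> {1..<n} \<Longrightarrow> i + 2 \<le> j \<Longrightarrow>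
    braid_eq n [(i, True), (j, True)] [(j, True), (i, True)]"
| braid_adjacent: "i \<in> {1..<n} \<Longrightarrow> i + 1 \<in> {1..<n} \<Longrightarrow>
    braid_eq n [(i, True), (i + 1, True), (i, True)] [(i + 1, True), (i, True), (i + 1, True)]"

definition braid_class :: "nat \<Rightarrow> braid_word \<Rightarrow> braid_word set" where
  "braid_class n u = {v. braid_eq n u v}"

definition braid_group :: "nat \<Rightarrow> braid_word set monoid" where
  "braid_group n = \<lparr>carrier = braid_class n ` braid_words n,
     mult = (\<lambda>A B. \<Union>u\<in>A. \<Union>v\<in>B. braid_class n (u @ v)),
     one = braid_class n []\<rparr>"

definition braid_gen :: "nat \<Rightarrow> nat \<Rightarrow> braid_word set" where
  "braid_gen n i = braid_class n [(i, True)]"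

lemma braid_eq_words: "braid_eq n u v \<Longrightarrow> u \<in> braid_words n \<and> v \<in> braid_words n"
  by (induction rule: braid_eq.induct) (auto simp: braid_words_def)

lemma braid_class_eq_iff:
  assumes "u \<in> braid_words n"
  shows "braid_class n u = braid_class n v \<longleftrightarrow> braid_eq n u v"
proof
  assume "braid_class n u = braid_class n v"
  moreover have "u \<in> braid_class n u" using assms by (simp add: braid_class_def braid_refl)
  ultimately have "u \<in> braid_class n v" by simp
  then show "braid_eq n u v" by (simp add: braid_class_def braid_sym)
next
  assume "braid_eq n u v"
  then show "braid_class n u = braid_class n v"
    unfolding braid_class_def by (blast intro: braid_sym braid_trans)
qed

lemma braid_mult_class:
  assumes "u \<in> braid_words n" "v \<in> braid_words n"
  shows "braid_class n u \<otimes>\<^bsub>braid_group n\<^esub> braid_class n v = braid_class n (u @ v)"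
proof -
  have eq: "braid_class n (u' @ v') = braid_class n (u @ v)"
    if "u' \<in> braid_class n u" "v' \<in> braid_class n v" for u' v'
  proof -
    have "braid_eq n (u @ v) (u' @ v')"
      using that by (simp add: braid_class_def braid_cong)
    then show ?thesis using braid_class_eq_iff braid_eq_words by metis
  qed
  have ne: "braid_class n u \<noteq> {}" "braid_class n v \<noteq> {}"
    using assms by (auto simp: braid_class_def intro: braid_refl)
  have "(\<Union>u'\<in>braid_class n u. \<Union>v'\<in>braid_class n v. braid_class n (u' @ v'))
      = (\<Union>u'\<in>braid_class n u. \<Union>v'\<in>braid_class n v. braid_class n (u @ v))"
    by (intro SUP_cong refl eq)
  also have "\<dots> = braid_class n (u @ v)"
    using ne by simp
  finally have "(\<Union>u'\<in>braid_class n u. \<Union>v'\<in>braid_class n v. braid_class n (u' @ v'))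
      = braid_class n (u @ v)" .
  then show ?thesis by (simp add: braid_group_def)
qed

lemma braid_group_carrier: "carrier (braid_group n) = braid_class n ` braid_words n"
  by (simp add: braid_group_def)

lemma braid_group_one: "\<one>\<^bsub>braid_group n\<^esub> = braid_class n []"
  by (simp add: braid_group_def)

lemma braid_words_append [simp]:
  "u @ v \<in> braid_words n \<longleftrightarrow> u \<in> braid_words n \<and> v \<in> braid_words n"
  by (auto simp: braid_words_def)

lemma braid_words_Nil [simp]: "[] \<in> braid_words n"
  by (simp add: braid_words_def)

lemma braid_left_inverse:
  assumes "u \<in> braid_words n"
  shows "\<exists>v \<in> braid_words n. braid_eq n (v @ u) []"
  using assms
proof (induction u)
  case Nil
  then show ?case by (intro bexI[of _ "[]"]) (auto intro: braid_refl)
next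
  case (Cons a u)
  obtain i b where a: "a = (i, b)" by force
  have u: "u \<in> braid_words n" and i: "i \<in> {1..<n}"
    using Cons.prems a by (auto simp: braid_words_def)
  obtain v where v: "v \<in> braid_words n" "braid_eq n (v @ u) []" using Cons.IH u by blast
  have "braid_eq n [(i, \<not> b), (i, b)] []"
    using braid_cancel[OF i, of "\<not> b"] by simp
  then have "braid_eq n (v @ ([(i, \<not> b), (i, b)] @ u)) (v @ ([] @ u))"
    using braid_cong braid_refl u v(1) by meson
  then have "braid_eq n ((v @ [(i, \<not> b)]) @ (a # u)) []"
    using v(2) a by (auto intro: braid_trans)
  moreover have "v @ [(i, \<not> b)] \<in> braid_words n"
    using v(1) i by (auto simp: braid_words_def)
  ultimately show ?case by blast
qed

lemma group_braid_group: "group (braid_group n)"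
proof (rule groupI)
  show "x \<otimes>\<^bsub>braid_group n\<^esub> y \<in> carrier (braid_group n)"
    if "x \<in> carrier (braid_group n)" "y \<in> carrier (braid_group n)" for x y
    using that by (auto simp: braid_group_carrier braid_mult_class)
  show "\<one>\<^bsub>braid_group n\<^esub> \<in> carrier (braid_group n)"
    by (auto simp: braid_group_carrier braid_group_one)
  show "x \<otimes>\<^bsub>braid_group n\<^esub> y \<otimes>\<^bsub>braid_group n\<^esub> z
      = x \<otimes>\<^bsub>braid_group n\<^esub> (y \<otimes>\<^bsub>braid_group n\<^esub> z)"
    if "x \<in> carrier (braid_group n)" "y \<in> carrier (braid_group n)"
      "z \<in> carrier (braid_group n)" for x y z
    using that by (auto simp: braid_group_carrier braid_mult_class)
  show "\<one>\<^bsub>braid_group n\<^esub> \<otimes>\<^bsub>braid_group n\<^esub> x = x"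
    if "x \<in> carrier (braid_group n)" for x
    using that by (auto simp: braid_group_carrier braid_group_one braid_mult_class)
  show "\<exists>y \<in> carrier (braid_group n). y \<otimes>\<^bsub>braid_group n\<^esub> x = \<one>\<^bsub>braid_group n\<^esub>"
    if "x \<in> carrier (braid_group n)" for x
  proof -
    obtain u where u: "u \<in> braid_words n" "x = braid_class n u"
      using \<open>x \<in> carrier (braid_group n)\<close> by (auto simp: braid_group_carrier)
    obtain v where v: "v \<in> braid_words n" "braid_eq n (v @ u) []"
      using braid_left_inverse u(1) by blast
    have "braid_class n (v @ u) = braid_class n []"
      using v braid_class_eq_iff braid_eq_words by blast
    then show ?thesis
      using u v(1) by (auto simp: braid_group_carrier braid_group_one braid_mult_class)
  qed
qed

section \<open>Representations of the infinitesimal braid algebra\<close>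

text \<open>A representation on \<open>k\<^sup>N\<close> of the semidirect product of the group algebra of the symmetric
  group with \<open>U(T\<^sub>n)\<close> is given by its restriction \<open>S\<close> to the symmetric group and by the images
  \<open>t i j\<close> of the generators of \<open>T\<^sub>n\<close>.\<close>

definition inf_braid_rep ::
    "nat \<Rightarrow> nat \<Rightarrow> ((nat \<Rightarrow> nat) \<Rightarrow> 'k::field mat) \<times> (nat \<Rightarrow> nat \<Rightarrow> 'k mat) \<Rightarrow> bool" where
  "inf_braid_rep n N = (\<lambda>(S, t). S \<in> hom (sym_group n) (GL N)
     \<and> (\<forall>i\<in>{1..n}. \<forall>j\<in>{1..n}. t i j \<in> carrier_mat N N)
     \<and> (\<forall>i\<in>{1..n}. t i i = 0\<^sub>m N N)
     \<and> (\<forall>i\<in>{1..n}. \<forall>j\<in>{1..n}. t i j = t j i)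
     \<and> (\<forall>i\<in>{1..n}. \<forall>j\<in>{1..n}. \<forall>k\<in>{1..n}. \<forall>l\<in>{1..n}. card {i, j, k, l} = 4 \<longrightarrow>
          t i j * t k l = t k l * t i j)
     \<and> (\<forall>i\<in>{1..n}. \<forall>j\<in>{1..n}. \<forall>k\<in>{1..n}.
          t i j * (t i k + t k j) = (t i k + t k j) * t i j)
     \<and> (\<forall>s \<in> carrier (sym_group n). \<forall>i\<in>{1..n}. \<forall>j\<in>{1..n}.
          S s * t i j = t (s i) (s j) * S s))"

definition inf_hecke_rep ::
    "nat \<Rightarrow> ((nat \<Rightarrow> nat) \<Rightarrow> 'k::field mat)
      \<Rightarrow> ((nat \<Rightarrow> nat) \<Rightarrow> 'k mat) \<times> (nat \<Rightarrow> nat \<Rightarrow> 'k mat)" where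
  "inf_hecke_rep N \<rho>0 =
     (\<rho>0, \<lambda>i j. if i = j then 0\<^sub>m N N else 2 \<cdot>\<^sub>m \<rho>0 (Transposition.transpose i j))"

lemma GL_mult: "x \<otimes>\<^bsub>GL N\<^esub> y = x * y"
  by (simp add: GL_def units_of_def ring_mat_simps)

lemma GL_carrier_mat: "x \<in> carrier (GL N) \<Longrightarrow> x \<in> carrier_mat N N"
  by (simp add: GL_def units_of_def Units_def ring_mat_simps)

lemma transpose_in_sym_group:
  "i \<in> {1..n} \<Longrightarrow> j \<in> {1..n} \<Longrightarrow> Transposition.transpose i j \<in> carrier (sym_group n)"
  by (simp add: sym_group_carrier permutes_swap_id)

lemma inf_braid_rep_inf_hecke_rep:
  assumes S: "S \<in> hom (sym_group n) (GL N :: 'k::field mat monoid)"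
  shows "inf_braid_rep n N (inf_hecke_rep N S)"
proof -
  let ?T = "Transposition.transpose :: nat \<Rightarrow> nat \<Rightarrow> nat \<Rightarrow> nat"
  define t where "t = (\<lambda>i j. if i = j then 0\<^sub>m N N else 2 \<cdot>\<^sub>m S (?T i j))"
  have t_same: "t i i = 0\<^sub>m N N" for i by (simp add: t_def)
  have t_diff: "t i j = 2 \<cdot>\<^sub>m S (?T i j)" if "i \<noteq> j" for i j using that by (simp add: t_def)
  have C: "S p \<in> carrier_mat N N" if "p \<in> carrier (sym_group n)" for p
    using S that GL_carrier_mat unfolding hom_def by blast
  have M: "S p * S q = S (p \<circ> q)"
    if "p \<in> carrier (sym_group n)" "q \<in> carrier (sym_group n)" for p q
    using S that unfolding hom_def by (auto simp: GL_mult sym_group_mult)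
  have TC: "S (?T i j) \<in> carrier_mat N N" if "i \<in> {1..n}" "j \<in> {1..n}" for i j
    by (rule C[OF transpose_in_sym_group[OF that]])
  have tC: "t i j \<in> carrier_mat N N" if "i \<in> {1..n}" "j \<in> {1..n}" for i j
    using TC[OF that] by (simp add: t_def)
  have tsym: "t i j = t j i" for i j
    by (simp add: t_def Transposition.transpose_commute)
  have conj: "S s * t i j = t (s i) (s j) * S s"
    if s: "s \<in> carrier (sym_group n)" and i: "i \<in> {1..n}" and j: "j \<in> {1..n}" for s i j
  proof (cases "i = j")
    case True
    then show ?thesis using C[OF s] by (simp add: t_same)
  next
    case False
    have p: "s permutes {1..n}" using s by (simp add: sym_group_carrier)
    have inj: "s x = s y \<longleftrightarrow> x = y" for x y using permutes_inj[OF p] by (rule inj_eq)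
    then have ne: "s i \<noteq> s j" using False by simp
    have si: "s i \<in> {1..n}" "s j \<in> {1..n}" using permutes_in_image[OF p] i j by blast+
    have "s \<circ> ?T i j = ?T (s i) (s j) \<circ> s"
      by (rule ext) (simp add: Transposition.transpose_def inj)
    then have "S s * S (?T i j) = S (?T (s i) (s j)) * S s"
      using M[OF s transpose_in_sym_group[OF i j]] M[OF transpose_in_sym_group[OF si] s] by simp
    then show ?thesis
      unfolding t_diff[OF False] t_diff[OF ne]
        mult_smult_distrib[OF C[OF s] TC[OF i j]] mult_smult_assoc_mat[OF TC[OF si] C[OF s]]
      by simp
  qed
  have comm: "t i j * t k l = t (?T i j k) (?T i j l) * t i j"
    if ne: "i \<noteq> j" and i: "i \<in> {1..n}" and j: "j \<in> {1..n}" and k: "k \<in> {1..n}"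
      and l: "l \<in> {1..n}" for i j k l
  proof -
    have kl: "?T i j k \<in> {1..n}" "?T i j l \<in> {1..n}"
      using i j k l by (auto simp: Transposition.transpose_def)
    show ?thesis
      unfolding t_diff[OF ne] mult_smult_assoc_mat[OF TC[OF i j] tC[OF k l]]
        mult_smult_distrib[OF tC[OF kl] TC[OF i j]] conj[OF transpose_in_sym_group[OF i j] k l] ..
  qed
  have rel4: "t i j * t k l = t k l * t i j"
    if i: "i \<in> {1..n}" and j: "j \<in> {1..n}" and k: "k \<in> {1..n}" and l: "l \<in> {1..n}"
      and c: "card {i, j, k, l} = 4" for i j k l
  proof -
    have ne: "i \<noteq> j" "k \<noteq> i" "k \<noteq> j" "l \<noteq> i" "l \<noteq> j"
      using c by (auto simp: card_insert_if split: if_splits)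
    have "?T i j k = k" "?T i j l = l" using ne by (simp_all add: Transposition.transpose_def)
    with comm[OF ne(1) i j k l] show ?thesis by simp
  qed
  have rel3: "t i j * (t i k + t k j) = (t i k + t k j) * t i j"
    if i: "i \<in> {1..n}" and j: "j \<in> {1..n}" and k: "k \<in> {1..n}" for i j k
  proof (cases "i = j \<or> k = i \<or> k = j")
    case True
    consider "k = i \<or> k = j" | "i = j" using True by blast
    then show ?thesis
    proof cases
      case 1
      then have "t i k + t k j = t i j" using tC[OF i j] by (auto simp: t_same)
      then show ?thesis by simp
    next
      case 2
      have c: "t i k + t k j \<in> carrier_mat N N" using tC[OF i k] tC[OF k j] by simp
      have "t i j = 0\<^sub>m N N" using 2 t_same by simp
      then show ?thesis
        by (simp only: left_mult_zero_mat[OF c] right_mult_zero_mat[OF c])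
    qed
  next
    case False
    then have ne: "i \<noteq> j" by simp
    have T: "?T i j i = j" "?T i j j = i" "?T i j k = k"
      using False by (simp_all add: Transposition.transpose_def)
    have "t i j * (t i k + t k j) = t i j * t i k + t i j * t k j"
      by (rule mult_add_distrib_mat[OF tC[OF i j] tC[OF i k] tC[OF k j]])
    also have "\<dots> = t k j * t i j + t i k * t i j"
      using comm[OF ne i j i k] comm[OF ne i j k j] tsym[of j k] tsym[of k i] by (simp add: T)
    also have "\<dots> = t i k * t i j + t k j * t i j"
      by (rule comm_add_mat[OF mult_carrier_mat[OF tC[OF k j] tC[OF i j]]
            mult_carrier_mat[OF tC[OF i k] tC[OF i j]]])
    also have "\<dots> = (t i k + t k j) * t i j"
      by (rule add_mult_distrib_mat[OF tC[OF i k] tC[OF k j] tC[OF i j], symmetric])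
    finally show ?thesis .
  qed
  have eq: "inf_hecke_rep N S = (S, t)" by (simp add: inf_hecke_rep_def t_def)
  show ?thesis
    unfolding inf_braid_rep_def eq prod.case
    by (intro conjI ballI impI S tC t_same tsym rel4 rel3 conj)
qed

text \<open>For square matrices \<open>A\<close>, \<open>B\<close> over \<open>k\<close>, the matrices \<open>\<Phi>(hA, hB)\<close> and \<open>exp(hA)\<close> over \<open>k[[h]]\<close>.\<close>

definition subst_mat_h ::
    "nat \<Rightarrow> (xy, 'k::field) ncs \<Rightarrow> 'k mat \<Rightarrow> 'k mat \<Rightarrow> 'k fps mat" where
  "subst_mat_h N \<Phi> A B = mat N N (\<lambda>(a, b). Abs_fps (\<lambda>d. \<Sum>w | length w = d.
      ncs_coeff \<Phi> w * foldr (*) (map (sel_xy A B) w) (1\<^sub>m N) $$ (a, b)))"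

definition exp_mat_h :: "nat \<Rightarrow> 'k::field_char_0 mat \<Rightarrow> 'k fps mat" where
  "exp_mat_h N A = mat N N (\<lambda>(a, b). Abs_fps (\<lambda>d. (A ^\<^sub>m d) $$ (a, b) / fact d))"

definition Y_mat :: "nat \<Rightarrow> (nat \<Rightarrow> nat \<Rightarrow> 'k::field mat) \<Rightarrow> nat \<Rightarrow> 'k mat" where
  "Y_mat N t r = mat N N (\<lambda>(a, b). \<Sum>i=1..<r. t i r $$ (a, b))"

definition Phi_hat_gen ::
    "(xy, 'k::field_char_0) ncs \<Rightarrow> 'k \<Rightarrow> nat
      \<Rightarrow> ((nat \<Rightarrow> nat) \<Rightarrow> 'k mat) \<times> (nat \<Rightarrow> nat \<Rightarrow> 'k mat) \<Rightarrow> nat \<Rightarrow> 'k fps mat" where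
  "Phi_hat_gen \<Phi> lam N = (\<lambda>(S, t) i.
     subst_mat_h N \<Phi> (t i (i + 1)) (Y_mat N t i)
     * map_mat fps_const (S (Transposition.transpose i (i + 1)))
     * exp_mat_h N ((lam / 2) \<cdot>\<^sub>m t i (i + 1))
     * subst_mat_h N \<Phi> (Y_mat N t i) (t i (i + 1)))"

text \<open>Extension of scalars from \<open>k[[h]]\<close> to \<open>k'((h))\<close> along \<open>\<iota> : k \<rightarrow> k'\<close>.\<close>

definition base_change :: "('k::zero \<Rightarrow> 'l::zero) \<Rightarrow> 'k fps mat \<Rightarrow> 'l fls mat" where
  "base_change \<iota> = map_mat (\<lambda>f. fps_to_fls (Abs_fps (\<lambda>d. \<iota> (fps_nth f d))))"

section \<open>Partitions, tableaux and irreducible representations of the symmetric group\<close>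

definition is_partition :: "nat \<Rightarrow> nat list \<Rightarrow> bool" where
  "is_partition n \<alpha> \<longleftrightarrow> sorted_wrt (\<ge>) \<alpha> \<and> 0 \<notin> set \<alpha> \<and> sum_list \<alpha> = n"

text \<open>Boxes are pairs (column, row), both counted from 0; the parts are the column lengths.\<close>

definition diagram :: "nat list \<Rightarrow> (nat \<times> nat) set" where
  "diagram \<alpha> = {(c, l). c < length \<alpha> \<and> l < \<alpha> ! c}"

definition fillings :: "nat list \<Rightarrow> (nat \<times> nat \<Rightarrow> nat) set" where
  "fillings \<alpha> = {T. bij_betw T (diagram \<alpha>) {1..sum_list \<alpha>} \<and> (\<forall>b. b \<notin> diagram \<alpha> \<longrightarrow> T b = 0)}"

definition box_of :: "nat list \<Rightarrow> (nat \<times> nat \<Rightarrow> nat) \<Rightarrow> nat \<Rightarrow> nat \<times> nat" where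
  "box_of \<alpha> T r = the_inv_into (diagram \<alpha>) T r"

definition col_of :: "nat list \<Rightarrow> (nat \<times> nat \<Rightarrow> nat) \<Rightarrow> nat \<Rightarrow> nat" where
  "col_of \<alpha> T r = fst (box_of \<alpha> T r)"

definition row_of :: "nat list \<Rightarrow> (nat \<times> nat \<Rightarrow> nat) \<Rightarrow> nat \<Rightarrow> nat" where
  "row_of \<alpha> T r = snd (box_of \<alpha> T r)"

definition standard_tableaux :: "nat list \<Rightarrow> (nat \<times> nat \<Rightarrow> nat) set" where
  "standard_tableaux \<alpha> = {T \<in> fillings \<alpha>.
     (\<forall>c c' l. (c, l) \<in> diagram \<alpha> \<longrightarrow> (c', l) \<in> diagram \<alpha> \<longrightarrow> c < c' \<longrightarrow> T (c, l) < T (c', l)) \<and>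
     (\<forall>c l l'. (c, l) \<in> diagram \<alpha> \<longrightarrow> (c, l') \<in> diagram \<alpha> \<longrightarrow> l < l' \<longrightarrow> T (c, l) < T (c, l'))}"

lemma finite_standard_tableaux: "finite (standard_tableaux \<alpha>)"
proof -
  have "diagram \<alpha> \<subseteq> (\<Union>c<length \<alpha>. Pair c ` {..<\<alpha> ! c})"
    by (auto simp: diagram_def)
  then have fin: "finite (diagram \<alpha>)" by (rule finite_subset) auto
  have "standard_tableaux \<alpha> \<subseteq>
      {T. \<forall>b. (b \<in> diagram \<alpha> \<longrightarrow> T b \<in> {1..sum_list \<alpha>}) \<and> (b \<notin> diagram \<alpha> \<longrightarrow> T b = 0)}"
    by (auto simp: standard_tableaux_def fillings_def bij_betw_def)
  then show ?thesis
    by (rule finite_subset) (rule finite_set_of_finite_funs[OF fin finite_atLeastAtMost])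
qed

subsection \<open>Young symmetrizers\<close>

text \<open>Elements of the group algebra of the symmetric group are coefficient functions which vanish
  outside the permutations of \<open>{1..n}\<close>.\<close>

definition gralg_mult ::
    "nat \<Rightarrow> ((nat \<Rightarrow> nat) \<Rightarrow> 'k::field) \<Rightarrow> ((nat \<Rightarrow> nat) \<Rightarrow> 'k) \<Rightarrow> (nat \<Rightarrow> nat) \<Rightarrow> 'k" where
  "gralg_mult n f g = (\<lambda>p. if p permutes {1..n}
     then \<Sum>s | s permutes {1..n}. f s * g (Hilbert_Choice.inv s \<circ> p) else 0)"

definition gralg :: "nat \<Rightarrow> ((nat \<Rightarrow> nat) \<Rightarrow> 'k::field) set" where
  "gralg n = {f. \<forall>p. \<not> p permutes {1..n} \<longrightarrow> f p = 0}"

definition gralg_of :: "(nat \<Rightarrow> nat) \<Rightarrow> (nat \<Rightarrow> nat) \<Rightarrow> 'k::field" where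
  "gralg_of s = (\<lambda>p. if p = s then 1 else 0)"

definition col_stabilizer :: "nat list \<Rightarrow> (nat \<times> nat \<Rightarrow> nat) \<Rightarrow> (nat \<Rightarrow> nat) set" where
  "col_stabilizer \<alpha> T = {p. p permutes {1..sum_list \<alpha>} \<and>
     (\<forall>r\<in>{1..sum_list \<alpha>}. col_of \<alpha> T (p r) = col_of \<alpha> T r)}"

definition row_stabilizer :: "nat list \<Rightarrow> (nat \<times> nat \<Rightarrow> nat) \<Rightarrow> (nat \<Rightarrow> nat) set" where
  "row_stabilizer \<alpha> T = {p. p permutes {1..sum_list \<alpha>} \<and>
     (\<forall>r\<in>{1..sum_list \<alpha>}. row_of \<alpha> T (p r) = row_of \<alpha> T r)}"

text \<open>As the parts of \<open>\<alpha>\<close> are the lengths of the columns, it is the column stabilizer which is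
  symmetrized, so that the partition \<open>[n]\<close> gives the trivial representation.\<close>

definition young_symmetrizer ::
    "nat list \<Rightarrow> (nat \<times> nat \<Rightarrow> nat) \<Rightarrow> (nat \<Rightarrow> nat) \<Rightarrow> 'k::field" where
  "young_symmetrizer \<alpha> T = gralg_mult (sum_list \<alpha>)
     (\<lambda>p. if p \<in> col_stabilizer \<alpha> T then 1 else 0)
     (\<lambda>p. if p \<in> row_stabilizer \<alpha> T then of_int (sign p) else 0)"

text \<open>\<open>S\<close> is, in some basis, the left ideal of the group algebra generated by a Young symmetrizer
  of shape \<open>\<alpha>\<close>, i.e. the irreducible representation associated with \<open>\<alpha>\<close>.\<close>

definition is_irrep_of ::
    "nat \<Rightarrow> nat list \<Rightarrow> ((nat \<Rightarrow> nat) \<Rightarrow> 'k::field mat) \<Rightarrow> bool" where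
  "is_irrep_of n \<alpha> S \<longleftrightarrow> (\<exists>d. S \<in> hom (sym_group n) (GL d) \<and>
     (\<exists>T \<in> fillings \<alpha>. \<exists>\<phi> :: 'k vec \<Rightarrow> (nat \<Rightarrow> nat) \<Rightarrow> 'k.
        bij_betw \<phi> (carrier_vec d) {gralg_mult n f (young_symmetrizer \<alpha> T) | f. f \<in> gralg n}
      \<and> (\<forall>v \<in> carrier_vec d. \<forall>w \<in> carrier_vec d. \<phi> (v + w) = (\<lambda>p. \<phi> v p + \<phi> w p))
      \<and> (\<forall>c. \<forall>v \<in> carrier_vec d. \<phi> (c \<cdot>\<^sub>v v) = (\<lambda>p. c * \<phi> v p))
      \<and> (\<forall>s \<in> carrier (sym_group n). \<forall>v \<in> carrier_vec d.
           \<phi> (S s *\<^sub>v v) = gralg_mult n (gralg_of s) (\<phi> v))))"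

section \<open>The representations \<open>R\<^sub>\<alpha>\<close> of the braid group\<close>

definition q_of :: "'l::field_char_0 \<Rightarrow> 'l fls" where
  "q_of lam = fps_to_fls (fps_exp lam)"

definition q_num :: "'l::field_char_0 \<Rightarrow> nat \<Rightarrow> 'l fls" where
  "q_num lam m =
     (q_of lam ^ m - inverse (q_of lam) ^ m) / (q_of lam - inverse (q_of lam))"

text \<open>The square root of \<open>[d+1]\<^sub>q [d-1]\<^sub>q\<close> with constant term \<open>rt d\<close>, a chosen square root of
  \<open>d\<^sup>2 - 1\<close>.\<close>

definition q_sqrt :: "'l::field_char_0 \<Rightarrow> (nat \<Rightarrow> 'l) \<Rightarrow> nat \<Rightarrow> 'l fls" where
  "q_sqrt lam rt d = fps_to_fls (THE f. fps_nth f 0 = rt d \<and>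
     (fps_to_fls f)\<^sup>2 = q_num lam (d + 1) * q_num lam (d - 1))"

definition M_mat :: "'l::field_char_0 \<Rightarrow> (nat \<Rightarrow> 'l) \<Rightarrow> nat \<Rightarrow> 'l fls mat" where
  "M_mat lam rt d = (1 / q_num lam d) \<cdot>\<^sub>m mat_of_rows_list 2
     [[- (inverse (q_of lam) ^ d), q_sqrt lam rt d],
      [q_sqrt lam rt d,          q_of lam ^ d]]"

definition axial_dist :: "nat list \<Rightarrow> (nat \<times> nat \<Rightarrow> nat) \<Rightarrow> nat \<Rightarrow> nat" where
  "axial_dist \<alpha> T r = nat (int (row_of \<alpha> T r) - int (row_of \<alpha> T (r + 1))
     + int (col_of \<alpha> T (r + 1)) - int (col_of \<alpha> T r))"

text \<open>\<open>R_coeff lam rt \<alpha> r T U\<close> is the coefficient of \<open>U\<close> in \<open>\<sigma>\<^sub>r T\<close>.  In the last case \<open>T\<close> is the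
  second vector of the basis \<open>(T', T)\<close> of the plane, where \<open>r\<close> precedes \<open>r + 1\<close> in \<open>T'\<close>.\<close>

definition R_coeff ::
    "'l::field_char_0 \<Rightarrow> (nat \<Rightarrow> 'l) \<Rightarrow> nat list \<Rightarrow> nat
      \<Rightarrow> (nat \<times> nat \<Rightarrow> nat) \<Rightarrow> (nat \<times> nat \<Rightarrow> nat) \<Rightarrow> 'l fls" where
  "R_coeff lam rt \<alpha> r T U = (let T' = Transposition.transpose r (r + 1) \<circ> T in
     if col_of \<alpha> T r = col_of \<alpha> T (r + 1) then
       (if U = T then q_of lam else 0)
     else if row_of \<alpha> T r = row_of \<alpha> T (r + 1) then
       (if U = T then - inverse (q_of lam) else 0)
     else if col_of \<alpha> T r < col_of \<alpha> T (r + 1) then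
       (let M = M_mat lam rt (axial_dist \<alpha> T r) in
        if U = T then M $$ (0, 0) else if U = T' then M $$ (1, 0) else 0)
     else
       (let M = M_mat lam rt (axial_dist \<alpha> T' r) in
        if U = T' then M $$ (0, 1) else if U = T then M $$ (1, 1) else 0))"

definition tableaux_list :: "nat list \<Rightarrow> (nat \<times> nat \<Rightarrow> nat) list" where
  "tableaux_list \<alpha> = (SOME Ts. set Ts = standard_tableaux \<alpha> \<and> distinct Ts)"

lemma tableaux_list:
  "set (tableaux_list \<alpha>) = standard_tableaux \<alpha>" "distinct (tableaux_list \<alpha>)"
  using someI_ex[OF finite_distinct_list[OF finite_standard_tableaux[of \<alpha>]]]
  unfolding tableaux_list_def by auto

definition R_dim :: "nat list \<Rightarrow> nat" where
  "R_dim \<alpha> = card (standard_tableaux \<alpha>)"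

definition R_gen ::
    "'l::field_char_0 \<Rightarrow> (nat \<Rightarrow> 'l) \<Rightarrow> nat list \<Rightarrow> nat \<Rightarrow> 'l fls mat" where
  "R_gen lam rt \<alpha> r = mat (R_dim \<alpha>) (R_dim \<alpha>) (\<lambda>(a, b).
     R_coeff lam rt \<alpha> r (tableaux_list \<alpha> ! b) (tableaux_list \<alpha> ! a))"

definition fls_eps :: "'l::field fls \<Rightarrow> 'l fls" where
  "fls_eps f = Abs_fls (\<lambda>m. if even m then fls_nth f m else - fls_nth f m)"

lemma fls_nth_fls_eps:
  "fls_nth (fls_eps f) m = (if even m then fls_nth f m else - fls_nth f m)"
proof -
  have "\<forall>\<^sub>\<infinity>k::nat. (if even (- int k) then fls_nth f (- int k) else - fls_nth f (- int k)) = 0"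
    using fls_nth[of f] by (auto simp: MOST_mono elim: MOST_mono)
  then show ?thesis
    unfolding fls_eps_def by (subst Abs_fls_inverse) auto
qed

definition U_eps :: "nat \<Rightarrow> 'l::field fls mat set" where
  "U_eps N = {x \<in> carrier (GL N). inv\<^bsub>GL N\<^esub> x = transpose_mat (map_mat fls_eps x)}"

end

theory Submission
  imports Defs
begin

text \<open>In Young's orthogonal form the Jucys--Murphy element \<open>Y\<^sub>r / 2\<close> acts on the vector of a standard
  tableau \<open>T\<close> by the content of the box of \<open>r\<close>, so \<open>s\<^sub>r\<close>, the generator
  \<open>t\<^sub>i\<^sub>j\<close> with \<open>(i, j) = (r, r + 1)\<close>, which acts as \<open>2 s\<^sub>r\<close>, and \<open>Y\<^sub>r\<close> all preserve the plane spanned by \<open>T\<close> and \<open>T' = s\<^sub>r T\<close>, and \<open>\<sigma>\<^sub>r\<close> acts there by a series in two-by-two matrices.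
  With \<open>B\<close> the diagonal matrix of \<open>Y\<^sub>r\<close> and \<open>Z\<close> its trace, the hexagon becomes
  \<open>\<sigma> e\<^sup>B \<sigma> = e\<^sup>Z\<^sup>-\<^sup>B\<close> (with \<open>h\<close> and \<open>\<lambda>\<close> absorbed into \<open>B\<close>); together with the eigenvalues \<open>q\<close>, \<open>-q\<^sup>-\<^sup>1\<close> of \<open>\<sigma>\<close>
  this determines the diagonal of \<open>\<sigma>\<close>.  Evenness of \<open>\<Phi>\<close> makes \<open>\<sigma>\<close> symmetric, hence the
  off-diagonal entry is a square root whose sign is read off at \<open>h = 0\<close>: \<open>\<sigma>\<close> is \<open>M\<^sub>d\<^sup>q\<close>.  Over \<open>k'\<close> an
  irreducible representation given by a Young symmetrizer is isomorphic to the orthogonal form, and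
  this isomorphism, constant in \<open>h\<close>, carries \<open>\<Phi>\<close>-hat to the sum of the \<open>R\<^sub>\<alpha>\<close>.\<close>

section \<open>Braid and Coxeter relations\<close>

text \<open>One computation serves both sides: matrices with diagonal entries \<open>a d\<close>,
  \<open>a (- d)\<close> and off-diagonal entry \<open>b d\<close>, for the axial distance d,
  satisfy quadratic and braid relations as soon as a few identities in \<open>a\<close>,
  \<open>b\<close>, \<open>z\<close> hold. z = 0 gives Young's form, z = q - 1/q gives R_\<alpha>.
  The hexagon also contains an unknown value of \<Phi>. In the plane its third variable is sBs minus
  a scalar. Scalar shifts do not change an even group-like series, and as s exchanges B and sBs, the
  unknown factor s \<Phi>(B, sBs) is an involution and cancels in \<sigma> e^B \<sigma>. The square
  root in M_d is not constructed separately: it is the off-diagonal entry of \<sigma> for the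
  contents d and 0. The other obstacle is that Phi-hat is given on generators only and must become a
  homomorphism over k[[h]], not merely over k'((h)). Its braid relations are pulled back from the
  R_\<alpha> along an injective change of scalars. Its invertibility comes from the Hecke relation,
  whose coefficient q - 1/q already lies in k[[h]].\<close>

locale braid_images = group G for G (structure) +
  fixes n :: nat and X :: "nat \<Rightarrow> 'a"
  assumes X_closed: "i \<in> {1..<n} \<Longrightarrow> X i \<in> carrier G"
    and X_far: "i \<in> {1..<n} \<Longrightarrow> j \<in> {1..<n} \<Longrightarrow> i + 2 \<le> j \<Longrightarrow> X i \<otimes> X j = X j \<otimes> X i"
    and X_adjacent: "i \<in> {1..<n} \<Longrightarrow> i + 1 \<in> {1..<n} \<Longrightarrow>
      X i \<otimes> X (i + 1) \<otimes> X i = X (i + 1) \<otimes> X i \<otimes> X (i + 1)"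
begin

definition braid_letter :: "nat \<times> bool \<Rightarrow> 'a" where
  "braid_letter a = (if snd a then X (fst a) else inv (X (fst a)))"

definition braid_eval :: "braid_word \<Rightarrow> 'a" where
  "braid_eval w = foldr (\<lambda>a g. braid_letter a \<otimes> g) w \<one>"

lemma braid_letter_closed: "fst a \<in> {1..<n} \<Longrightarrow> braid_letter a \<in> carrier G"
  using X_closed by (auto simp: braid_letter_def)

lemma braid_eval_closed: "w \<in> braid_words n \<Longrightarrow> braid_eval w \<in> carrier G"
  by (induction w) (auto simp: braid_eval_def braid_words_def intro!: braid_letter_closed)

lemma braid_eval_append:
  "u \<in> braid_words n \<Longrightarrow> v \<in> braid_words n \<Longrightarrow>
    braid_eval (u @ v) = braid_eval u \<otimes> braid_eval v"
proof (induction u)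
  case Nil
  then show ?case using braid_eval_closed[of v] by (simp add: braid_eval_def)
next
  case (Cons a u)
  have a: "fst a \<in> {1..<n}" and u: "u \<in> braid_words n"
    using Cons.prems by (auto simp: braid_words_def)
  have "braid_eval (a # u @ v) = braid_letter a \<otimes> braid_eval (u @ v)"
    by (simp add: braid_eval_def)
  then show ?case
    using Cons.IH[OF u Cons.prems(2)] braid_letter_closed[OF a] braid_eval_closed[OF u]
      braid_eval_closed[OF Cons.prems(2)]
    by (simp add: braid_eval_def m_assoc)
qed

lemma braid_eval_eq: "braid_eq n u v \<Longrightarrow> braid_eval u = braid_eval v"
proof (induction rule: braid_eq.induct)
  case (braid_cong u u' v v')
  then show ?case using braid_eq_words by (metis braid_eval_append)
next
  case (braid_cancel i b)
  then show ?case using X_closed[of i] by (simp add: braid_eval_def braid_letter_def)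
next
  case (braid_far i j)
  then show ?case using X_closed[of i] X_closed[of j] X_far[of i j]
    by (simp add: braid_eval_def braid_letter_def)
next
  case (braid_adjacent i)
  then show ?case using X_closed[of i] X_closed[of "i + 1"] X_adjacent[of i]
    by (simp add: braid_eval_def braid_letter_def m_assoc)
qed auto

text \<open>The word chosen in the class does not matter: words of one class have the same value by
  \<open>braid_eval_eq\<close>.\<close>

definition braid_hom :: "braid_word set \<Rightarrow> 'a" where
  "braid_hom A = braid_eval (SOME u. u \<in> A)"

lemma braid_hom_class:
  assumes "u \<in> braid_words n"
  shows "braid_hom (braid_class n u) = braid_eval u"
proof -
  have "u \<in> braid_class n u" using assms by (simp add: braid_class_def braid_refl)
  then have "(SOME v. v \<in> braid_class n u) \<in> braid_class n u" by (rule someI)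
  then have "braid_eq n u (SOME v. v \<in> braid_class n u)" by (simp add: braid_class_def)
  then show ?thesis unfolding braid_hom_def by (metis braid_eval_eq)
qed

lemma braid_hom_hom: "braid_hom \<in> hom (braid_group n) G"
  by (rule homI) (auto simp: braid_group_carrier braid_mult_class braid_hom_class
      braid_eval_closed braid_eval_append)

lemma braid_hom_gen: "i \<in> {1..<n} \<Longrightarrow> braid_hom (braid_gen n i) = X i"
  using X_closed[of i]
  by (simp add: braid_gen_def braid_hom_class braid_words_def braid_eval_def braid_letter_def)

text \<open>The product X_j X_(j+1) ... X_(m-1), empty for j = m. For adjacent transpositions it is
  the cycle that carries m to j, a representative of a coset of S_(m-1) in S_m; this is why products
  of this shape are studied.\<close>

definition ascent :: "nat \<Rightarrow> nat \<Rightarrow> 'a" where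
  "ascent j m = foldr (\<lambda>i g. X i \<otimes> g) [j..<m] \<one>"

lemma ascent_closed: "1 \<le> j \<Longrightarrow> m \<le> n \<Longrightarrow> ascent j m \<in> carrier G"
proof -
  assume "1 \<le> j" "m \<le> n"
  then have "set [j..<m] \<subseteq> {1..<n}" by auto
  moreover have "set is \<subseteq> {1..<n} \<Longrightarrow> foldr (\<lambda>i g. X i \<otimes> g) is \<one> \<in> carrier G" for "is"
    by (induction "is") (auto intro!: m_closed X_closed)
  ultimately show ?thesis unfolding ascent_def by blast
qed

lemma ascent_rec: "j < m \<Longrightarrow> ascent j m = X j \<otimes> ascent (Suc j) m"
  by (simp add: ascent_def upt_conv_Cons)

lemma ascent_refl: "ascent m m = \<one>"
  by (simp add: ascent_def)

lemma ascent_far: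
  assumes "1 \<le> i" "i + 2 \<le> j" "j \<le> m" "m \<le> n"
  shows "X i \<otimes> ascent j m = ascent j m \<otimes> X i"
  using assms(3,1,2,4)
proof (induction rule: inc_induct)
  case base
  then show ?case using X_closed[of i] by (simp add: ascent_refl)
next
  case (step k)
  have c: "X i \<in> carrier G" "X k \<in> carrier G" "ascent (Suc k) m \<in> carrier G"
    using step by (auto intro!: X_closed ascent_closed)
  have "X i \<otimes> (X k \<otimes> ascent (Suc k) m) = X i \<otimes> X k \<otimes> ascent (Suc k) m"
    using c by (simp add: m_assoc)
  also have "\<dots> = X k \<otimes> (X i \<otimes> ascent (Suc k) m)"
    using c X_far[of i k] step by (simp add: m_assoc)
  also have "\<dots> = X k \<otimes> (ascent (Suc k) m \<otimes> X i)"
    using step by simp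
  finally show ?case using c step by (simp add: ascent_rec m_assoc)
qed

text \<open>The braid relation is needed only once, when the ascent starts at i - 1; every earlier
  letter commutes with \<open>X i\<close>. Hence the induction on j downwards from i - 1.\<close>

lemma ascent_shift:
  assumes "1 \<le> j" "j < i" "i < m" "m \<le> n"
  shows "X i \<otimes> ascent j m = ascent j m \<otimes> X (i - 1)"
proof -
  have "j \<le> i - 1" using assms by simp
  then show ?thesis using assms(1)
  proof (induction rule: inc_induct)
    case base
    define k where "k = i - 1"
    have i: "i = Suc k" "1 \<le> k" using assms k_def base by auto
    have "Suc k < m" using assms i by simp
    then have rec: "ascent k m = X k \<otimes> (X (Suc k) \<otimes> ascent (Suc (Suc k)) m)"
        "ascent (Suc k) m = X (Suc k) \<otimes> ascent (Suc (Suc k)) m"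
      by (simp_all add: ascent_rec)
    have c: "X k \<in> carrier G" "X (Suc k) \<in> carrier G" "ascent (Suc (Suc k)) m \<in> carrier G"
      using assms i by (auto intro!: X_closed ascent_closed)
    have far: "X k \<otimes> ascent (Suc (Suc k)) m = ascent (Suc (Suc k)) m \<otimes> X k"
      by (rule ascent_far) (use assms i in auto)
    have "X (Suc k) \<otimes> (X k \<otimes> (X (Suc k) \<otimes> ascent (Suc (Suc k)) m))
        = (X (Suc k) \<otimes> X k \<otimes> X (Suc k)) \<otimes> ascent (Suc (Suc k)) m"
      using c by (simp add: m_assoc)
    also have "\<dots> = (X k \<otimes> X (Suc k) \<otimes> X k) \<otimes> ascent (Suc (Suc k)) m"
      using X_adjacent[of k] assms i by simp
    also have "\<dots> = X k \<otimes> (X (Suc k) \<otimes> ascent (Suc (Suc k)) m) \<otimes> X k"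
      using c far by (simp add: m_assoc)
    finally have "X (Suc k) \<otimes> ascent k m = ascent k m \<otimes> X k"
      unfolding rec .
    then show ?case by (simp add: i(1))
  next
    case (step k)
    have c: "X k \<in> carrier G" "X i \<in> carrier G" "X (i - 1) \<in> carrier G"
        "ascent (Suc k) m \<in> carrier G"
      using assms step by (auto intro!: X_closed ascent_closed)
    have far: "X i \<otimes> X k = X k \<otimes> X i" using X_far[of k i] assms step by simp
    have "X i \<otimes> (X k \<otimes> ascent (Suc k) m) = (X i \<otimes> X k) \<otimes> ascent (Suc k) m"
      using c by (simp add: m_assoc)
    also have "\<dots> = X k \<otimes> (X i \<otimes> ascent (Suc k) m)"
      unfolding far using c by (simp add: m_assoc)
    also have "\<dots> = X k \<otimes> (ascent (Suc k) m \<otimes> X (i - 1))"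
      using step by simp
    finally show ?case using c assms step by (simp add: ascent_rec m_assoc)
  qed
qed

end

lemma hom_braid_group_eqI:
  assumes G: "group G" and H: "H1 \<in> hom (braid_group n) G" "H2 \<in> hom (braid_group n) G"
    and gen: "\<And>i. i \<in> {1..<n} \<Longrightarrow> H1 (braid_gen n i) = H2 (braid_gen n i)"
    and b: "b \<in> carrier (braid_group n)"
  shows "H1 b = H2 b"
proof -
  interpret B: group "braid_group n" by (rule group_braid_group)
  interpret H1: group_hom "braid_group n" G H1
    using G H by (simp add: group_hom_def group_hom_axioms_def B.group_axioms)
  interpret H2: group_hom "braid_group n" G H2
    using G H by (simp add: group_hom_def group_hom_axioms_def B.group_axioms)
  have word: "H1 (braid_class n u) = H2 (braid_class n u)" if "u \<in> braid_words n" for u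
    using that
  proof (induction u)
    case Nil
    then show ?case using H1.hom_one H2.hom_one by (simp add: braid_group_one)
  next
    case (Cons a u)
    obtain i b where a: "a = (i, b)" by force
    have u: "u \<in> braid_words n" and i: "i \<in> {1..<n}"
      using Cons.prems a by (auto simp: braid_words_def)
    have l: "[(i, c)] \<in> braid_words n" for c using i by (simp add: braid_words_def)
    have lc: "braid_class n [(i, c)] \<in> carrier (braid_group n)" for c
      using l by (auto simp: braid_group_carrier)
    have uc: "braid_class n u \<in> carrier (braid_group n)" using u by (auto simp: braid_group_carrier)
    have "braid_class n [(i, False)] \<otimes>\<^bsub>braid_group n\<^esub> braid_gen n i = \<one>\<^bsub>braid_group n\<^esub>"
    proof -
      have "braid_eq n ([(i, False)] @ [(i, True)]) []" using braid_cancel[OF i, of False] by simp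
      moreover have "[(i, False)] @ [(i, True)] \<in> braid_words n"
        using l by (simp only: braid_words_append)
      ultimately have "braid_class n ([(i, False)] @ [(i, True)]) = braid_class n []"
        using braid_class_eq_iff by blast
      then show ?thesis
        using braid_mult_class[OF l l] by (simp only: braid_gen_def braid_group_one)
    qed
    then have "braid_class n [(i, False)] = inv\<^bsub>braid_group n\<^esub> (braid_gen n i)"
      using B.inv_equality lc braid_gen_def by metis
    then have "H1 (braid_class n [(i, c)]) = H2 (braid_class n [(i, c)])" for c
      using gen[OF i] lc[of True] H1.hom_inv H2.hom_inv
      by (cases c) (auto simp: braid_gen_def)
    then show ?case
      using Cons.IH[OF u] braid_mult_class[OF l u] H1.hom_mult[OF lc uc] H2.hom_mult[OF lc uc]
      by (simp add: a)
  qed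
  show ?thesis using b word by (auto simp: braid_group_carrier)
qed

section \<open>The symmetric group through its Coxeter generators\<close>

locale coxeter_images = braid_images +
  assumes X_square: "i \<in> {1..<n} \<Longrightarrow> X i \<otimes> X i = \<one>"

abbreviation adj :: "nat \<Rightarrow> nat \<Rightarrow> nat" where
  "adj i \<equiv> Transposition.transpose i (Suc i)"

lemma adj_permutes: "i \<in> {1..<n} \<Longrightarrow> adj i permutes {1..n}"
  by (rule permutes_swap_id) auto

interpretation sym: coxeter_images "sym_group n" n adj for n
proof -
  interpret group "sym_group n" by (rule sym_group_is_group)
  show "coxeter_images (sym_group n) n adj"
  proof
    show "adj i \<in> carrier (sym_group n)" if "i \<in> {1..<n}" for i
      using adj_permutes[OF that] by (simp add: sym_group_carrier)
  qed (auto simp: sym_group_mult sym_group_one fun_eq_iff Transposition.transpose_def)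
qed

lemma sym_ascent_permutes: "1 \<le> j \<Longrightarrow> sym.ascent m j m permutes {1..m}"
  using sym.ascent_closed[of j m m] by (simp add: sym_group_carrier)

text \<open>The ambient n only fixes the carrier; product and unit are those of functions. A fact
  about an ascent proved in S_m therefore passes to every S_n.\<close>

lemma sym_ascent_indep: "sym.ascent n j m = sym.ascent n' j m"
  unfolding sym.ascent_def by (simp add: sym_group_mult sym_group_one)

lemma sym_ascent_top: "j \<le> m \<Longrightarrow> sym.ascent n j m m = j"
  by (induction rule: inc_induct)
    (simp_all add: sym.ascent_rec sym.ascent_refl sym_group_mult sym_group_one)

text \<open>Coset decomposition of S_(m+1) modulo the stabilizer S_m of the point m+1: the ascent
  that agrees with p at m+1 is divided off on the left.\<close>

lemma permutes_decomposition:
  assumes p: "p permutes {1..Suc m}"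
  obtains p' where "p' permutes {1..m}" "p = sym.ascent n (p (Suc m)) (Suc m) \<circ> p'"
proof
  define c where "c = sym.ascent n (p (Suc m)) (Suc m)"
  have j: "p (Suc m) \<in> {1..Suc m}" using permutes_in_image[OF p, of "Suc m"] by simp
  have c: "c permutes {1..Suc m}"
    using sym_ascent_permutes[of "p (Suc m)" "Suc m"] j
    unfolding c_def by (simp add: sym_ascent_indep[of n _ _ "Suc m"])
  have cm: "c (Suc m) = p (Suc m)" unfolding c_def using j by (intro sym_ascent_top) simp
  have perm: "inv' c \<circ> p permutes {1..Suc m}"
    by (rule permutes_compose[OF p permutes_inv[OF c]])
  have top: "(inv' c \<circ> p) (Suc m) = Suc m"
    using cm permutes_inverses(2)[OF c] by (metis comp_apply)
  show "inv' c \<circ> p permutes {1..m}"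
  proof (rule permutes_superset[OF perm])
    fix x assume "x \<in> {1..Suc m} - {1..m}"
    then have "x = Suc m" by auto
    then show "(inv' c \<circ> p) x = x" using top by simp
  qed
  show "p = sym.ascent n (p (Suc m)) (Suc m) \<circ> (inv' c \<circ> p)"
    using permutes_inverses(1)[OF c] by (simp add: c_def[symmetric] fun_eq_iff)
qed

context coxeter_images
begin

text \<open>A normal form instead of a quotient by relations: the value of p at m+1 selects the
  coset representative, and what remains lies in S_m. Nothing has to be shown well defined; the
  price is that multiplicativity must be proved one generator at a time.\<close>

primrec coxeter_eval :: "nat \<Rightarrow> (nat \<Rightarrow> nat) \<Rightarrow> 'a" where
  "coxeter_eval 0 p = \<one>"
| "coxeter_eval (Suc m) p = ascent (p (Suc m)) (Suc m) \<otimes>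
    coxeter_eval m (inv' (sym.ascent n (p (Suc m)) (Suc m)) \<circ> p)"

lemma coxeter_eval_step:
  assumes p: "p permutes {1..m}" and j: "1 \<le> j" "j \<le> Suc m"
  shows "coxeter_eval (Suc m) (sym.ascent n j (Suc m) \<circ> p) = ascent j (Suc m) \<otimes> coxeter_eval m p"
proof -
  have "p (Suc m) = Suc m" using permutes_not_in[OF p] by simp
  then have top: "(sym.ascent n j (Suc m) \<circ> p) (Suc m) = j" using j by (simp add: sym_ascent_top)
  have "sym.ascent n j (Suc m) permutes {1..Suc m}"
    using sym_ascent_permutes[of j "Suc m"] j by (simp add: sym_ascent_indep[of n _ _ "Suc m"])
  then have "inv' (sym.ascent n j (Suc m)) \<circ> (sym.ascent n j (Suc m) \<circ> p) = p"
    using permutes_inverses(2) by (fastforce simp: fun_eq_iff)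
  then show ?thesis using top by simp
qed

lemma coxeter_eval_closed: "m \<le> n \<Longrightarrow> p permutes {1..m} \<Longrightarrow> coxeter_eval m p \<in> carrier G"
proof (induction m arbitrary: p)
  case (Suc m)
  obtain p' where p': "p' permutes {1..m}" "p = sym.ascent n (p (Suc m)) (Suc m) \<circ> p'"
    using permutes_decomposition Suc.prems by blast
  have j: "p (Suc m) \<in> {1..Suc m}" using permutes_in_image[OF Suc.prems(2), of "Suc m"] by simp
  have "coxeter_eval (Suc m) p = ascent (p (Suc m)) (Suc m) \<otimes> coxeter_eval m p'"
    using coxeter_eval_step[OF p'(1), of "p (Suc m)"] p'(2) j by simp
  then show ?case using Suc.IH[OF _ p'(1)] Suc.prems(1) j by (auto intro!: ascent_closed)
qed simp

text \<open>The four cases compare i with j = p (m+1): the ascent gains a letter, loses its first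
  letter by \<open>X_square\<close>, commutes with \<open>X i\<close>, or lets it pass as
  \<open>X (i - 1)\<close>. In the last two cases the letter is absorbed by the factor in S_m, which
  is the induction hypothesis.\<close>

lemma coxeter_eval_adj:
  "m \<le> n \<Longrightarrow> p permutes {1..m} \<Longrightarrow> i \<in> {1..<m} \<Longrightarrow>
    coxeter_eval m (adj i \<circ> p) = X i \<otimes> coxeter_eval m p"
proof (induction m arbitrary: p i)
  case (Suc m)
  define j where "j = p (Suc m)"
  obtain p' where p': "p' permutes {1..m}" "p = sym.ascent n j (Suc m) \<circ> p'"
    using permutes_decomposition Suc.prems j_def by blast
  have j: "1 \<le> j" "j \<le> Suc m"
    using permutes_in_image[OF Suc.prems(2), of "Suc m"] by (auto simp: j_def)
  have m: "Suc m \<le> n" "m \<le> n" and i: "1 \<le> i" "i \<le> m" "i \<in> {1..<n}" using Suc.prems by auto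
  have eval: "coxeter_eval (Suc m) p = ascent j (Suc m) \<otimes> coxeter_eval m p'"
    using coxeter_eval_step[OF p'(1) j] p'(2) by simp
  have c: "X i \<in> carrier G" "coxeter_eval m p' \<in> carrier G" "ascent j (Suc m) \<in> carrier G"
    using coxeter_eval_closed p'(1) m i j by (auto intro!: X_closed ascent_closed)
  consider "i + 1 = j" | "i = j" | "i + 2 \<le> j" | "j < i" by linarith
  then show ?case
  proof cases
    case 1
    have "adj i \<circ> p = sym.ascent n i (Suc m) \<circ> p'"
      using sym.ascent_rec[of i "Suc m" n] 1 i p'(2) by (simp add: sym_group_mult comp_assoc)
    then have "coxeter_eval (Suc m) (adj i \<circ> p) = ascent i (Suc m) \<otimes> coxeter_eval m p'"
      using coxeter_eval_step[OF p'(1), of i] i by simp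
    also have "\<dots> = X i \<otimes> (ascent j (Suc m) \<otimes> coxeter_eval m p')"
      using ascent_rec[of i "Suc m"] 1 i c by (simp add: m_assoc)
    finally show ?thesis by (simp only: eval)
  next
    case 2
    have "adj i \<circ> p = sym.ascent n (Suc i) (Suc m) \<circ> p'"
      using sym.ascent_rec[of i "Suc m" n] 2 i p'(2) by (simp add: sym_group_mult fun_eq_iff)
    then have e: "coxeter_eval (Suc m) (adj i \<circ> p) = ascent (Suc i) (Suc m) \<otimes> coxeter_eval m p'"
      using coxeter_eval_step[OF p'(1), of "Suc i"] i by simp
    have c': "ascent (Suc i) (Suc m) \<in> carrier G" using m by (auto intro!: ascent_closed)
    have "X i \<otimes> coxeter_eval (Suc m) p = X i \<otimes> (X i \<otimes> ascent (Suc i) (Suc m)) \<otimes> coxeter_eval m p'"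
      unfolding eval using ascent_rec[of i "Suc m"] 2 i c c' by (simp add: m_assoc)
    also have "\<dots> = (X i \<otimes> X i) \<otimes> ascent (Suc i) (Suc m) \<otimes> coxeter_eval m p'"
      using c c' by (simp add: m_assoc)
    also have "\<dots> = coxeter_eval (Suc m) (adj i \<circ> p)"
      unfolding e X_square[OF i(3)] using c c' by simp
    finally show ?thesis ..
  next
    case 3
    have im: "i \<in> {1..<m}" using 3 j i by auto
    have "adj i \<circ> sym.ascent n j (Suc m) = sym.ascent n j (Suc m) \<circ> adj i"
      using sym.ascent_far[of i j "Suc m" n] 3 i j m by (simp add: sym_group_mult)
    moreover have "adj i \<circ> p = (adj i \<circ> sym.ascent n j (Suc m)) \<circ> p'"
      by (subst p'(2)) (rule comp_assoc[symmetric])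
    ultimately have "adj i \<circ> p = sym.ascent n j (Suc m) \<circ> (adj i \<circ> p')"
      by (simp only: comp_assoc)
    then have "coxeter_eval (Suc m) (adj i \<circ> p)
        = ascent j (Suc m) \<otimes> coxeter_eval m (adj i \<circ> p')"
      using coxeter_eval_step[OF permutes_compose[OF p'(1) adj_permutes[OF im]] j] by simp
    also have "\<dots> = (ascent j (Suc m) \<otimes> X i) \<otimes> coxeter_eval m p'"
      unfolding Suc.IH[OF m(2) p'(1) im] using c by (simp add: m_assoc)
    also have "\<dots> = X i \<otimes> (ascent j (Suc m) \<otimes> coxeter_eval m p')"
      using ascent_far[of i j "Suc m"] 3 i j m c by (simp add: m_assoc[symmetric])
    finally show ?thesis by (simp only: eval)
  next
    case 4
    have im: "i - 1 \<in> {1..<m}" using 4 j i by auto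
    have c1: "X (i - 1) \<in> carrier G" using im m by (auto intro!: X_closed)
    have "adj i \<circ> sym.ascent n j (Suc m) = sym.ascent n j (Suc m) \<circ> adj (i - 1)"
      using sym.ascent_shift[of j i "Suc m" n] 4 i j m by (simp add: sym_group_mult)
    moreover have "adj i \<circ> p = (adj i \<circ> sym.ascent n j (Suc m)) \<circ> p'"
      by (subst p'(2)) (rule comp_assoc[symmetric])
    ultimately have "adj i \<circ> p = sym.ascent n j (Suc m) \<circ> (adj (i - 1) \<circ> p')"
      by (simp only: comp_assoc)
    then have "coxeter_eval (Suc m) (adj i \<circ> p)
        = ascent j (Suc m) \<otimes> coxeter_eval m (adj (i - 1) \<circ> p')"
      using coxeter_eval_step[OF permutes_compose[OF p'(1) adj_permutes[OF im]] j] by simp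
    also have "\<dots> = (ascent j (Suc m) \<otimes> X (i - 1)) \<otimes> coxeter_eval m p'"
      unfolding Suc.IH[OF m(2) p'(1) im] using c c1 by (simp add: m_assoc)
    also have "\<dots> = X i \<otimes> (ascent j (Suc m) \<otimes> coxeter_eval m p')"
      using ascent_shift[of j i "Suc m"] 4 i j m c by (simp add: m_assoc[symmetric])
    finally show ?thesis by (simp only: eval)
  qed
qed simp

end

text \<open>The transposition of a and c+1 is that of a and c conjugated by \<open>adj c\<close>. It
  matters that only indices i with a <= i < b occur: if a function is constant on the interval from
  a to b, all these \<open>adj i\<close> preserve it.\<close>

lemma transpose_closed_if_adj_closed:
  assumes step: "\<And>p i. a \<le> i \<Longrightarrow> i < b \<Longrightarrow> Q p \<Longrightarrow> Q (adj i \<circ> p)"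
    and "a \<le> b" "Q p"
  shows "Q (Transposition.transpose a b \<circ> p)"
proof -
  have "Q (Transposition.transpose a c \<circ> p)" if "a \<le> c" "c \<le> b" "Q p" for c p
    using that
  proof (induction c arbitrary: p rule: dec_induct)
    case base
    then show ?case by simp
  next
    case (step c)
    have c: "a \<le> c" "c < b" using step.hyps step.prems by auto
    show ?case
    proof (cases "a = c")
      case True
      then show ?thesis using assms(1)[OF c step.prems(2)] by (simp only:)
    next
      case False
      have cb: "c \<le> b" using c by simp
      have "Q (Transposition.transpose a c \<circ> (adj c \<circ> p))"
        by (rule step.IH[OF cb assms(1)[OF c step.prems(2)]])
      then have "Q (adj c \<circ> (Transposition.transpose a c \<circ> (adj c \<circ> p)))"
        by (rule assms(1)[OF c])
      moreover have "adj c (Transposition.transpose a c (adj c x)) = Transposition.transpose a (Suc c) x"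
        for x using False c by (auto simp: Transposition.transpose_def)
      then have "adj c \<circ> (Transposition.transpose a c \<circ> (adj c \<circ> p))
          = Transposition.transpose a (Suc c) \<circ> p"
        by (simp add: fun_eq_iff)
      ultimately show ?thesis by (simp only:)
    qed
  qed
  then show ?thesis using assms(2,3) by blast
qed

text \<open>Composing p with the transposition of a and p a turns a into a fixed point and creates
  no new moved point, so the number of moved points drops. Both points lie in one fibre of f, so
  fibres stay preserved.\<close>

lemma fibre_permutation_induct [consumes 2, case_names id swap]:
  fixes f :: "nat \<Rightarrow> 'b"
  assumes p: "p permutes {1..n}" "\<And>x. x \<in> {1..n} \<Longrightarrow> f (p x) = f x"
    and id: "Q id"
    and swap: "\<And>a b p. a \<in> {1..n} \<Longrightarrow> b \<in> {1..n} \<Longrightarrow> a < b \<Longrightarrow> f a = f b \<Longrightarrow> p permutes {1..n} \<Longrightarrow>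
      (\<And>x. x \<in> {1..n} \<Longrightarrow> f (p x) = f x) \<Longrightarrow> Q p \<Longrightarrow> Q (Transposition.transpose a b \<circ> p)"
  shows "Q p"
  using p
proof (induction "card {x \<in> {1..n}. p x \<noteq> x}" arbitrary: p rule: less_induct)
  case less
  show ?case
  proof (cases "p = id")
    case True
    then show ?thesis using id by simp
  next
    case False
    then obtain a where a: "p a \<noteq> a" by (auto simp: fun_eq_iff)
    let ?t = "Transposition.transpose a (p a)"
    define p' where "p' = ?t \<circ> p"
    have an: "a \<in> {1..n}" using a permutes_not_in[OF less.prems(1)] by blast
    then have pan: "p a \<in> {1..n}" using permutes_in_image[OF less.prems(1)] by blast
    have p': "p' permutes {1..n}" unfolding p'_def
      by (rule permutes_compose[OF less.prems(1) permutes_swap_id[OF an pan]])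
    have fp': "f (p' x) = f x" if "x \<in> {1..n}" for x
      using less.prems(2)[OF that] less.prems(2)[OF an]
      by (auto simp: p'_def Transposition.transpose_def)
    have "{x \<in> {1..n}. p' x \<noteq> x} \<subset> {x \<in> {1..n}. p x \<noteq> x}"
    proof (intro psubsetI)
      show "{x \<in> {1..n}. p' x \<noteq> x} \<subseteq> {x \<in> {1..n}. p x \<noteq> x}"
        using a permutes_inj[OF less.prems(1)]
        by (auto simp: p'_def Transposition.transpose_def inj_eq split: if_splits)
      have "a \<in> {x \<in> {1..n}. p x \<noteq> x}" "a \<notin> {x \<in> {1..n}. p' x \<noteq> x}"
        using a an by (auto simp: p'_def)
      then show "{x \<in> {1..n}. p' x \<noteq> x} \<noteq> {x \<in> {1..n}. p x \<noteq> x}" by blast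
    qed
    then have "card {x \<in> {1..n}. p' x \<noteq> x} < card {x \<in> {1..n}. p x \<noteq> x}"
      by (intro psubset_card_mono) auto
    then have Q: "Q p'" using less.hyps p' fp' by blast
    have p: "p = ?t \<circ> p'" by (simp add: p'_def fun_eq_iff)
    have t: "?t = Transposition.transpose (p a) a" by (rule Transposition.transpose_commute)
    have f: "f a = f (p a)" using less.prems(2)[OF an] by simp
    show ?thesis
    proof (cases "a < p a")
      case True
      have "Q (?t \<circ> p')" by (rule swap[OF an pan True f p' fp' Q])
      then show ?thesis using p by simp
    next
      case False
      then have "p a < a" using a by simp
      then have "Q (Transposition.transpose (p a) a \<circ> p')"
        by (rule swap[OF pan an _ f[symmetric] p' fp' Q])
      then show ?thesis using p t by simp
    qed
  qed
qed

lemma adj_permutation_induct [consumes 1, case_names id adj]: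
  assumes p: "p permutes {1..n}"
    and id: "Q id"
    and adj: "\<And>i p. i \<in> {1..<n} \<Longrightarrow> p permutes {1..n} \<Longrightarrow> Q p \<Longrightarrow> Q (adj i \<circ> p)"
  shows "Q p"
proof -
  have "p permutes {1..n} \<and> Q p"
  proof (rule fibre_permutation_induct[where f = "\<lambda>_. ()" and Q = "\<lambda>p. p permutes {1..n} \<and> Q p"])
    show "id permutes {1..n} \<and> Q id" using id by (simp add: permutes_id)
  next
    fix a b p assume ab: "a \<in> {1..n}" "b \<in> {1..n}" "a < b" and p: "p permutes {1..n} \<and> Q p"
    have step: "adj i \<circ> p permutes {1..n} \<and> Q (adj i \<circ> p)"
      if "a \<le> i" "i < b" "p permutes {1..n} \<and> Q p" for p i
    proof -
      have i: "i \<in> {1..<n}" using that ab by auto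
      show ?thesis using adj[OF i] permutes_compose[OF _ adj_permutes[OF i]] that(3) by blast
    qed
    show "Transposition.transpose a b \<circ> p permutes {1..n} \<and> Q (Transposition.transpose a b \<circ> p)"
      by (rule transpose_closed_if_adj_closed[where Q = "\<lambda>p. p permutes {1..n} \<and> Q p", OF step
            less_imp_le[OF ab(3)] p])
  qed (use p in auto)
  then show ?thesis by blast
qed

lemma (in coxeter_images) coxeter_eval_hom: "coxeter_eval n \<in> hom (sym_group n) G"
proof (rule homI)
  show "coxeter_eval n p \<in> carrier G" if "p \<in> carrier (sym_group n)" for p
    using that coxeter_eval_closed by (simp add: sym_group_carrier)
  have one: "coxeter_eval m id = \<one>" for m
  proof (induction m)
    case (Suc m)
    have "inv' (sym.ascent n (Suc m) (Suc m)) \<circ> id = id"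
      by (simp add: sym.ascent_refl sym_group_one)
    then show ?case using Suc by (simp add: ascent_refl)
  qed simp
  fix p q assume pq: "p \<in> carrier (sym_group n)" "q \<in> carrier (sym_group n)"
  then have p: "p permutes {1..n}" and q: "q permutes {1..n}" by (auto simp: sym_group_carrier)
  from p have "coxeter_eval n (p \<circ> q) = coxeter_eval n p \<otimes> coxeter_eval n q"
  proof (induction rule: adj_permutation_induct)
    case id
    have "id \<circ> q = q" by (rule id_comp)
    then show ?case using one[of n] coxeter_eval_closed[OF order_refl q] by (simp only: l_one)
  next
    case (adj i p)
    have "coxeter_eval n (adj i \<circ> p \<circ> q) = X i \<otimes> coxeter_eval n (p \<circ> q)"
      unfolding comp_assoc by (rule coxeter_eval_adj[OF order_refl permutes_compose[OF q adj(2)] adj(1)])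
    also have "\<dots> = X i \<otimes> coxeter_eval n p \<otimes> coxeter_eval n q"
      unfolding adj(3) using coxeter_eval_closed[OF order_refl q]
        coxeter_eval_closed[OF order_refl adj(2)] X_closed[OF adj(1)] by (simp add: m_assoc)
    finally show ?case unfolding coxeter_eval_adj[OF order_refl adj(2,1)] .
  qed
  then show "coxeter_eval n (p \<otimes>\<^bsub>sym_group n\<^esub> q) = coxeter_eval n p \<otimes> coxeter_eval n q"
    by (simp add: sym_group_mult)
qed

lemma (in coxeter_images) coxeter_eval_gen:
  assumes "i \<in> {1..<n}"
  shows "coxeter_eval n (adj i) = X i"
proof -
  interpret H: group_hom "sym_group n" G "coxeter_eval n"
    by (simp add: group_hom_def group_hom_axioms_def sym_group_is_group is_group coxeter_eval_hom)
  have "coxeter_eval n (adj i \<circ> id) = X i \<otimes> coxeter_eval n id"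
    by (rule coxeter_eval_adj[OF order_refl permutes_id assms])
  then show ?thesis using H.hom_one X_closed[OF assms] by (simp add: sym_group_one)
qed

section \<open>Standard tableaux\<close>

lemma adj_comp_self [simp]: "adj r \<circ> (adj r \<circ> T) = T"
  by (simp add: fun_eq_iff)

locale partition_shape =
  fixes n :: nat and \<alpha> :: "nat list"
  assumes partition: "is_partition n \<alpha>"
begin

abbreviation "STD \<equiv> standard_tableaux \<alpha>"
abbreviation "Dg \<equiv> diagram \<alpha>"

lemma sum_list_shape: "sum_list \<alpha> = n"
  using partition by (simp add: is_partition_def)

lemma diagram_down:
  assumes "(c, l) \<in> Dg" "c' \<le> c" "l' \<le> l"
  shows "(c', l') \<in> Dg"
proof -
  have s: "sorted_wrt (\<ge>) \<alpha>" using partition by (simp add: is_partition_def)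
  have "\<alpha> ! c \<le> \<alpha> ! c'"
    using assms sorted_wrt_nth_less[OF s, of c' c] by (cases "c' = c") (auto simp: diagram_def)
  then show ?thesis using assms by (auto simp: diagram_def)
qed

lemma finite_diagram: "finite Dg"
proof -
  have "Dg = Sigma {..<length \<alpha>} (\<lambda>c. {..<\<alpha> ! c})" by (auto simp: diagram_def)
  then show ?thesis by simp
qed

lemma card_diagram: "card Dg = n"
proof -
  have "Dg = Sigma {..<length \<alpha>} (\<lambda>c. {..<\<alpha> ! c})" by (auto simp: diagram_def)
  then have "card Dg = (\<Sum>c<length \<alpha>. \<alpha> ! c)" by (simp add: card_SigmaI)
  then show ?thesis by (simp add: sum_list_shape[symmetric] sum_list_sum_nth lessThan_atLeast0)
qed

lemma filling_bij: "T \<in> fillings \<alpha> \<Longrightarrow> bij_betw T Dg {1..n}"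
  by (simp add: fillings_def sum_list_shape)

lemma filling_outside: "T \<in> fillings \<alpha> \<Longrightarrow> b \<notin> Dg \<Longrightarrow> T b = 0"
  by (cases b) (simp add: fillings_def)

lemma std_filling: "T \<in> STD \<Longrightarrow> T \<in> fillings \<alpha>"
  by (simp add: standard_tableaux_def)

lemma box_of_in: "T \<in> fillings \<alpha> \<Longrightarrow> r \<in> {1..n} \<Longrightarrow> box_of \<alpha> T r \<in> Dg"
  unfolding box_of_def using filling_bij[of T]
  by (metis bij_betw_imp_surj_on bij_betw_def the_inv_into_into order_refl)

lemma box_of_entry: "T \<in> fillings \<alpha> \<Longrightarrow> r \<in> {1..n} \<Longrightarrow> T (box_of \<alpha> T r) = r"
  unfolding box_of_def using filling_bij[of T] by (metis bij_betw_def f_the_inv_into_f)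

lemma box_of_eq: "T \<in> fillings \<alpha> \<Longrightarrow> b \<in> Dg \<Longrightarrow> box_of \<alpha> T (T b) = b"
  unfolding box_of_def using filling_bij[of T] by (metis bij_betw_def the_inv_into_f_f)

lemma entry_range: "T \<in> fillings \<alpha> \<Longrightarrow> b \<in> Dg \<Longrightarrow> T b \<in> {1..n}"
  using filling_bij[of T] by (auto simp: bij_betw_def)

lemma filling_comp:
  assumes "T \<in> fillings \<alpha>" "p permutes {1..n}"
  shows "p \<circ> T \<in> fillings \<alpha>"
proof -
  have "bij_betw (p \<circ> T) Dg {1..n}"
    using filling_bij[OF assms(1)] permutes_imp_bij[OF assms(2)] by (rule bij_betw_trans)
  then show ?thesis
    using filling_outside[OF assms(1)] permutes_not_in[OF assms(2), of 0]
    by (simp add: fillings_def sum_list_shape)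
qed

lemma box_of_comp:
  assumes T: "T \<in> fillings \<alpha>" and p: "p permutes {1..n}" and x: "x \<in> {1..n}"
  shows "box_of \<alpha> (p \<circ> T) (p x) = box_of \<alpha> T x"
  using box_of_eq[OF filling_comp[OF T p] box_of_in[OF T x]] box_of_entry[OF T x] by simp

lemma box_of_adj:
  assumes T: "T \<in> fillings \<alpha>" and r: "r \<in> {1..<n}" and x: "x \<in> {1..n}"
  shows "box_of \<alpha> (adj r \<circ> T) x = box_of \<alpha> T (adj r x)"
proof -
  have "adj r x \<in> {1..n}" using permutes_in_image[OF adj_permutes[OF r]] x by simp
  from box_of_comp[OF T adj_permutes[OF r] this] show ?thesis by simp
qed

text \<open>The content, with the sign that goes with parts being column lengths: rows count
  positively. Its differences \<open>ax\<close> are the signed axial distances, which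
  \<open>axial_dist\<close> truncates to natural numbers.\<close>

definition ct :: "(nat \<times> nat \<Rightarrow> nat) \<Rightarrow> nat \<Rightarrow> int" where
  "ct T r = int (row_of \<alpha> T r) - int (col_of \<alpha> T r)"

definition ax :: "nat \<Rightarrow> (nat \<times> nat \<Rightarrow> nat) \<Rightarrow> int" where
  "ax r T = ct T r - ct T (Suc r)"

lemma ct_adj:
  "T \<in> fillings \<alpha> \<Longrightarrow> r \<in> {1..<n} \<Longrightarrow> x \<in> {1..n} \<Longrightarrow> ct (adj r \<circ> T) x = ct T (adj r x)"
  by (simp add: ct_def row_of_def col_of_def box_of_adj del: o_apply)

lemma filling_adj: "T \<in> fillings \<alpha> \<Longrightarrow> r \<in> {1..<n} \<Longrightarrow> adj r \<circ> T \<in> fillings \<alpha>"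
  by (rule filling_comp[OF _ adj_permutes])

lemma std_row:
  "T \<in> STD \<Longrightarrow> (c, l) \<in> Dg \<Longrightarrow> (c', l) \<in> Dg \<Longrightarrow> c < c' \<Longrightarrow> T (c, l) < T (c', l)"
  by (simp add: standard_tableaux_def)

lemma std_col:
  "T \<in> STD \<Longrightarrow> (c, l) \<in> Dg \<Longrightarrow> (c, l') \<in> Dg \<Longrightarrow> l < l' \<Longrightarrow> T (c, l) < T (c, l')"
  by (simp add: standard_tableaux_def)

lemma std_less:
  assumes T: "T \<in> STD" and b: "(c', l') \<in> Dg" and le: "c \<le> c'" "l \<le> l'" "(c, l) \<noteq> (c', l')"
  shows "T (c, l) < T (c', l')"
proof -
  have d: "(c, l) \<in> Dg" "(c', l) \<in> Dg" using diagram_down[OF b] le by auto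
  have "T (c, l) \<le> T (c', l)" using std_row[OF T d] le by (cases "c = c'") auto
  moreover have "T (c', l) \<le> T (c', l')" using std_col[OF T d(2) b] le by (cases "l = l'") auto
  moreover have "c < c' \<or> l < l'" using le by auto
  ultimately show ?thesis using std_row[OF T d] std_col[OF T d(2) b] by fastforce
qed

text \<open>No entry lies strictly between r and r+1, while entries increase to the right and
  upwards. So no further box lies between the two boxes in the product order, and if they are
  comparable they are neighbours.\<close>

lemma std_step_cases:
  assumes T: "T \<in> STD" and r: "r \<in> {1..<n}"
  obtains (column) "col_of \<alpha> T (Suc r) = col_of \<alpha> T r" "row_of \<alpha> T (Suc r) = Suc (row_of \<alpha> T r)"
  | (row) "row_of \<alpha> T (Suc r) = row_of \<alpha> T r" "col_of \<alpha> T (Suc r) = Suc (col_of \<alpha> T r)"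
  | (right) "col_of \<alpha> T r < col_of \<alpha> T (Suc r)" "row_of \<alpha> T (Suc r) < row_of \<alpha> T r"
  | (left) "col_of \<alpha> T (Suc r) < col_of \<alpha> T r" "row_of \<alpha> T r < row_of \<alpha> T (Suc r)"
proof -
  obtain c l where b: "box_of \<alpha> T r = (c, l)" by force
  obtain c' l' where b': "box_of \<alpha> T (Suc r) = (c', l')" by force
  have F: "T \<in> fillings \<alpha>" by (rule std_filling[OF T])
  have r': "r \<in> {1..n}" "Suc r \<in> {1..n}" using r by auto
  have in_D: "(c, l) \<in> Dg" "(c', l') \<in> Dg" using box_of_in[OF F] r' b b' by metis+
  have val: "T (c, l) = r" "T (c', l') = Suc r" using box_of_entry[OF F] r' b b' by metis+
  have no: False if "c' \<le> c" "l' \<le> l"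
  proof -
    have "(c', l') \<noteq> (c, l)" using val by auto
    from std_less[OF T in_D(1) that this] show False using val by simp
  qed
  have between: False if "c \<le> x" "x \<le> c'" "l \<le> y" "y \<le> l'" "(x, y) \<noteq> (c, l)" "(x, y) \<noteq> (c', l')" for x y
  proof -
    have xy: "(x, y) \<in> Dg" using diagram_down[OF in_D(2)] that by blast
    have "T (c, l) < T (x, y)" using std_less[OF T xy, of c l] that by auto
    moreover have "T (x, y) < T (c', l')" using std_less[OF T in_D(2), of x y] that by auto
    ultimately show False using val by simp
  qed
  have c: "col_of \<alpha> T r = c" "col_of \<alpha> T (Suc r) = c'" "row_of \<alpha> T r = l" "row_of \<alpha> T (Suc r) = l'"
    using b b' by (simp_all add: col_of_def row_of_def)
  have rc: "c' = c \<and> l' = Suc l \<or> l' = l \<and> c' = Suc c" if "c \<le> c'" "l \<le> l'"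
  proof (cases "c = c'")
    case True
    then have "l < l'" using no that by (metis le_refl not_less)
    then have "l' = Suc l" using between[of c "Suc l"] True by auto
    then show ?thesis using True by simp
  next
    case False
    then have "c < c'" using that by simp
    then have "(c', l') = (Suc c, l)" using between[of "Suc c" l] that by auto
    then show ?thesis by simp
  qed
  show ?thesis using that no rc unfolding c by (metis le_cases not_le)
qed

lemma ax_cases:
  assumes T: "T \<in> STD" and r: "r \<in> {1..<n}"
  obtains (column) "ax r T = - 1" "col_of \<alpha> T (Suc r) = col_of \<alpha> T r"
      "row_of \<alpha> T r < row_of \<alpha> T (Suc r)" "adj r \<circ> T \<notin> STD"
  | (row) "ax r T = 1" "row_of \<alpha> T (Suc r) = row_of \<alpha> T r"
      "col_of \<alpha> T r < col_of \<alpha> T (Suc r)" "adj r \<circ> T \<notin> STD"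
  | (right) "ax r T \<ge> 2" "col_of \<alpha> T r < col_of \<alpha> T (Suc r)"
      "row_of \<alpha> T (Suc r) < row_of \<alpha> T r" "adj r \<circ> T \<in> STD"
  | (left) "ax r T \<le> - 2" "col_of \<alpha> T (Suc r) < col_of \<alpha> T r"
      "row_of \<alpha> T r < row_of \<alpha> T (Suc r)" "adj r \<circ> T \<in> STD"
proof -
  have F: "T \<in> fillings \<alpha>" by (rule std_filling[OF T])
  have r': "r \<in> {1..n}" "Suc r \<in> {1..n}" using r by auto
  obtain c l where b: "box_of \<alpha> T r = (c, l)" by force
  obtain c' l' where b': "box_of \<alpha> T (Suc r) = (c', l')" by force
  have in_D: "(c, l) \<in> Dg" "(c', l') \<in> Dg" using box_of_in[OF F] r' b b' by metis+
  have val: "T (c, l) = r" "T (c', l') = Suc r" using box_of_entry[OF F] r' b b' by metis+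
  have cl: "col_of \<alpha> T r = c" "col_of \<alpha> T (Suc r) = c'" "row_of \<alpha> T r = l" "row_of \<alpha> T (Suc r) = l'"
    using b b' by (simp_all add: col_of_def row_of_def)
  have swap: "adj r \<circ> T \<in> STD" if "c \<noteq> c'" "l \<noteq> l'"
  proof -
    \<comment> \<open>Exchanging r and r+1 reverses no inequality other than the one between these
      two entries.\<close>
    have mono: "adj r (T x) < adj r (T y)"
      if "T x < T y" "x \<in> Dg" "y \<in> Dg" "\<not> (T x = r \<and> T y = Suc r)" for x y
      using that by (auto simp: Transposition.transpose_def)
    have box: "x = (c, l)" if "T x = r" "x \<in> Dg" for x using box_of_eq[OF F that(2)] that b by simp
    have box': "x = (c', l')" if "T x = Suc r" "x \<in> Dg" for x
      using box_of_eq[OF F that(2)] that b' by simp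
    show ?thesis
      unfolding standard_tableaux_def
    proof (intro CollectI conjI allI impI)
      show "adj r \<circ> T \<in> fillings \<alpha>" by (rule filling_adj[OF F r])
    next
      fix x x' y assume d: "(x, y) \<in> Dg" "(x', y) \<in> Dg" "x < x'"
      have "\<not> (T (x, y) = r \<and> T (x', y) = Suc r)" using box box' d that by blast
      then show "(adj r \<circ> T) (x, y) < (adj r \<circ> T) (x', y)" using mono std_row[OF T d] d by simp
    next
      fix x y y' assume d: "(x, y) \<in> Dg" "(x, y') \<in> Dg" "y < y'"
      have "\<not> (T (x, y) = r \<and> T (x, y') = Suc r)" using box box' d that by blast
      then show "(adj r \<circ> T) (x, y) < (adj r \<circ> T) (x, y')" using mono std_col[OF T d] d by simp
    qed
  qed
  have swapped: "(adj r \<circ> T) (c, l) = Suc r" "(adj r \<circ> T) (c', l') = r" using val by simp_all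
  have noswap: "adj r \<circ> T \<notin> STD" if "c \<le> c'" "l \<le> l'"
  proof
    assume S: "adj r \<circ> T \<in> STD"
    have "(c, l) \<noteq> (c', l')" using val by auto
    from std_less[OF S in_D(2) that this] show False using swapped by simp
  qed
  from T r show ?thesis
  proof (cases rule: std_step_cases)
    case column
    then show ?thesis using that(1) noswap unfolding ax_def ct_def cl by simp
  next
    case row
    then show ?thesis using that(2) noswap unfolding ax_def ct_def cl by simp
  next
    case right
    then show ?thesis using that(3) swap unfolding ax_def ct_def cl by simp
  next
    case left
    then show ?thesis using that(4) swap unfolding ax_def ct_def cl by simp
  qed
qed

lemma ax_nonzero: "T \<in> STD \<Longrightarrow> r \<in> {1..<n} \<Longrightarrow> ax r T \<noteq> 0"
  by (cases rule: ax_cases) auto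

lemma ax_pm_one:
  assumes "T \<in> STD" "r \<in> {1..<n}" "adj r \<circ> T \<notin> STD"
  shows "\<bar>ax r T\<bar> = 1"
  using assms(1,2) by (cases rule: ax_cases) (use assms(3) in auto)

text \<open>The hook through (0,l), (0,0) and (c,0) has l + c + 1 boxes, all in the diagram. It
  bounds axial distances by n - 1, and so the range of d for which roots of d^2 - 1 are
  required.\<close>

lemma hook_bound:
  assumes "(0, l) \<in> Dg" "(c, 0) \<in> Dg"
  shows "l + c < n"
proof -
  let ?A = "(\<lambda>y. (0 :: nat, y)) ` {..l}" and ?B = "(\<lambda>x. (x, 0 :: nat)) ` {1..c}"
  have "?A \<union> ?B \<subseteq> Dg" using diagram_down[OF assms(1)] diagram_down[OF assms(2)] by auto
  then have "card (?A \<union> ?B) \<le> n" using card_mono[OF finite_diagram] card_diagram by metis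
  moreover have "card (?A \<union> ?B) = card ?A + card ?B" by (rule card_Un_disjoint) auto
  moreover have "card ?A = Suc l" by (subst card_image) (auto simp: inj_on_def)
  moreover have "card ?B = c" by (subst card_image) (auto simp: inj_on_def)
  ultimately show ?thesis by simp
qed

lemma ct_diff_bound:
  assumes T: "T \<in> fillings \<alpha>" and "r \<in> {1..n}" "s \<in> {1..n}"
  shows "\<bar>ct T r - ct T s\<bar> < int n"
proof -
  obtain c l where b: "box_of \<alpha> T r = (c, l)" by force
  obtain c' l' where b': "box_of \<alpha> T s = (c', l')" by force
  have "(c, l) \<in> Dg" "(c', l') \<in> Dg" using box_of_in[OF T] assms b b' by metis+
  then have "(0, l) \<in> Dg" "(c', 0) \<in> Dg" "(0, l') \<in> Dg" "(c, 0) \<in> Dg"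
    using diagram_down by blast+
  then have "l + c' < n" "l' + c < n" using hook_bound by blast+
  then show ?thesis using b b' by (simp add: ct_def col_of_def row_of_def)
qed

text \<open>Equal contents would put both boxes on one diagonal, and then the right and the upper
  neighbour of the first box would both have to hold r+1. For the braid relation this says that two
  consecutive axial distances never add up to zero.\<close>

lemma ct_two_apart:
  assumes T: "T \<in> STD" and r: "r \<in> {1..n}" "Suc (Suc r) \<in> {1..n}"
  shows "ct T r \<noteq> ct T (Suc (Suc r))"
proof
  assume eq: "ct T r = ct T (Suc (Suc r))"
  have F: "T \<in> fillings \<alpha>" by (rule std_filling[OF T])
  obtain c l where b: "box_of \<alpha> T r = (c, l)" by force
  obtain c' l' where b': "box_of \<alpha> T (Suc (Suc r)) = (c', l')" by force
  have in_D: "(c, l) \<in> Dg" "(c', l') \<in> Dg" using box_of_in[OF F] r b b' by metis+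
  have val: "T (c, l) = r" "T (c', l') = Suc (Suc r)" using box_of_entry[OF F] r b b' by metis+
  have diag: "int l - int c = int l' - int c'" using eq b b' by (simp add: ct_def col_of_def row_of_def)
  have "\<not> (c' \<le> c \<and> l' \<le> l)" using std_less[OF T in_D(1), of c' l'] val by force
  then have lt: "c < c'" "l < l'" using diag by linarith+
  have d: "(Suc c, l) \<in> Dg" "(c, Suc l) \<in> Dg" using diagram_down[OF in_D(2)] lt by auto
  have "r < T (Suc c, l)" using std_less[OF T d(1), of c l] val by simp
  moreover have "r < T (c, Suc l)" using std_less[OF T d(2), of c l] val by simp
  moreover have "T (Suc c, l) < Suc (Suc r)" using std_less[OF T in_D(2), of "Suc c" l] val lt by simp
  moreover have "T (c, Suc l) < Suc (Suc r)" using std_less[OF T in_D(2), of c "Suc l"] val lt by simp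
  ultimately have "T (Suc c, l) = T (c, Suc l)" by simp
  then show False using box_of_eq[OF F d(1)] box_of_eq[OF F d(2)] by simp
qed

text \<open>At the least r that is placed differently, the two boxes lie on one diagonal. The inner
  one holds a smaller entry in the tableau that puts r further out, and that smaller entry has the
  same place in both tableaux: a contradiction.\<close>

lemma std_eq_if_ct_eq:
  assumes T: "T \<in> STD" and U: "U \<in> STD" and eq: "\<And>r. r \<in> {1..n} \<Longrightarrow> ct T r = ct U r"
  shows "T = U"
proof -
  have FT: "T \<in> fillings \<alpha>" and FU: "U \<in> fillings \<alpha>" using T U std_filling by auto
  have aux: False
    if A: "A \<in> STD" and B: "B \<in> STD" and e: "ct A r = ct B r" and r: "r \<in> {1..n}"
      and IH: "\<And>s. s \<in> {1..n} \<Longrightarrow> s < r \<Longrightarrow> box_of \<alpha> A s = box_of \<alpha> B s"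
      and lt: "fst (box_of \<alpha> A r) < fst (box_of \<alpha> B r)" for A B r
  proof -
    obtain c l where b: "box_of \<alpha> A r = (c, l)" by force
    obtain c' l' where b': "box_of \<alpha> B r = (c', l')" by force
    have FA: "A \<in> fillings \<alpha>" and FB: "B \<in> fillings \<alpha>" using A B std_filling by auto
    have in_D: "(c, l) \<in> Dg" "(c', l') \<in> Dg" using box_of_in[OF FA r] box_of_in[OF FB r] b b' by auto
    have lt': "c < c'" "l < l'" using lt e b b' by (auto simp: ct_def col_of_def row_of_def)
    have "B (c', l') = r" using box_of_entry[OF FB r] b' by simp
    then have "B (c, l) < r" using std_less[OF B in_D(2), of c l] lt' by simp
    then have "box_of \<alpha> A (B (c, l)) = (c, l)"
      using IH[of "B (c, l)"] entry_range[OF FB in_D(1)] box_of_eq[OF FB in_D(1)] by simp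
    then have "A (c, l) = B (c, l)"
      using box_of_entry[OF FA entry_range[OF FB in_D(1)]] by simp
    then show False using box_of_entry[OF FA r] b \<open>B (c, l) < r\<close> by simp
  qed
  have box: "r \<in> {1..n} \<Longrightarrow> box_of \<alpha> T r = box_of \<alpha> U r" for r
  proof (induction r rule: less_induct)
    case (less r)
    have "fst (box_of \<alpha> T r) = fst (box_of \<alpha> U r)"
      using aux[OF T U eq[OF less.prems] less.prems] aux[OF U T eq[OF less.prems, symmetric] less.prems]
        less.IH by (metis linorder_neqE_nat)
    moreover from this have "snd (box_of \<alpha> T r) = snd (box_of \<alpha> U r)"
      using eq[OF less.prems] by (simp add: ct_def col_of_def row_of_def)
    ultimately show ?case by (rule prod_eqI)
  qed
  show ?thesis
  proof
    fix b
    show "T b = U b"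
    proof (cases "b \<in> Dg")
      case True
      then show ?thesis
        using box[OF entry_range[OF FT True]] box_of_eq[OF FT True]
          box_of_entry[OF FU entry_range[OF FT True]] by simp
    next
      case False
      then show ?thesis using filling_outside[OF FT] filling_outside[OF FU] by simp
    qed
  qed
qed

section \<open>Tableaux from linear orders of the boxes, and connectedness under swaps\<close>

definition ranking :: "(nat \<times> nat \<Rightarrow> nat) \<Rightarrow> nat \<times> nat \<Rightarrow> nat" where
  "ranking key b = (if b \<in> Dg then card {x \<in> Dg. key x \<le> key b} else 0)"

lemma ranking_less:
  assumes "x \<in> Dg" "y \<in> Dg" "key x < key y"
  shows "ranking key x < ranking key y"
proof -
  have "y \<in> {z \<in> Dg. key z \<le> key y}" "y \<notin> {z \<in> Dg. key z \<le> key x}" using assms by auto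
  moreover have "{z \<in> Dg. key z \<le> key x} \<subseteq> {z \<in> Dg. key z \<le> key y}" using assms by auto
  ultimately have "{z \<in> Dg. key z \<le> key x} \<subset> {z \<in> Dg. key z \<le> key y}" by blast
  then have "card {z \<in> Dg. key z \<le> key x} < card {z \<in> Dg. key z \<le> key y}"
    by (rule psubset_card_mono[rotated]) (simp add: finite_diagram)
  then show ?thesis using assms by (simp add: ranking_def)
qed

lemma ranking_std:
  assumes inj: "inj_on key Dg"
    and row: "\<And>c c' l. (c, l) \<in> Dg \<Longrightarrow> (c', l) \<in> Dg \<Longrightarrow> c < c' \<Longrightarrow> key (c, l) < key (c', l)"
    and col: "\<And>c l l'. (c, l) \<in> Dg \<Longrightarrow> (c, l') \<in> Dg \<Longrightarrow> l < l' \<Longrightarrow> key (c, l) < key (c, l')"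
  shows "ranking key \<in> STD"
proof -
  have "inj_on (ranking key) Dg"
  proof (rule inj_onI)
    fix x y assume xy: "x \<in> Dg" "y \<in> Dg" "ranking key x = ranking key y"
    then have "key x = key y"
      using ranking_less[of x y key] ranking_less[of y x key] by (metis less_irrefl linorder_neqE_nat)
    then show "x = y" using inj xy by (auto dest: inj_onD)
  qed
  moreover have "ranking key ` Dg \<subseteq> {1..n}"
  proof
    fix v assume "v \<in> ranking key ` Dg"
    then obtain x where x: "x \<in> Dg" "v = card {z \<in> Dg. key z \<le> key x}" by (auto simp: ranking_def)
    have "x \<in> {z \<in> Dg. key z \<le> key x}" using x by simp
    then have "{z \<in> Dg. key z \<le> key x} \<noteq> {}" by blast
    then have "v \<noteq> 0" using x(2) finite_diagram by (simp add: card_eq_0_iff)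
    moreover have "v \<le> n" unfolding x(2) card_diagram[symmetric]
      by (rule card_mono[OF finite_diagram]) auto
    ultimately show "v \<in> {1..n}" by simp
  qed
  ultimately have "bij_betw (ranking key) Dg {1..n}"
    unfolding bij_betw_def using card_image[of "ranking key" Dg] card_diagram
    by (metis card_atLeastAtMost card_subset_eq diff_Suc_1 finite_atLeastAtMost)
  then have "ranking key \<in> fillings \<alpha>" by (auto simp: fillings_def sum_list_shape ranking_def)
  then show ?thesis using row col ranking_less unfolding standard_tableaux_def by blast
qed

lemma diagram_bounds:
  assumes "(c, l) \<in> Dg" shows "c < n" "l < n"
  using hook_bound[of l c] diagram_down[OF assms] by auto

text \<open>Coordinates are smaller than n, so this is a lexicographic order of boxes written in
  base n. Ranking by it fills the diagram column by column, and ranking by \<open>row_key\<close>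
  row by row.\<close>

definition col_key :: "nat \<times> nat \<Rightarrow> nat" where "col_key b = fst b * n + snd b"
definition row_key :: "nat \<times> nat \<Rightarrow> nat" where "row_key b = snd b * n + fst b"

lemma key_less: "x < x' \<Longrightarrow> y < n \<Longrightarrow> x * n + y < x' * n + y'" for x y :: nat
proof -
  assume "x < x'" "y < n"
  then have "x * n + y < Suc x * n" by simp
  also have "\<dots> \<le> x' * n" using \<open>x < x'\<close> by (intro mult_le_mono1) simp
  finally show ?thesis by simp
qed

lemma col_key_std: "ranking col_key \<in> STD"
proof (rule ranking_std)
  show "inj_on col_key Dg"
  proof (rule inj_onI)
    fix x y assume "x \<in> Dg" "y \<in> Dg" "col_key x = col_key y"
    then show "x = y"
      using key_less[of "fst x" "fst y" "snd x" "snd y"] key_less[of "fst y" "fst x" "snd y" "snd x"]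
        diagram_bounds[of "fst x" "snd x"] diagram_bounds[of "fst y" "snd y"]
      by (cases "fst x" "fst y" rule: linorder_cases) (auto simp: col_key_def prod_eq_iff)
  qed
qed (auto simp: col_key_def dest: diagram_bounds)

lemma row_key_std: "ranking row_key \<in> STD"
proof (rule ranking_std)
  show "inj_on row_key Dg"
  proof (rule inj_onI)
    fix x y assume "x \<in> Dg" "y \<in> Dg" "row_key x = row_key y"
    then show "x = y"
      using key_less[of "snd x" "snd y" "fst x" "fst y"] key_less[of "snd y" "snd x" "fst y" "fst x"]
        diagram_bounds[of "fst x" "snd x"] diagram_bounds[of "fst y" "snd y"]
      by (cases "snd x" "snd y" rule: linorder_cases) (auto simp: row_key_def prod_eq_iff)
  qed
qed (auto simp: row_key_def dest: diagram_bounds)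

lemma ranking_mono:
  assumes T: "ranking key \<in> fillings \<alpha>" and r: "r \<in> {1..n}" "s \<in> {1..n}" "r \<le> s"
  shows "key (box_of \<alpha> (ranking key) r) \<le> key (box_of \<alpha> (ranking key) s)"
proof (rule ccontr)
  assume "\<not> ?thesis"
  then have "ranking key (box_of \<alpha> (ranking key) s) < ranking key (box_of \<alpha> (ranking key) r)"
    using box_of_in[OF T] r by (intro ranking_less) auto
  then show False using box_of_entry[OF T] r by simp
qed

lemma col_key_mono:
  assumes "r \<in> {1..n}" "s \<in> {1..n}" "r \<le> s"
  shows "col_of \<alpha> (ranking col_key) r \<le> col_of \<alpha> (ranking col_key) s"
proof (rule ccontr)
  let ?b = "box_of \<alpha> (ranking col_key)"
  have T: "ranking col_key \<in> fillings \<alpha>" by (rule std_filling[OF col_key_std])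
  assume "\<not> ?thesis"
  then have "fst (?b s) < fst (?b r)" by (simp add: col_of_def)
  moreover have "snd (?b s) < n"
    using diagram_bounds(2)[of "fst (?b s)" "snd (?b s)"] box_of_in[OF T assms(2)] by simp
  ultimately have "col_key (?b s) < col_key (?b r)" unfolding col_key_def by (rule key_less)
  then show False using ranking_mono[OF T assms] by simp
qed

lemma row_key_mono:
  assumes "r \<in> {1..n}" "s \<in> {1..n}" "r \<le> s"
  shows "row_of \<alpha> (ranking row_key) r \<le> row_of \<alpha> (ranking row_key) s"
proof (rule ccontr)
  let ?b = "box_of \<alpha> (ranking row_key)"
  have T: "ranking row_key \<in> fillings \<alpha>" by (rule std_filling[OF row_key_std])
  assume "\<not> ?thesis"
  then have "snd (?b s) < snd (?b r)" by (simp add: row_of_def)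
  moreover have "fst (?b s) < n"
    using diagram_bounds(1)[of "fst (?b s)" "snd (?b s)"] box_of_in[OF T assms(2)] by simp
  ultimately have "row_key (?b s) < row_key (?b r)" unfolding row_key_def by (rule key_less)
  then show False using ranking_mono[OF T assms] by simp
qed

text \<open>Monotone column indices leave no choice: an earlier column is exhausted before the next
  one starts, and each column is filled upwards. Thus T orders the boxes as \<open>col_key\<close>
  does, and an entry is the rank of its box.\<close>

lemma col_monotone_std_unique:
  assumes T: "T \<in> STD" and mono: "\<And>r. r \<in> {1..<n} \<Longrightarrow> col_of \<alpha> T r \<le> col_of \<alpha> T (Suc r)"
  shows "T = ranking col_key"
proof
  fix b
  have F: "T \<in> fillings \<alpha>" by (rule std_filling[OF T])
  have mono': "col_of \<alpha> T r \<le> col_of \<alpha> T s" if "r \<le> s" "1 \<le> r" "s \<le> n" for r s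
    using that
  proof (induction s rule: dec_induct)
    case (step s)
    then show ?case using mono[of s] by simp
  qed simp
  have less: "T x < T y" if xy_in: "x \<in> Dg" "y \<in> Dg" "col_key x < col_key y" for x y
  proof -
    obtain c l c' l' where xy: "x = (c, l)" "y = (c', l')" by force
    have "l' < n" using diagram_bounds(2) xy_in xy by blast
    then have "\<not> c' < c" using xy_in key_less[of c' c l' l] xy by (auto simp: col_key_def)
    then consider "c < c'" | "c = c'" "l < l'" using xy_in xy by (force simp: col_key_def)
    then show ?thesis
    proof cases
      case 1
      show ?thesis
      proof (rule ccontr)
        assume "\<not> T x < T y"
        then have "col_of \<alpha> T (T y) \<le> col_of \<alpha> T (T x)"
          using entry_range[OF F] xy_in by (intro mono') auto
        then show False using 1 box_of_eq[OF F] xy_in xy by (simp add: col_of_def)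
      qed
    qed (use std_col[OF T] xy_in xy in auto)
  qed
  show "T b = ranking col_key b"
  proof (cases "b \<in> Dg")
    case True
    have iff: "col_key x \<le> col_key b \<longleftrightarrow> T x \<le> T b" if x: "x \<in> Dg" for x
    proof
      assume le: "col_key x \<le> col_key b"
      show "T x \<le> T b"
      proof (cases "col_key x = col_key b")
        case True
        have "ranking col_key x = ranking col_key b" using x \<open>b \<in> Dg\<close> True by (simp add: ranking_def)
        then have "x = b" using filling_bij[OF std_filling[OF col_key_std]] x \<open>b \<in> Dg\<close>
          by (auto simp: bij_betw_def dest: inj_onD)
        then show ?thesis by simp
      qed (use less[OF x \<open>b \<in> Dg\<close>] le in auto)
    next
      assume le: "T x \<le> T b"
      show "col_key x \<le> col_key b" using less[OF \<open>b \<in> Dg\<close> x] le by (meson leD leI)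
    qed
    have "T ` {x \<in> Dg. T x \<le> T b} = {1..T b}"
    proof
      show "T ` {x \<in> Dg. T x \<le> T b} \<subseteq> {1..T b}" using entry_range[OF F] by fastforce
      show "{1..T b} \<subseteq> T ` {x \<in> Dg. T x \<le> T b}"
      proof
        fix v assume v: "v \<in> {1..T b}"
        then have "v \<in> {1..n}" using entry_range[OF F True] by auto
        then show "v \<in> T ` {x \<in> Dg. T x \<le> T b}"
          using box_of_in[OF F] box_of_entry[OF F] v by (intro image_eqI[of _ _ "box_of \<alpha> T v"]) auto
      qed
    qed
    moreover have "inj_on T {x \<in> Dg. T x \<le> T b}"
      using filling_bij[OF F] by (auto simp: bij_betw_def inj_on_def)
    ultimately have "card {x \<in> Dg. T x \<le> T b} = T b"
      using card_image[of T "{x \<in> Dg. T x \<le> T b}"] by simp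
    moreover have "{x \<in> Dg. col_key x \<le> col_key b} = {x \<in> Dg. T x \<le> T b}" using iff by blast
    ultimately show ?thesis using True by (simp add: ranking_def)
  next
    case False
    then show ?thesis using filling_outside[OF F] by (simp add: ranking_def)
  qed
qed

text \<open>A potential for swaps: it grows exactly when a swap removes a descent of the column
  index from r to r+1.\<close>

definition col_moment :: "(nat \<times> nat \<Rightarrow> nat) \<Rightarrow> int" where
  "col_moment T = (\<Sum>x\<in>{1..n}. int x * int (col_of \<alpha> T x))"

lemma col_moment_adj:
  assumes T: "T \<in> fillings \<alpha>" and r: "r \<in> {1..<n}"
  shows "col_moment (adj r \<circ> T) - col_moment T = int (col_of \<alpha> T r) - int (col_of \<alpha> T (Suc r))"
proof -
  have p: "adj r permutes {1..n}" by (rule adj_permutes[OF r])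
  have "col_moment (adj r \<circ> T) = (\<Sum>x\<in>{1..n}. int x * int (col_of \<alpha> T (adj r x)))"
    unfolding col_moment_def by (rule sum.cong) (simp_all add: col_of_def box_of_adj[OF T r] del: o_apply)
  also have "\<dots> = (\<Sum>x\<in>{1..n}. int (adj r x) * int (col_of \<alpha> T (adj r (adj r x))))"
    by (rule sum.permute[OF p, unfolded o_def])
  finally have "col_moment (adj r \<circ> T) - col_moment T
      = (\<Sum>x\<in>{1..n}. (int (adj r x) - int x) * int (col_of \<alpha> T x))"
    by (simp add: col_moment_def sum_subtractf left_diff_distrib)
  also have "\<dots> = (\<Sum>x\<in>{r, Suc r}. (int (adj r x) - int x) * int (col_of \<alpha> T x))"
    by (rule sum.mono_neutral_right) (use r in \<open>auto simp: Transposition.transpose_def\<close>)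
  finally show ?thesis by simp
qed

text \<open>A swap at a descent of the column index keeps the tableau standard and raises
  \<open>col_moment\<close>; as there are finitely many tableaux, such swaps end at the
  column-by-column tableau. Swaps are involutions, so Q travels along them in both
  directions.\<close>

lemma std_connected:
  assumes closed: "\<And>T r. T \<in> STD \<Longrightarrow> r \<in> {1..<n} \<Longrightarrow> adj r \<circ> T \<in> STD \<Longrightarrow> Q T \<Longrightarrow> Q (adj r \<circ> T)"
    and T: "T \<in> STD" "Q T" and U: "U \<in> STD"
  shows "Q U"
proof -
  have climb: "Q V \<longleftrightarrow> Q (ranking col_key)" if "V \<in> STD" for V
    using that
  proof (induction "card {W \<in> STD. col_moment V < col_moment W}" arbitrary: V rule: less_induct)
    case less
    show ?case
    proof (cases "\<forall>r\<in>{1..<n}. col_of \<alpha> V r \<le> col_of \<alpha> V (Suc r)")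
      case True
      then show ?thesis using col_monotone_std_unique[OF less.prems] by blast
    next
      case False
      then obtain r where r: "r \<in> {1..<n}" "col_of \<alpha> V (Suc r) < col_of \<alpha> V r" by auto
      have S: "adj r \<circ> V \<in> STD"
        using less.prems r(1) by (cases rule: ax_cases) (use r(2) in auto)
      have gt: "col_moment V < col_moment (adj r \<circ> V)"
        using col_moment_adj[OF std_filling[OF less.prems] r(1)] r(2) by simp
      have "{W \<in> STD. col_moment (adj r \<circ> V) < col_moment W} \<subset> {W \<in> STD. col_moment V < col_moment W}"
        using gt S by force
      then have "card {W \<in> STD. col_moment (adj r \<circ> V) < col_moment W}
          < card {W \<in> STD. col_moment V < col_moment W}"
        by (rule psubset_card_mono[rotated]) (simp add: finite_standard_tableaux)
      then have "Q (adj r \<circ> V) \<longleftrightarrow> Q (ranking col_key)" using less.hyps S by blast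
      moreover have "Q V \<Longrightarrow> Q (adj r \<circ> V)" using closed[OF less.prems r(1) S] .
      moreover have "Q (adj r \<circ> V) \<Longrightarrow> Q V"
        using closed[OF S r(1)] less.prems by (simp only: adj_comp_self)
      ultimately show ?thesis by blast
    qed
  qed
  show ?thesis using climb T U by blast
qed

end

section \<open>Orthogonal forms\<close>

lemma monoid_mat_ring: "monoid (ring_mat TYPE('a::comm_ring_1) N ())"
  using ring_mat[of N "()", where ?'a = 'a] by (simp add: ring_def)

lemma GL_group: "group (GL N :: 'a::comm_ring_1 mat monoid)"
  unfolding GL_def by (rule monoid.units_group[OF monoid_mat_ring])

lemma GL_one: "\<one>\<^bsub>GL N\<^esub> = 1\<^sub>m N"
  by (simp add: GL_def units_of_def ring_mat_simps)

lemma GL_memI: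
  assumes "A \<in> carrier_mat N N" "B \<in> carrier_mat N N" "A * B = 1\<^sub>m N" "B * A = 1\<^sub>m N"
  shows "A \<in> carrier (GL N)"
  using assms by (auto simp: GL_def units_of_def Units_def ring_mat_simps)

lemma GL_memE:
  assumes "A \<in> carrier (GL N)"
  obtains B where "A \<in> carrier_mat N N" "B \<in> carrier_mat N N" "A * B = 1\<^sub>m N" "B * A = 1\<^sub>m N"
  using assms by (auto simp: GL_def units_of_def Units_def ring_mat_simps)

lemma GL_inv_eqI:
  fixes A B :: "'a::comm_ring_1 mat"
  assumes "A \<in> carrier_mat N N" "B \<in> carrier_mat N N" "A * B = 1\<^sub>m N" "B * A = 1\<^sub>m N"
  shows "inv\<^bsub>GL N\<^esub> A = B"
proof -
  interpret group "GL N :: 'a mat monoid" by (rule GL_group)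
  show ?thesis
    using assms by (intro inv_equality) (auto simp: GL_mult GL_one intro: GL_memI)
qed

lemma GL_map_hom:
  assumes "comm_ring_hom h" and A: "A \<in> carrier (GL N)"
  shows "map_mat h A \<in> carrier (GL N)"
proof -
  interpret h: comm_ring_hom h by fact
  obtain B where B: "A \<in> carrier_mat N N" "B \<in> carrier_mat N N" "A * B = 1\<^sub>m N" "B * A = 1\<^sub>m N"
    using GL_memE[OF A] .
  show ?thesis
    using B h.mat_hom_mult[OF B(1,2)] h.mat_hom_mult[OF B(2,1)] h.mat_hom_one
    by (intro GL_memI[where B = "map_mat h B"]) auto
qed

text \<open>Rewriting the quadratic relation as A (A - z) = 1 produces the inverse over any
  commutative ring, in particular over k[[h]].\<close>

lemma quadratic_inverse:
  fixes A :: "'a::comm_ring_1 mat"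
  assumes A: "A \<in> carrier_mat N N" and sq: "A * A = z \<cdot>\<^sub>m A + 1\<^sub>m N"
  shows "A * (A - z \<cdot>\<^sub>m 1\<^sub>m N) = 1\<^sub>m N" "(A - z \<cdot>\<^sub>m 1\<^sub>m N) * A = 1\<^sub>m N"
proof -
  have c: "z \<cdot>\<^sub>m 1\<^sub>m N \<in> carrier_mat N N" by simp
  have e: "z \<cdot>\<^sub>m A + 1\<^sub>m N - z \<cdot>\<^sub>m A = 1\<^sub>m N"
    by (rule eq_matI) (use A in auto)
  show "A * (A - z \<cdot>\<^sub>m 1\<^sub>m N) = 1\<^sub>m N"
    using e by (simp add: mult_minus_distrib_mat[OF A A c] sq mult_smult_distrib[OF A one_carrier_mat] right_mult_one_mat[OF A])
  show "(A - z \<cdot>\<^sub>m 1\<^sub>m N) * A = 1\<^sub>m N"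
    using e by (simp add: minus_mult_distrib_mat[OF A c A] sq mult_smult_assoc_mat[OF one_carrier_mat A] left_mult_one_mat[OF A])
qed

lemma quadratic_GL:
  fixes A :: "'a::comm_ring_1 mat"
  assumes A: "A \<in> carrier_mat N N" and sq: "A * A = z \<cdot>\<^sub>m A + 1\<^sub>m N"
  shows "A \<in> carrier (GL N)"
  by (rule GL_memI[OF A _ quadratic_inverse[OF A sq]]) (use A in auto)

lemma mult_mat_vec_unit_vec:
  fixes A :: "'a::semiring_1 mat"
  assumes "A \<in> carrier_mat nr nc" "i < nr" "j < nc"
  shows "(A *\<^sub>v unit_vec nc j) $ i = A $$ (i, j)"
  using assms by (simp add: scalar_prod_right_unit)

lemma eq_mat_if_eq_on_vecs:
  fixes A B :: "'a::semiring_1 mat"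
  assumes A: "A \<in> carrier_mat nr nc" and B: "B \<in> carrier_mat nr nc"
    and eq: "\<And>v. v \<in> carrier_vec nc \<Longrightarrow> A *\<^sub>v v = B *\<^sub>v v"
  shows "A = B"
proof (rule eq_matI)
  fix i j assume "i < dim_row B" "j < dim_col B"
  then have ij: "i < nr" "j < nc" using B by auto
  show "A $$ (i, j) = B $$ (i, j)"
    using eq[of "unit_vec nc j"] mult_mat_vec_unit_vec[OF A ij] mult_mat_vec_unit_vec[OF B ij] by simp
qed (use A B in auto)

lemma smult_mat_mult_vec:
  fixes A :: "'a::semiring_0 mat"
  assumes "A \<in> carrier_mat nr nc" "v \<in> carrier_vec nc"
  shows "(k \<cdot>\<^sub>m A) *\<^sub>v v = k \<cdot>\<^sub>v (A *\<^sub>v v)"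
  using assms by (intro eq_vecI) (auto simp: scalar_prod_def sum_distrib_left mult.assoc)

text \<open>The difference of the two sides is p - q times the defect of the first assumption. With
  p, q, s the diagonal entries for the distances d, e, d + e it is the coefficient of T itself in
  the braid relation.\<close>

lemma braid_identity_coefficient:
  fixes p q s z u v :: "'g::comm_ring_1"
  assumes "p * q = s * (p + q - z)" "u = 1 + p * (z - p)" "v = 1 + q * (z - q)"
  shows "p * q * p + u * s = q * p * q + v * s"
proof -
  have "p * q * p + u * s - (q * p * q + v * s) = (p - q) * (p * q - s * (p + q - z))"
    unfolding assms(2,3) by (simp add: algebra_simps)
  then show ?thesis using assms(1) by simp
qed

section \<open>Axial distances under swaps, and vectors indexed by standard tableaux\<close>

context partition_shape
begin

lemma ax_adj_self: "T \<in> fillings \<alpha> \<Longrightarrow> r \<in> {1..<n} \<Longrightarrow> ax r (adj r \<circ> T) = - ax r T"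
  by (simp add: ax_def ct_adj del: o_apply)

lemma ax_adj_next:
  assumes "T \<in> fillings \<alpha>" "r \<in> {1..<n}" "Suc r \<in> {1..<n}"
  shows "ax (Suc r) (adj r \<circ> T) = ax r T + ax (Suc r) T"
    "ax r (adj (Suc r) \<circ> T) = ax r T + ax (Suc r) T"
proof -
  have "adj r (Suc (Suc r)) = Suc (Suc r)" "adj (Suc r) r = r"
    by (simp_all add: Transposition.transpose_def)
  then show "ax (Suc r) (adj r \<circ> T) = ax r T + ax (Suc r) T"
    "ax r (adj (Suc r) \<circ> T) = ax r T + ax (Suc r) T"
    using assms by (simp_all add: ax_def ct_adj del: o_apply)
qed

lemma ax_adj_far:
  assumes "T \<in> fillings \<alpha>" "r \<in> {1..<n}" "s \<in> {1..<n}" "r + 2 \<le> s \<or> s + 2 \<le> r"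
  shows "ax s (adj r \<circ> T) = ax s T"
proof -
  have "adj r s = s" "adj r (Suc s) = Suc s" using assms(4) by (auto simp: Transposition.transpose_def)
  then show ?thesis using assms by (simp add: ax_def ct_adj del: o_apply)
qed

lemma adj_comp_neq:
  assumes T: "T \<in> fillings \<alpha>" and r: "r \<in> {1..<n}"
  shows "adj r \<circ> T \<noteq> T"
proof
  assume "adj r \<circ> T = T"
  then have "adj r (T (box_of \<alpha> T r)) = T (box_of \<alpha> T r)" by (metis comp_apply)
  then show False using box_of_entry[OF T, of r] r by simp
qed

lemma length_tableaux_list: "length (tableaux_list \<alpha>) = R_dim \<alpha>"
  unfolding R_dim_def tableaux_list(1)[symmetric] by (rule distinct_card[OF tableaux_list(2), symmetric])

lemma tableaux_list_nth: "i < R_dim \<alpha> \<Longrightarrow> tableaux_list \<alpha> ! i \<in> STD"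
  using nth_mem[of i "tableaux_list \<alpha>"] by (simp add: length_tableaux_list tableaux_list(1))

lemma tableaux_list_bij: "bij_betw ((!) (tableaux_list \<alpha>)) {..<R_dim \<alpha>} STD"
  using bij_betw_nth[OF tableaux_list(2)[of \<alpha>] refl refl]
  by (simp add: length_tableaux_list tableaux_list(1))

lemma tableaux_list_nth_eq:
  "i < R_dim \<alpha> \<Longrightarrow> j < R_dim \<alpha> \<Longrightarrow> tableaux_list \<alpha> ! i = tableaux_list \<alpha> ! j \<longleftrightarrow> i = j"
  using nth_eq_iff_index_eq[OF tableaux_list(2)] by (simp add: length_tableaux_list)

definition tvec :: "((nat \<times> nat \<Rightarrow> nat) \<Rightarrow> 'f) \<Rightarrow> 'f vec" where
  "tvec f = vec (R_dim \<alpha>) (\<lambda>i. f (tableaux_list \<alpha> ! i))"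

lemma tvec_carrier [simp]: "tvec f \<in> carrier_vec (R_dim \<alpha>)"
  by (simp add: tvec_def)

lemma tvec_cong: "(\<And>T. T \<in> STD \<Longrightarrow> f T = g T) \<Longrightarrow> tvec f = tvec g"
  using tableaux_list_nth by (auto simp: tvec_def)

lemma tvec_eq_iff: "tvec f = tvec g \<longleftrightarrow> (\<forall>T\<in>STD. f T = g T)"
proof
  assume eq: "tvec f = tvec g"
  show "\<forall>T\<in>STD. f T = g T"
  proof
    fix T assume "T \<in> STD"
    then obtain i where i: "i < R_dim \<alpha>" "T = tableaux_list \<alpha> ! i"
      using tableaux_list_bij by (auto simp: bij_betw_def)
    have "tvec f $ i = tvec g $ i" by (simp only: eq)
    then show "f T = g T" using i by (simp add: tvec_def)
  qed
qed (blast intro: tvec_cong)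

lemma vec_eq_tvec:
  assumes "v \<in> carrier_vec (R_dim \<alpha>)"
  obtains f where "v = tvec f"
proof
  let ?i = "the_inv_into {..<R_dim \<alpha>} ((!) (tableaux_list \<alpha>))"
  show "v = tvec (\<lambda>T. v $ ?i T)"
    using assms the_inv_into_f_f[of "(!) (tableaux_list \<alpha>)" "{..<R_dim \<alpha>}"] tableaux_list_bij
    by (intro eq_vecI) (auto simp: tvec_def bij_betw_def)
qed

lemma tvec_add: "tvec f + tvec g = tvec (\<lambda>T. f T + g T)"
  by (auto simp: tvec_def)

lemma tvec_smult: "c \<cdot>\<^sub>v tvec f = tvec (\<lambda>T. c * f T)"
  by (auto simp: tvec_def)

lemma sum_tableaux_list: "(\<Sum>i<R_dim \<alpha>. g (tableaux_list \<alpha> ! i)) = (\<Sum>T\<in>STD. g T)"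
  by (rule sum.reindex_bij_betw[OF tableaux_list_bij])

definition tab_vec :: "(nat \<times> nat \<Rightarrow> nat) \<Rightarrow> 'f::{zero,one} vec" where
  "tab_vec T = tvec (\<lambda>U. if U = T then 1 else 0)"

lemma tab_vec_carrier [simp]: "tab_vec T \<in> carrier_vec (R_dim \<alpha>)"
  by (simp add: tab_vec_def)

text \<open>The value 0 allows formulas with \<open>adj r \<circ> T\<close> to be written without
  asking whether that filling is standard.\<close>

lemma tab_vec_nonstd: "T \<notin> STD \<Longrightarrow> tab_vec T = 0\<^sub>v (R_dim \<alpha>)"
proof -
  assume "T \<notin> STD"
  then have "tab_vec T = tvec (\<lambda>U. 0)" unfolding tab_vec_def by (intro tvec_cong) auto
  then show ?thesis by (simp add: tvec_def zero_vec_def)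
qed

lemma eq_mat_if_eq_on_tab_vec:
  fixes X Y :: "'r::semiring_1 mat"
  assumes X: "X \<in> carrier_mat M (R_dim \<alpha>)" and Y: "Y \<in> carrier_mat M (R_dim \<alpha>)"
    and eq: "\<And>T. T \<in> STD \<Longrightarrow> X *\<^sub>v tab_vec T = Y *\<^sub>v tab_vec T"
  shows "X = Y"
proof (rule eq_matI)
  fix i j assume "i < dim_row Y" "j < dim_col Y"
  then have ij: "i < M" "j < R_dim \<alpha>" using Y by auto
  have "(tab_vec (tableaux_list \<alpha> ! j) :: 'r vec) = unit_vec (R_dim \<alpha>) j"
    by (rule eq_vecI) (auto simp: tab_vec_def tvec_def tableaux_list_nth_eq ij unit_vec_def)
  then have "X *\<^sub>v unit_vec (R_dim \<alpha>) j = Y *\<^sub>v unit_vec (R_dim \<alpha>) j"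
    using eq[OF tableaux_list_nth[OF ij(2)]] by simp
  then show "X $$ (i, j) = Y $$ (i, j)"
    using mult_mat_vec_unit_vec[OF X ij] mult_mat_vec_unit_vec[OF Y ij] by simp
qed (use X Y in auto)

end

text \<open>On the plane of T and its swap a generator is the symmetric matrix with diagonal
  \<open>a d\<close>, \<open>a (- d)\<close> and off-diagonal entry \<open>b d\<close>. Its trace is
  z by \<open>a_neg\<close> and its determinant -1 by \<open>b_square\<close>; \<open>b_one\<close>
  cuts it off where a swap leaves the standard tableaux; \<open>a_add\<close> is what the braid
  relation demands of distances d, e and d + e.\<close>

locale orthogonal_form = partition_shape +
  fixes a b :: "int \<Rightarrow> 'f::field" and z :: 'f
  assumes a_neg: "d \<noteq> 0 \<Longrightarrow> a (- d) = z - a d"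
    and a_add: "d \<noteq> 0 \<Longrightarrow> e \<noteq> 0 \<Longrightarrow> d + e \<noteq> 0 \<Longrightarrow> a d * a e = a (d + e) * (a d + a e - z)"
    and b_square: "d \<noteq> 0 \<Longrightarrow> \<bar>d\<bar> < int n \<Longrightarrow> b d * b d = 1 + a d * (z - a d)"
    and b_neg: "b (- d) = b d"
    and b_one: "b 1 = 0"
begin

text \<open>Acts on functions of all fillings, so that the relations become identities between
  values of f with no case distinction on standardness. At a standard T the value at a nonstandard
  neighbour has coefficient 0.\<close>

definition yop :: "nat \<Rightarrow> ((nat \<times> nat \<Rightarrow> nat) \<Rightarrow> 'f) \<Rightarrow> (nat \<times> nat \<Rightarrow> nat) \<Rightarrow> 'f" where
  "yop r f T = a (ax r T) * f T + b (ax r T) * f (adj r \<circ> T)"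

lemma ax_range: "T \<in> fillings \<alpha> \<Longrightarrow> r \<in> {1..<n} \<Longrightarrow> \<bar>ax r T\<bar> < int n"
  unfolding ax_def by (rule ct_diff_bound) auto

lemma b_nonstd: "T \<in> STD \<Longrightarrow> r \<in> {1..<n} \<Longrightarrow> adj r \<circ> T \<notin> STD \<Longrightarrow> b (ax r T) = 0"
  using ax_pm_one[of T r] b_one b_neg[of 1] by (auto simp: abs_if split: if_splits)

lemma yop_square:
  assumes T: "T \<in> STD" and r: "r \<in> {1..<n}"
  shows "yop r (yop r f) T = z * yop r f T + f T"
proof -
  have F: "T \<in> fillings \<alpha>" by (rule std_filling[OF T])
  define x where "x = ax r T"
  have x: "x \<noteq> 0" "\<bar>x\<bar> < int n" using ax_nonzero[OF T r] ax_range[OF F r] by (auto simp: x_def)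
  have "yop r (yop r f) T
      = a x * (a x * f T + b x * f (adj r \<circ> T)) + b x * (a (- x) * f (adj r \<circ> T) + b (- x) * f T)"
    by (simp add: yop_def x_def ax_adj_self[OF F r] del: o_apply)
  also have "\<dots> = (a x * a x + b x * b x) * f T + z * b x * f (adj r \<circ> T)"
    using x by (simp add: a_neg b_neg algebra_simps)
  also have "\<dots> = z * (a x * f T + b x * f (adj r \<circ> T)) + f T"
    using x by (simp add: b_square algebra_simps)
  finally show ?thesis by (simp add: yop_def x_def)
qed

lemma yop_far:
  assumes T: "T \<in> STD" and rs: "r \<in> {1..<n}" "s \<in> {1..<n}" "r + 2 \<le> s"
  shows "yop r (yop s f) T = yop s (yop r f) T"
proof -
  have F: "T \<in> fillings \<alpha>" by (rule std_filling[OF T])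
  have comm: "adj s \<circ> (adj r \<circ> T) = adj r \<circ> (adj s \<circ> T)"
    using rs(3) by (auto simp: fun_eq_iff Transposition.transpose_def)
  have "ax s (adj r \<circ> T) = ax s T" "ax r (adj s \<circ> T) = ax r T"
    using ax_adj_far[OF F] rs by auto
  then show ?thesis unfolding yop_def comm by (simp add: algebra_simps del: o_apply)
qed

text \<open>Both sides are combinations of the values of f at the six fillings that the two swaps
  reach from T. The coefficients of \<open>f12\<close>, \<open>f21\<close>, \<open>f121\<close>
  agree term by term; those of \<open>f0\<close>, \<open>f1\<close>, \<open>f2\<close> agree by
  \<open>a_add\<close> and \<open>b_square\<close>.\<close>

lemma yop_braid:
  assumes T: "T \<in> STD" and r: "r \<in> {1..<n}" "Suc r \<in> {1..<n}"
  shows "yop r (yop (Suc r) (yop r f)) T = yop (Suc r) (yop r (yop (Suc r) f)) T"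
proof -
  have F: "T \<in> fillings \<alpha>" by (rule std_filling[OF T])
  define x y where "x = ax r T" and "y = ax (Suc r) T"
  define s1 s2 where "s1 = adj r" and "s2 = adj (Suc r)"
  have long: "s1 \<circ> (s2 \<circ> (s1 \<circ> T)) = s2 \<circ> (s1 \<circ> (s2 \<circ> T))"
    by (auto simp: s1_def s2_def fun_eq_iff Transposition.transpose_def)
  have F1: "s1 \<circ> T \<in> fillings \<alpha>" and F2: "s2 \<circ> T \<in> fillings \<alpha>"
    using filling_adj[OF F] r by (auto simp: s1_def s2_def)
  have axs: "ax r T = x" "ax (Suc r) T = y" "ax r (s1 \<circ> T) = - x" "ax (Suc r) (s2 \<circ> T) = - y"
      "ax (Suc r) (s1 \<circ> T) = x + y" "ax r (s2 \<circ> T) = x + y"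
      "ax r (s2 \<circ> (s1 \<circ> T)) = y" "ax (Suc r) (s1 \<circ> (s2 \<circ> T)) = x"
    using ax_adj_self[OF F] ax_adj_next[OF F r] ax_adj_next[OF F1 r] ax_adj_next[OF F2 r]
      ax_adj_self[OF F1] ax_adj_self[OF F2] r
    by (simp_all add: x_def y_def s1_def s2_def del: o_apply)
  have nz: "x \<noteq> 0" "y \<noteq> 0" "\<bar>x\<bar> < int n" "\<bar>y\<bar> < int n"
    using ax_nonzero[OF T] ax_range[OF F] r by (auto simp: x_def y_def)
  have nz': "x + y \<noteq> 0" using ct_two_apart[OF T, of r] r by (simp add: x_def y_def ax_def)
  define f0 f1 f2 f12 f21 f121 where "f0 = f T" and "f1 = f (s1 \<circ> T)" and "f2 = f (s2 \<circ> T)"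
    and "f12 = f (s1 \<circ> (s2 \<circ> T))" and "f21 = f (s2 \<circ> (s1 \<circ> T))" and "f121 = f (s2 \<circ> (s1 \<circ> (s2 \<circ> T)))"
  have s: "adj r = s1" "adj (Suc r) = s2" by (simp_all add: s1_def s2_def)
  have canc: "s1 \<circ> (s1 \<circ> U) = U" "s2 \<circ> (s2 \<circ> U) = U" for U :: "nat \<times> nat \<Rightarrow> nat"
    by (simp_all add: s1_def s2_def)
  have L: "yop r (yop (Suc r) (yop r f)) T =
      a x * (a y * (a x * f0 + b x * f1) + b y * (a (x + y) * f2 + b (x + y) * f12)) +
      b x * (a (x + y) * (a (- x) * f1 + b (- x) * f0) + b (x + y) * (a y * f21 + b y * f121))"
    unfolding yop_def s axs long canc f0_def f1_def f2_def f12_def f21_def f121_def ..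
  have R: "yop (Suc r) (yop r (yop (Suc r) f)) T =
      a y * (a x * (a y * f0 + b y * f2) + b x * (a (x + y) * f1 + b (x + y) * f21)) +
      b y * (a (x + y) * (a (- y) * f2 + b (- y) * f0) + b (x + y) * (a x * f12 + b x * f121))"
    unfolding yop_def s axs long canc f0_def f1_def f2_def f12_def f21_def f121_def ..
  have A: "a x * a y = a (x + y) * (a x + a y - z)" using a_add nz nz' by blast
  have c0: "a x * a y * a x + b x * b x * a (x + y) = a y * a x * a y + b y * b y * a (x + y)"
    using b_square nz by (intro braid_identity_coefficient[OF A]) auto
  have c1: "a x * a y + a (x + y) * (z - a x) = a y * a (x + y)"
    and c2: "a x * a (x + y) = a y * a x + a (x + y) * (z - a y)"
    unfolding mult.commute[of "a y" "a x"] A by (simp_all add: algebra_simps)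
  have "yop r (yop (Suc r) (yop r f)) T - yop (Suc r) (yop r (yop (Suc r) f)) T =
      ((a x * a y * a x + b x * b x * a (x + y)) - (a y * a x * a y + b y * b y * a (x + y))) * f0
      + b x * ((a x * a y + a (x + y) * (z - a x)) - a y * a (x + y)) * f1
      + b y * (a x * a (x + y) - (a y * a x + a (x + y) * (z - a y))) * f2"
    unfolding L R a_neg[OF nz(1)] a_neg[OF nz(2)] b_neg by (simp add: algebra_simps)
  also have "\<dots> = 0" unfolding c0 c1 c2 by simp
  finally show ?thesis by simp
qed

definition ocoeff :: "nat \<Rightarrow> (nat \<times> nat \<Rightarrow> nat) \<Rightarrow> (nat \<times> nat \<Rightarrow> nat) \<Rightarrow> 'f" where
  "ocoeff r T U = (if U = T then a (ax r T) else if U = adj r \<circ> T then b (ax r T) else 0)"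

definition omat :: "nat \<Rightarrow> 'f mat" where
  "omat r = mat (R_dim \<alpha>) (R_dim \<alpha>) (\<lambda>(i, j). ocoeff r (tableaux_list \<alpha> ! j) (tableaux_list \<alpha> ! i))"

lemma omat_carrier [simp]: "omat r \<in> carrier_mat (R_dim \<alpha>) (R_dim \<alpha>)"
  by (simp add: omat_def)

lemma omat_tvec:
  assumes r: "r \<in> {1..<n}"
  shows "omat r *\<^sub>v tvec f = tvec (yop r f)"
proof (rule eq_vecI)
  fix i assume "i < dim_vec (tvec (yop r f))"
  then have i: "i < R_dim \<alpha>" by (simp add: tvec_def)
  define U where "U = tableaux_list \<alpha> ! i"
  have U: "U \<in> STD" using tableaux_list_nth[OF i] by (simp add: U_def)
  have F: "U \<in> fillings \<alpha>" by (rule std_filling[OF U])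
  have "(omat r *\<^sub>v tvec f) $ i
      = (\<Sum>j<R_dim \<alpha>. ocoeff r (tableaux_list \<alpha> ! j) U * f (tableaux_list \<alpha> ! j))"
    using i by (simp add: omat_def tvec_def scalar_prod_def U_def lessThan_atLeast0)
  also have "\<dots> = (\<Sum>T\<in>STD. ocoeff r T U * f T)"
    by (rule sum_tableaux_list)
  also have "\<dots> = (\<Sum>T\<in>STD \<inter> {U, adj r \<circ> U}. ocoeff r T U * f T)"
    by (rule sum.mono_neutral_right) (auto simp: finite_standard_tableaux ocoeff_def simp del: o_apply)
  also have "\<dots> = ocoeff r U U * f U + (if adj r \<circ> U \<in> STD then ocoeff r (adj r \<circ> U) U * f (adj r \<circ> U) else 0)"
    using U adj_comp_neq[OF F r] by (auto simp: Int_insert_right)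
  also have "\<dots> = yop r f U"
    using b_nonstd[OF U r] adj_comp_neq[OF F r] ax_adj_self[OF F r]
    by (auto simp: ocoeff_def yop_def b_neg simp del: o_apply)
  finally show "(omat r *\<^sub>v tvec f) $ i = tvec (yop r f) $ i" using i by (simp add: tvec_def U_def)
qed (simp add: tvec_def omat_def)

lemma omat_tab_vec:
  assumes T: "T \<in> STD" and r: "r \<in> {1..<n}"
  shows "omat r *\<^sub>v tab_vec T = a (ax r T) \<cdot>\<^sub>v tab_vec T + b (ax r T) \<cdot>\<^sub>v tab_vec (adj r \<circ> T)"
  unfolding tab_vec_def omat_tvec[OF r] tvec_smult tvec_add
proof (rule tvec_cong)
  fix U assume U: "U \<in> STD"
  have iff: "adj r \<circ> U = T \<longleftrightarrow> U = adj r \<circ> T" using adj_comp_self by metis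
  show "yop r (\<lambda>U. if U = T then 1 else 0) U
      = a (ax r T) * (if U = T then 1 else 0) + b (ax r T) * (if U = adj r \<circ> T then 1 else 0)"
    using adj_comp_neq[OF std_filling[OF T] r] ax_adj_self[OF std_filling[OF T] r]
    by (auto simp: yop_def iff b_neg simp del: o_apply)
qed

lemma mat_eq_if_eq_on_tvec:
  fixes A B :: "'f mat"
  assumes "A \<in> carrier_mat (R_dim \<alpha>) (R_dim \<alpha>)" "B \<in> carrier_mat (R_dim \<alpha>) (R_dim \<alpha>)"
    and "\<And>f. A *\<^sub>v tvec f = B *\<^sub>v tvec f"
  shows "A = B"
  by (rule eq_mat_if_eq_on_vecs[OF assms(1,2)]) (metis assms(3) vec_eq_tvec)

lemma omat_mult_tvec:
  assumes "r \<in> {1..<n}" "A \<in> carrier_mat (R_dim \<alpha>) (R_dim \<alpha>)"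
  shows "(A * omat r) *\<^sub>v tvec f = A *\<^sub>v tvec (yop r f)"
  using assms by (simp add: assoc_mult_mat_vec[OF assms(2) omat_carrier tvec_carrier] omat_tvec)

lemma omat_square:
  assumes r: "r \<in> {1..<n}"
  shows "omat r * omat r = z \<cdot>\<^sub>m omat r + 1\<^sub>m (R_dim \<alpha>)"
proof (rule mat_eq_if_eq_on_tvec)
  fix f
  have "(z \<cdot>\<^sub>m omat r + 1\<^sub>m (R_dim \<alpha>)) *\<^sub>v tvec f = z \<cdot>\<^sub>v (omat r *\<^sub>v tvec f) + tvec f"
    by (simp add: add_mult_distrib_mat_vec[of _ "R_dim \<alpha>" "R_dim \<alpha>"] smult_mat_mult_vec[OF omat_carrier tvec_carrier])
  also have "\<dots> = (omat r * omat r) *\<^sub>v tvec f"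
    unfolding omat_mult_tvec[OF r omat_carrier] omat_tvec[OF r] tvec_add tvec_smult
    by (rule tvec_cong) (simp only: yop_square r)
  finally show "(omat r * omat r) *\<^sub>v tvec f = (z \<cdot>\<^sub>m omat r + 1\<^sub>m (R_dim \<alpha>)) *\<^sub>v tvec f" ..
qed (simp_all add: mult_carrier_mat[OF omat_carrier omat_carrier])

lemma omat_inverse:
  assumes r: "r \<in> {1..<n}"
  shows "omat r * (omat r - z \<cdot>\<^sub>m 1\<^sub>m (R_dim \<alpha>)) = 1\<^sub>m (R_dim \<alpha>)"
    "(omat r - z \<cdot>\<^sub>m 1\<^sub>m (R_dim \<alpha>)) * omat r = 1\<^sub>m (R_dim \<alpha>)"
  by (rule quadratic_inverse[OF omat_carrier omat_square[OF r]])+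

lemma omat_GL: "r \<in> {1..<n} \<Longrightarrow> omat r \<in> carrier (GL (R_dim \<alpha>))"
  by (rule quadratic_GL[OF omat_carrier omat_square])

lemma omat_braid_images: "braid_images (GL (R_dim \<alpha>)) n omat"
proof -
  interpret G: group "GL (R_dim \<alpha>) :: 'f mat monoid" by (rule GL_group)
  have m: "omat r * omat s \<in> carrier_mat (R_dim \<alpha>) (R_dim \<alpha>)" for r s
    by (rule mult_carrier_mat[OF omat_carrier omat_carrier])
  show ?thesis
  proof
    show "omat r \<in> carrier (GL (R_dim \<alpha>))" if "r \<in> {1..<n}" for r by (rule omat_GL[OF that])
    show "omat r \<otimes>\<^bsub>GL (R_dim \<alpha>)\<^esub> omat s = omat s \<otimes>\<^bsub>GL (R_dim \<alpha>)\<^esub> omat r"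
      if "r \<in> {1..<n}" "s \<in> {1..<n}" "r + 2 \<le> s" for r s
      unfolding GL_mult
      by (rule mat_eq_if_eq_on_tvec[OF m m])
        (simp only: omat_mult_tvec[OF that(1) omat_carrier] omat_mult_tvec[OF that(2) omat_carrier]
          omat_tvec[OF that(1)] omat_tvec[OF that(2)], rule tvec_cong, rule yop_far[OF _ that])
    show "omat r \<otimes>\<^bsub>GL (R_dim \<alpha>)\<^esub> omat (r + 1) \<otimes>\<^bsub>GL (R_dim \<alpha>)\<^esub> omat r
        = omat (r + 1) \<otimes>\<^bsub>GL (R_dim \<alpha>)\<^esub> omat r \<otimes>\<^bsub>GL (R_dim \<alpha>)\<^esub> omat (r + 1)"
      if r: "r \<in> {1..<n}" "r + 1 \<in> {1..<n}" for r
      unfolding GL_mult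
    proof (rule mat_eq_if_eq_on_tvec)
      fix f
      have r': "Suc r \<in> {1..<n}" using r by simp
      show "(omat r * omat (r + 1) * omat r) *\<^sub>v tvec f
          = (omat (r + 1) * omat r * omat (r + 1)) *\<^sub>v tvec f"
        unfolding Suc_eq_plus1[symmetric]
        by (simp only: omat_mult_tvec[OF r(1) m] omat_mult_tvec[OF r' m]
            omat_mult_tvec[OF r(1) omat_carrier] omat_mult_tvec[OF r' omat_carrier]
            omat_tvec[OF r(1)] omat_tvec[OF r'])
          (rule tvec_cong, rule yop_braid[OF _ r(1) r'])
    qed (rule mult_carrier_mat[OF m omat_carrier])+
  qed
qed

end

text \<open>The maximum is at least the cardinality minus one; remove it and induct. The equality
  case is used to turn a count of row indices into an equality of sets.\<close>

lemma sum_ge_initial_segment: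
  assumes "finite (X :: nat set)"
  shows "\<Sum>{..<card X} \<le> \<Sum>X" "\<Sum>X = \<Sum>{..<card X} \<Longrightarrow> X = {..<card X}"
proof -
  have "\<Sum>{..<card X} \<le> \<Sum>X \<and> (\<Sum>X = \<Sum>{..<card X} \<longrightarrow> X = {..<card X})"
    using assms
  proof (induction "card X" arbitrary: X)
    case (Suc m)
    define x where "x = Max X"
    have ne: "X \<noteq> {}" using Suc.hyps(2) by auto
    have x: "x \<in> X" using Suc.prems ne by (simp add: x_def)
    have "X \<subseteq> {..x}" using Suc.prems by (auto simp: x_def)
    from card_mono[OF _ this] have mx: "m \<le> x" using Suc.hyps(2) by simp
    define Y where "Y = X - {x}"
    have Y: "finite Y" "m = card Y" "x \<notin> Y" "X = insert x Y"
      using Suc.prems Suc.hyps(2) x by (auto simp: Y_def)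
    have IH: "\<Sum>{..<m} \<le> \<Sum>Y" "\<Sum>Y = \<Sum>{..<m} \<longrightarrow> Y = {..<m}"
      using Suc.hyps(1)[OF Y(2,1)] unfolding Y(2) by auto
    have sum: "\<Sum>X = x + \<Sum>Y" using Y by simp
    have seg: "\<Sum>{..<card X} = m + \<Sum>{..<m}" using Suc.hyps(2)[symmetric] by simp
    show ?case
    proof (intro conjI impI)
      show "\<Sum>{..<card X} \<le> \<Sum>X" using IH(1) mx by (simp add: sum seg)
      assume "\<Sum>X = \<Sum>{..<card X}"
      then have "x = m" "Y = {..<m}" using IH mx by (auto simp: sum seg)
      then show "X = {..<card X}" using Y(4) Suc.hyps(2)[symmetric] by (auto simp: lessThan_Suc)
    qed
  qed simp
  then show "\<Sum>{..<card X} \<le> \<Sum>X" "\<Sum>X = \<Sum>{..<card X} \<Longrightarrow> X = {..<card X}" by auto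
qed

section \<open>The group algebra of the symmetric group\<close>

abbreviation perms :: "nat \<Rightarrow> (nat \<Rightarrow> nat) set" where
  "perms n \<equiv> {p. p permutes {1..n}}"

lemma finite_perms: "finite {p. p permutes {k..n :: nat}}"
  by (rule finite_permutations) simp

lemma inv_comp_eq_iff:
  assumes s: "s permutes S"
  shows "inv' s \<circ> p = t \<longleftrightarrow> p = s \<circ> t"
proof
  assume t: "inv' s \<circ> p = t"
  show "p = s \<circ> t" unfolding t[symmetric] by (simp add: fun_eq_iff permutes_inverses(1)[OF s])
next
  assume p: "p = s \<circ> t"
  show "inv' s \<circ> p = t" unfolding p by (simp add: fun_eq_iff permutes_inverses(2)[OF s])
qed

lemma sum_perms_shift:
  assumes "q permutes {1..n}"
  shows "(\<Sum>p\<in>perms n. f (inv' q \<circ> p) (p :: nat \<Rightarrow> nat)) = (\<Sum>p\<in>perms n. f p (q \<circ> p))"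
proof -
  have "inv' q \<circ> (q \<circ> p) = p" for p :: "nat \<Rightarrow> nat"
    using permutes_inverses(2)[OF assms] by (simp add: fun_eq_iff)
  then show ?thesis
    by (subst setum_permutations_compose_left[OF assms]) simp
qed

lemma inv_comp_permutes:
  assumes "p permutes S" "q permutes S"
  shows "inv' (p \<circ> q) = inv' q \<circ> inv' p"
  using assms by (intro o_inv_distrib permutes_bij)

lemma gralg_mult_apply:
  "p permutes {1..n} \<Longrightarrow> gralg_mult n f g p = (\<Sum>s\<in>perms n. f s * g (inv' s \<circ> p))"
  by (simp add: gralg_mult_def)

lemma gralg_mult_outside: "\<not> p permutes {1..n} \<Longrightarrow> gralg_mult n f g p = 0"
  by (simp add: gralg_mult_def)

lemma gralg_mult_gralg: "gralg_mult n f g \<in> gralg n"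
  by (simp add: gralg_def gralg_mult_outside)

lemma gralg_mult_assoc:
  "gralg_mult n (gralg_mult n f g) h = gralg_mult n f (gralg_mult n g h)"
proof
  fix p
  show "gralg_mult n (gralg_mult n f g) h p = gralg_mult n f (gralg_mult n g h) p"
  proof (cases "p permutes {1..n}")
    case True
    have "gralg_mult n (gralg_mult n f g) h p
        = (\<Sum>u\<in>perms n. \<Sum>s\<in>perms n. f s * g (inv' s \<circ> u) * h (inv' u \<circ> p))"
      unfolding gralg_mult_apply[OF True]
      by (rule sum.cong) (simp_all add: gralg_mult_apply sum_distrib_right)
    also have "\<dots> = (\<Sum>s\<in>perms n. \<Sum>u\<in>perms n. f s * g (inv' s \<circ> u) * h (inv' u \<circ> p))"
      by (rule sum.swap)
    also have "\<dots> = (\<Sum>s\<in>perms n. \<Sum>t\<in>perms n. f s * g t * h (inv' (s \<circ> t) \<circ> p))"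
      by (intro sum.cong refl sum_perms_shift) simp
    also have "\<dots> = (\<Sum>s\<in>perms n. f s * (\<Sum>t\<in>perms n. g t * h (inv' t \<circ> (inv' s \<circ> p))))"
      by (intro sum.cong refl) (simp add: sum_distrib_left mult.assoc inv_comp_permutes comp_assoc)
    also have "\<dots> = gralg_mult n f (gralg_mult n g h) p"
    proof -
      have "gralg_mult n g h (inv' s \<circ> p) = (\<Sum>t\<in>perms n. g t * h (inv' t \<circ> (inv' s \<circ> p)))"
        if "s \<in> perms n" for s
        using that by (intro gralg_mult_apply permutes_compose[OF True permutes_inv]) simp
      then show ?thesis unfolding gralg_mult_apply[OF True] by (intro sum.cong refl) (simp only:)
    qed
    finally show ?thesis .
  qed (simp add: gralg_mult_outside)
qed

lemma gralg_of_mult: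
  assumes s: "s permutes {1..n}" and p: "p permutes {1..n}"
  shows "gralg_mult n (gralg_of s) f p = f (inv' s \<circ> p)"
proof -
  have "gralg_mult n (gralg_of s) f p = (\<Sum>u\<in>perms n. if u = s then f (inv' u \<circ> p) else 0)"
    unfolding gralg_mult_apply[OF p] by (rule sum.cong) (simp_all add: gralg_of_def)
  then show ?thesis using s by (simp add: sum.delta finite_perms)
qed

lemma mult_gralg_of:
  assumes s: "s permutes {1..n}" and p: "p permutes {1..n}"
  shows "gralg_mult n f (gralg_of s) p = f (p \<circ> inv' s)"
proof -
  have eq: "inv' u \<circ> p = s \<longleftrightarrow> u = p \<circ> inv' s" if u: "u permutes {1..n}" for u
  proof -
    have "inv' u \<circ> p = s \<longleftrightarrow> p = u \<circ> s" by (rule inv_comp_eq_iff[OF u])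
    also have "\<dots> \<longleftrightarrow> u = p \<circ> inv' s"
    proof
      assume p': "p = u \<circ> s"
      show "u = p \<circ> inv' s" unfolding p' by (simp add: fun_eq_iff permutes_inverses(1)[OF s])
    next
      assume u': "u = p \<circ> inv' s"
      show "p = u \<circ> s" unfolding u' by (simp add: fun_eq_iff permutes_inverses(2)[OF s])
    qed
    finally show ?thesis .
  qed
  have "gralg_mult n f (gralg_of s) p = (\<Sum>u\<in>perms n. if u = p \<circ> inv' s then f u else 0)"
    unfolding gralg_mult_apply[OF p] by (rule sum.cong) (auto simp: gralg_of_def eq)
  then show ?thesis using permutes_compose[OF permutes_inv[OF s] p] by (simp add: sum.delta finite_perms)
qed

lemma gralg_of_comp:
  assumes s: "s permutes {1..n}" and t: "t permutes {1..n}"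
  shows "gralg_mult n (gralg_of s) (gralg_of t) = (gralg_of (s \<circ> t) :: _ \<Rightarrow> 'k::field)"
proof
  fix p
  show "gralg_mult n (gralg_of s) (gralg_of t) p = (gralg_of (s \<circ> t) p :: 'k)"
  proof (cases "p permutes {1..n}")
    case True
    have "inv' s \<circ> p = t \<longleftrightarrow> p = s \<circ> t" by (rule inv_comp_eq_iff[OF s])
    then show ?thesis by (simp add: gralg_of_mult[OF s True]) (simp add: gralg_of_def)
  next
    case False
    then have "p \<noteq> s \<circ> t" using permutes_compose[OF t s] by auto
    then show ?thesis using False by (simp add: gralg_mult_outside gralg_of_def)
  qed
qed

lemma gralg_mult_sum_left:
  "gralg_mult n (\<lambda>p. \<Sum>i\<in>I. c i * f i p) g = (\<lambda>p. \<Sum>i\<in>I. c i * gralg_mult n (f i) g p)"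
proof
  fix p
  show "gralg_mult n (\<lambda>p. \<Sum>i\<in>I. c i * f i p) g p = (\<Sum>i\<in>I. c i * gralg_mult n (f i) g p)"
    by (simp add: gralg_mult_def sum_distrib_left sum_distrib_right mult.assoc sum.swap[of _ I])
qed

lemma gralg_mult_sum_right:
  "gralg_mult n g (\<lambda>p. \<Sum>i\<in>I. c i * f i p) = (\<lambda>p. \<Sum>i\<in>I. c i * gralg_mult n g (f i) p)"
proof
  fix p
  show "gralg_mult n g (\<lambda>p. \<Sum>i\<in>I. c i * f i p) p = (\<Sum>i\<in>I. c i * gralg_mult n g (f i) p)"
    by (simp add: gralg_mult_def sum_distrib_left mult.left_commute sum.swap[of _ I])
qed

lemma gralg_mult_scale_right: "gralg_mult n g (\<lambda>p. c * f p) = (\<lambda>p. c * gralg_mult n g f p)"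
  using gralg_mult_sum_right[of n g "\<lambda>_. c" "\<lambda>_. f" "{()}"] by simp

lemma gralg_expand:
  assumes "f \<in> gralg n"
  shows "f = (\<lambda>p. \<Sum>s\<in>perms n. f s * gralg_of s p)"
proof
  fix p
  have "(\<Sum>s\<in>perms n. f s * gralg_of s p) = (\<Sum>s\<in>perms n. if s = p then f s else 0)"
    by (rule sum.cong) (auto simp: gralg_of_def)
  then show "f p = (\<Sum>s\<in>perms n. f s * gralg_of s p)"
    using assms by (simp add: sum.delta finite_perms gralg_def)
qed

text \<open>The coefficient at the identity is a trace form on the group algebra. The arguments on
  Young symmetrizers read scalars off from it.\<close>

lemma gralg_mult_trace: "gralg_mult n f g id = gralg_mult n g f id"
proof -
  have "gralg_mult n f g id = (\<Sum>s\<in>perms n. f s * g (inv' s))"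
    by (simp add: gralg_mult_apply permutes_id)
  also have "\<dots> = (\<Sum>s\<in>perms n. f (inv' s) * g (inv' (inv' s)))"
    by (rule sum_permutations_inverse)
  also have "\<dots> = (\<Sum>s\<in>perms n. g s * f (inv' s))"
    by (rule sum.cong) (simp_all add: permutes_inv_inv mult.commute)
  also have "\<dots> = gralg_mult n g f id"
    by (simp add: gralg_mult_apply permutes_id)
  finally show ?thesis .
qed

section \<open>Young symmetrizers\<close>

context partition_shape
begin

lemma col_stabilizer_iff:
  "p \<in> col_stabilizer \<alpha> T \<longleftrightarrow> p permutes {1..n} \<and> (\<forall>r\<in>{1..n}. col_of \<alpha> T (p r) = col_of \<alpha> T r)"
  by (simp add: col_stabilizer_def sum_list_shape)

lemma row_stabilizer_iff:
  "p \<in> row_stabilizer \<alpha> T \<longleftrightarrow> p permutes {1..n} \<and> (\<forall>r\<in>{1..n}. row_of \<alpha> T (p r) = row_of \<alpha> T r)"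
  by (simp add: row_stabilizer_def sum_list_shape)

lemma stabilizer_group:
  fixes f :: "nat \<Rightarrow> 'c"
  assumes "p permutes {1..n}" "\<forall>r\<in>{1..n}. f (p r) = f r" "q permutes {1..n}"
  shows "(\<forall>r\<in>{1..n}. f ((inv' p \<circ> q) r) = f r) \<longleftrightarrow> (\<forall>r\<in>{1..n}. f (q r) = f r)"
    "(\<forall>r\<in>{1..n}. f ((q \<circ> inv' p) r) = f r) \<longleftrightarrow> (\<forall>r\<in>{1..n}. f (q r) = f r)"
proof -
  have pi: "f (inv' p r) = f r" if "r \<in> {1..n}" for r
  proof -
    have "inv' p r \<in> {1..n}" using permutes_in_image[OF permutes_inv[OF assms(1)]] that by simp
    then show ?thesis using assms(2) permutes_inverses(1)[OF assms(1)] by metis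
  qed
  have q: "q r \<in> {1..n}" if "r \<in> {1..n}" for r using permutes_in_image[OF assms(3)] that by simp
  have pin: "inv' p r \<in> {1..n}" "p r \<in> {1..n}" if "r \<in> {1..n}" for r
    using permutes_in_image[OF permutes_inv[OF assms(1)]] permutes_in_image[OF assms(1)] that by auto
  show "(\<forall>r\<in>{1..n}. f ((inv' p \<circ> q) r) = f r) \<longleftrightarrow> (\<forall>r\<in>{1..n}. f (q r) = f r)"
    using pi q by simp
  show "(\<forall>r\<in>{1..n}. f ((q \<circ> inv' p) r) = f r) \<longleftrightarrow> (\<forall>r\<in>{1..n}. f (q r) = f r)"
  proof
    assume h: "\<forall>r\<in>{1..n}. f ((q \<circ> inv' p) r) = f r"
    show "\<forall>r\<in>{1..n}. f (q r) = f r"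
    proof
      fix r assume r: "r \<in> {1..n}"
      have "f (q (inv' p (p r))) = f (p r)" using h pin(2)[OF r] by simp
      then show "f (q r) = f r" using permutes_inverses(2)[OF assms(1)] assms(2) r by simp
    qed
  qed (use pi pin in simp)
qed

text \<open>Von Neumann's lemma. Send i to the position in its own column and in the row of
  \<open>inv' p i\<close>. This map is injective, puts the right number of positions into each
  column and keeps the total of the row indices. Rows 0, 1, ... give the least total in a column, so
  the image is the diagram. The permutation q read off from it keeps columns, and
  \<open>q \<circ> p\<close> keeps rows.\<close>

lemma stabilizer_factorization:
  assumes T: "T \<in> fillings \<alpha>" and p: "p permutes {1..n}"
    and no_bad: "\<And>i j. i \<in> {1..n} \<Longrightarrow> j \<in> {1..n} \<Longrightarrow> i \<noteq> j \<Longrightarrow> col_of \<alpha> T i = col_of \<alpha> T j \<Longrightarrow>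
      row_of \<alpha> T (inv' p i) \<noteq> row_of \<alpha> T (inv' p j)"
  shows "\<exists>q\<in>col_stabilizer \<alpha> T. \<exists>r\<in>row_stabilizer \<alpha> T. p = q \<circ> r"
proof -
  define g where "g i = (col_of \<alpha> T i, row_of \<alpha> T (inv' p i))" for i
  have g_inj: "inj_on g {1..n}" by (intro inj_onI) (metis no_bad g_def prod.inject)
  have box: "box_of \<alpha> T i = (col_of \<alpha> T i, row_of \<alpha> T i)" for i by (simp add: col_of_def row_of_def)
  have box_bij: "bij_betw (box_of \<alpha> T) {1..n} Dg"
    by (rule bij_betwI[where g = T])
      (use box_of_in[OF T] box_of_entry[OF T] box_of_eq[OF T] entry_range[OF T] in auto)
  define E where "E = g ` {1..n}"
  have finE: "finite E" by (simp add: E_def)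
  define col_set where "col_set X c = {l. (c, l) \<in> X}" for X :: "(nat \<times> nat) set" and c
  have fin_col: "finite X \<Longrightarrow> finite (col_set X c)" for X c
  proof (rule finite_subset)
    show "col_set X c \<subseteq> snd ` X" unfolding col_set_def by (rule subsetI) (metis imageI mem_Collect_eq snd_conv)
  qed simp
  have card_col: "card (col_set (h ` {1..n}) c) = card {i \<in> {1..n}. col_of \<alpha> T i = c}"
    if "inj_on h {1..n}" "\<And>i. fst (h i) = col_of \<alpha> T i" for h c
  proof -
    have image: "col_set (h ` {1..n}) c = (snd \<circ> h) ` {i \<in> {1..n}. col_of \<alpha> T i = c}"
    proof (intro equalityI subsetI)
      fix l assume "l \<in> col_set (h ` {1..n}) c"
      then obtain i where "i \<in> {1..n}" "h i = (c, l)" unfolding col_set_def by force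
      then show "l \<in> (snd \<circ> h) ` {i \<in> {1..n}. col_of \<alpha> T i = c}"
        using that(2)[of i] by (intro image_eqI[of _ _ i]) auto
    next
      fix l assume "l \<in> (snd \<circ> h) ` {i \<in> {1..n}. col_of \<alpha> T i = c}"
      then obtain i where i: "i \<in> {1..n}" "col_of \<alpha> T i = c" "l = snd (h i)" by auto
      then have "(c, l) = h i" using that(2)[of i] by (simp add: prod_eq_iff)
      then show "l \<in> col_set (h ` {1..n}) c" unfolding col_set_def using i(1) by blast
    qed
    have inj: "inj_on (snd \<circ> h) {i \<in> {1..n}. col_of \<alpha> T i = c}"
    proof (rule inj_onI)
      fix x y assume xy: "x \<in> {i \<in> {1..n}. col_of \<alpha> T i = c}" "y \<in> {i \<in> {1..n}. col_of \<alpha> T i = c}"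
        "(snd \<circ> h) x = (snd \<circ> h) y"
      then have "h x = h y" using that(2)[of x] that(2)[of y] by (simp add: prod_eq_iff)
      then show "x = y" using inj_onD[OF that(1)] xy by blast
    qed
    show ?thesis unfolding image by (rule card_image[OF inj])
  qed
  have D_image: "Dg = box_of \<alpha> T ` {1..n}" using box_bij by (simp add: bij_betw_def)
  have cards: "card (col_set E c) = card (col_set Dg c)" for c
    unfolding E_def D_image using g_inj box_bij
    by (subst (1 2) card_col) (auto simp: g_def box bij_betw_def)
  have initial: "col_set Dg c = {..<card (col_set Dg c)}" for c
  proof (cases "c < length \<alpha>")
    case True
    then have "col_set Dg c = {..<\<alpha> ! c}" by (auto simp: col_set_def diagram_def)
    then show ?thesis by simp
  next
    case False
    then have "col_set Dg c = {}" by (auto simp: col_set_def diagram_def)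
    then show ?thesis by simp
  qed
  define cs where "cs = fst ` E \<union> fst ` Dg"
  have fincs: "finite cs" using finE finite_diagram by (simp add: cs_def)
  have total: "(\<Sum>b\<in>X. snd b) = (\<Sum>c\<in>cs. \<Sum>(col_set X c))" if "finite X" "fst ` X \<subseteq> cs" for X
  proof -
    have "X = Sigma cs (col_set X)" using that by (force simp: col_set_def)
    then have "(\<Sum>b\<in>X. snd b) = (\<Sum>b\<in>Sigma cs (col_set X). snd b)" by simp
    also have "\<dots> = (\<Sum>c\<in>cs. \<Sum>l\<in>col_set X c. l)"
      using fincs fin_col[OF that(1)] by (subst sum.Sigma) (auto simp: case_prod_unfold)
    finally show ?thesis by simp
  qed
  have sumE: "(\<Sum>b\<in>E. snd b) = (\<Sum>i\<in>{1..n}. row_of \<alpha> T (inv' p i))"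
    unfolding E_def by (subst sum.reindex[OF g_inj]) (simp add: g_def)
  have sumD: "(\<Sum>b\<in>Dg. snd b) = (\<Sum>i\<in>{1..n}. row_of \<alpha> T i)"
    using sum.reindex_bij_betw[OF box_bij, of snd] by (simp add: row_of_def)
  have "(\<Sum>i\<in>{1..n}. row_of \<alpha> T (inv' p i)) = (\<Sum>i\<in>{1..n}. row_of \<alpha> T i)"
    using sum.permute[OF permutes_inv[OF p], of "row_of \<alpha> T"] by (simp add: o_def)
  \<comment> \<open>Reindexing by p shows that the totals over E and over the diagram agree. No
    column of E has a smaller sum than that of the diagram, so equality holds column by
    column.\<close>
  then have sums: "(\<Sum>c\<in>cs. \<Sum>(col_set Dg c)) = (\<Sum>c\<in>cs. \<Sum>(col_set E c))"
    using total[OF finE] total[OF finite_diagram] sumE sumD by (simp add: cs_def)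
  have le: "\<Sum>(col_set Dg c) \<le> \<Sum>(col_set E c)" for c
    using sum_ge_initial_segment(1)[OF fin_col[OF finE], of c] initial[of c] cards[of c] by simp
  have eq: "\<Sum>(col_set E c) = \<Sum>(col_set Dg c)" if "c \<in> cs" for c
    using sum_mono_inv[OF sums le that fincs] by simp
  have col_eq: "col_set E c = col_set Dg c" for c
  proof (cases "c \<in> cs")
    case True
    then show ?thesis
      using sum_ge_initial_segment(2)[OF fin_col[OF finE], of c] initial[of c] cards[of c] eq by simp
  next
    case False
    then show ?thesis by (force simp: cs_def col_set_def)
  qed
  have "(c, l) \<in> E \<longleftrightarrow> (c, l) \<in> Dg" for c l
    using col_eq[of c] unfolding col_set_def by (simp add: set_eq_iff)
  then have ED: "E = Dg" by (auto simp: set_eq_iff)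
  define q where "q i = (if i \<in> {1..n} then T (g i) else i)" for i
  have gD: "g i \<in> Dg" if "i \<in> {1..n}" for i using that ED by (auto simp: E_def)
  have "bij_betw g {1..n} Dg" using g_inj ED by (simp add: bij_betw_def E_def)
  then have "bij_betw (T \<circ> g) {1..n} {1..n}" using filling_bij[OF T] by (rule bij_betw_trans)
  then have "bij_betw q {1..n} {1..n}" by (subst bij_betw_cong[of _ _ "T \<circ> g"]) (auto simp: q_def)
  then have q: "q permutes {1..n}" by (rule bij_imp_permutes) (auto simp: q_def)
  have boxq: "box_of \<alpha> T (q i) = g i" if "i \<in> {1..n}" for i
    using box_of_eq[OF T gD[OF that]] that by (simp add: q_def)
  have qC: "\<forall>i\<in>{1..n}. col_of \<alpha> T (q i) = col_of \<alpha> T i"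
    using boxq by (simp add: col_of_def g_def)
  have qrow: "row_of \<alpha> T (q i) = row_of \<alpha> T (inv' p i)" if "i \<in> {1..n}" for i
    using boxq[OF that] unfolding row_of_def g_def by simp
  have "q \<circ> p \<in> row_stabilizer \<alpha> T"
    unfolding row_stabilizer_iff
  proof (intro conjI ballI)
    show "q \<circ> p permutes {1..n}" by (rule permutes_compose[OF p q])
    fix i assume "i \<in> {1..n}"
    then have "p i \<in> {1..n}" using permutes_in_image[OF p] by simp
    then show "row_of \<alpha> T ((q \<circ> p) i) = row_of \<alpha> T i"
      using qrow permutes_inverses(2)[OF p] by simp
  qed
  moreover have "inv' q \<in> col_stabilizer \<alpha> T"
    using stabilizer_group(1)[OF q qC permutes_id] permutes_inv[OF q] by (simp add: col_stabilizer_iff)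
  moreover have "p = inv' q \<circ> (q \<circ> p)" using permutes_inverses(2)[OF q] by (simp add: fun_eq_iff)
  ultimately show ?thesis by blast
qed

definition col_sum :: "(nat \<times> nat \<Rightarrow> nat) \<Rightarrow> (nat \<Rightarrow> nat) \<Rightarrow> 'k::field" where
  "col_sum T p = (if p \<in> col_stabilizer \<alpha> T then 1 else 0)"

definition row_sum :: "(nat \<times> nat \<Rightarrow> nat) \<Rightarrow> (nat \<Rightarrow> nat) \<Rightarrow> 'k::field" where
  "row_sum T p = (if p \<in> row_stabilizer \<alpha> T then of_int (sign p) else 0)"

lemma young_symmetrizer_eq: "young_symmetrizer \<alpha> T = gralg_mult n (col_sum T) (row_sum T)"
  unfolding young_symmetrizer_def col_sum_def row_sum_def sum_list_shape ..

lemma col_sum_outside: "\<not> p permutes {1..n} \<Longrightarrow> col_sum T p = 0"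
  and row_sum_outside: "\<not> p permutes {1..n} \<Longrightarrow> row_sum T p = 0"
  by (auto simp: col_sum_def row_sum_def col_stabilizer_iff row_stabilizer_iff)

lemma col_sum_mult_gralg_of:
  assumes q: "q \<in> col_stabilizer \<alpha> T"
  shows "gralg_mult n (col_sum T) (gralg_of q) = (col_sum T :: _ \<Rightarrow> 'k::field)"
proof
  fix p
  have qp: "q permutes {1..n}" using q by (simp add: col_stabilizer_iff)
  show "gralg_mult n (col_sum T) (gralg_of q) p = (col_sum T p :: 'k)"
  proof (cases "p permutes {1..n}")
    case True
    have "p \<circ> inv' q \<in> col_stabilizer \<alpha> T \<longleftrightarrow> p \<in> col_stabilizer \<alpha> T"
      using stabilizer_group(2)[OF qp _ True, of "col_of \<alpha> T"] q
        permutes_compose[OF permutes_inv[OF qp] True] True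
      by (simp add: col_stabilizer_iff)
    then show ?thesis by (simp add: mult_gralg_of[OF qp True] col_sum_def)
  next
    case False
    then show ?thesis using gralg_mult_outside col_sum_outside by metis
  qed
qed

lemma gralg_of_mult_row_sum:
  assumes q: "q \<in> row_stabilizer \<alpha> T"
  shows "gralg_mult n (gralg_of q) (row_sum T) = (\<lambda>p. of_int (sign q) * row_sum T p :: 'k::field)"
proof
  fix p
  have qp: "q permutes {1..n}" using q by (simp add: row_stabilizer_iff)
  show "gralg_mult n (gralg_of q) (row_sum T) p = (of_int (sign q) * row_sum T p :: 'k)"
  proof (cases "p permutes {1..n}")
    case True
    have "inv' q \<circ> p \<in> row_stabilizer \<alpha> T \<longleftrightarrow> p \<in> row_stabilizer \<alpha> T"
      using stabilizer_group(1)[OF qp _ True, of "row_of \<alpha> T"] q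
        permutes_compose[OF True permutes_inv[OF qp]] True
      by (simp add: row_stabilizer_iff)
    moreover have "permutation q" "permutation p"
      using permutes_imp_permutation[of "{1..n}"] qp True by auto
    then have "sign (inv' q \<circ> p) = sign q * sign p"
      by (simp add: sign_compose permutation_inverse sign_inverse)
    ultimately show ?thesis by (simp add: gralg_of_mult[OF qp True] row_sum_def)
  next
    case False
    then show ?thesis using gralg_mult_outside row_sum_outside mult_zero_right by metis
  qed
qed

lemma transpose_col_stabilizer:
  "i \<in> {1..n} \<Longrightarrow> j \<in> {1..n} \<Longrightarrow> col_of \<alpha> T i = col_of \<alpha> T j \<Longrightarrow>
    Transposition.transpose i j \<in> col_stabilizer \<alpha> T"
  unfolding col_stabilizer_iff using permutes_swap_id[of i "{1..n}" j]
  by (auto simp: Transposition.transpose_def)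

lemma transpose_row_stabilizer:
  "i \<in> {1..n} \<Longrightarrow> j \<in> {1..n} \<Longrightarrow> row_of \<alpha> T i = row_of \<alpha> T j \<Longrightarrow>
    Transposition.transpose i j \<in> row_stabilizer \<alpha> T"
  unfolding row_stabilizer_iff using permutes_swap_id[of i "{1..n}" j]
  by (auto simp: Transposition.transpose_def)

text \<open>If p brings two entries of one row into one column, a transposition t in the column
  stabilizer satisfies t p = p t' with a transposition t' in the row stabilizer. The product then
  equals its own negative. Otherwise p factors by \<open>stabilizer_factorization\<close>.\<close>

lemma col_sum_perm_row_sum:
  assumes T: "T \<in> fillings \<alpha>" and p: "p permutes {1..n}"
  shows "\<exists>c. gralg_mult n (gralg_mult n (col_sum T) (gralg_of p)) (row_sum T)
    = (\<lambda>x. c * young_symmetrizer \<alpha> T x :: 'k::field_char_0)"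
proof (cases "\<exists>i j. i \<in> {1..n} \<and> j \<in> {1..n} \<and> i \<noteq> j \<and> col_of \<alpha> T i = col_of \<alpha> T j \<and>
    row_of \<alpha> T (inv' p i) = row_of \<alpha> T (inv' p j)")
  case True
  then obtain i j where ij: "i \<in> {1..n}" "j \<in> {1..n}" "i \<noteq> j" "col_of \<alpha> T i = col_of \<alpha> T j"
    "row_of \<alpha> T (inv' p i) = row_of \<alpha> T (inv' p j)" by blast
  let ?t = "Transposition.transpose i j" and ?t' = "Transposition.transpose (inv' p i) (inv' p j)"
  let ?a = "col_sum T :: _ \<Rightarrow> 'k" and ?b = "row_sum T :: _ \<Rightarrow> 'k"
  have in': "inv' p i \<in> {1..n}" "inv' p j \<in> {1..n}" "inv' p i \<noteq> inv' p j"
    using permutes_in_image[OF permutes_inv[OF p]] ij permutes_inj[OF permutes_inv[OF p]]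
    by (auto simp: inj_eq)
  have t: "?t \<in> col_stabilizer \<alpha> T" and t': "?t' \<in> row_stabilizer \<alpha> T"
    using transpose_col_stabilizer transpose_row_stabilizer ij in' by auto
  have tp: "?t permutes {1..n}" "?t' permutes {1..n}"
    using t t' by (auto simp: col_stabilizer_iff row_stabilizer_iff)
  have "?t \<circ> p = p \<circ> ?t'"
  proof
    fix x
    have "p x = y \<longleftrightarrow> x = inv' p y" for y using permutes_inv_eq[OF p] by metis
    then show "(?t \<circ> p) x = (p \<circ> ?t') x"
      using permutes_inverses(1)[OF p] by (simp add: Transposition.transpose_def)
  qed
  then have comm: "gralg_mult n (gralg_of ?t) (gralg_of p) = (gralg_mult n (gralg_of p) (gralg_of ?t') :: _ \<Rightarrow> 'k)"
    using gralg_of_comp[OF tp(1) p] gralg_of_comp[OF p tp(2)] by metis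
  have "gralg_mult n (gralg_mult n ?a (gralg_of p)) ?b
      = gralg_mult n (gralg_mult n (gralg_mult n ?a (gralg_of ?t)) (gralg_of p)) ?b"
    by (simp only: col_sum_mult_gralg_of[OF t])
  also have "\<dots> = gralg_mult n (gralg_mult n ?a (gralg_of p)) (gralg_mult n (gralg_of ?t') ?b)"
    by (simp only: gralg_mult_assoc comm)
  also have "gralg_mult n (gralg_of ?t') ?b = (\<lambda>x. - 1 * ?b x)"
    using gralg_of_mult_row_sum[OF t'] in'(3) by (simp add: sign_swap_id)
  also have "gralg_mult n (gralg_mult n ?a (gralg_of p)) (\<lambda>x. - 1 * ?b x)
      = (\<lambda>x. - 1 * gralg_mult n (gralg_mult n ?a (gralg_of p)) ?b x)"
    by (rule gralg_mult_scale_right)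
  finally have e: "gralg_mult n (gralg_mult n ?a (gralg_of p)) ?b
      = (\<lambda>x. - 1 * gralg_mult n (gralg_mult n ?a (gralg_of p)) ?b x)" .
  have "gralg_mult n (gralg_mult n ?a (gralg_of p)) ?b x = 0" for x
  proof -
    have "y = 0" if "y = - 1 * y" for y :: 'k
    proof -
      have "2 * y = y + (- 1 * y)" using that by (simp only: mult_2)
      then show ?thesis by simp
    qed
    then show ?thesis using fun_cong[OF e, of x] by blast
  qed
  then show ?thesis by (intro exI[of _ 0]) auto
next
  case False
  then obtain q r where qr: "q \<in> col_stabilizer \<alpha> T" "r \<in> row_stabilizer \<alpha> T" "p = q \<circ> r"
    using stabilizer_factorization[OF T p] by blast
  then have qrp: "q permutes {1..n}" "r permutes {1..n}"
    by (auto simp: col_stabilizer_iff row_stabilizer_iff)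
  let ?a = "col_sum T :: _ \<Rightarrow> 'k" and ?b = "row_sum T :: _ \<Rightarrow> 'k"
  have "gralg_mult n (gralg_mult n ?a (gralg_of p)) ?b
      = gralg_mult n (gralg_mult n ?a (gralg_of q)) (gralg_mult n (gralg_of r) ?b)"
    unfolding qr(3) gralg_of_comp[OF qrp, symmetric] by (simp only: gralg_mult_assoc)
  also have "\<dots> = (\<lambda>x. of_int (sign r) * young_symmetrizer \<alpha> T x)"
    unfolding col_sum_mult_gralg_of[OF qr(1)] gralg_of_mult_row_sum[OF qr(2)]
      gralg_mult_scale_right young_symmetrizer_eq ..
  finally show ?thesis by blast
qed

lemma col_sum_gralg_row_sum:
  assumes T: "T \<in> fillings \<alpha>" and f: "f \<in> gralg n"
  shows "\<exists>c. gralg_mult n (gralg_mult n (col_sum T) f) (row_sum T)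
    = (\<lambda>x. c * young_symmetrizer \<alpha> T x :: 'k::field_char_0)"
proof -
  have "\<forall>p\<in>perms n. \<exists>c. gralg_mult n (gralg_mult n (col_sum T) (gralg_of p)) (row_sum T)
      = (\<lambda>x. c * young_symmetrizer \<alpha> T x :: 'k)"
    using col_sum_perm_row_sum[OF T] by blast
  then obtain c where c: "\<And>p. p \<in> perms n \<Longrightarrow>
      gralg_mult n (gralg_mult n (col_sum T) (gralg_of p)) (row_sum T)
      = (\<lambda>x. c p * young_symmetrizer \<alpha> T x :: 'k)" by metis
  have "gralg_mult n (gralg_mult n (col_sum T) f) (row_sum T)
      = (\<lambda>x. \<Sum>p\<in>perms n. f p * gralg_mult n (gralg_mult n (col_sum T) (gralg_of p)) (row_sum T) x)"
    by (subst gralg_expand[OF f]) (simp only: gralg_mult_sum_right gralg_mult_sum_left)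
  also have "\<dots> = (\<lambda>x. (\<Sum>p\<in>perms n. f p * c p) * young_symmetrizer \<alpha> T x)"
    by (rule ext) (simp add: c sum_distrib_right mult.assoc)
  finally show ?thesis by blast
qed

text \<open>With c = a b for the column sum a and the row sum b, the product c f c is a (b f a) b,
  to which \<open>col_sum_gralg_row_sum\<close> applies.\<close>

lemma young_symmetrizer_sandwich:
  assumes T: "T \<in> fillings \<alpha>"
  shows "\<exists>c. gralg_mult n (gralg_mult n (young_symmetrizer \<alpha> T) f) (young_symmetrizer \<alpha> T)
    = (\<lambda>x. c * young_symmetrizer \<alpha> T x :: 'k::field_char_0)"
proof -
  let ?a = "col_sum T :: _ \<Rightarrow> 'k" and ?b = "row_sum T :: _ \<Rightarrow> 'k"
  have "gralg_mult n (gralg_mult n (young_symmetrizer \<alpha> T) f) (young_symmetrizer \<alpha> T)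
      = gralg_mult n (gralg_mult n ?a (gralg_mult n (gralg_mult n ?b f) ?a)) ?b"
    unfolding young_symmetrizer_eq by (simp only: gralg_mult_assoc)
  then show ?thesis using col_sum_gralg_row_sum[OF T gralg_mult_gralg] by metis
qed

text \<open>A permutation that keeps rows and columns keeps boxes, so only the identity contributes.
  Consequently the factor in a multiple of the symmetrizer can be read off at
  \<open>id\<close>.\<close>

lemma young_symmetrizer_id:
  assumes T: "T \<in> fillings \<alpha>"
  shows "young_symmetrizer \<alpha> T id = (1 :: 'k::field)"
proof -
  have trivial: "s = id" if s: "s \<in> col_stabilizer \<alpha> T" "inv' s \<in> row_stabilizer \<alpha> T" for s
  proof
    fix x
    have sp: "s permutes {1..n}" using s by (simp add: col_stabilizer_iff)
    show "s x = id x"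
    proof (cases "x \<in> {1..n}")
      case True
      then have sx: "s x \<in> {1..n}" using permutes_in_image[OF sp] by simp
      have "row_of \<alpha> T (inv' s (s x)) = row_of \<alpha> T (s x)" using s(2) sx by (simp add: row_stabilizer_iff)
      then have "row_of \<alpha> T x = row_of \<alpha> T (s x)" using permutes_inverses(2)[OF sp] by simp
      moreover have "col_of \<alpha> T (s x) = col_of \<alpha> T x" using s(1) True by (simp add: col_stabilizer_iff)
      ultimately have "box_of \<alpha> T (s x) = box_of \<alpha> T x" by (simp add: col_of_def row_of_def prod_eq_iff)
      then show ?thesis using box_of_entry[OF T] True sx by (metis id_apply)
    next
      case False
      then show ?thesis using permutes_not_in[OF sp] by simp
    qed
  qed
  have "young_symmetrizer \<alpha> T id = (\<Sum>s\<in>perms n. col_sum T s * row_sum T (inv' s) :: 'k)"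
    by (simp add: young_symmetrizer_eq gralg_mult_apply permutes_id)
  also have "\<dots> = (\<Sum>s\<in>perms n. if s = id then 1 else 0)"
    by (rule sum.cong)
      (use trivial in \<open>auto simp: col_sum_def row_sum_def col_stabilizer_iff row_stabilizer_iff inv_id\<close>)
  also have "\<dots> = 1" by (simp add: sum.delta finite_perms permutes_id)
  finally show ?thesis .
qed

end

section \<open>Young's orthogonal form\<close>

lemma smult_vec_zeroD:
  fixes v :: "'a::field vec"
  assumes v: "v \<in> carrier_vec N" and z: "c \<cdot>\<^sub>v v = 0\<^sub>v N" and c: "c \<noteq> 0"
  shows "v = 0\<^sub>v N"
proof (rule eq_vecI)
  fix i assume "i < dim_vec (0\<^sub>v N :: 'a vec)"
  then have i: "i < N" by simp
  have "(c \<cdot>\<^sub>v v) $ i = 0" unfolding z using i by simp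
  then show "v $ i = 0\<^sub>v N $ i" using v c i by simp
qed (use v in simp)

lemma zero_smult_carrier_vec:
  fixes v :: "'a::semiring_0 vec"
  assumes "v \<in> carrier_vec N"
  shows "0 \<cdot>\<^sub>v v = 0\<^sub>v N"
  using assms by (intro eq_vecI) auto

section \<open>The group algebra acting through a matrix representation\<close>

locale sn_rep =
  fixes n N :: nat and \<rho> :: "(nat \<Rightarrow> nat) \<Rightarrow> 'f::field mat"
  assumes rep: "\<rho> \<in> hom (sym_group n) (GL N)"
begin

lemma rep_GL: "p permutes {1..n} \<Longrightarrow> \<rho> p \<in> carrier (GL N)"
proof -
  assume "p permutes {1..n}"
  then have "p \<in> carrier (sym_group n)" by (simp only: sym_group_carrier)
  then show ?thesis using rep by (auto simp: hom_def)
qed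

lemma rep_carrier: "p permutes {1..n} \<Longrightarrow> \<rho> p \<in> carrier_mat N N"
  by (rule GL_carrier_mat[OF rep_GL])

lemma rep_comp: "p permutes {1..n} \<Longrightarrow> q permutes {1..n} \<Longrightarrow> \<rho> (p \<circ> q) = \<rho> p * \<rho> q"
  using rep unfolding hom_def by (auto simp: sym_group_carrier sym_group_mult GL_mult)

lemma rep_id: "\<rho> id = 1\<^sub>m N"
proof -
  interpret group_hom "sym_group n" "GL N :: 'f mat monoid" \<rho>
    by (simp add: group_hom_def group_hom_axioms_def sym_group_is_group GL_group rep)
  show ?thesis using hom_one by (simp add: sym_group_one GL_one)
qed

definition gmat :: "((nat \<Rightarrow> nat) \<Rightarrow> 'f) \<Rightarrow> 'f mat" where
  "gmat x = mat N N (\<lambda>(i, j). \<Sum>p\<in>perms n. x p * \<rho> p $$ (i, j))"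

lemma gmat_carrier [simp]: "gmat x \<in> carrier_mat N N"
  by (simp add: gmat_def)

lemma gmat_gralg_of:
  assumes "s permutes {1..n}"
  shows "gmat (gralg_of s) = \<rho> s"
proof (rule eq_matI)
  fix i j assume "i < dim_row (\<rho> s)" "j < dim_col (\<rho> s)"
  then have ij: "i < N" "j < N" using rep_carrier[OF assms] by auto
  have "(\<Sum>p\<in>perms n. gralg_of s p * \<rho> p $$ (i, j)) = (\<Sum>p\<in>perms n. if p = s then \<rho> p $$ (i, j) else 0)"
    by (rule sum.cong) (auto simp: gralg_of_def)
  also have "\<dots> = \<rho> s $$ (i, j)" using assms by (simp add: sum.delta finite_perms)
  finally show "gmat (gralg_of s) $$ (i, j) = \<rho> s $$ (i, j)" using ij by (simp add: gmat_def)
qed (use rep_carrier[OF assms] in \<open>auto simp: gmat_def\<close>)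

lemma gmat_mult: "gmat (gralg_mult n x y) = gmat x * gmat y"
proof (rule eq_matI)
  fix i j assume "i < dim_row (gmat x * gmat y)" "j < dim_col (gmat x * gmat y)"
  then have ij: "i < N" "j < N" by (auto simp: gmat_def)
  have prod: "\<rho> (s \<circ> t) $$ (i, j) = (\<Sum>k<N. \<rho> s $$ (i, k) * \<rho> t $$ (k, j))"
    if "s \<in> perms n" "t \<in> perms n" for s t
    using that ij rep_comp[of s t] rep_carrier[of s] rep_carrier[of t]
    by (simp add: scalar_prod_def lessThan_atLeast0)
  have "(\<Sum>p\<in>perms n. gralg_mult n x y p * \<rho> p $$ (i, j))
      = (\<Sum>p\<in>perms n. \<Sum>s\<in>perms n. x s * y (inv' s \<circ> p) * \<rho> p $$ (i, j))"
    by (rule sum.cong) (simp_all add: gralg_mult_apply sum_distrib_right)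
  also have "\<dots> = (\<Sum>s\<in>perms n. \<Sum>p\<in>perms n. x s * y (inv' s \<circ> p) * \<rho> p $$ (i, j))"
    by (rule sum.swap)
  also have "\<dots> = (\<Sum>s\<in>perms n. \<Sum>t\<in>perms n. x s * y t * \<rho> (s \<circ> t) $$ (i, j))"
    by (intro sum.cong refl sum_perms_shift) simp
  also have "\<dots> = (\<Sum>s\<in>perms n. \<Sum>t\<in>perms n. \<Sum>k<N. (x s * \<rho> s $$ (i, k)) * (y t * \<rho> t $$ (k, j)))"
    by (intro sum.cong refl) (simp add: prod sum_distrib_left algebra_simps)
  also have "\<dots> = (\<Sum>s\<in>perms n. \<Sum>k<N. \<Sum>t\<in>perms n. (x s * \<rho> s $$ (i, k)) * (y t * \<rho> t $$ (k, j)))"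
    by (intro sum.cong refl sum.swap)
  also have "\<dots> = (\<Sum>k<N. \<Sum>s\<in>perms n. \<Sum>t\<in>perms n. (x s * \<rho> s $$ (i, k)) * (y t * \<rho> t $$ (k, j)))"
    by (rule sum.swap)
  also have "\<dots> = (\<Sum>k<N. (\<Sum>s\<in>perms n. x s * \<rho> s $$ (i, k)) * (\<Sum>t\<in>perms n. y t * \<rho> t $$ (k, j)))"
    by (simp add: sum_product)
  finally show "gmat (gralg_mult n x y) $$ (i, j) = (gmat x * gmat y) $$ (i, j)"
    using ij by (simp add: gmat_def scalar_prod_def lessThan_atLeast0)
qed (auto simp: gmat_def)

lemma gmat_add: "gmat (\<lambda>p. x p + y p) = gmat x + gmat y"
  by (rule eq_matI) (auto simp: gmat_def sum.distrib distrib_right)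

lemma gmat_scale: "gmat (\<lambda>p. c * x p) = c \<cdot>\<^sub>m gmat x"
  by (rule eq_matI) (auto simp: gmat_def sum_distrib_left mult.assoc)

lemma gmat_vec:
  assumes "v \<in> carrier_vec N" "i < N"
  shows "(gmat x *\<^sub>v v) $ i = (\<Sum>p\<in>perms n. x p * (\<rho> p *\<^sub>v v) $ i)"
proof -
  have "(gmat x *\<^sub>v v) $ i = (\<Sum>j<N. \<Sum>p\<in>perms n. x p * \<rho> p $$ (i, j) * v $ j)"
    using assms by (simp add: gmat_def scalar_prod_def sum_distrib_right lessThan_atLeast0)
  also have "\<dots> = (\<Sum>p\<in>perms n. \<Sum>j<N. x p * \<rho> p $$ (i, j) * v $ j)" by (rule sum.swap)
  also have "\<dots> = (\<Sum>p\<in>perms n. x p * (\<rho> p *\<^sub>v v) $ i)"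
  proof (rule sum.cong[OF refl])
    fix p assume "p \<in> perms n"
    then have "\<rho> p \<in> carrier_mat N N" using rep_carrier by simp
    then show "(\<Sum>j<N. x p * \<rho> p $$ (i, j) * v $ j) = x p * (\<rho> p *\<^sub>v v) $ i"
      using assms by (simp add: scalar_prod_def sum_distrib_left mult.assoc lessThan_atLeast0)
  qed
  finally show ?thesis .
qed

lemma gmat_mult_vec:
  "v \<in> carrier_vec N \<Longrightarrow> gmat (gralg_mult n x y) *\<^sub>v v = gmat x *\<^sub>v (gmat y *\<^sub>v v)"
  unfolding gmat_mult by (rule assoc_mult_mat_vec[OF gmat_carrier gmat_carrier])

text \<open>The cyclic submodule generated by v, since x ranges over the group algebra and not over
  the group.\<close>

definition orbit :: "'f vec \<Rightarrow> 'f vec set" where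
  "orbit v = {gmat x *\<^sub>v v | x. True}"

lemma orbit_gmat:
  assumes v: "v \<in> carrier_vec N" and w: "w \<in> orbit v"
  shows "gmat y *\<^sub>v w \<in> orbit v"
proof -
  obtain x where "w = gmat x *\<^sub>v v" using w by (auto simp: orbit_def)
  then have "gmat y *\<^sub>v w = gmat (gralg_mult n y x) *\<^sub>v v" by (simp add: gmat_mult_vec[OF v])
  then show ?thesis by (auto simp: orbit_def)
qed

lemma orbit_self: "v \<in> carrier_vec N \<Longrightarrow> v \<in> orbit v"
proof -
  assume "v \<in> carrier_vec N"
  then have "gmat (gralg_of id) *\<^sub>v v = v" by (simp add: gmat_gralg_of permutes_id rep_id)
  then show ?thesis unfolding orbit_def by (metis (mono_tags) mem_Collect_eq)
qed

lemma orbit_add: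
  assumes v: "v \<in> carrier_vec N" and "w \<in> orbit v" "w' \<in> orbit v"
  shows "w + w' \<in> orbit v"
proof -
  obtain x x' where "w = gmat x *\<^sub>v v" "w' = gmat x' *\<^sub>v v" using assms by (auto simp: orbit_def)
  then have "w + w' = gmat (\<lambda>p. x p + x' p) *\<^sub>v v"
    by (simp add: gmat_add add_mult_distrib_mat_vec[OF gmat_carrier gmat_carrier v])
  then show ?thesis by (auto simp: orbit_def)
qed

lemma orbit_smult:
  assumes v: "v \<in> carrier_vec N" and "w \<in> orbit v"
  shows "c \<cdot>\<^sub>v w \<in> orbit v"
proof -
  obtain x where "w = gmat x *\<^sub>v v" using assms by (auto simp: orbit_def)
  then have "c \<cdot>\<^sub>v w = gmat (\<lambda>p. c * x p) *\<^sub>v v"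
    by (simp add: gmat_scale smult_mat_mult_vec[OF gmat_carrier v])
  then show ?thesis by (auto simp: orbit_def)
qed

end

text \<open>The Jucys-Murphy element. As t_ij acts by twice a transposition, Y_r acts by twice the
  image of \<open>jm r\<close>.\<close>

definition jm :: "nat \<Rightarrow> (nat \<Rightarrow> nat) \<Rightarrow> 'f::field" where
  "jm r p = (if \<exists>i\<in>{1..<r}. p = Transposition.transpose i r then 1 else 0)"

text \<open>With s = \<open>adj r\<close> this reads J_(r+1) = s J_r s + s: conjugation by s turns
  (i r) into (i r+1), and s itself supplies the missing (r r+1).\<close>

lemma jm_Suc:
  assumes r: "r \<in> {1..<n}"
  shows "(jm (Suc r) :: _ \<Rightarrow> 'f::field)
    = (\<lambda>p. gralg_mult n (gralg_mult n (gralg_of (adj r)) (jm r)) (gralg_of (adj r)) p + gralg_of (adj r) p)"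
proof
  fix p
  let ?s = "adj r"
  have s: "?s permutes {1..n}" by (rule adj_permutes[OF r])
  have si: "inv' ?s = ?s" by (rule inv_transpose_eq)
  show "(jm (Suc r) p :: 'f) = gralg_mult n (gralg_mult n (gralg_of ?s) (jm r)) (gralg_of ?s) p + gralg_of ?s p"
  proof (cases "p permutes {1..n}")
    case p: True
    have "gralg_mult n (gralg_mult n (gralg_of ?s) (jm r)) (gralg_of ?s) p = (jm r (?s \<circ> (p \<circ> ?s)) :: 'f)"
      using gralg_of_mult[OF s permutes_compose[OF s p], of "jm r"]
      by (simp only: mult_gralg_of[OF s p] si)
    moreover have conj: "?s \<circ> (p \<circ> ?s) = Transposition.transpose i r \<longleftrightarrow> p = Transposition.transpose i (Suc r)"
      if "i < r" for i
    proof -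
      have tt: "?s \<circ> (Transposition.transpose i (Suc r) \<circ> ?s) = Transposition.transpose i r"
        using that by (auto simp: fun_eq_iff Transposition.transpose_def)
      have "p = ?s \<circ> ((?s \<circ> (p \<circ> ?s)) \<circ> ?s)" by (simp add: fun_eq_iff)
      moreover have "Transposition.transpose i (Suc r)
          = ?s \<circ> ((?s \<circ> (Transposition.transpose i (Suc r) \<circ> ?s)) \<circ> ?s)" by (simp add: fun_eq_iff)
      ultimately show ?thesis using tt by metis
    qed
    moreover have "\<not> (\<exists>i\<in>{1..<r}. ?s \<circ> (?s \<circ> ?s) = Transposition.transpose i r)"
    proof
      assume "\<exists>i\<in>{1..<r}. ?s \<circ> (?s \<circ> ?s) = Transposition.transpose i r"
      then obtain i where i: "i < r" "?s \<circ> (?s \<circ> ?s) = Transposition.transpose i r" by auto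
      then have "(?s \<circ> (?s \<circ> ?s)) r = Transposition.transpose i r r" by (simp only:)
      then show False using i(1) by simp
    qed
    ultimately show ?thesis
      using r by (auto simp: jm_def gralg_of_def less_Suc_eq)
  next
    case False
    have "p \<noteq> Transposition.transpose i (Suc r)" if "i \<in> {1..<Suc r}" for i
      using False permutes_swap_id[of i "{1..n}" "Suc r"] that r by auto
    moreover have "p \<noteq> ?s" using False s by auto
    ultimately show ?thesis using False by (auto simp: jm_def gralg_mult_outside gralg_of_def)
  qed
qed

section \<open>Jucys-Murphy eigenvalues and irreducibility of the orthogonal form\<close>

locale young_form = partition_shape +
  fixes rt :: "nat \<Rightarrow> 'f::field_char_0"
  assumes rt_square: "2 \<le> d \<Longrightarrow> d \<le> n - 1 \<Longrightarrow> (rt d)\<^sup>2 = of_nat (d\<^sup>2 - 1)"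
begin

text \<open>The constant term of -q^(-d)/[d]_q. For neighbours in a column, where \<open>ax\<close>
  is -1, it equals 1, in agreement with one column being the trivial representation.\<close>

definition ya :: "int \<Rightarrow> 'f" where "ya d = - 1 / of_int d"
text \<open>The roots \<open>rt\<close> are constrained from 2 on only; for d = 1 and d = -1 the
  entry is 0, as 1 - 1/d^2 demands.\<close>

definition yb :: "int \<Rightarrow> 'f" where
  "yb d = (if \<bar>d\<bar> \<le> 1 then 0 else rt (nat \<bar>d\<bar>) / of_int \<bar>d\<bar>)"

lemma rt_square_int:
  assumes "2 \<le> \<bar>d\<bar>" "\<bar>d\<bar> < int n"
  shows "rt (nat \<bar>d\<bar>) * rt (nat \<bar>d\<bar>) = of_int d * of_int d - 1"
proof -
  define m where "m = nat \<bar>d\<bar>"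
  have m: "2 \<le> m" "m \<le> n - 1" using assms by (auto simp: m_def)
  have "1 \<le> m\<^sup>2" using m by (simp add: power2_eq_square)
  then have "(rt m)\<^sup>2 = of_nat m * of_nat m - 1" using rt_square[OF m] by (simp add: power2_eq_square)
  moreover have "(of_nat m :: 'f) = of_int \<bar>d\<bar>" by (simp add: m_def)
  moreover have "(of_int \<bar>d\<bar> * of_int \<bar>d\<bar> :: 'f) = of_int d * of_int d" by (simp flip: of_int_mult)
  ultimately show ?thesis by (simp add: power2_eq_square m_def)
qed

lemma yb_square: "d \<noteq> 0 \<Longrightarrow> \<bar>d\<bar> < int n \<Longrightarrow> yb d * yb d = 1 - 1 / (of_int d * of_int d)"
proof -
  assume d: "d \<noteq> 0" "\<bar>d\<bar> < int n"
  show ?thesis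
  proof (cases "\<bar>d\<bar> \<le> 1")
    case True
    then have "d = 1 \<or> d = - 1" using d by auto
    then show ?thesis by (auto simp: yb_def)
  next
    case False
    have sq: "(of_int \<bar>d\<bar> * of_int \<bar>d\<bar> :: 'f) = of_int d * of_int d" by (simp flip: of_int_mult)
    have nz: "(of_int d * of_int d :: 'f) \<noteq> 0" using d by simp
    have "yb d * yb d = (rt (nat \<bar>d\<bar>) * rt (nat \<bar>d\<bar>)) / (of_int \<bar>d\<bar> * of_int \<bar>d\<bar>)"
      using False by (simp add: yb_def)
    also have "\<dots> = (of_int d * of_int d - 1) / (of_int d * of_int d)"
      unfolding sq using rt_square_int[of d] False d by simp
    finally show ?thesis using nz by (simp add: diff_divide_distrib)
  qed
qed

sublocale orthogonal_form n \<alpha> ya yb 0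
proof
  show "ya (- d) = 0 - ya d" for d by (simp add: ya_def)
  show "ya d * ya e = ya (d + e) * (ya d + ya e - 0)" if "d \<noteq> 0" "e \<noteq> 0" "d + e \<noteq> 0" for d e
  proof -
    have nz: "(of_int d :: 'f) \<noteq> 0" "(of_int e :: 'f) \<noteq> 0" "(of_int d + of_int e :: 'f) \<noteq> 0"
      using that by (simp_all flip: of_int_add)
    define D E S :: 'f where "D = of_int d" and "E = of_int e" and "S = D + E"
    have S: "S \<noteq> 0" "of_int (d + e) = S" using nz by (simp_all add: D_def E_def S_def)
    have "- 1 / D + - 1 / E = - S / (D * E)"
      using nz by (simp add: S_def D_def E_def field_simps)
    then have "ya d + ya e - 0 = - S / (D * E)" by (simp add: ya_def D_def E_def)
    moreover have "ya (d + e) = - 1 / S" unfolding ya_def S(2) ..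
    ultimately have "ya (d + e) * (ya d + ya e - 0) = 1 / (D * E)" using S(1) by simp
    then show ?thesis by (simp add: ya_def D_def E_def)
  qed
  show "yb d * yb d = 1 + ya d * (0 - ya d)" if "d \<noteq> 0" "\<bar>d\<bar> < int n" for d
    using yb_square[OF that] by (simp add: ya_def)
qed (simp_all add: yb_def)

sublocale yc: coxeter_images "GL (R_dim \<alpha>)" n omat
proof -
  interpret braid_images "GL (R_dim \<alpha>)" n omat by (rule omat_braid_images)
  show "coxeter_images (GL (R_dim \<alpha>)) n omat"
    by unfold_locales (simp add: GL_mult GL_one omat_square, rule eq_matI, auto simp: omat_def)
qed

definition yrep :: "(nat \<Rightarrow> nat) \<Rightarrow> 'f mat" where "yrep = yc.coxeter_eval n"

sublocale sn_rep n "R_dim \<alpha>" yrep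
  by unfold_locales (simp add: yrep_def yc.coxeter_eval_hom)

lemma yrep_adj: "r \<in> {1..<n} \<Longrightarrow> yrep (adj r) = omat r"
  unfolding yrep_def by (rule yc.coxeter_eval_gen)

lemma ct_first:
  assumes T: "T \<in> STD" and n: "1 \<le> n"
  shows "ct T 1 = 0"
proof -
  obtain c l where b: "box_of \<alpha> T 1 = (c, l)" by force
  have F: "T \<in> fillings \<alpha>" by (rule std_filling[OF T])
  have D: "(c, l) \<in> Dg" "T (c, l) = 1" using box_of_in[OF F, of 1] box_of_entry[OF F, of 1] n b by auto
  have "(0, 0) \<in> Dg" by (rule diagram_down[OF D(1)]) auto
  then have "1 \<le> T (0, 0)" using entry_range[OF F] by auto
  then have "(0, 0) = (c, l)" using std_less[OF T D(1), of 0 0] D(2) by force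
  then show ?thesis using b by (simp add: ct_def col_of_def row_of_def)
qed

text \<open>Induction along \<open>jm_Suc\<close>. The off-diagonal terms of s J_r s are cancelled
  by those of s, because the contents of r and r+1 differ by the axial distance X while
  \<open>ya\<close> is -1/X; the same fact lowers the diagonal eigenvalue by X.\<close>

lemma jucys_murphy:
  assumes "1 \<le> r" "r \<le> n"
  shows "gmat (jm r) *\<^sub>v tvec f = tvec (\<lambda>T. of_int (ct T r) * f T)"
  using assms
proof (induction r arbitrary: f rule: nat_induct_at_least)
  case base
  have "jm 1 = (\<lambda>p. 0 * jm 1 p :: 'f)" by (rule ext) (simp add: jm_def)
  then have "gmat (jm 1) *\<^sub>v tvec f = gmat (\<lambda>p. 0 * jm 1 p) *\<^sub>v tvec f"
    by (rule arg_cong[where f = "\<lambda>x. gmat x *\<^sub>v tvec f"])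
  also have "\<dots> = 0 \<cdot>\<^sub>v (gmat (jm 1) *\<^sub>v tvec f)"
    unfolding gmat_scale by (rule smult_mat_mult_vec[OF gmat_carrier tvec_carrier])
  also have "\<dots> = tvec (\<lambda>T. 0)" by (rule eq_vecI) (auto simp: tvec_def gmat_def)
  also have "\<dots> = tvec (\<lambda>T. of_int (ct T 1) * f T)"
    by (rule tvec_cong) (use ct_first base in simp)
  finally show ?case .
next
  case (Suc r)
  have r: "r \<in> {1..<n}" using Suc by auto
  have "gmat (jm (Suc r)) = omat r * gmat (jm r) * omat r + omat r"
    by (simp only: jm_Suc[OF r] gmat_add gmat_mult gmat_gralg_of[OF adj_permutes[OF r]] yrep_adj[OF r])
  then have "gmat (jm (Suc r)) *\<^sub>v tvec f = (omat r * gmat (jm r) * omat r) *\<^sub>v tvec f + omat r *\<^sub>v tvec f"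
    by (simp only: add_mult_distrib_mat_vec[OF mult_carrier_mat[OF mult_carrier_mat[OF omat_carrier
            gmat_carrier] omat_carrier] omat_carrier tvec_carrier])
  also have "(omat r * gmat (jm r) * omat r) *\<^sub>v tvec f = (omat r * gmat (jm r)) *\<^sub>v tvec (yop r f)"
    by (rule omat_mult_tvec[OF r mult_carrier_mat[OF omat_carrier gmat_carrier]])
  also have "\<dots> = omat r *\<^sub>v (gmat (jm r) *\<^sub>v tvec (yop r f))"
    by (rule assoc_mult_mat_vec[OF omat_carrier gmat_carrier tvec_carrier])
  also have "\<dots> = tvec (yop r (\<lambda>T. of_int (ct T r) * yop r f T))"
    using Suc by (simp add: omat_tvec[OF r])
  also have "\<dots> + omat r *\<^sub>v tvec f
      = tvec (\<lambda>T. yop r (\<lambda>T. of_int (ct T r) * yop r f T) T + yop r f T)"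
    by (simp only: omat_tvec[OF r] tvec_add)
  also have "\<dots> = tvec (\<lambda>T. of_int (ct T (Suc r)) * f T)"
  proof (rule tvec_cong)
    fix T assume T: "T \<in> STD"
    have F: "T \<in> fillings \<alpha>" by (rule std_filling[OF T])
    define x where "x = ax r T"
    have x: "x \<noteq> 0" "\<bar>x\<bar> < int n" using ax_nonzero[OF T r] ax_range[OF F r] by (auto simp: x_def)
    define X :: 'f where "X = of_int x"
    have X: "X \<noteq> 0" using x by (simp add: X_def)
    define C :: 'f where "C = of_int (ct T r)"
    have c: "of_int (ct T (Suc r)) = C - X" by (simp add: C_def X_def x_def ax_def)
    have cadj: "ct (adj r \<circ> T) r = ct T (Suc r)" using ct_adj[OF F r, of r] r by simp
    have bb: "yb x * yb x = 1 - 1 / (X * X)" using yb_square[OF x] by (simp add: X_def)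
    have "yop r (\<lambda>T. of_int (ct T r) * yop r f T) T + yop r f T
      = ya x * (C * (ya x * f T + yb x * f (adj r \<circ> T)))
        + yb x * ((C - X) * (ya (- x) * f (adj r \<circ> T) + yb (- x) * f T))
        + (ya x * f T + yb x * f (adj r \<circ> T))"
      unfolding yop_def cadj c ax_adj_self[OF F r] x_def[symmetric] C_def[symmetric] adj_comp_self ..
    also have "\<dots> = (C / (X * X) + (yb x * yb x) * (C - X) - 1 / X) * f T
        + yb x * (- C / X + (C - X) / X + 1) * f (adj r \<circ> T)"
      unfolding b_neg by (simp add: ya_def X_def[symmetric] algebra_simps)
    also have "\<dots> = (C - X) * f T"
      unfolding bb using X by (simp add: field_simps)
    finally show "yop r (\<lambda>T. of_int (ct T r) * yop r f T) T + yop r f T = of_int (ct T (Suc r)) * f T"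
      by (simp only: c)
  qed
  finally show ?case .
qed

lemma yb_nonzero: "2 \<le> \<bar>d\<bar> \<Longrightarrow> \<bar>d\<bar> < int n \<Longrightarrow> yb d \<noteq> 0"
proof
  assume d: "2 \<le> \<bar>d\<bar>" "\<bar>d\<bar> < int n" "yb d = 0"
  then have "rt (nat \<bar>d\<bar>) = 0" by (auto simp: yb_def)
  then have "(of_int (d * d - 1) :: 'f) = 0" using rt_square_int[OF d(1,2)] by simp
  then have "d * d = 1" by (simp only: of_int_eq_0_iff)
  then have "\<bar>d\<bar> = 1" using zmult_eq_1_iff by auto
  then show False using d by simp
qed

text \<open>A standard tableau is determined by its contents, so the Jucys--Murphy elements separate
  the basis vectors: \<open>orbit v\<close> contains a multiple of some basis vector.\<close>

lemma orbit_isolate: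
  assumes v: "v \<in> carrier_vec (R_dim \<alpha>)" and f: "tvec f \<in> orbit v"
    and T: "T \<in> STD" "f T \<noteq> 0" and A: "finite A" "A \<subseteq> STD - {T}"
  shows "\<exists>g. tvec g \<in> orbit v \<and> g T \<noteq> 0 \<and> (\<forall>U\<in>A. g U = 0)"
  using A
proof (induction A rule: finite_induct)
  case empty
  then show ?case using f T by blast
next
  case (insert U A)
  then obtain g where g: "tvec g \<in> orbit v" "g T \<noteq> 0" "\<forall>U\<in>A. g U = 0" by blast
  have U: "U \<in> STD" "U \<noteq> T" using insert by auto
  obtain r where r: "r \<in> {1..n}" "ct T r \<noteq> ct U r"
    using std_eq_if_ct_eq[OF T(1) U(1)] U(2) by blast
  \<comment> \<open>The Jucys-Murphy element minus its eigenvalue at U kills the component at U and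
    keeps zero components zero; as the contents of r differ, the component at T survives.\<close>
  define g' where "g' W = (of_int (ct W r) - of_int (ct U r)) * g W" for W
  have "tvec g' = gmat (jm r) *\<^sub>v tvec g + (- of_int (ct U r)) \<cdot>\<^sub>v tvec g"
    using r by (simp add: jucys_murphy tvec_add tvec_smult g'_def[abs_def] algebra_simps)
  then have "tvec g' \<in> orbit v"
    using orbit_add[OF v orbit_gmat[OF v g(1)] orbit_smult[OF v g(1)]] by simp
  moreover have "g' T \<noteq> 0" using g(2) r(2) by (simp add: g'_def)
  moreover have "\<forall>W\<in>insert U A. g' W = 0" using g(3) by (simp add: g'_def)
  ultimately show ?case by blast
qed

text \<open>By \<open>orbit_isolate\<close> a nonzero vector generates some basis vector. From a
  basis vector a generator reaches the swapped one, since \<open>yb\<close> does not vanish at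
  distances of absolute value at least 2, and \<open>std_connected\<close> reaches all of
  them.\<close>

lemma irreducible:
  assumes v: "v \<in> carrier_vec (R_dim \<alpha>)" "v \<noteq> 0\<^sub>v (R_dim \<alpha>)" and w: "w \<in> carrier_vec (R_dim \<alpha>)"
  shows "w \<in> orbit v"
proof -
  obtain f where f: "v = tvec f" using vec_eq_tvec[OF v(1)] by metis
  have "\<exists>T\<in>STD. f T \<noteq> 0"
  proof (rule ccontr)
    assume "\<not> (\<exists>T\<in>STD. f T \<noteq> 0)"
    then have "tvec f = tvec (\<lambda>_. 0)" by (intro tvec_cong) auto
    then have "v = 0\<^sub>v (R_dim \<alpha>)" using f by (auto simp: tvec_def)
    then show False using v(2) by simp
  qed
  then obtain T where T: "T \<in> STD" "f T \<noteq> 0" by blast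
  have "finite (STD - {T})" by (simp add: finite_standard_tableaux)
  moreover have "tvec f \<in> orbit v" using orbit_self[OF v(1)] f by simp
  ultimately obtain g where g: "tvec g \<in> orbit v" "g T \<noteq> 0" "\<forall>U\<in>STD - {T}. g U = 0"
    using orbit_isolate[where v = v and f = f and T = T and A = "STD - {T}"] v(1) T by blast
  have "(1 / g T) \<cdot>\<^sub>v tvec g = tab_vec T"
    unfolding tab_vec_def tvec_smult by (rule tvec_cong) (use g in auto)
  then have base: "tab_vec T \<in> orbit v" using orbit_smult[OF v(1) g(1)] by metis
  have all: "tab_vec U \<in> orbit v" if U: "U \<in> STD" for U
  proof (rule std_connected[of "\<lambda>T. tab_vec T \<in> orbit v", OF _ T(1) base U])
    fix W r assume W: "W \<in> STD" and r: "r \<in> {1..<n}" and W': "adj r \<circ> W \<in> STD"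
      and IH: "tab_vec W \<in> orbit v"
    have F: "W \<in> fillings \<alpha>" by (rule std_filling[OF W])
    have "2 \<le> \<bar>ax r W\<bar>" using W r by (cases rule: ax_cases) (use W' in auto)
    then have b: "yb (ax r W) \<noteq> 0" using yb_nonzero ax_range[OF F r] by blast
    have "tab_vec (adj r \<circ> W)
      = (1 / yb (ax r W)) \<cdot>\<^sub>v (omat r *\<^sub>v tab_vec W + (- ya (ax r W)) \<cdot>\<^sub>v tab_vec W)"
      unfolding omat_tab_vec[OF W r] using b by (intro eq_vecI) (auto simp: tab_vec_def tvec_def)
    moreover have "omat r *\<^sub>v tab_vec W \<in> orbit v"
      using orbit_gmat[OF v(1) IH, of "gralg_of (adj r)"]
      by (simp only: gmat_gralg_of[OF adj_permutes[OF r]] yrep_adj[OF r])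
    ultimately show "tab_vec (adj r \<circ> W) \<in> orbit v"
      using orbit_smult[OF v(1) orbit_add[OF v(1) _ orbit_smult[OF v(1) IH]]] by metis
  qed
  obtain h where h: "w = tvec h" using vec_eq_tvec[OF w] by metis
  have "tvec (\<lambda>T. if T \<in> A then h T else 0) \<in> orbit v" if "finite A" "A \<subseteq> STD" for A
    using that
  proof (induction A rule: finite_induct)
    case empty
    have "tvec (\<lambda>T. 0 :: 'f) = 0 \<cdot>\<^sub>v tab_vec T"
      unfolding tab_vec_def tvec_smult by (rule tvec_cong) simp
    then show ?case using orbit_smult[OF v(1) base] by simp
  next
    case (insert U A)
    have "tvec (\<lambda>T. if T \<in> insert U A then h T else 0)
        = tvec (\<lambda>T. if T \<in> A then h T else 0) + h U \<cdot>\<^sub>v tab_vec U"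
      unfolding tab_vec_def tvec_smult tvec_add using insert by (intro tvec_cong) auto
    then show ?case
      using orbit_add[OF v(1) insert.IH orbit_smult[OF v(1) all]] insert.prems by simp
  qed
  from this[OF finite_standard_tableaux order_refl]
  have "tvec (\<lambda>T. if T \<in> STD then h T else 0) \<in> orbit v" .
  moreover have "tvec (\<lambda>T. if T \<in> STD then h T else 0) = w" unfolding h by (rule tvec_cong) simp
  ultimately show ?thesis by simp
qed

section \<open>Eigenvectors of column and row stabilizers, and nondegeneracy of Young
  symmetrizers\<close>

lemma tab_vec_nonzero: "T \<in> STD \<Longrightarrow> tab_vec T \<noteq> (0\<^sub>v (R_dim \<alpha>) :: 'f vec)"
proof
  assume T: "T \<in> STD" and "tab_vec T = (0\<^sub>v (R_dim \<alpha>) :: 'f vec)"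
  moreover have "0\<^sub>v (R_dim \<alpha>) = tvec (\<lambda>_. 0 :: 'f)" by (auto simp: tvec_def)
  ultimately have "tvec (\<lambda>U. if U = T then 1 else 0) = tvec (\<lambda>_. 0 :: 'f)" by (simp only: tab_vec_def)
  then have "(if T = T then 1 else 0) = (0 :: 'f)" unfolding tvec_eq_iff using T by (rule bspec)
  then show False by simp
qed

lemma omat_tab_vec_nonstd:
  assumes T: "T \<in> STD" and r: "r \<in> {1..<n}" and no: "adj r \<circ> T \<notin> STD"
  shows "omat r *\<^sub>v tab_vec T = ya (ax r T) \<cdot>\<^sub>v tab_vec T"
  unfolding omat_tab_vec[OF T r] tab_vec_nonstd[OF no]
  by (rule eq_vecI) (auto simp: tab_vec_def tvec_def)

text \<open>As f is monotone, its fibres are intervals, so a transposition inside a fibre is a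
  product of adjacent ones inside the same fibre, each of which multiplies w by e. The function
  \<open>chi\<close> will be constant 1 for columns and the sign for rows.\<close>

lemma stabilizer_eigenvector:
  fixes f :: "nat \<Rightarrow> nat"
  assumes w: "w \<in> carrier_vec (R_dim \<alpha>)"
    and mono: "\<And>r s. r \<in> {1..n} \<Longrightarrow> s \<in> {1..n} \<Longrightarrow> r \<le> s \<Longrightarrow> f r \<le> f s"
    and adj: "\<And>r. r \<in> {1..<n} \<Longrightarrow> f r = f (Suc r) \<Longrightarrow> omat r *\<^sub>v w = e \<cdot>\<^sub>v w"
    and chi: "chi id = 1" "\<And>r p. r \<in> {1..<n} \<Longrightarrow> p permutes {1..n} \<Longrightarrow> chi (adj r \<circ> p) = e * chi p"
    and p: "p permutes {1..n}" "\<And>r. r \<in> {1..n} \<Longrightarrow> f (p r) = f r"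
  shows "yrep p *\<^sub>v w = chi p \<cdot>\<^sub>v w"
proof -
  have "p permutes {1..n} \<and> yrep p *\<^sub>v w = chi p \<cdot>\<^sub>v w"
  proof (rule fibre_permutation_induct[where f = f and Q = "\<lambda>p. p permutes {1..n} \<and> yrep p *\<^sub>v w = chi p \<cdot>\<^sub>v w"])
    show "id permutes {1..n} \<and> yrep id *\<^sub>v w = chi id \<cdot>\<^sub>v w"
      using w by (simp add: permutes_id rep_id chi)
  next
    fix a b p assume ab: "a \<in> {1..n}" "b \<in> {1..n}" "a < b" "f a = f b"
      and p: "p permutes {1..n} \<and> yrep p *\<^sub>v w = chi p \<cdot>\<^sub>v w"
    have step: "adj i \<circ> p permutes {1..n} \<and> yrep (adj i \<circ> p) *\<^sub>v w = chi (adj i \<circ> p) \<cdot>\<^sub>v w"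
      if "a \<le> i" "i < b" "p permutes {1..n} \<and> yrep p *\<^sub>v w = chi p \<cdot>\<^sub>v w" for p i
    proof -
      have i: "i \<in> {1..<n}" using that ab by auto
      have "f a \<le> f i" by (rule mono) (use that ab in auto)
      moreover have "f i \<le> f (Suc i)" by (rule mono) (use that ab in auto)
      moreover have "f (Suc i) \<le> f b" by (rule mono) (use that ab in auto)
      ultimately have fi: "f i = f (Suc i)" using ab by simp
      have pp: "p permutes {1..n}" using that by simp
      have "yrep (adj i \<circ> p) *\<^sub>v w = omat i *\<^sub>v (yrep p *\<^sub>v w)"
        unfolding rep_comp[OF adj_permutes[OF i] pp] yrep_adj[OF i]
        by (rule assoc_mult_mat_vec[OF omat_carrier rep_carrier[OF pp] w])
      also have "\<dots> = chi p \<cdot>\<^sub>v (e \<cdot>\<^sub>v w)"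
        using that w by (simp add: mult_mat_vec[OF omat_carrier w] adj[OF i fi])
      also have "\<dots> = chi (adj i \<circ> p) \<cdot>\<^sub>v w"
        unfolding chi(2)[OF i pp] by (simp add: smult_smult_assoc mult.commute)
      finally show ?thesis using permutes_compose[OF pp adj_permutes[OF i]] by blast
    qed
    show "Transposition.transpose a b \<circ> p permutes {1..n} \<and>
        yrep (Transposition.transpose a b \<circ> p) *\<^sub>v w = chi (Transposition.transpose a b \<circ> p) \<cdot>\<^sub>v w"
      by (rule transpose_closed_if_adj_closed[where
            Q = "\<lambda>p. p permutes {1..n} \<and> yrep p *\<^sub>v w = chi p \<cdot>\<^sub>v w", OF step less_imp_le[OF ab(3)] p])
  qed (use p in auto)
  then show ?thesis by blast
qed

lemma filling_transport:
  assumes T: "T \<in> fillings \<alpha>" and U: "U \<in> fillings \<alpha>"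
  obtains g where "g permutes {1..n}" "T = g \<circ> U"
proof
  define g where "g x = (if x \<in> {1..n} then T (box_of \<alpha> U x) else x)" for x
  have "bij_betw (box_of \<alpha> U) {1..n} Dg"
    by (rule bij_betwI[where g = U])
      (use box_of_in[OF U] box_of_entry[OF U] box_of_eq[OF U] entry_range[OF U] in auto)
  then have "bij_betw (T \<circ> box_of \<alpha> U) {1..n} {1..n}" using filling_bij[OF T] by (rule bij_betw_trans)
  then have "bij_betw g {1..n} {1..n}" by (subst bij_betw_cong[of _ _ "T \<circ> box_of \<alpha> U"]) (auto simp: g_def)
  then show "g permutes {1..n}" by (rule bij_imp_permutes) (auto simp: g_def)
  show "T = g \<circ> U"
  proof
    fix b
    show "T b = (g \<circ> U) b"
    proof (cases "b \<in> Dg")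
      case True
      then show ?thesis using entry_range[OF U True] box_of_eq[OF U True] by (simp add: g_def)
    next
      case False
      then show ?thesis using filling_outside[OF T] filling_outside[OF U] by (simp add: g_def)
    qed
  qed
qed

text \<open>Acting by g carries an eigenvector for the conjugate of H to one for H. Each p in H then
  contributes \<open>chi p * chi p = 1\<close>, so the sum acts by the cardinality of H, which is
  nonzero in characteristic 0.\<close>

lemma transported_eigenvector:
  assumes w: "w \<in> carrier_vec (R_dim \<alpha>)" "w \<noteq> 0\<^sub>v (R_dim \<alpha>)"
    and g: "g permutes {1..n}"
    and H: "H \<subseteq> perms n" "id \<in> H" "\<And>p. p \<in> H \<Longrightarrow> yrep (inv' g \<circ> p \<circ> g) *\<^sub>v w = chi p \<cdot>\<^sub>v w"
    and chi: "\<And>p. p \<in> H \<Longrightarrow> chi p * chi p = 1"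
  shows "\<exists>v c. v \<in> carrier_vec (R_dim \<alpha>) \<and> v \<noteq> 0\<^sub>v (R_dim \<alpha>) \<and> c \<noteq> 0 \<and>
    gmat (\<lambda>p. if p \<in> H then chi p else 0) *\<^sub>v v = c \<cdot>\<^sub>v v"
proof (intro exI conjI)
  let ?v = "yrep g *\<^sub>v w"
  have gi: "inv' g permutes {1..n}" by (rule permutes_inv[OF g])
  show v: "?v \<in> carrier_vec (R_dim \<alpha>)" using rep_carrier[OF g] w(1) by (rule mult_mat_vec_carrier)
  have "yrep (inv' g) *\<^sub>v ?v = yrep (inv' g \<circ> g) *\<^sub>v w"
    unfolding rep_comp[OF gi g] by (rule assoc_mult_mat_vec[OF rep_carrier[OF gi] rep_carrier[OF g] w(1), symmetric])
  also have "\<dots> = w" using w(1) by (simp add: permutes_inv_o(2)[OF g] rep_id)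
  finally have ret: "yrep (inv' g) *\<^sub>v ?v = w" .
  show "?v \<noteq> 0\<^sub>v (R_dim \<alpha>)"
  proof
    assume "?v = 0\<^sub>v (R_dim \<alpha>)"
    then have "w = yrep (inv' g) *\<^sub>v 0\<^sub>v (R_dim \<alpha>)" using ret by simp
    then show False using w(2) rep_carrier[OF gi] by auto
  qed
  have pv: "yrep p *\<^sub>v ?v = chi p \<cdot>\<^sub>v ?v" if p: "p \<in> H" for p
  proof -
    have pp: "p permutes {1..n}" using p H by auto
    have gp: "inv' g \<circ> p \<circ> g permutes {1..n}"
      by (rule permutes_compose[OF g permutes_compose[OF pp gi]])
    have e: "p \<circ> g = g \<circ> (inv' g \<circ> p \<circ> g)"
      using permutes_inverses(1)[OF g] by (simp add: fun_eq_iff)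
    have "yrep p *\<^sub>v ?v = yrep (p \<circ> g) *\<^sub>v w"
      unfolding rep_comp[OF pp g]
      by (rule assoc_mult_mat_vec[OF rep_carrier[OF pp] rep_carrier[OF g] w(1), symmetric])
    also have "\<dots> = yrep g *\<^sub>v (yrep (inv' g \<circ> p \<circ> g) *\<^sub>v w)"
      unfolding e rep_comp[OF g gp]
      by (rule assoc_mult_mat_vec[OF rep_carrier[OF g] rep_carrier[OF gp] w(1)])
    finally show ?thesis using H(3)[OF p] by (simp add: mult_mat_vec[OF rep_carrier[OF g] w(1)])
  qed
  show "(of_nat (card H) :: 'f) \<noteq> 0"
    using H(1,2) finite_subset[OF H(1) finite_perms] by auto
  show "gmat (\<lambda>p. if p \<in> H then chi p else 0) *\<^sub>v ?v = of_nat (card H) \<cdot>\<^sub>v ?v"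
  proof (rule eq_vecI)
    fix i assume "i < dim_vec (of_nat (card H) \<cdot>\<^sub>v ?v)"
    then have i: "i < R_dim \<alpha>" using carrier_vecD[OF v] by (simp only: index_smult_vec)
    have ix: "(c \<cdot>\<^sub>v ?v) $ i = c * ?v $ i" for c
      by (rule index_smult_vec(1)) (simp only: carrier_vecD[OF v] i)
    have "(gmat (\<lambda>p. if p \<in> H then chi p else 0) *\<^sub>v ?v) $ i
        = (\<Sum>p\<in>perms n. if p \<in> H then ?v $ i else 0)"
      unfolding gmat_vec[OF v i]
    proof (rule sum.cong[OF refl])
      fix p
      have "chi p * (chi p * ?v $ i) = ?v $ i" if "p \<in> H" using chi[OF that] by (simp add: mult.assoc[symmetric])
      then show "(if p \<in> H then chi p else 0) * (yrep p *\<^sub>v ?v) $ i = (if p \<in> H then ?v $ i else 0)"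
        by (cases "p \<in> H") (simp_all only: pv ix if_True if_False mult_zero_left)
    qed
    also have "\<dots> = (\<Sum>p\<in>H. ?v $ i)"
      using H(1) by (subst sum.inter_restrict[symmetric]) (auto simp: finite_perms Int_absorb1)
    finally show "(gmat (\<lambda>p. if p \<in> H then chi p else 0) *\<^sub>v ?v) $ i = (of_nat (card H) \<cdot>\<^sub>v ?v) $ i"
      by (simp only: ix sum_constant)
  qed (use carrier_vecD[OF v] in \<open>simp add: gmat_def\<close>)
qed

text \<open>In the column-by-column tableau each column holds consecutive entries, so
  \<open>stabilizer_eigenvector\<close> applies, with eigenvalue \<open>ya (- 1)\<close>, that is 1.
  Any other filling only conjugates the stabilizer.\<close>

lemma col_sum_eigenvector:
  assumes T: "T \<in> fillings \<alpha>"
  shows "\<exists>v c. v \<in> carrier_vec (R_dim \<alpha>) \<and> v \<noteq> 0\<^sub>v (R_dim \<alpha>) \<and> c \<noteq> 0 \<and>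
    gmat (col_sum T) *\<^sub>v v = c \<cdot>\<^sub>v v"
proof -
  let ?U = "ranking col_key"
  have U: "?U \<in> STD" by (rule col_key_std)
  obtain g where g: "g permutes {1..n}" "T = g \<circ> ?U"
    using filling_transport[OF T std_filling[OF U]] .
  let ?w = "tab_vec ?U :: 'f vec"
  have adj: "omat r *\<^sub>v ?w = 1 \<cdot>\<^sub>v ?w" if r: "r \<in> {1..<n}" "col_of \<alpha> ?U r = col_of \<alpha> ?U (Suc r)" for r
    using U r(1)
  proof (cases rule: ax_cases)
    case column
    then show ?thesis using omat_tab_vec_nonstd[OF U r(1)] by (simp add: ya_def)
  qed (use r(2) in auto)
  have eig: "yrep p *\<^sub>v ?w = 1 \<cdot>\<^sub>v ?w"
    if "p permutes {1..n}" "\<And>r. r \<in> {1..n} \<Longrightarrow> col_of \<alpha> ?U (p r) = col_of \<alpha> ?U r" for p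
    by (rule stabilizer_eigenvector[where chi = "\<lambda>_. 1" and e = 1 and f = "col_of \<alpha> ?U" and w = ?w, OF tab_vec_carrier col_key_mono adj _ _ that]) auto
  have "\<exists>v c. v \<in> carrier_vec (R_dim \<alpha>) \<and> v \<noteq> 0\<^sub>v (R_dim \<alpha>) \<and> c \<noteq> 0 \<and>
    gmat (\<lambda>p. if p \<in> col_stabilizer \<alpha> T then 1 else 0) *\<^sub>v v = c \<cdot>\<^sub>v v"
  proof (rule transported_eigenvector[where chi = "\<lambda>_. 1", OF tab_vec_carrier tab_vec_nonzero[OF U] g(1)])
    fix p assume p: "p \<in> col_stabilizer \<alpha> T"
    then have pp: "p permutes {1..n}" by (simp add: col_stabilizer_iff)
    have "inv' g \<circ> p \<circ> g permutes {1..n}"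
      by (rule permutes_compose[OF g(1) permutes_compose[OF pp permutes_inv[OF g(1)]]])
    then show "yrep (inv' g \<circ> p \<circ> g) *\<^sub>v ?w = 1 \<cdot>\<^sub>v ?w"
    proof (rule eig)
      fix r assume r: "r \<in> {1..n}"
      have gr: "g r \<in> {1..n}" using permutes_in_image[OF g(1)] r by simp
      have pr: "p (g r) \<in> {1..n}" using permutes_in_image[OF pp] gr by simp
      define x where "x = inv' g (p (g r))"
      have x: "x \<in> {1..n}" "g x = p (g r)"
        using permutes_in_image[OF permutes_inv[OF g(1)]] pr permutes_inverses(1)[OF g(1)] by (auto simp: x_def)
      have "col_of \<alpha> T (g x) = col_of \<alpha> T (g r)" using p gr x by (simp add: col_stabilizer_iff)
      then have "col_of \<alpha> ?U x = col_of \<alpha> ?U r"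
        using box_of_comp[OF std_filling[OF U] g(1)] x(1) r by (simp add: g(2) col_of_def del: o_apply)
      then show "col_of \<alpha> ?U ((inv' g \<circ> p \<circ> g) r) = col_of \<alpha> ?U r" by (simp add: x_def)
    qed
  qed (auto simp: col_stabilizer_iff permutes_id)
  moreover have "(\<lambda>p. if p \<in> col_stabilizer \<alpha> T then 1 else 0) = (col_sum T :: _ \<Rightarrow> 'f)"
    by (rule ext) (simp add: col_sum_def)
  ultimately show ?thesis by simp
qed

text \<open>The argument of \<open>col_sum_eigenvector\<close> for the row-by-row tableau:
  neighbours in a row have \<open>ax\<close> equal to 1, so a generator acts by \<open>ya 1\<close>,
  that is -1, and the character is the sign.\<close>

lemma row_sum_eigenvector:
  assumes T: "T \<in> fillings \<alpha>"
  shows "\<exists>v c. v \<in> carrier_vec (R_dim \<alpha>) \<and> v \<noteq> 0\<^sub>v (R_dim \<alpha>) \<and> c \<noteq> 0 \<and>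
    gmat (row_sum T) *\<^sub>v v = c \<cdot>\<^sub>v v"
proof -
  let ?U = "ranking row_key"
  have U: "?U \<in> STD" by (rule row_key_std)
  obtain g where g: "g permutes {1..n}" "T = g \<circ> ?U"
    using filling_transport[OF T std_filling[OF U]] .
  let ?w = "tab_vec ?U :: 'f vec"
  let ?chi = "\<lambda>p. of_int (sign p) :: 'f"
  have adj: "omat r *\<^sub>v ?w = (- 1) \<cdot>\<^sub>v ?w" if r: "r \<in> {1..<n}" "row_of \<alpha> ?U r = row_of \<alpha> ?U (Suc r)" for r
    using U r(1)
  proof (cases rule: ax_cases)
    case row
    then show ?thesis using omat_tab_vec_nonstd[OF U r(1)] by (simp add: ya_def)
  qed (use r(2) in auto)
  have chi: "?chi (adj r \<circ> p) = - 1 * ?chi p" if "p permutes {1..n}" for r p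
  proof -
    have "permutation p" using permutes_imp_permutation[OF _ that] by simp
    then show ?thesis by (simp add: sign_compose permutation_swap_id sign_swap_id)
  qed
  have eig: "yrep p *\<^sub>v ?w = ?chi p \<cdot>\<^sub>v ?w"
    if "p permutes {1..n}" "\<And>r. r \<in> {1..n} \<Longrightarrow> row_of \<alpha> ?U (p r) = row_of \<alpha> ?U r" for p
    by (rule stabilizer_eigenvector[where chi = ?chi and e = "- 1" and f = "row_of \<alpha> ?U" and w = ?w, OF tab_vec_carrier row_key_mono adj _ chi that]) auto
  have "\<exists>v c. v \<in> carrier_vec (R_dim \<alpha>) \<and> v \<noteq> 0\<^sub>v (R_dim \<alpha>) \<and> c \<noteq> 0 \<and>
    gmat (\<lambda>p. if p \<in> row_stabilizer \<alpha> T then ?chi p else 0) *\<^sub>v v = c \<cdot>\<^sub>v v"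
  proof (rule transported_eigenvector[where chi = ?chi, OF tab_vec_carrier tab_vec_nonzero[OF U] g(1)])
    fix p assume p: "p \<in> row_stabilizer \<alpha> T"
    then have pp: "p permutes {1..n}" by (simp add: row_stabilizer_iff)
    have perm: "permutation p" "permutation g" "permutation (inv' g)"
      using permutes_imp_permutation[of "{1..n}"] pp g(1) permutes_inv[OF g(1)] by auto
    have sgn: "sign (inv' g \<circ> p \<circ> g) = sign p"
      by (simp add: sign_compose permutation_compose perm sign_inverse)
    have "inv' g \<circ> p \<circ> g permutes {1..n}"
      by (rule permutes_compose[OF g(1) permutes_compose[OF pp permutes_inv[OF g(1)]]])
    then have "yrep (inv' g \<circ> p \<circ> g) *\<^sub>v ?w = ?chi (inv' g \<circ> p \<circ> g) \<cdot>\<^sub>v ?w"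
    proof (rule eig)
      fix r assume r: "r \<in> {1..n}"
      have gr: "g r \<in> {1..n}" using permutes_in_image[OF g(1)] r by simp
      have pr: "p (g r) \<in> {1..n}" using permutes_in_image[OF pp] gr by simp
      define x where "x = inv' g (p (g r))"
      have x: "x \<in> {1..n}" "g x = p (g r)"
        using permutes_in_image[OF permutes_inv[OF g(1)]] pr permutes_inverses(1)[OF g(1)] by (auto simp: x_def)
      have "row_of \<alpha> T (g x) = row_of \<alpha> T (g r)" using p gr x by (simp add: row_stabilizer_iff)
      then have "row_of \<alpha> ?U x = row_of \<alpha> ?U r"
        using box_of_comp[OF std_filling[OF U] g(1)] x(1) r by (simp add: g(2) row_of_def del: o_apply)
      then show "row_of \<alpha> ?U ((inv' g \<circ> p \<circ> g) r) = row_of \<alpha> ?U r" by (simp add: x_def)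
    qed
    then show "yrep (inv' g \<circ> p \<circ> g) *\<^sub>v ?w = ?chi p \<cdot>\<^sub>v ?w" unfolding sgn .
  qed (auto simp: row_stabilizer_iff permutes_id simp flip: of_int_mult)
  moreover have "(\<lambda>p. if p \<in> row_stabilizer \<alpha> T then ?chi p else 0) = (row_sum T :: _ \<Rightarrow> 'f)"
    by (rule ext) (simp add: row_sum_def)
  ultimately show ?thesis by simp
qed

text \<open>Take eigenvectors v of the column sum a and w of the row sum b; irreducibility gives x
  with x w = v. Then a x b sends w to a nonzero multiple of v. But a x b is a multiple of the Young
  symmetrizer, which therefore does not kill w.\<close>

lemma young_vector:
  assumes T: "T \<in> fillings \<alpha>"
  obtains v where "v \<in> carrier_vec (R_dim \<alpha>)" "gmat (young_symmetrizer \<alpha> T) *\<^sub>v v \<noteq> 0\<^sub>v (R_dim \<alpha>)"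
proof -
  let ?N = "R_dim \<alpha>"
  let ?a = "col_sum T :: _ \<Rightarrow> 'f" and ?b = "row_sum T :: _ \<Rightarrow> 'f" and ?c = "young_symmetrizer \<alpha> T :: _ \<Rightarrow> 'f"
  obtain v c where v: "v \<in> carrier_vec ?N" "v \<noteq> 0\<^sub>v ?N" "c \<noteq> 0" "gmat ?a *\<^sub>v v = c \<cdot>\<^sub>v v"
    using col_sum_eigenvector[OF T] by blast
  obtain w e where w: "w \<in> carrier_vec ?N" "w \<noteq> 0\<^sub>v ?N" "e \<noteq> 0" "gmat ?b *\<^sub>v w = e \<cdot>\<^sub>v w"
    using row_sum_eigenvector[OF T] by blast
  obtain x where x: "gmat x *\<^sub>v w = v" using irreducible[OF w(1,2) v(1)] by (auto simp: orbit_def)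
  \<comment> \<open>Restricting x to permutations changes no matrix, but makes it an element of the
    group algebra as \<open>col_sum_gralg_row_sum\<close> requires.\<close>
  define x' where "x' p = (if p permutes {1..n} then x p else 0)" for p
  have x': "gmat x' *\<^sub>v w = v"
  proof -
    have "gmat x' = gmat x" unfolding gmat_def x'_def by (intro cong_mat refl) (auto intro!: sum.cong)
    then show ?thesis using x by simp
  qed
  have "x' \<in> gralg n" by (simp add: gralg_def x'_def)
  then obtain d where d: "gralg_mult n (gralg_mult n ?a x') ?b = (\<lambda>p. d * ?c p)"
    using col_sum_gralg_row_sum[OF T] by blast
  have "d \<cdot>\<^sub>v (gmat ?c *\<^sub>v w) = gmat (gralg_mult n (gralg_mult n ?a x') ?b) *\<^sub>v w"
    unfolding d gmat_scale by (rule smult_mat_mult_vec[OF gmat_carrier w(1), symmetric])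
  also have "\<dots> = gmat ?a *\<^sub>v (gmat x' *\<^sub>v (gmat ?b *\<^sub>v w))"
  proof -
    have "gmat ?b *\<^sub>v w \<in> carrier_vec ?N" by (rule mult_mat_vec_carrier[OF gmat_carrier w(1)])
    then show ?thesis by (simp only: gmat_mult_vec w(1))
  qed
  also have "\<dots> = (e * c) \<cdot>\<^sub>v v"
    unfolding w(4) mult_mat_vec[OF gmat_carrier w(1)] x' mult_mat_vec[OF gmat_carrier v(1)] v(4)
    by (simp add: smult_smult_assoc)
  finally have eq: "d \<cdot>\<^sub>v (gmat ?c *\<^sub>v w) = (e * c) \<cdot>\<^sub>v v" .
  have "gmat ?c *\<^sub>v w \<noteq> 0\<^sub>v ?N"
  proof
    assume "gmat ?c *\<^sub>v w = 0\<^sub>v ?N"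
    moreover have "d \<cdot>\<^sub>v 0\<^sub>v ?N = 0\<^sub>v ?N" by auto
    ultimately have "(e * c) \<cdot>\<^sub>v v = 0\<^sub>v ?N" using eq by simp
    then show False using smult_vec_zeroD[OF v(1), of "e * c"] v(2,3) w(3) by simp
  qed
  then show ?thesis using that w(1) by blast
qed

text \<open>For the symmetrizer c, suppose c c = 0 and take v with c v nonzero and x with x c v = v.
  Then c x c = l c, and coefficients at \<open>id\<close> give l = (c x c)(id) = (x c c)(id) = 0.
  Yet c v = c x c v = l c v.\<close>

lemma young_square:
  assumes T: "T \<in> fillings \<alpha>"
  obtains k where "k \<noteq> 0"
    "gralg_mult n (young_symmetrizer \<alpha> T) (young_symmetrizer \<alpha> T) = (\<lambda>p. k * young_symmetrizer \<alpha> T p :: 'f)"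
proof -
  let ?N = "R_dim \<alpha>"
  let ?c = "young_symmetrizer \<alpha> T :: _ \<Rightarrow> 'f"
  have unit: "gralg_mult n ?c (gralg_of id) = ?c"
  proof
    fix p
    show "gralg_mult n ?c (gralg_of id) p = ?c p"
      by (cases "p permutes {1..n}")
        (simp_all add: mult_gralg_of[OF permutes_id] gralg_mult_outside young_symmetrizer_eq)
  qed
  obtain k where k: "gralg_mult n ?c ?c = (\<lambda>p. k * ?c p)"
    using young_symmetrizer_sandwich[OF T, of "gralg_of id :: _ \<Rightarrow> 'f"] unfolding unit by blast
  have "k \<noteq> 0"
  proof
    assume k0: "k = 0"
    obtain v where v: "v \<in> carrier_vec ?N" "gmat ?c *\<^sub>v v \<noteq> 0\<^sub>v ?N" using young_vector[OF T] .
    have cv: "gmat ?c *\<^sub>v v \<in> carrier_vec ?N" by (rule mult_mat_vec_carrier[OF gmat_carrier v(1)])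
    obtain x where "v = gmat x *\<^sub>v (gmat ?c *\<^sub>v v)"
      using irreducible[OF cv v(2,1)] by (auto simp: orbit_def)
    note x = this[symmetric]
    obtain l where l: "gralg_mult n (gralg_mult n ?c x) ?c = (\<lambda>p. l * ?c p)"
      using young_symmetrizer_sandwich[OF T] by blast
    have "l = gralg_mult n (gralg_mult n ?c x) ?c id" unfolding l by (simp add: young_symmetrizer_id[OF T])
    also have "\<dots> = gralg_mult n x (gralg_mult n ?c ?c) id"
      unfolding gralg_mult_assoc by (subst gralg_mult_trace) (simp only: gralg_mult_assoc)
    also have "\<dots> = 0" unfolding k k0 by (simp add: gralg_mult_def)
    finally have l0: "l = 0" .
    have "gmat ?c *\<^sub>v v = gmat (gralg_mult n (gralg_mult n ?c x) ?c) *\<^sub>v v"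
      using x by (simp only: gmat_mult_vec v(1) cv)
    also have "\<dots> = 0\<^sub>v ?N" unfolding l l0 gmat_scale
      unfolding smult_mat_mult_vec[OF gmat_carrier v(1)] by (rule zero_smult_carrier_vec[OF cv])
    finally show False using v(2) by simp
  qed
  then show ?thesis using that k by blast
qed

text \<open>Put Y = u c and x = \<open>inv' p\<close>. Then c x Y = l c maps v to 0, so l = 0. As Y
  c = k Y with k nonzero, k Y(p) is the coefficient at \<open>id\<close> of x Y c, hence of c x Y,
  hence 0. Thus evaluation at v is injective on the left ideal of c.\<close>

lemma young_injective:
  assumes T: "T \<in> fillings \<alpha>"
    and v: "v \<in> carrier_vec (R_dim \<alpha>)" "gmat (young_symmetrizer \<alpha> T) *\<^sub>v v \<noteq> 0\<^sub>v (R_dim \<alpha>)"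
    and y: "gmat (gralg_mult n u (young_symmetrizer \<alpha> T)) *\<^sub>v v = 0\<^sub>v (R_dim \<alpha>)"
  shows "gralg_mult n u (young_symmetrizer \<alpha> T) p = 0"
proof (cases "p permutes {1..n}")
  case True
  let ?N = "R_dim \<alpha>"
  let ?c = "young_symmetrizer \<alpha> T :: _ \<Rightarrow> 'f"
  define Y where "Y = gralg_mult n u ?c"
  define x :: "_ \<Rightarrow> 'f" where "x = gralg_of (inv' p)"
  obtain k where k: "k \<noteq> 0" "gralg_mult n ?c ?c = (\<lambda>p. k * ?c p)" using young_square[OF T] .
  obtain l where l: "gralg_mult n (gralg_mult n ?c (gralg_mult n x u)) ?c = (\<lambda>p. l * ?c p)"
    using young_symmetrizer_sandwich[OF T] by blast
  have cxY: "gralg_mult n ?c (gralg_mult n x Y) = (\<lambda>p. l * ?c p)"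
    using l by (simp only: Y_def gralg_mult_assoc)
  have cv: "gmat ?c *\<^sub>v v \<in> carrier_vec ?N" by (rule mult_mat_vec_carrier[OF gmat_carrier v(1)])
  have zero: "gmat z *\<^sub>v 0\<^sub>v ?N = 0\<^sub>v ?N" for z by (rule eq_vecI) (auto simp: gmat_def scalar_prod_def)
  have "l \<cdot>\<^sub>v (gmat ?c *\<^sub>v v) = gmat (gralg_mult n ?c (gralg_mult n x Y)) *\<^sub>v v"
    unfolding cxY gmat_scale by (rule smult_mat_mult_vec[OF gmat_carrier v(1), symmetric])
  also have "\<dots> = 0\<^sub>v ?N" using y by (simp add: gmat_mult_vec v(1) Y_def zero)
  finally have lz: "l \<cdot>\<^sub>v (gmat ?c *\<^sub>v v) = 0\<^sub>v ?N" .
  have "l = 0" using smult_vec_zeroD[OF cv lz] v(2) by blast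
  have Yc: "gralg_mult n Y ?c = (\<lambda>p. k * Y p)"
    unfolding Y_def gralg_mult_assoc k gralg_mult_scale_right ..
  have "k * gralg_mult n x Y id = gralg_mult n x (gralg_mult n Y ?c) id"
    unfolding Yc gralg_mult_scale_right ..
  also have "\<dots> = gralg_mult n ?c (gralg_mult n x Y) id"
    by (subst gralg_mult_assoc[symmetric]) (rule gralg_mult_trace)
  also have "\<dots> = 0" unfolding cxY \<open>l = 0\<close> by simp
  finally have "gralg_mult n x Y id = 0" using k(1) by simp
  moreover have "gralg_mult n x Y id = Y p"
    unfolding x_def gralg_of_mult[OF permutes_inv[OF True] permutes_id]
    by (simp add: permutes_inv_inv[OF True])
  ultimately show ?thesis by (simp add: Y_def)
next
  case False
  then show ?thesis by (rule gralg_mult_outside)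
qed

end

section \<open>Evaluation of noncommutative power series\<close>

lemma finite_words: "finite {w :: xy list. length w = d}"
proof -
  have "(UNIV :: xy set) = {LX, LY}" using xy.exhaust by auto
  then have "finite (UNIV :: xy set)" by (metis finite.emptyI finite.insertI)
  from finite_lists_length_eq[OF this, of d] show ?thesis by simp
qed

lemma finite_words_le: "finite {w :: xy list. length w \<le> d}"
proof -
  have "{w :: xy list. length w \<le> d} = (\<Union>i\<le>d. {w. length w = i})" by auto
  then show ?thesis by (simp add: finite_words)
qed

lemma sum_words_split:
  assumes "i \<le> d"
  shows "(\<Sum>w :: xy list | length w = d. F (take i w) (drop i w))
    = (\<Sum>u | length u = i. \<Sum>v | length v = d - i. F u v)"
proof -
  have "(\<Sum>u | length u = i. \<Sum>v | length v = d - i. F u v)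
      = (\<Sum>(u, v)\<in>{u. length u = i} \<times> {v. length v = d - i}. F u v)"
    by (rule sum.cartesian_product)
  also have "\<dots> = (\<Sum>w :: xy list | length w = d. F (take i w) (drop i w))"
    by (rule sum.reindex_bij_witness[of _ "\<lambda>w. (take i w, drop i w)" "\<lambda>(u, v). u @ v"])
      (use assms in auto)
  finally show ?thesis ..
qed

lemma ncs_coeff_simps:
  "ncs_coeff (0 :: ('g, 'k::ring_1) ncs) w = 0"
  "ncs_coeff (1 :: ('g, 'k) ncs) w = (if w = [] then 1 else 0)"
  "ncs_coeff (f + g :: ('g, 'k) ncs) w = ncs_coeff f w + ncs_coeff g w"
  "ncs_coeff (f - g :: ('g, 'k) ncs) w = ncs_coeff f w - ncs_coeff g w"
  "ncs_coeff (- f :: ('g, 'k) ncs) w = - ncs_coeff f w"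
  "ncs_coeff (f * g :: ('g, 'k) ncs) w
    = (\<Sum>i=0..length w. ncs_coeff f (take i w) * ncs_coeff g (drop i w))"
  "ncs_coeff (ncs_scale c f) w = c * ncs_coeff f w"
  "ncs_coeff (ncs_gen a :: ('g, 'k) ncs) w = (if w = [a] then 1 else 0)"
  by (simp_all add: zero_ncs_def one_ncs_def plus_ncs_def minus_ncs_def uminus_ncs_def
      times_ncs_def ncs_scale_def ncs_gen_def)

text \<open>The series p h. Multiplying such series records the length of a word as the exponent of
  h.\<close>

definition fps_lin :: "'r::ring_1 \<Rightarrow> 'r fps" where
  "fps_lin p = Abs_fps (\<lambda>d. if d = 1 then p else 0)"

lemma fps_lin_mult_nth: "fps_nth (fps_lin p * f) d = (if d = 0 then 0 else p * fps_nth f (d - 1))"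
proof -
  have "fps_nth (fps_lin p * f) d = (\<Sum>i=0..d. if i = 1 then p * fps_nth f (d - 1) else 0)"
    unfolding fps_mult_nth by (rule sum.cong) (auto simp: fps_lin_def)
  then show ?thesis by (simp add: sum.delta)
qed

lemma prod_list_fps_lin:
  "fps_nth (prod_list (map fps_lin ps)) d = (if d = length ps then prod_list ps else 0)"
  by (induction ps arbitrary: d) (auto simp: fps_lin_mult_nth)

lemma fps_lin_power_nth: "fps_nth (fps_lin p ^ m) d = (if d = m then p ^ m else 0)"
proof -
  have eq: "fps_lin p ^ m = prod_list (map fps_lin (replicate m p))" by (simp add: prod_list_replicate)
  show ?thesis unfolding eq prod_list_fps_lin by (simp add: prod_list_replicate)
qed

section \<open>Group-like series and the coproduct of words\<close>

lemma tens_mult_prim: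
  "tens_mult (tens_prim a) F (u, v) =
    (if u \<noteq> [] \<and> hd u = a then F (tl u, v) else 0) + (if v \<noteq> [] \<and> hd v = a then F (u, tl v) else 0)"
proof -
  have prim: "tens_prim a (take i u, take j v) =
      (if i = 1 \<and> j = 0 \<and> hd u = a then 1 else 0) + (if i = 0 \<and> j = 1 \<and> hd v = a then 1 else 0)"
    if "i \<le> length u" "j \<le> length v" for i j
  proof -
    have l: "length (take i u) = i" "length (take j v) = j" using that by auto
    have "take i u = [a] \<longleftrightarrow> i = 1 \<and> hd u = a" using that by (cases u; cases i) auto
    moreover have "take j v = [a] \<longleftrightarrow> j = 1 \<and> hd v = a" using that by (cases v; cases j) auto
    moreover have "take i u = [] \<longleftrightarrow> i = 0" "take j v = [] \<longleftrightarrow> j = 0" using l by (metis length_0_conv)+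
    ultimately show ?thesis by (auto simp: tens_prim_def)
  qed
  have "tens_mult (tens_prim a) F (u, v) = (\<Sum>i\<le>length u. \<Sum>j\<le>length v.
      (if i = 1 then (if j = 0 then (if hd u = a then F (tl u, v) else 0) else 0) else 0)
      + (if i = 0 then (if j = 1 then (if hd v = a then F (u, tl v) else 0) else 0) else 0))"
    unfolding tens_mult_def prod.case
    by (intro sum.cong refl) (auto simp: prim drop_Suc)
  also have "\<dots> = (\<Sum>i\<le>length u. (if i = 1 then (if hd u = a then F (tl u, v) else 0) else 0)
      + (if i = 0 then (if 1 \<le> length v then (if hd v = a then F (u, tl v) else 0) else 0) else 0))"
    by (intro sum.cong refl) (simp add: sum.distrib sum.delta)
  also have "\<dots> = (if 1 \<le> length u then (if hd u = a then F (tl u, v) else 0) else 0)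
      + (if 1 \<le> length v then (if hd v = a then F (u, tl v) else 0) else 0)"
    by (simp add: sum.distrib sum.delta)
  also have "\<dots> = (if u \<noteq> [] \<and> hd u = a then F (tl u, v) else 0) + (if v \<noteq> [] \<and> hd v = a then F (u, tl v) else 0)"
    by (cases u; cases v) auto
  finally show ?thesis .
qed

lemma coproduct_word_Nil: "coproduct_word [] uv = (if uv = ([], []) then 1 else 0)"
  by (simp add: coproduct_word_def tens_one_def)

lemma coproduct_word_Cons:
  "coproduct_word (a # w) (u, v) =
    (if u \<noteq> [] \<and> hd u = a then coproduct_word w (tl u, v) else 0)
    + (if v \<noteq> [] \<and> hd v = a then coproduct_word w (u, tl v) else 0)"
  by (simp add: coproduct_word_def tens_mult_prim)

definition word_pairs :: "nat \<Rightarrow> (xy list \<times> xy list) set" where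
  "word_pairs m = {(u, v). length u + length v = m}"

lemma word_pairs_UN: "word_pairs m = (\<Union>i\<le>m. {u. length u = i} \<times> {v. length v = m - i})"
  by (auto simp: word_pairs_def)

lemma finite_word_pairs: "finite (word_pairs m)"
  unfolding word_pairs_UN by (intro finite_UN_I finite_atMost finite_cartesian_product finite_words)

lemma sum_word_pairs:
  "(\<Sum>(u, v)\<in>word_pairs m. F u v) = (\<Sum>i\<le>m. \<Sum>u | length u = i. \<Sum>v | length v = m - i. F u v)"
  unfolding word_pairs_UN
  by (subst sum.UNION_disjoint) (auto simp: finite_words sum.cartesian_product)

text \<open>\<open>biword t z w\<close> is the word \<open>w\<close> in the commuting operators \<open>X \<mapsto> t a * X\<close> and
  \<open>X \<mapsto> X * z a\<close>, added up letterwise and applied to \<open>1\<close>.\<close>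

fun biword :: "(xy \<Rightarrow> 'r::ring_1) \<Rightarrow> (xy \<Rightarrow> 'r) \<Rightarrow> xy list \<Rightarrow> 'r" where
  "biword t z [] = 1"
| "biword t z (a # w) = t a * biword t z w + biword t z w * z a"

lemma biword_neg: "w \<noteq> [] \<Longrightarrow> biword t (\<lambda>a. - t a) w = 0"
proof (induction w)
  case (Cons a w)
  then show ?case by (cases "w = []") auto
qed simp

lemma biword_central:
  assumes "\<And>a x. z a * x = x * z a"
  shows "biword t z w = prod_list (map (\<lambda>a. t a + z a) w)"
  by (induction w) (simp_all add: assms[symmetric] distrib_right)

text \<open>Makes the ring \<open>'r\<close> an algebra over k through central scalars. There are
  two instances: the field \<open>'l\<close> and the two-by-two matrices over it.\<close>

locale scalar_map =
  fixes sc :: "'k::field_char_0 \<Rightarrow> 'r::ring_1"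
  assumes sc_add: "sc (c + d) = sc c + sc d"
    and sc_mult: "sc (c * d) = sc c * sc d"
    and sc_one: "sc 1 = 1"
    and sc_central: "sc c * x = x * sc c"
begin

lemma sc_zero: "sc 0 = 0"
  using sc_add[of 0 0] by simp

lemma sc_minus: "sc (- c) = - sc c"
  using sc_add[of c "- c"] by (simp add: sc_zero eq_neg_iff_add_eq_0 add.commute)

lemma sc_sum: "sc (sum f A) = (\<Sum>a\<in>A. sc (f a))"
  by (induction A rule: infinite_finite_induct) (simp_all add: sc_add sc_zero)

text \<open>The series \<Psi>(hA, hB) with coefficients in a possibly noncommutative ring; each
  coefficient of h is a finite sum over words of one length.\<close>

definition ev :: "(xy, 'k) ncs \<Rightarrow> 'r \<Rightarrow> 'r \<Rightarrow> 'r fps" where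
  "ev \<Psi> A B = Abs_fps (\<lambda>d. \<Sum>w | length w = d.
     sc (ncs_coeff \<Psi> w) * prod_list (map (sel_xy A B) w))"

text \<open>Words are read backwards. Transposition of matrices produces this, and up to signs it is
  the antipode.\<close>

definition ev_rev :: "(xy, 'k) ncs \<Rightarrow> 'r \<Rightarrow> 'r \<Rightarrow> 'r fps" where
  "ev_rev \<Psi> A B = Abs_fps (\<lambda>d. \<Sum>w | length w = d.
     sc (ncs_coeff \<Psi> w) * prod_list (map (sel_xy A B) (rev w)))"

definition ex :: "'r \<Rightarrow> 'r fps" where
  "ex p = Abs_fps (\<lambda>d. sc (1 / fact d) * p ^ d)"

lemma ev_one: "ev 1 A B = 1"
proof (rule fps_ext)
  fix d
  have "(\<Sum>w | length w = d. sc (ncs_coeff 1 w) * prod_list (map (sel_xy A B) w))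
      = (\<Sum>w :: xy list | length w = d. if w = [] then 1 else 0)"
    by (rule sum.cong) (auto simp: ncs_coeff_simps sc_one sc_zero)
  also have "\<dots> = (if d = 0 then 1 else 0)" by (subst sum.delta) (auto simp: finite_words)
  finally show "fps_nth (ev 1 A B) d = fps_nth 1 d" by (simp add: ev_def)
qed

lemma ev_add: "ev (f + g) A B = ev f A B + ev g A B"
  by (rule fps_ext) (simp add: ev_def ncs_coeff_simps sc_add distrib_right sum.distrib)

lemma ev_minus: "ev (- f) A B = - ev f A B"
  by (rule fps_ext) (simp add: ev_def ncs_coeff_simps sc_minus sum_negf)

lemma ev_scale: "fps_nth (ev (ncs_scale c f) A B) d = sc c * fps_nth (ev f A B) d"
  by (simp add: ev_def ncs_coeff_simps sc_mult sum_distrib_left mult.assoc)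

lemma ev_mult: "ev (f * g) A B = ev f A B * ev g A B"
proof (rule fps_ext)
  fix d
  let ?p = "\<lambda>w. prod_list (map (sel_xy A B) w)"
  have swap: "(x * y) * (p * q) = (x * p) * (y * q)" if "y * p = p * y" for x y p q :: 'r
    using that by (metis mult.assoc)
  have trm: "sc (ncs_coeff f (take i w) * ncs_coeff g (drop i w)) * ?p w
      = (sc (ncs_coeff f (take i w)) * ?p (take i w)) * (sc (ncs_coeff g (drop i w)) * ?p (drop i w))" for i w
  proof -
    have "?p w = ?p (take i w) * ?p (drop i w)"
      using append_take_drop_id[of i w] by (metis map_append prod_list.append)
    then show ?thesis by (simp only: sc_mult swap[OF sc_central])
  qed
  have "fps_nth (ev (f * g) A B) d = (\<Sum>w | length w = d. \<Sum>i=0..d.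
      sc (ncs_coeff f (take i w) * ncs_coeff g (drop i w)) * ?p w)"
    by (auto simp: ev_def ncs_coeff_simps sc_sum sum_distrib_right intro!: sum.cong)
  also have "\<dots> = (\<Sum>i=0..d. \<Sum>w | length w = d.
      (sc (ncs_coeff f (take i w)) * ?p (take i w)) * (sc (ncs_coeff g (drop i w)) * ?p (drop i w)))"
    unfolding trm by (rule sum.swap)
  also have "\<dots> = (\<Sum>i=0..d. \<Sum>u | length u = i. \<Sum>v | length v = d - i.
      (sc (ncs_coeff f u) * ?p u) * (sc (ncs_coeff g v) * ?p v))"
    by (intro sum.cong refl
        sum_words_split[of _ d "\<lambda>u v. (sc (ncs_coeff f u) * ?p u) * (sc (ncs_coeff g v) * ?p v)"]) simp
  also have "\<dots> = fps_nth (ev f A B * ev g A B) d"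
    by (simp add: fps_mult_nth ev_def sum_product)
  finally show "fps_nth (ev (f * g) A B) d = fps_nth (ev f A B * ev g A B) d" .
qed

lemma ev_power: "ev (f ^ m) A B = ev f A B ^ m"
  by (induction m) (simp_all add: ev_one ev_mult)

lemma ev_prod_list: "ev (prod_list fs) A B = prod_list (map (\<lambda>f. ev f A B) fs)"
  by (induction fs) (simp_all add: ev_one ev_mult)

lemma ev_gen: "ev (ncs_gen a) A B = fps_lin (sel_xy A B a)"
proof (rule fps_ext)
  fix d
  have "(\<Sum>w | length w = d. sc (ncs_coeff (ncs_gen a) w) * prod_list (map (sel_xy A B) w))
      = (\<Sum>w :: xy list | length w = d. if w = [a] then sel_xy A B a else 0)"
    by (rule sum.cong) (auto simp: ncs_coeff_simps sc_one sc_zero)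
  also have "\<dots> = (if d = 1 then sel_xy A B a else 0)" by (subst sum.delta) (auto simp: finite_words)
  finally show "fps_nth (ev (ncs_gen a) A B) d = fps_nth (fps_lin (sel_xy A B a)) d"
    by (simp add: ev_def fps_lin_def)
qed

text \<open>P and Q evaluate to multiples of h, so a word u in them is homogeneous of degree
  \<open>length u\<close>; of the words of length at most d only those of length d contribute to
  h^d.\<close>

lemma ev_subst:
  assumes P: "ev P A B = fps_lin p" and Q: "ev Q A B = fps_lin q"
  shows "ev (ncs_subst \<Psi> P Q) A B = ev \<Psi> p q"
proof (rule fps_ext)
  fix d
  have lin: "ev (prod_list (map (sel_xy P Q) u)) A B = prod_list (map fps_lin (map (sel_xy p q) u))" for u
  proof -
    have "ev (sel_xy P Q a) A B = fps_lin (sel_xy p q a)" for a using P Q by (cases a) auto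
    then show ?thesis by (simp add: ev_prod_list o_def)
  qed
  have "fps_nth (ev (ncs_subst \<Psi> P Q) A B) d = (\<Sum>w | length w = d. \<Sum>u | length u \<le> d.
      sc (ncs_coeff \<Psi> u) * (sc (ncs_coeff (prod_list (map (sel_xy P Q) u)) w) * prod_list (map (sel_xy A B) w)))"
    by (auto simp: ev_def ncs_subst_def sc_sum sc_mult sum_distrib_right mult.assoc intro!: sum.cong)
  also have "\<dots> = (\<Sum>u | length u \<le> d. sc (ncs_coeff \<Psi> u) * fps_nth (ev (prod_list (map (sel_xy P Q) u)) A B) d)"
    by (subst sum.swap) (simp add: ev_def sum_distrib_left)
  also have "\<dots> = (\<Sum>u | length u \<le> d. if length u = d then sc (ncs_coeff \<Psi> u) * prod_list (map (sel_xy p q) u) else 0)"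
    unfolding lin prod_list_fps_lin by (rule sum.cong) auto
  also have "\<dots> = (\<Sum>u | length u = d. sc (ncs_coeff \<Psi> u) * prod_list (map (sel_xy p q) u))"
    by (rule sum.mono_neutral_cong_right) (auto simp: finite_words_le)
  finally show "fps_nth (ev (ncs_subst \<Psi> P Q) A B) d = fps_nth (ev \<Psi> p q) d" by (simp add: ev_def)
qed

lemma ev_exp:
  assumes P: "ev P A B = fps_lin p"
  shows "ev (ncs_exp P) A B = ex p"
proof (rule fps_ext)
  fix d
  have "fps_nth (ev (ncs_exp P) A B) d = (\<Sum>w | length w = d. \<Sum>m\<le>d.
      sc (1 / fact m) * (sc (ncs_coeff (P ^ m) w) * prod_list (map (sel_xy A B) w)))"
    by (auto simp: ev_def ncs_exp_def sc_sum sum_distrib_right mult.assoc[symmetric] sc_mult[symmetric]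
        intro!: sum.cong)
  also have "\<dots> = (\<Sum>m\<le>d. sc (1 / fact m) * fps_nth (ev (P ^ m) A B) d)"
    by (subst sum.swap) (simp add: ev_def sum_distrib_left)
  also have "\<dots> = (\<Sum>m\<le>d. if m = d then sc (1 / fact d) * p ^ d else 0)"
    by (rule sum.cong) (auto simp: ev_power P fps_lin_power_nth)
  also have "\<dots> = fps_nth (ex p) d" by (simp add: sum.delta ex_def)
  finally show "fps_nth (ev (ncs_exp P) A B) d = fps_nth (ex p) d" .
qed

text \<open>Left and right multiplications commute, so expanding a biword distributes its letters
  over two words exactly as the coproduct with primitive letters does. Right multiplication
  assembles its word in reverse order, hence \<open>rev v\<close>.\<close>

lemma biword_coproduct:
  "biword t z w = (\<Sum>(u, v)\<in>word_pairs (length w).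
     sc (coproduct_word w (u, v)) * (prod_list (map t u) * prod_list (map z (rev v))))"
proof (induction w)
  case Nil
  have "word_pairs 0 = {([], [])}" by (auto simp: word_pairs_def)
  then show ?case by (simp add: coproduct_word_Nil sc_one)
next
  case (Cons a w)
  define X where "X u v = prod_list (map t u) * prod_list (map z (rev v))" for u v
  let ?m = "length w"
  have left: "(\<Sum>(u, v)\<in>word_pairs (Suc ?m).
        if u \<noteq> [] \<and> hd u = a then sc (coproduct_word w (tl u, v)) * X u v else 0)
      = (\<Sum>(u, v)\<in>word_pairs ?m. sc (coproduct_word w (u, v)) * X (a # u) v)"
  proof -
    have "(\<Sum>(u, v)\<in>word_pairs (Suc ?m).
        if u \<noteq> [] \<and> hd u = a then sc (coproduct_word w (tl u, v)) * X u v else 0)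
      = (\<Sum>(u, v)\<in>{(u, v) \<in> word_pairs (Suc ?m). u \<noteq> [] \<and> hd u = a}.
          sc (coproduct_word w (tl u, v)) * X u v)"
      by (rule sum.mono_neutral_cong_right) (auto simp: finite_word_pairs split: if_splits)
    also have "\<dots> = (\<Sum>(u, v)\<in>word_pairs ?m. sc (coproduct_word w (u, v)) * X (a # u) v)"
      by (rule sum.reindex_bij_witness[of _ "\<lambda>(u, v). (a # u, v)" "\<lambda>(u, v). (tl u, v)"])
        (auto simp: word_pairs_def neq_Nil_conv)
    finally show ?thesis .
  qed
  have right: "(\<Sum>(u, v)\<in>word_pairs (Suc ?m).
        if v \<noteq> [] \<and> hd v = a then sc (coproduct_word w (u, tl v)) * X u v else 0)
      = (\<Sum>(u, v)\<in>word_pairs ?m. sc (coproduct_word w (u, v)) * X u (a # v))"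
  proof -
    have "(\<Sum>(u, v)\<in>word_pairs (Suc ?m).
        if v \<noteq> [] \<and> hd v = a then sc (coproduct_word w (u, tl v)) * X u v else 0)
      = (\<Sum>(u, v)\<in>{(u, v) \<in> word_pairs (Suc ?m). v \<noteq> [] \<and> hd v = a}.
          sc (coproduct_word w (u, tl v)) * X u v)"
      by (rule sum.mono_neutral_cong_right) (auto simp: finite_word_pairs split: if_splits)
    also have "\<dots> = (\<Sum>(u, v)\<in>word_pairs ?m. sc (coproduct_word w (u, v)) * X u (a # v))"
      by (rule sum.reindex_bij_witness[of _ "\<lambda>(u, v). (u, a # v)" "\<lambda>(u, v). (u, tl v)"])
        (auto simp: word_pairs_def neq_Nil_conv)
    finally show ?thesis .
  qed
  have "(\<Sum>(u, v)\<in>word_pairs (Suc ?m). sc (coproduct_word (a # w) (u, v)) * X u v)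
      = (\<Sum>(u, v)\<in>word_pairs (Suc ?m).
          (if u \<noteq> [] \<and> hd u = a then sc (coproduct_word w (tl u, v)) * X u v else 0)
          + (if v \<noteq> [] \<and> hd v = a then sc (coproduct_word w (u, tl v)) * X u v else 0))"
    by (rule sum.cong) (auto simp: coproduct_word_Cons sc_add sc_zero distrib_right)
  also have "\<dots> = (\<Sum>(u, v)\<in>word_pairs ?m. sc (coproduct_word w (u, v)) * X (a # u) v)
      + (\<Sum>(u, v)\<in>word_pairs ?m. sc (coproduct_word w (u, v)) * X u (a # v))"
    unfolding left[symmetric] right[symmetric] by (simp add: case_prod_unfold sum.distrib)
  also have "\<dots> = t a * (\<Sum>(u, v)\<in>word_pairs ?m. sc (coproduct_word w (u, v)) * X u v)
      + (\<Sum>(u, v)\<in>word_pairs ?m. sc (coproduct_word w (u, v)) * X u v) * z a"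
  proof -
    have "sc c * X (a # u) v = t a * (sc c * X u v)" for c u v
      using sc_central[of c "t a"] by (simp add: X_def mult.assoc[symmetric])
    moreover have "sc c * X u (a # v) = (sc c * X u v) * z a" for c u v
      by (simp add: X_def mult.assoc)
    ultimately show ?thesis by (simp add: sum_distrib_left sum_distrib_right case_prod_unfold)
  qed
  finally show ?case using Cons.IH by (simp add: X_def)
qed

lemma group_like_biword:
  assumes gl: "group_like \<Phi>"
  shows "(\<Sum>w | length w = d. sc (ncs_coeff \<Phi> w) * biword (sel_xy A B) (sel_xy C D) w)
    = fps_nth (ev \<Phi> A B * ev_rev \<Phi> C D) d"
proof -
  let ?X = "\<lambda>u v. prod_list (map (sel_xy A B) u) * prod_list (map (sel_xy C D) (rev v))"
  have "(\<Sum>w | length w = d. sc (ncs_coeff \<Phi> w) * biword (sel_xy A B) (sel_xy C D) w)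
      = (\<Sum>w | length w = d. \<Sum>(u, v)\<in>word_pairs d. sc (ncs_coeff \<Phi> w * coproduct_word w (u, v)) * ?X u v)"
    by (rule sum.cong) (auto simp: biword_coproduct sum_distrib_left sc_mult mult.assoc case_prod_unfold)
  also have "\<dots> = (\<Sum>(u, v)\<in>word_pairs d. \<Sum>w | length w = d. sc (ncs_coeff \<Phi> w * coproduct_word w (u, v)) * ?X u v)"
    unfolding case_prod_unfold by (rule sum.swap)
  also have "\<dots> = (\<Sum>(u, v)\<in>word_pairs d. sc (coproduct \<Phi> (u, v)) * ?X u v)"
    by (rule sum.cong) (auto simp: coproduct_def word_pairs_def sc_sum sum_distrib_right)
  also have "\<dots> = (\<Sum>(u, v)\<in>word_pairs d.
      (sc (ncs_coeff \<Phi> u) * prod_list (map (sel_xy A B) u)) * (sc (ncs_coeff \<Phi> v) * prod_list (map (sel_xy C D) (rev v))))"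
  proof (rule sum.cong[OF refl], clarify)
    fix u v
    have swap: "(x * y) * (p * q) = (x * p) * (y * q)" if "y * p = p * y" for x y p q :: 'r
      using that by (metis mult.assoc)
    show "sc (coproduct \<Phi> (u, v)) * ?X u v = (sc (ncs_coeff \<Phi> u) * prod_list (map (sel_xy A B) u))
        * (sc (ncs_coeff \<Phi> v) * prod_list (map (sel_xy C D) (rev v)))"
    proof -
      have "coproduct \<Phi> (u, v) = ncs_coeff \<Phi> u * ncs_coeff \<Phi> v" using gl by (simp add: group_like_def)
      then show ?thesis by (simp only: sc_mult swap[OF sc_central])
    qed
  qed
  also have "\<dots> = fps_nth (ev \<Phi> A B * ev_rev \<Phi> C D) d"
    unfolding sum_word_pairs by (simp add: fps_mult_nth ev_def ev_rev_def sum_product atLeast0AtMost)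
  finally show ?thesis .
qed

text \<open>With z = -t the innermost letter gives t a * 1 - 1 * t a = 0, so only the empty word
  survives in \<open>group_like_biword\<close>. This is the antipode formula for a group-like
  series.\<close>

lemma ev_antipode:
  assumes gl: "group_like \<Phi>"
  shows "ev \<Phi> A B * ev_rev \<Phi> (- A) (- B) = 1"
proof (rule fps_ext)
  fix d
  have neg: "sel_xy (- A) (- B) = (\<lambda>a. - sel_xy A B a)" by (rule ext, case_tac a) auto
  have "fps_nth (ev \<Phi> A B * ev_rev \<Phi> (- A) (- B)) d
      = (\<Sum>w :: xy list | length w = d. if w = [] then 1 else 0)"
    unfolding group_like_biword[OF gl, symmetric] neg
    by (rule sum.cong) (use gl in \<open>auto simp: biword_neg group_like_def sc_one\<close>)
  also have "\<dots> = (if d = 0 then 1 else 0)" by (subst sum.delta) (auto simp: finite_words)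
  finally show "fps_nth (ev \<Phi> A B * ev_rev \<Phi> (- A) (- B)) d = fps_nth 1 d" by simp
qed

lemma prod_list_rev_central:
  assumes "\<And>a x. z a * x = x * (z a :: 'r)"
  shows "prod_list (map z (rev w)) = prod_list (map z w)"
proof (induction w)
  case (Cons a w)
  then show ?case using assms[of a "prod_list (map z w)"] by simp
qed simp

text \<open>For central C and D right multiplication is left multiplication, so a biword is a word
  in A + C and B + D, and reversing words has no effect on the central factor.\<close>

lemma ev_central_shift:
  assumes gl: "group_like \<Phi>" and C: "\<And>x. C * x = x * C" and D: "\<And>x. D * x = x * D"
  shows "ev \<Phi> (A + C) (B + D) = ev \<Phi> A B * ev \<Phi> C D"
proof -
  have central: "sel_xy C D a * x = x * sel_xy C D a" for a x using C D by (cases a) auto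
  have sum: "sel_xy (A + C) (B + D) = (\<lambda>a. sel_xy A B a + sel_xy C D a)" by (rule ext, case_tac a) auto
  have "ev_rev \<Phi> C D = ev \<Phi> C D"
    unfolding ev_rev_def ev_def prod_list_rev_central[OF central] ..
  moreover have "ev \<Phi> (A + C) (B + D) = ev \<Phi> A B * ev_rev \<Phi> C D"
    by (rule fps_ext, unfold group_like_biword[OF gl, symmetric] biword_central[OF central])
      (simp only: ev_def sum fps_nth_Abs_fps)
  ultimately show ?thesis by simp
qed

lemma ev_gen_LX: "ev (ncs_gen LX) A B = fps_lin A" and ev_gen_LY: "ev (ncs_gen LY) A B = fps_lin B"
  by (simp_all add: ev_gen)

lemma fps_lin_uminus: "- fps_lin p = fps_lin (- p :: 'r)"
  by (rule fps_ext) (simp add: fps_lin_def)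

lemma fps_lin_add: "fps_lin p + fps_lin q = fps_lin (p + q :: 'r)"
  by (rule fps_ext) (simp add: fps_lin_def)

lemma ev_even:
  assumes "even_series \<Phi>"
  shows "ev \<Phi> (- A) (- B) = ev \<Phi> A B"
proof -
  have "ev (ncs_subst \<Phi> (- ncs_gen LX) (- ncs_gen LY)) A B = ev \<Phi> (- A) (- B)"
    by (rule ev_subst) (simp_all add: ev_minus ev_gen fps_lin_uminus)
  then show ?thesis using assms by (simp add: even_series_def)
qed

lemma ev_duality:
  assumes "\<Phi> \<in> Ass lam"
  shows "ev \<Phi> A B * ev \<Phi> B A = 1"
proof -
  have "ev (\<Phi> * ncs_subst \<Phi> (ncs_gen LY) (ncs_gen LX)) A B = ev \<Phi> A B * ev \<Phi> B A"
    by (simp add: ev_mult ev_subst[OF ev_gen_LY ev_gen_LX])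
  then show ?thesis using assms by (simp add: Ass_def ev_one)
qed

lemma ev_hexagon:
  assumes "\<Phi> \<in> Ass lam" and ABC: "C = - A - B"
  shows "ex (sc (lam / 2) * A) * ev \<Phi> C A * ex (sc (lam / 2) * C) * ev \<Phi> B C
    * ex (sc (lam / 2) * B) * ev \<Phi> A B = 1"
proof -
  have z: "ev (- ncs_gen LX - ncs_gen LY) A B = fps_lin C"
    unfolding diff_conv_add_uminus ev_add ev_minus ev_gen fps_lin_uminus fps_lin_add sel_xy.simps ABC ..
  have scale: "ev (ncs_scale c f) A B = fps_lin (sc c * p)" if "ev f A B = fps_lin p" for c f p
    by (rule fps_ext) (simp add: ev_scale that fps_lin_def)
  note sub = ev_subst[OF z ev_gen_LX] ev_subst[OF ev_gen_LY z] ev_subst[OF ev_gen_LX ev_gen_LY]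
  note E = ev_exp[OF scale[OF ev_gen_LX]] ev_exp[OF scale[OF ev_gen_LY]] ev_exp[OF scale[OF z]]
  have "hexagon lam \<Phi>" using assms(1) by (simp add: Ass_def)
  then have "ev (ncs_exp (ncs_scale (lam / 2) (ncs_gen LX)) * ncs_subst \<Phi> (- ncs_gen LX - ncs_gen LY) (ncs_gen LX)
      * ncs_exp (ncs_scale (lam / 2) (- ncs_gen LX - ncs_gen LY))
      * ncs_subst \<Phi> (ncs_gen LY) (- ncs_gen LX - ncs_gen LY)
      * ncs_exp (ncs_scale (lam / 2) (ncs_gen LY)) * ncs_subst \<Phi> (ncs_gen LX) (ncs_gen LY)) A B = ev 1 A B"
    unfolding hexagon_def Let_def by (simp only:)
  moreover have "ev (ncs_subst \<Phi> (ncs_gen LX) (ncs_gen LY)) A B = ev \<Phi> A B"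
    by (rule ev_subst[OF ev_gen_LX ev_gen_LY])
  ultimately show ?thesis by (simp only: ev_mult ev_one sub E)
qed

end

lemma ncs_gen_mult_coeff:
  "ncs_coeff (ncs_gen a * f) w = (if w \<noteq> [] \<and> hd w = a then ncs_coeff f (tl w) else 0)"
proof -
  have "ncs_coeff (ncs_gen a * f) w
      = (\<Sum>i=0..length w. if i = 1 then (if hd w = a then ncs_coeff f (tl w) else 0) else 0)"
    unfolding ncs_coeff_simps
  proof (rule sum.cong[OF refl])
    fix i assume "i \<in> {0..length w}"
    then have "take i w = [a] \<longleftrightarrow> i = 1 \<and> hd w = a" by (cases w; cases i) auto
    then show "(if take i w = [a] then 1 else 0) * ncs_coeff f (drop i w)
        = (if i = 1 then if hd w = a then ncs_coeff f (tl w) else 0 else 0)"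
      by (auto simp: drop_Suc)
  qed
  also have "\<dots> = (if w \<noteq> [] \<and> hd w = a then ncs_coeff f (tl w) else 0)"
    by (subst sum.delta) (auto simp: Suc_le_eq)
  finally show ?thesis .
qed

text \<open>Substituting -x and -y only multiplies the coefficient of w by a sign. Evenness as a
  condition on single coefficients also applies to the reversed evaluation, which is no instance of
  \<open>ncs_subst\<close>.\<close>

lemma even_series_coeff:
  assumes "even_series (\<Phi> :: (xy, 'k::field) ncs)"
  shows "(- 1) ^ length w * ncs_coeff \<Phi> w = ncs_coeff \<Phi> w"
proof -
  have word: "ncs_coeff (prod_list (map (sel_xy (- ncs_gen LX) (- ncs_gen LY)) u)) w
      = (if w = u then (- 1) ^ length u else 0 :: 'k)" for u w
  proof (induction u arbitrary: w)
    case (Cons a u)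
    have "sel_xy (- ncs_gen LX) (- ncs_gen LY) a = - (ncs_gen a :: (xy, 'k) ncs)" by (cases a) auto
    then show ?case using Cons by (cases w) (auto simp: ncs_coeff_simps(5) ncs_gen_mult_coeff)
  qed (simp add: ncs_coeff_simps)
  have "ncs_coeff (ncs_subst \<Phi> (- ncs_gen LX) (- ncs_gen LY)) w
      = (\<Sum>u | length u \<le> length w. if u = w then (- 1) ^ length w * ncs_coeff \<Phi> w else 0)"
    unfolding ncs_subst_def ncs_coeff_Abs by (rule sum.cong) (auto simp: word)
  also have "\<dots> = (- 1) ^ length w * ncs_coeff \<Phi> w" by (subst sum.delta) (auto simp: finite_words_le)
  finally show ?thesis using assms by (simp add: even_series_def)
qed

lemma (in scalar_map) ev_rev_even:
  assumes "even_series \<Phi>"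
  shows "ev_rev \<Phi> (- A) (- B) = ev_rev \<Phi> A B"
proof (rule fps_ext)
  fix d
  have neg: "sel_xy (- A) (- B) = (\<lambda>a. - sel_xy A B a)" by (rule ext, case_tac a) auto
  have "sc ((- 1) ^ m) = (- 1) ^ m" for m by (induction m) (simp_all add: sc_one sc_minus)
  moreover have "prod_list (map (\<lambda>a. - sel_xy A B a) w) = (- 1) ^ length w * prod_list (map (sel_xy A B) w)" for w
    by (induction w) (auto simp: minus_one_power_iff)
  ultimately have pr: "prod_list (map (\<lambda>a. - sel_xy A B a) w)
      = sc ((- 1) ^ length w) * prod_list (map (sel_xy A B) w)" for w by simp
  have "sc (ncs_coeff \<Phi> w) * prod_list (map (\<lambda>a. - sel_xy A B a) (rev w))
      = sc (ncs_coeff \<Phi> w) * prod_list (map (sel_xy A B) (rev w))" for w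
  proof -
    have "sc c * (sc e * P) = sc (e * c) * P" for c e P
      by (simp only: mult.commute[of e c] sc_mult mult.assoc)
    then show ?thesis unfolding pr length_rev by (simp only: even_series_coeff[OF assms])
  qed
  then show "fps_nth (ev_rev \<Phi> (- A) (- B)) d = fps_nth (ev_rev \<Phi> A B) d"
    unfolding ev_rev_def neg by simp
qed

section \<open>Two-by-two matrices\<close>

text \<open>A type with a ring instance, so that formal power series with two-by-two matrix
  coefficients form a ring.\<close>

datatype 'a m2 = M2 (m11: 'a) (m12: 'a) (m21: 'a) (m22: 'a)

instantiation m2 :: (comm_ring_1) ring_1
begin

definition "0 = M2 0 0 0 0"
definition "1 = M2 1 0 0 1"
definition "X + Y = M2 (m11 X + m11 Y) (m12 X + m12 Y) (m21 X + m21 Y) (m22 X + m22 Y)"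
definition "X - Y = M2 (m11 X - m11 Y) (m12 X - m12 Y) (m21 X - m21 Y) (m22 X - m22 Y)"
definition "- X = M2 (- m11 X) (- m12 X) (- m21 X) (- m22 X)"
definition "X * Y = M2 (m11 X * m11 Y + m12 X * m21 Y) (m11 X * m12 Y + m12 X * m22 Y)
  (m21 X * m11 Y + m22 X * m21 Y) (m21 X * m12 Y + m22 X * m22 Y)"

instance
  by standard (auto simp: zero_m2_def one_m2_def plus_m2_def minus_m2_def uminus_m2_def times_m2_def
      algebra_simps)

end

lemmas m2_defs = zero_m2_def one_m2_def plus_m2_def minus_m2_def uminus_m2_def times_m2_def

lemma m2_sel_sum:
  "m11 (sum f A) = (\<Sum>a\<in>A. m11 (f a))" "m12 (sum f A) = (\<Sum>a\<in>A. m12 (f a))"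
  "m21 (sum f A) = (\<Sum>a\<in>A. m21 (f a))" "m22 (sum f A) = (\<Sum>a\<in>A. m22 (f a))"
  by (induction A rule: infinite_finite_induct; simp add: m2_defs)+

definition m2_scalar :: "'a::comm_ring_1 \<Rightarrow> 'a m2" where
  "m2_scalar c = M2 c 0 0 c"

lemma m2_scalar_mult: "m2_scalar c * M2 a b d e = M2 (c * a) (c * b) (c * d) (c * e)"
  by (simp add: m2_scalar_def m2_defs)

lemma m2_scalar_mult_sel:
  "m11 (m2_scalar c * X) = c * m11 X" "m12 (m2_scalar c * X) = c * m12 X"
  "m21 (m2_scalar c * X) = c * m21 X" "m22 (m2_scalar c * X) = c * m22 X"
  by (cases X; simp add: m2_scalar_mult)+

lemma m2_scalar_central: "m2_scalar c * X = X * m2_scalar c"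
  by (cases X) (simp add: m2_scalar_def m2_defs mult.commute)

definition m2_transpose :: "'a m2 \<Rightarrow> 'a m2" where
  "m2_transpose X = M2 (m11 X) (m21 X) (m12 X) (m22 X)"

lemma m2_transpose_mult: "m2_transpose (X * Y) = m2_transpose Y * m2_transpose (X :: 'a::comm_ring_1 m2)"
  by (simp add: m2_transpose_def m2_defs mult.commute)

lemma m2_transpose_prod_list:
  "m2_transpose (prod_list (map t w)) = prod_list (map (\<lambda>a. m2_transpose (t a :: 'a::comm_ring_1 m2)) (rev w))"
proof (induction w)
  case Nil
  then show ?case by (simp add: m2_transpose_def one_m2_def)
qed (simp add: m2_transpose_mult)

text \<open>Passes from series of matrices, where \<Phi> is evaluated, to matrices of series, where
  entries are compared.\<close>

definition m2_series :: "'a::comm_ring_1 m2 fps \<Rightarrow> 'a fps m2" where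
  "m2_series F = M2 (Abs_fps (\<lambda>d. m11 (fps_nth F d))) (Abs_fps (\<lambda>d. m12 (fps_nth F d)))
    (Abs_fps (\<lambda>d. m21 (fps_nth F d))) (Abs_fps (\<lambda>d. m22 (fps_nth F d)))"

lemma m2_series_mult: "m2_series (F * G) = m2_series F * m2_series G"
  by (simp add: m2_series_def times_m2_def fps_eq_iff fps_mult_nth m2_sel_sum sum.distrib)

lemma m2_series_one: "m2_series 1 = 1"
  by (simp add: m2_series_def m2_defs fps_eq_iff)

definition m2_const :: "'a::comm_ring_1 m2 \<Rightarrow> 'a fps m2" where
  "m2_const X = M2 (fps_const (m11 X)) (fps_const (m12 X)) (fps_const (m21 X)) (fps_const (m22 X))"

lemma m2_series_const: "m2_series (fps_const X) = m2_const X"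
  by (simp add: m2_series_def m2_const_def fps_eq_iff zero_m2_def)

context scalar_map
begin

lemma prod_list_conj:
  assumes "s * s = (1 :: 'r)"
  shows "prod_list (map (\<lambda>a. s * t a * s) w) = s * prod_list (map t w) * s"
proof (induction w)
  case (Cons a w)
  have "prod_list (map (\<lambda>a. s * t a * s) (a # w)) = s * t a * (s * s) * prod_list (map t w) * s"
    using Cons by (simp add: mult.assoc)
  then show ?case by (simp add: assms mult.assoc)
qed (simp add: assms)

lemma conj_scalar: "sc c * (s * x * s) = s * (sc c * x) * s"
  using sc_central[of c s] by (metis mult.assoc)

lemma ev_conj:
  assumes s: "s * s = 1"
  shows "ev \<Psi> (s * A * s) (s * B * s) = fps_const s * ev \<Psi> A B * fps_const s"
proof (rule fps_ext)
  fix d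
  have sel: "sel_xy (s * A * s) (s * B * s) = (\<lambda>a. s * sel_xy A B a * s)" by (rule ext, case_tac a) auto
  have "fps_nth (ev \<Psi> (s * A * s) (s * B * s)) d
      = (\<Sum>w | length w = d. s * (sc (ncs_coeff \<Psi> w) * prod_list (map (sel_xy A B) w)) * s)"
    unfolding ev_def sel prod_list_conj[OF s] conj_scalar by simp
  also have "\<dots> = s * (\<Sum>w | length w = d. sc (ncs_coeff \<Psi> w) * prod_list (map (sel_xy A B) w)) * s"
    by (simp only: sum_distrib_left sum_distrib_right)
  finally show "fps_nth (ev \<Psi> (s * A * s) (s * B * s)) d
      = fps_nth (fps_const s * ev \<Psi> A B * fps_const s) d"
    by (simp add: ev_def fps_mult_left_const_nth fps_mult_right_const_nth)
qed

lemma ex_conj: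
  assumes s: "s * s = 1"
  shows "ex (s * p * s) = fps_const s * ex p * fps_const s"
proof (rule fps_ext)
  fix d
  have "(s * p * s) ^ d = s * p ^ d * s"
    using prod_list_conj[OF s, of "\<lambda>_. p" "replicate d undefined"]
    by (simp only: map_replicate prod_list_replicate)
  then show "fps_nth (ex (s * p * s)) d = fps_nth (fps_const s * ex p * fps_const s) d"
    by (simp add: ex_def conj_scalar fps_mult_left_const_nth fps_mult_right_const_nth)
qed

lemma ev_zero:
  assumes "ncs_coeff \<Psi> [] = 1"
  shows "ev \<Psi> 0 0 = 1"
proof (rule fps_ext)
  fix d
  have zero: "prod_list (map (sel_xy 0 0) w) = (if w = [] then 1 else 0 :: 'r)" for w
    by (cases w) (auto, metis mult_zero_left sel_xy.elims)
  have "fps_nth (ev \<Psi> 0 0) d = (\<Sum>w :: xy list | length w = d. if w = [] then 1 else 0)"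
    unfolding ev_def fps_nth_Abs_fps
    by (rule sum.cong) (auto simp: zero assms sc_one)
  also have "\<dots> = (if d = 0 then 1 else 0)" by (subst sum.delta) (auto simp: finite_words)
  finally show "fps_nth (ev \<Psi> 0 0) d = fps_nth 1 d" by simp
qed

lemma ev_constant_term: "ncs_coeff \<Psi> [] = 1 \<Longrightarrow> fps_nth (ev \<Psi> A B) 0 = 1"
  by (simp add: ev_def sc_one)

lemma ex_constant_term: "fps_nth (ex p) 0 = 1"
  by (simp add: ex_def sc_one)

end

section \<open>Even associators on two-by-two matrices\<close>

locale even_associator =
  fixes \<Phi> :: "(xy, 'k::field_char_0) ncs" and lam :: 'k and \<iota> :: "'k \<Rightarrow> 'l::field_char_0"
  assumes Ass: "\<Phi> \<in> Ass lam" and even: "even_series \<Phi>" and hom: "field_hom \<iota>"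
begin

sublocale \<iota>: field_hom \<iota> by (rule hom)

sublocale one: scalar_map \<iota>
  by unfold_locales (simp_all add: \<iota>.hom_add \<iota>.hom_mult mult.commute)

sublocale two: scalar_map "\<lambda>c. m2_scalar (\<iota> c)"
  by unfold_locales
    (simp_all add: m2_scalar_def m2_defs \<iota>.hom_add \<iota>.hom_mult mult.commute)

lemma group_like: "group_like \<Phi>"
  using Ass by (simp add: Ass_def)

lemma constant_term: "ncs_coeff \<Phi> [] = 1"
  using group_like by (simp add: group_like_def)

text \<open>Scalars are central, so 1 = \<Phi>(-c + c, -d + d) = \<Phi>(-c, -d) \<Phi>(c, d), which
  by evenness is the square of \<Phi>(c, d). The constant term 1 excludes the value -1.\<close>

lemma one_ev_trivial: "one.ev \<Phi> c d = 1"
proof -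
  let ?f = "one.ev \<Phi> c d"
  have "one.ev \<Phi> (- c + c) (- d + d) = one.ev \<Phi> (- c) (- d) * ?f"
    by (rule one.ev_central_shift[OF group_like]) (simp_all add: mult.commute)
  then have "?f * ?f = 1" by (simp add: one.ev_even[OF even] one.ev_zero[OF constant_term])
  then have "(?f - 1) * (?f + 1) = 0" by (simp add: algebra_simps)
  then have "?f = 1 \<or> ?f = - 1" by (auto simp: eq_neg_iff_add_eq_0)
  moreover have "?f \<noteq> - 1"
  proof
    assume "?f = - 1"
    then have "fps_nth ?f 0 = - 1" by simp
    then show False using one.ev_constant_term[OF constant_term, of c d] by simp
  qed
  ultimately show ?thesis by blast
qed

lemma two_ev_trivial: "two.ev \<Phi> (m2_scalar c) (m2_scalar d) = 1"
proof (rule fps_ext)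
  fix m
  have sel: "sel_xy (m2_scalar c) (m2_scalar d) a = m2_scalar (sel_xy c d a)" for a by (cases a) auto
  have mm: "m2_scalar x * m2_scalar y = m2_scalar (x * y)" for x y :: 'l
    by (simp add: m2_scalar_def m2_defs)
  have pl: "prod_list (map (sel_xy (m2_scalar c) (m2_scalar d)) w) = m2_scalar (prod_list (map (sel_xy c d) w))" for w
  proof (induction w)
    case Nil
    then show ?case by (simp add: m2_scalar_def one_m2_def)
  qed (simp add: sel mm)
  have ms: "(\<Sum>w\<in>W. m2_scalar (f w)) = m2_scalar (\<Sum>w\<in>W. f w :: 'l)" for W :: "xy list set" and f
    by (induction W rule: infinite_finite_induct) (simp_all add: m2_scalar_def m2_defs)
  have "fps_nth (two.ev \<Phi> (m2_scalar c) (m2_scalar d)) m = m2_scalar (fps_nth (one.ev \<Phi> c d) m)"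
    unfolding two.ev_def one.ev_def fps_nth_Abs_fps pl mm ms ..
  then show "fps_nth (two.ev \<Phi> (m2_scalar c) (m2_scalar d)) m = fps_nth 1 m"
    by (simp add: one_ev_trivial m2_scalar_def m2_defs)
qed

lemma two_ev_shift: "two.ev \<Phi> (A + m2_scalar c) (B + m2_scalar d) = two.ev \<Phi> A B"
  using two.ev_central_shift[OF group_like m2_scalar_central m2_scalar_central]
  by (simp add: two_ev_trivial)

text \<open>Transposition reverses words. By the antipode formula and evenness the reversed
  evaluation is the inverse of \<Phi>(A, B), and by duality this inverse is \<Phi>(B, A).\<close>

lemma two_ev_transpose:
  assumes A: "m2_transpose A = A" and B: "m2_transpose B = B"
  shows "m2_transpose (m2_series (two.ev \<Phi> A B)) = m2_series (two.ev \<Phi> B A)"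
proof -
  have tr_sum: "m2_transpose (sum f W) = (\<Sum>w\<in>W. m2_transpose (f w :: 'l m2))" for f and W :: "xy list set"
    by (rule m2.expand) (simp add: m2_transpose_def m2_sel_sum)
  have tr_scalar: "m2_transpose (m2_scalar c * X) = m2_scalar c * m2_transpose X" for c :: 'l and X
    by (cases X) (simp add: m2_transpose_def m2_scalar_mult)
  have sel: "m2_transpose (sel_xy A B a) = sel_xy A B a" for a using A B by (cases a) auto
  have "fps_nth (two.ev_rev \<Phi> A B) d = m2_transpose (fps_nth (two.ev \<Phi> A B) d)" for d
    by (simp add: two.ev_def two.ev_rev_def tr_sum tr_scalar m2_transpose_prod_list sel)
  then have series: "m2_series (two.ev_rev \<Phi> A B) = m2_transpose (m2_series (two.ev \<Phi> A B))"
    by (simp add: m2_series_def m2_transpose_def)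
  have inv: "two.ev \<Phi> A B * two.ev_rev \<Phi> A B = 1"
    using two.ev_antipode[OF group_like, of A B] by (simp add: two.ev_rev_even[OF even])
  have "two.ev_rev \<Phi> A B = (two.ev \<Phi> B A * two.ev \<Phi> A B) * two.ev_rev \<Phi> A B"
    by (simp add: two.ev_duality[OF Ass])
  also have "\<dots> = two.ev \<Phi> B A" by (simp add: mult.assoc inv)
  finally show ?thesis using series by simp
qed

text \<open>The formula of Phi-hat on a generator, with s, A and B in the roles of s_r, t_(r,r+1)
  and Y_r.\<close>

definition braid_matrix :: "'l m2 \<Rightarrow> 'l m2 \<Rightarrow> 'l m2 \<Rightarrow> 'l m2 fps" where
  "braid_matrix s A B = two.ev \<Phi> A B * fps_const s * two.ex (m2_scalar (\<iota> (lam / 2)) * A) * two.ev \<Phi> B A"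

abbreviation "\<mu> \<equiv> \<iota> lam"

lemma half: "\<iota> (lam / 2) * 2 = \<mu>"
  using \<iota>.hom_mult[of "lam / 2" 2] by (simp add: \<iota>.hom_add[of 1 1, simplified])

lemma m2_diag_power: "M2 x 0 0 y ^ d = M2 (x ^ d) 0 0 (y ^ d)" for x y :: "'a::comm_ring_1"
  by (induction d) (simp_all add: m2_defs)

lemma hom_fact_inverse: "\<iota> (1 / fact d) = 1 / fact d"
proof -
  have "\<iota> (of_nat (fact d)) = of_nat (fact d)" by (rule \<iota>.hom_of_nat)
  then have "\<iota> (fact d) = fact d" by (simp only: of_nat_fact)
  then show ?thesis by (simp add: divide_inverse \<iota>.hom_inverse)
qed

lemma ex_diag: "m2_series (two.ex (M2 x 0 0 y)) = M2 (fps_exp x) 0 0 (fps_exp y)"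
  by (simp add: two.ex_def m2_series_def m2_diag_power m2_scalar_mult hom_fact_inverse fps_eq_iff)

text \<open>Here s is a reflection, A = 2 s and B = diag(x, y). The condition p (x - y) = -2 is the
  Jucys-Murphy recursion in the plane: it makes sBs + A equal to diag(y, x). So the third variable
  -A - B of the hexagon is sBs - (x + y), and every factor except \<Phi>(B, sBs) becomes a conjugate
  of a known one. Once that factor is eliminated, the quadratic relation makes the equation for the
  diagonal of \<sigma> linear.\<close>

lemma braid_matrix_plane:
  fixes p r x y :: 'l
  assumes pr: "p * p + r * r = 1" and pxy: "p * (x - y) = - 2"
  defines "s \<equiv> M2 p r r (- p)"
    and "u \<equiv> fps_exp (\<mu> / 2 * (x - y))" and "u' \<equiv> fps_exp (\<mu> / 2 * (y - x))"
    and "z \<equiv> fps_exp \<mu> - fps_exp (- \<mu>)"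
  obtains a b d where
    "m2_series (braid_matrix s (m2_scalar 2 * s) (M2 x 0 0 y)) = M2 a b b d"
    "a * (u - u') = - z * u'" "d * (u - u') = z * u" "a * a + b * b = z * a + 1" "fps_nth b 0 = r"
proof -
  define A B where "A = m2_scalar 2 * s" and "B = M2 x 0 0 y"
  define Z where "Z = x + y"
  define C where "C = s * B * s"
  define K where "K = fps_const s"
  define F F' where "F = two.ev \<Phi> A B" and "F' = two.ev \<Phi> B A"
  define H where "H = two.ev \<Phi> B C"
  define EA where "EA = two.ex (m2_scalar (\<iota> (lam / 2)) * A)"
  define EB where "EB = two.ex (m2_scalar (\<iota> (lam / 2)) * B)"
  define D' where "D' = two.ex (m2_scalar (\<iota> (lam / 2)) * (B - m2_scalar Z))"
  have half': "\<iota> (lam / 2) = \<mu> / 2" using half by (simp add: field_simps)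
  have ss: "s * s = 1" using pr by (simp add: s_def m2_defs algebra_simps)
  have sAs: "s * A * s = A"
    using ss m2_scalar_central[of 2 s] unfolding A_def by (metis mult.assoc mult.right_neutral)
  have sCs: "s * C * s = B" using ss unfolding C_def by (metis mult.assoc mult.right_neutral mult.left_neutral)
  have rr: "r * r = 1 - p * p" using pr by (simp add: algebra_simps)
  have px: "p * x = p * y - 2" using pxy by (simp add: algebra_simps)
  have CZ: "- A - B = C + m2_scalar (- Z)"
  proof -
    have e11: "- 2 * p - x = p * p * x + r * r * y - (x + y)"
    proof -
      have "p * p * x = p * (p * x)" by (simp only: mult.assoc)
      also have "\<dots> = p * p * y - 2 * p" unfolding px by (simp add: algebra_simps)
      finally show ?thesis unfolding rr by (simp add: algebra_simps)
    qed
    have e22: "2 * p - y = r * r * x + p * p * y - (x + y)"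
    proof -
      have "p * p * x = p * (p * x)" by (simp only: mult.assoc)
      also have "\<dots> = p * p * y - 2 * p" unfolding px by (simp add: algebra_simps)
      finally show ?thesis unfolding rr by (simp add: algebra_simps)
    qed
    have e12: "- 2 * r = p * x * r - r * y * p" unfolding px by (simp add: algebra_simps)
    have "C = M2 (p * p * x + r * r * y) (p * x * r - r * y * p) (p * x * r - r * y * p) (r * r * x + p * p * y)"
      by (simp add: C_def s_def B_def m2_defs algebra_simps)
    then have rhs: "C + m2_scalar (- Z) = M2 (p * p * x + r * r * y - (x + y)) (p * x * r - r * y * p)
        (p * x * r - r * y * p) (r * r * x + p * p * y - (x + y))"
      by (simp add: Z_def m2_scalar_def m2_defs)
    have lhs: "- A - B = M2 (- 2 * p - x) (- 2 * r) (- 2 * r) (2 * p - y)"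
      by (simp add: A_def B_def s_def m2_scalar_def m2_defs)
    show ?thesis unfolding lhs rhs e11 e12 e22 ..
  qed
  have KK: "K * K = 1" unfolding K_def by (simp add: ss)
  have FF: "F * F' = 1" "F' * F = 1" unfolding F_def F'_def by (rule two.ev_duality[OF Ass])+
  have CA: "two.ev \<Phi> (- A - B) A = K * F' * K"
  proof -
    have "two.ev \<Phi> (- A - B) A = two.ev \<Phi> C A"
      unfolding CZ using two_ev_shift[of C "- Z" A 0] by (simp add: m2_scalar_def zero_m2_def[symmetric])
    also have "\<dots> = two.ev \<Phi> (s * B * s) (s * A * s)" by (simp only: sAs C_def)
    also have "\<dots> = K * F' * K" unfolding K_def F'_def by (rule two.ev_conj[OF ss])
    finally show ?thesis .
  qed
  have BC: "two.ev \<Phi> B (- A - B) = H"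
    unfolding CZ H_def using two_ev_shift[of B 0 C "- Z"] by (simp add: m2_scalar_def zero_m2_def[symmetric])
  \<comment> \<open>Conjugation by s exchanges B and C, so K H K = \<Phi>(C, B), the inverse of H.
    Hence the unknown K H is an involution.\<close>
  have KHK: "K * H * K * H = 1"
  proof -
    have "K * H * K = two.ev \<Phi> (s * B * s) (s * C * s)" unfolding K_def H_def by (rule two.ev_conj[OF ss, symmetric])
    also have "\<dots> = two.ev \<Phi> C B" by (simp only: sCs C_def[symmetric])
    finally show ?thesis unfolding H_def using two.ev_duality[OF Ass] by simp
  qed
  have Ez: "two.ex (m2_scalar (\<iota> (lam / 2)) * (- A - B)) = K * D' * K"
  proof -
    have "- A - B = s * (B - m2_scalar Z) * s"
    proof -
      have "s * m2_scalar Z * s = m2_scalar Z"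
        using m2_scalar_central[of Z s] ss by (metis mult.assoc mult.right_neutral)
      moreover have "m2_scalar (- Z) = - m2_scalar Z" by (simp add: m2_scalar_def m2_defs)
      ultimately show ?thesis unfolding CZ C_def by (simp add: algebra_simps)
    qed
    then have "m2_scalar (\<iota> (lam / 2)) * (- A - B) = s * (m2_scalar (\<iota> (lam / 2)) * (B - m2_scalar Z)) * s"
      using two.conj_scalar by simp
    then show ?thesis unfolding D'_def K_def using two.ex_conj[OF ss] by simp
  qed
  have hex: "EA * (K * F' * K) * (K * D' * K) * H * EB * F = 1"
    using two.ev_hexagon[OF Ass refl, of A B] unfolding CA BC Ez EA_def EB_def F_def .
  define sig where "sig = F * K * EA * F'"
  have KEA: "K * EA = EA * K"
  proof -
    have "two.ex (s * (m2_scalar (\<iota> (lam / 2)) * A) * s) = EA"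
      unfolding EA_def two.conj_scalar[symmetric] sAs ..
    then have "K * EA * K = EA" unfolding EA_def K_def two.ex_conj[OF ss] .
    then have "K * EA * (K * K) = EA * K" by (metis mult.assoc)
    then show ?thesis by (simp add: KK)
  qed
  have hex2: "EA * K * F' * D' * (K * H) * EB * F = 1"
  proof -
    have "EA * (K * F' * K) * (K * D' * K) * H * EB * F = EA * K * F' * (K * K) * D' * (K * H) * EB * F"
      by (simp only: mult.assoc)
    then show ?thesis using hex by (simp add: KK)
  qed
  \<comment> \<open>The hexagon conjugated by \<open>F\<close>, which collects the matrix
    \<open>sig\<close> of the generator at the front.\<close>
  have sig1: "sig * D' * (K * H) * EB = 1"
  proof -
    have "sig * D' * (K * H) * EB = F * (K * EA) * F' * D' * (K * H) * EB * (F * F')"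
      by (simp add: sig_def mult.assoc FF)
    also have "\<dots> = F * (EA * K * F' * D' * (K * H) * EB * F) * F'"
      by (simp only: KEA mult.assoc)
    finally show ?thesis by (simp add: hex2 FF)
  qed
  define W E D EBi Di where "W = m2_series sig" and "E = m2_series EB" and "D = m2_series D'"
    and "EBi = M2 (fps_exp (- (\<mu> / 2 * x))) 0 0 (fps_exp (- (\<mu> / 2 * y)))"
    and "Di = M2 (fps_exp (\<mu> / 2 * y)) 0 0 (fps_exp (\<mu> / 2 * x))"
  define G where "G = m2_series (K * H)"
  have exp_inv: "fps_exp (- c) * fps_exp c = 1" "fps_exp c * fps_exp (- c) = (1 :: 'l fps)" for c
    by (simp_all flip: fps_exp_add_mult)
  have E: "E = M2 (fps_exp (\<mu> / 2 * x)) 0 0 (fps_exp (\<mu> / 2 * y))"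
    unfolding E_def EB_def B_def m2_scalar_mult half' using ex_diag[of "\<mu> / 2 * x" "\<mu> / 2 * y"] by simp
  have D: "D = M2 (fps_exp (- (\<mu> / 2 * y))) 0 0 (fps_exp (- (\<mu> / 2 * x)))"
  proof -
    have "m2_scalar (\<mu> / 2) * (B - m2_scalar Z) = M2 (- (\<mu> / 2 * y)) 0 0 (- (\<mu> / 2 * x))"
      unfolding B_def Z_def m2_scalar_def by (simp add: m2_defs algebra_simps)
    then show ?thesis unfolding D_def D'_def half' using ex_diag by simp
  qed
  have EE: "E * EBi = 1" "EBi * E = 1" and DD: "D * Di = 1" "Di * D = 1"
    unfolding E EBi_def D Di_def by (simp_all add: m2_defs exp_inv)
  have GG: "G * G = 1"
    unfolding G_def m2_series_mult[symmetric] using KHK by (simp add: mult.assoc m2_series_one)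
  have "W * D * G * E = 1"
    using arg_cong[OF sig1, of m2_series] by (simp only: m2_series_mult m2_series_one W_def D_def G_def E_def)
  \<comment> \<open>W is E^(-1) G D^(-1), and G squares to 1, so the unknown G disappears from W (D
    E) W. Since D E is e^B up to the central factor e^(-Z/2), this is \<sigma> e^B \<sigma> =
    e^(Z-B).\<close>
  have WDE: "W * (D * E) * W = EBi * Di"
  proof -
    have W: "W = EBi * G * Di"
    proof -
      have WDG: "W * D * G = EBi"
      proof -
        have "W * D * G = (W * D * G * E) * EBi" by (simp add: mult.assoc EE)
        then show ?thesis by (simp add: \<open>W * D * G * E = 1\<close>)
      qed
      have "EBi * G * Di = W * D * (G * G) * Di" unfolding WDG[symmetric] by (simp only: mult.assoc)
      then show ?thesis by (simp add: GG mult.assoc DD)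
    qed
    have "W * (D * E) * W = EBi * G * (Di * D) * (E * EBi) * G * Di"
      unfolding W by (simp only: mult.assoc)
    then show ?thesis by (simp add: DD EE) (simp add: mult.assoc GG)
  qed
  have expm: "fps_exp v * fps_exp w = fps_exp (v + w)" for v w :: 'l by (simp add: fps_exp_add_mult)
  have DE: "D * E = M2 u 0 0 u'"
    unfolding D E u_def u'_def by (simp add: m2_defs expm algebra_simps diff_divide_distrib)
  have ED: "EBi * Di = M2 u' 0 0 u"
    unfolding EBi_def Di_def u_def u'_def by (simp add: m2_defs expm algebra_simps diff_divide_distrib)
  have conj: "W * M2 u 0 0 u' * W = M2 u' 0 0 u" using WDE unfolding DE ED .
  \<comment> \<open>Hyperbolic cosine and sine of \<mu> h. As s is an involution, exp(\<mu> h s) =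
    ch + sh s, and its product with s is sh + ch s, with eigenvalues q and -1/q.\<close>
  define ch sh where "ch = Abs_fps (\<lambda>d. if Parity.even d then \<mu> ^ d / fact d else 0)"
    and "sh = Abs_fps (\<lambda>d. if Parity.even d then 0 else \<mu> ^ d / fact d)"
  have q: "fps_exp \<mu> = ch + sh" "fps_exp (- \<mu>) = ch - sh"
    by (auto simp: fps_eq_iff ch_def sh_def)
  have chsh: "ch * ch - sh * sh = 1"
    using exp_inv(2)[of \<mu>] unfolding q by (simp add: algebra_simps)
  have z: "z = sh + sh" unfolding z_def q by simp
  have sEA: "m2_series EA = m2_scalar ch + m2_scalar sh * m2_const s"
  proof -
    have arg: "m2_scalar (\<iota> (lam / 2)) * A = m2_scalar \<mu> * s"
      unfolding A_def mult.assoc[symmetric] using half by (simp add: m2_scalar_def m2_defs mult.commute)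
    have pow: "(m2_scalar \<mu> * s) ^ d = m2_scalar (\<mu> ^ d) * (if Parity.even d then 1 else s)" for d
    proof (induction d)
      case (Suc d)
      have "(m2_scalar \<mu> * s) ^ Suc d = (m2_scalar \<mu> * m2_scalar (\<mu> ^ d)) * (s * (if Parity.even d then 1 else s))"
        using Suc m2_scalar_central[of "\<mu> ^ d" s] by (simp add: mult.assoc) (metis mult.assoc)
      moreover have "m2_scalar \<mu> * m2_scalar (\<mu> ^ d) = m2_scalar (\<mu> ^ Suc d)"
        by (simp add: m2_scalar_def m2_defs)
      ultimately show ?case by (simp add: ss)
    qed (simp add: m2_scalar_def m2_defs)
    show ?thesis
      unfolding EA_def arg two.ex_def pow
      by (simp add: m2_series_def m2_const_def m2_scalar_def m2_defs fps_eq_iff ch_def sh_def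
          hom_fact_inverse s_def)
  qed
  have mK: "m2_series K = m2_const s" by (simp add: K_def m2_series_const)
  have cc: "m2_const s * m2_const s = 1"
    using KK by (metis mK m2_series_mult m2_series_one)
  have KE: "m2_series (K * EA) = m2_scalar sh + m2_scalar ch * m2_const s"
  proof -
    have "m2_series (K * EA) = m2_scalar ch * m2_const s + m2_scalar sh * (m2_const s * m2_const s)"
      unfolding m2_series_mult mK sEA distrib_left
      using m2_scalar_central[of ch "m2_const s"] m2_scalar_central[of sh "m2_const s"]
      by (simp add: mult.assoc) (metis mult.assoc)
    then show ?thesis by (simp add: cc add.commute)
  qed
  have quadK: "m2_series (K * EA) * m2_series (K * EA) = m2_scalar z * m2_series (K * EA) + 1"
  proof -
    have "m2_scalar ch * m2_const s * (m2_scalar ch * m2_const s) = m2_scalar (ch * ch)"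
    proof -
      have "m2_scalar ch * m2_const s * (m2_scalar ch * m2_const s)
          = m2_scalar ch * m2_scalar ch * (m2_const s * m2_const s)"
        using m2_scalar_central[of ch "m2_const s"] by (metis mult.assoc)
      then show ?thesis by (simp add: cc) (simp add: m2_scalar_def m2_defs)
    qed
    moreover have "m2_scalar (ch * ch) = 1 + m2_scalar (sh * sh)"
      using chsh by (simp add: m2_scalar_def m2_defs algebra_simps)
    moreover have "m2_scalar sh * (m2_scalar ch * m2_const s) = m2_scalar ch * m2_const s * m2_scalar sh"
      by (rule m2_scalar_central)
    ultimately show ?thesis
      unfolding KE z by (simp add: distrib_left distrib_right)
        (simp add: m2_scalar_def m2_defs algebra_simps)
  qed
  have WF: "W = m2_series F * m2_series (K * EA) * m2_series F'"
    unfolding W_def sig_def by (simp only: m2_series_mult mult.assoc)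
  have FFs: "m2_series F' * m2_series F = 1" "m2_series F * m2_series F' = 1"
    using FF by (metis m2_series_mult m2_series_one)+
  have quad: "W * W = m2_scalar z * W + 1"
  proof -
    have "W * W = m2_series F * m2_series (K * EA) * (m2_series F' * m2_series F) * m2_series (K * EA) * m2_series F'"
      unfolding WF by (simp only: mult.assoc)
    also have "\<dots> = m2_series F * (m2_series (K * EA) * m2_series (K * EA)) * m2_series F'"
      by (simp add: FFs mult.assoc)
    also have "\<dots> = m2_scalar z * (m2_series F * m2_series (K * EA) * m2_series F') + m2_series F * m2_series F'"
    proof -
      have "m2_series F * (m2_scalar z * Q + 1) * m2_series F'
          = (m2_series F * m2_scalar z) * Q * m2_series F' + m2_series F * m2_series F'" for Q
        by (simp add: distrib_left distrib_right mult.assoc)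
      then show ?thesis
        unfolding quadK m2_scalar_central[of z "m2_series F", symmetric] by (simp only: mult.assoc)
    qed
    finally show ?thesis by (simp add: WF FFs)
  qed
  have sym: "m2_transpose W = W"
  proof -
    have "m2_transpose A = A" "m2_transpose B = B"
      by (simp_all add: A_def B_def s_def m2_scalar_mult m2_transpose_def)
    then have t: "m2_transpose (m2_series F) = m2_series F'" "m2_transpose (m2_series F') = m2_series F"
      unfolding F_def F'_def by (simp_all add: two_ev_transpose)
    have "m2_transpose (m2_series (K * EA)) = m2_series (K * EA)"
      unfolding KE s_def by (simp add: m2_transpose_def m2_scalar_def m2_const_def m2_defs)
    then show ?thesis unfolding WF m2_transpose_mult t by (simp add: mult.assoc)
  qed
  obtain a b c d where Wabcd: "W = M2 a b c d" by (cases W)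
  have bc: "c = b" using arg_cong[OF sym, of m12] by (simp add: Wabcd m2_transpose_def)
  have quad11: "a * a + b * b = z * a + 1"
    using quad unfolding Wabcd bc by (simp add: m2_scalar_mult) (simp add: m2_defs)
  \<comment> \<open>The quadratic relation says that W - z is the inverse of W; multiplying by it
    turns \<open>conj\<close>, which is quadratic in W, into a linear equation whose diagonal
    entries determine a and d.\<close>
  have left: "M2 u 0 0 u' * W = (W - m2_scalar z) * M2 u' 0 0 u"
  proof -
    have inv: "(W - m2_scalar z) * W = 1" using quad by (simp add: left_diff_distrib)
    have "M2 u 0 0 u' * W = ((W - m2_scalar z) * W) * M2 u 0 0 u' * W" by (simp add: inv)
    also have "\<dots> = (W - m2_scalar z) * (W * M2 u 0 0 u' * W)" by (simp only: mult.assoc)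
    finally show ?thesis by (simp only: conj)
  qed
  have e11: "u * a = (a - z) * u'" and e22: "u' * d = (d - z) * u"
    using left unfolding Wabcd by (simp_all add: m2_scalar_def m2_defs)
  have const: "fps_nth b 0 = r"
  proof -
    have "fps_nth sig 0 = s"
      unfolding sig_def F_def F'_def K_def EA_def
      by (simp add: two.ev_constant_term[OF constant_term] two.ex_constant_term)
    then have "fps_nth (m12 W) 0 = m12 s" by (simp add: W_def m2_series_def)
    then show ?thesis by (simp add: Wabcd s_def)
  qed
  show ?thesis
  proof (rule that)
    show "m2_series (braid_matrix s (m2_scalar 2 * s) (M2 x 0 0 y)) = M2 a b b d"
      using Wabcd unfolding W_def sig_def braid_matrix_def F_def F'_def K_def EA_def A_def B_def bc .
    show "a * (u - u') = - z * u'" using e11 by (simp add: algebra_simps)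
    show "d * (u - u') = z * u" using e22 by (simp add: algebra_simps)
  qed (rule quad11, rule const)
qed

end

section \<open>Irreducible representations as orthogonal forms\<close>

lemma gralg_mult_expand:
  "gralg_mult n x c = (\<lambda>q. \<Sum>s\<in>perms n. x s * gralg_mult n (gralg_of s) c q)"
proof
  fix q
  show "gralg_mult n x c q = (\<Sum>s\<in>perms n. x s * gralg_mult n (gralg_of s) c q)"
  proof (cases "q permutes {1..n}")
    case True
    show ?thesis unfolding gralg_mult_apply[OF True, of x]
      by (rule sum.cong) (simp_all only: mem_Collect_eq gralg_of_mult[OF _ True])
  next
    case False
    have "gralg_mult n f c q = 0" for f by (rule gralg_mult_outside[OF False])
    then show ?thesis by (simp only: mult_zero_right sum.neutral_const)
  qed
qed

text \<open>The traces of P Q and Q P agree. In characteristic 0 this forces m = d, which is how the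
  dimension of an irreducible representation is identified with the number of standard
  tableaux.\<close>

lemma trace_mult_eq:
  fixes P Q :: "'a::comm_semiring_1 mat"
  assumes P: "P \<in> carrier_mat m d" and Q: "Q \<in> carrier_mat d m"
    and PQ: "P * Q = 1\<^sub>m m" and QP: "Q * P = 1\<^sub>m d"
  shows "(of_nat m :: 'a) = of_nat d"
proof -
  have "(of_nat m :: 'a) = (\<Sum>i<m. (P * Q) $$ (i, i))" unfolding PQ by simp
  also have "\<dots> = (\<Sum>i<m. \<Sum>j<d. P $$ (i, j) * Q $$ (j, i))"
    using P Q by (intro sum.cong refl) (simp add: scalar_prod_def lessThan_atLeast0)
  also have "\<dots> = (\<Sum>j<d. \<Sum>i<m. Q $$ (j, i) * P $$ (i, j))"
    by (subst sum.swap) (simp add: mult.commute)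
  also have "\<dots> = (\<Sum>j<d. (Q * P) $$ (j, j))"
    using P Q by (intro sum.cong refl) (simp add: scalar_prod_def lessThan_atLeast0)
  also have "\<dots> = of_nat d" unfolding QP by simp
  finally show ?thesis .
qed

lemma hom_gralg_mult:
  assumes "field_hom \<iota>"
  shows "\<iota> (gralg_mult n f g p) = gralg_mult n (\<lambda>q. \<iota> (f q)) (\<lambda>q. \<iota> (g q)) p"
proof -
  interpret field_hom \<iota> by (rule assms)
  show ?thesis by (simp add: gralg_mult_def hom_sum hom_mult)
qed

lemma hom_young_symmetrizer:
  assumes "field_hom \<iota>"
  shows "\<iota> (young_symmetrizer \<alpha> T p) = young_symmetrizer \<alpha> T p"
proof -
  interpret field_hom \<iota> by (rule assms)
  have "(\<lambda>q. \<iota> (if q \<in> S then 1 else 0)) = (\<lambda>q. if q \<in> S then 1 else 0)" for S :: "(nat \<Rightarrow> nat) set"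
    by auto
  moreover have "(\<lambda>q. \<iota> (if q \<in> S then of_int (sign q) else 0)) = (\<lambda>q. if q \<in> S then of_int (sign q) else 0)"
    for S :: "(nat \<Rightarrow> nat) set"
    by (auto simp: hom_of_int)
  ultimately show ?thesis by (simp only: young_symmetrizer_def hom_gralg_mult[OF assms])
qed

lemma hom_gralg_of: "field_hom \<iota> \<Longrightarrow> \<iota> (gralg_of s p) = gralg_of s p"
proof -
  assume "field_hom \<iota>"
  then interpret field_hom \<iota> .
  show ?thesis by (simp add: gralg_of_def)
qed

text \<open>Over \<open>'l\<close>, an irreducible \<open>S\<close> becomes isomorphic to the orthogonal form through
  \<open>f \<mapsto> f v\<close>, where \<open>v\<close> is a vector which the Young symmetrizer does not kill.\<close>

lemma (in young_form) irrep_intertwiner: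
  fixes \<iota> :: "'k::field_char_0 \<Rightarrow> 'f"
  assumes hom: "field_hom \<iota>" and S: "is_irrep_of n \<alpha> S"
  obtains P where "P \<in> carrier (GL (R_dim \<alpha>))" "S \<in> hom (sym_group n) (GL (R_dim \<alpha>))"
    "\<And>p. p permutes {1..n} \<Longrightarrow> P * map_mat \<iota> (S p) = yrep p * P"
proof -
  interpret \<iota>: field_hom \<iota> by (rule hom)
  let ?D = "R_dim \<alpha>"
  obtain d T and \<phi> :: "'k vec \<Rightarrow> (nat \<Rightarrow> nat) \<Rightarrow> 'k" where
    Shom: "S \<in> hom (sym_group n) (GL d)" and T: "T \<in> fillings \<alpha>"
    and bij: "bij_betw \<phi> (carrier_vec d) {gralg_mult n f (young_symmetrizer \<alpha> T) | f. f \<in> gralg n}"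
    and add: "\<And>v w. v \<in> carrier_vec d \<Longrightarrow> w \<in> carrier_vec d \<Longrightarrow> \<phi> (v + w) = (\<lambda>p. \<phi> v p + \<phi> w p)"
    and scal: "\<And>c v. v \<in> carrier_vec d \<Longrightarrow> \<phi> (c \<cdot>\<^sub>v v) = (\<lambda>p. c * \<phi> v p)"
    and equi: "\<And>s v. s \<in> carrier (sym_group n) \<Longrightarrow> v \<in> carrier_vec d \<Longrightarrow>
      \<phi> (S s *\<^sub>v v) = gralg_mult n (gralg_of s) (\<phi> v)"
    using S unfolding is_irrep_of_def by blast
  interpret S: sn_rep n d S by unfold_locales (rule Shom)
  let ?ck = "young_symmetrizer \<alpha> T :: _ \<Rightarrow> 'k" and ?c = "young_symmetrizer \<alpha> T :: _ \<Rightarrow> 'f"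
  have lincomb: "\<phi> (vec d (\<lambda>i. \<Sum>a\<in>A. c a * z a $ i)) = (\<lambda>q. \<Sum>a\<in>A. c a * \<phi> (z a) q)"
    if "finite A" "\<And>a. a \<in> A \<Longrightarrow> z a \<in> carrier_vec d" for A :: "'x set" and c z
    using that
  proof (induction A rule: finite_induct)
    case empty
    have "vec d (\<lambda>i. 0) = 0 \<cdot>\<^sub>v (0\<^sub>v d :: 'k vec)" by auto
    then show ?case using scal[of "0\<^sub>v d" 0] by simp
  next
    case (insert a A)
    have za: "z a \<in> carrier_vec d" using insert by simp
    have "vec d (\<lambda>i. \<Sum>a\<in>insert a A. c a * z a $ i) = c a \<cdot>\<^sub>v z a + vec d (\<lambda>i. \<Sum>a\<in>A. c a * z a $ i)"
    proof (rule eq_vecI)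
      fix i assume "i < dim_vec (c a \<cdot>\<^sub>v z a + vec d (\<lambda>i. \<Sum>a\<in>A. c a * z a $ i))"
      then have i: "i < d" by simp
      have "(c a \<cdot>\<^sub>v z a) $ i = c a * z a $ i"
        by (rule index_smult_vec(1)) (simp only: carrier_vecD[OF za] i)
      then show "vec d (\<lambda>i. \<Sum>a\<in>insert a A. c a * z a $ i) $ i
          = (c a \<cdot>\<^sub>v z a + vec d (\<lambda>i. \<Sum>a\<in>A. c a * z a $ i)) $ i"
        using i insert.hyps by simp
    qed simp
    then have "\<phi> (vec d (\<lambda>i. \<Sum>a\<in>insert a A. c a * z a $ i))
        = (\<lambda>q. c a * \<phi> (z a) q + (\<Sum>a\<in>A. c a * \<phi> (z a) q))"
      using add[of "c a \<cdot>\<^sub>v z a" "vec d (\<lambda>i. \<Sum>a\<in>A. c a * z a $ i)"] scal[OF za] za insert by simp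
    then show ?case using insert by simp
  qed
  \<comment> \<open>The k-basis of the left ideal that corresponds to the unit vectors.\<close>
  define F where "F j = \<phi> (unit_vec d j)" for j
  have expand: "\<phi> v = (\<lambda>q. \<Sum>j<d. v $ j * F j q)" if "v \<in> carrier_vec d" for v
  proof -
    have "v = vec d (\<lambda>i. \<Sum>j<d. v $ j * unit_vec d j $ i)"
    proof (rule eq_vecI)
      fix i assume "i < dim_vec (vec d (\<lambda>i. \<Sum>j<d. v $ j * unit_vec d j $ i))"
      then have i: "i < d" by simp
      have "(\<Sum>j<d. v $ j * unit_vec d j $ i) = (\<Sum>j<d. if j = i then v $ j else 0)"
        using i by (intro sum.cong refl) (auto simp: unit_vec_def)
      then show "v $ i = vec d (\<lambda>i. \<Sum>j<d. v $ j * unit_vec d j $ i) $ i" using i by simp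
    qed (use that in simp)
    then have "\<phi> v = \<phi> (vec d (\<lambda>i. \<Sum>j<d. v $ j * unit_vec d j $ i))" by simp
    also have "\<dots> = (\<lambda>q. \<Sum>j<d. v $ j * F j q)"
      unfolding F_def by (rule lincomb) simp_all
    finally show ?thesis .
  qed
  have surj: "\<exists>v\<in>carrier_vec d. \<phi> v = gralg_mult n f ?ck" if "f \<in> gralg n" for f
  proof -
    have "gralg_mult n f ?ck \<in> \<phi> ` carrier_vec d" using bij that by (auto simp: bij_betw_def)
    then show ?thesis by (metis imageE)
  qed
  have inj: "v = w" if "v \<in> carrier_vec d" "w \<in> carrier_vec d" "\<phi> v = \<phi> w" for v w
    using bij that by (auto simp: bij_betw_def dest: inj_onD)
  have "\<forall>s\<in>perms n. \<exists>v\<in>carrier_vec d. \<phi> v = gralg_mult n (gralg_of s) ?ck"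
    by (intro ballI surj) (auto simp: gralg_def gralg_of_def)
  \<comment> \<open>\<open>z s\<close> holds the coordinates of s times the symmetrizer. These
    coordinates over k stay valid after applying \<iota>, and give preimages over
    \<open>'l\<close>.\<close>
  then obtain z where z: "\<And>s. s \<in> perms n \<Longrightarrow> z s \<in> carrier_vec d"
      "\<And>s. s \<in> perms n \<Longrightarrow> \<phi> (z s) = gralg_mult n (gralg_of s) ?ck" by metis
  have "\<forall>j. j < d \<longrightarrow> (\<exists>f. F j = gralg_mult n f ?ck)"
  proof (intro allI impI)
    fix j
    have "\<phi> (unit_vec d j) \<in> \<phi> ` carrier_vec d" by auto
    then show "\<exists>f. F j = gralg_mult n f ?ck" using bij by (auto simp: bij_betw_def F_def)
  qed
  then obtain f where f: "\<And>j. j < d \<Longrightarrow> F j = gralg_mult n (f j) ?ck" by metis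
  have \<iota>c: "(\<lambda>p. \<iota> (?ck p)) = ?c" by (rule ext) (rule hom_young_symmetrizer[OF hom])
  have \<iota>F: "(\<lambda>p. \<iota> (F j p)) = gralg_mult n (\<lambda>p. \<iota> (f j p)) ?c" if "j < d" for j
    unfolding f[OF that] hom_gralg_mult[OF hom] \<iota>c ..
  obtain v where v: "v \<in> carrier_vec ?D" "gmat ?c *\<^sub>v v \<noteq> 0\<^sub>v ?D" using young_vector[OF T] .
  have cv: "gmat ?c *\<^sub>v v \<in> carrier_vec ?D" by (rule mult_mat_vec_carrier[OF gmat_carrier v(1)])
  \<comment> \<open>Column j is the image of \<open>F j\<close> applied to v; \<open>Py\<close> then
    says that P evaluates at v the element of the ideal with coordinates y.\<close>
  define P where "P = mat ?D d (\<lambda>(i, j). (gmat (\<lambda>p. \<iota> (F j p)) *\<^sub>v v) $ i)"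
  have P: "P \<in> carrier_mat ?D d" by (simp add: P_def)
  have Py: "P *\<^sub>v y = gmat (\<lambda>p. \<Sum>j<d. y $ j * \<iota> (F j p)) *\<^sub>v v" if y: "y \<in> carrier_vec d" for y
  proof (rule eq_vecI)
    fix i assume "i < dim_vec (gmat (\<lambda>p. \<Sum>j<d. y $ j * \<iota> (F j p)) *\<^sub>v v)"
    then have i: "i < ?D" by (simp add: gmat_def)
    have "(P *\<^sub>v y) $ i = (\<Sum>j<d. (gmat (\<lambda>p. \<iota> (F j p)) *\<^sub>v v) $ i * y $ j)"
      using y i by (simp add: P_def scalar_prod_def lessThan_atLeast0)
    also have "\<dots> = (\<Sum>j<d. \<Sum>p\<in>perms n. y $ j * \<iota> (F j p) * (yrep p *\<^sub>v v) $ i)"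
      unfolding gmat_vec[OF v(1) i] by (simp add: sum_distrib_left mult_ac)
    also have "\<dots> = (gmat (\<lambda>p. \<Sum>j<d. y $ j * \<iota> (F j p)) *\<^sub>v v) $ i"
      unfolding gmat_vec[OF v(1) i] by (subst sum.swap) (simp add: sum_distrib_right)
    finally show "(P *\<^sub>v y) $ i = (gmat (\<lambda>p. \<Sum>j<d. y $ j * \<iota> (F j p)) *\<^sub>v v) $ i" .
  qed (simp add: P_def gmat_def)
  have \<iota>\<phi>: "(\<lambda>p. \<Sum>j<d. \<iota> (w $ j) * \<iota> (F j p)) = (\<lambda>p. \<iota> (\<phi> w p))" if "w \<in> carrier_vec d" for w
    by (rule ext) (simp add: expand[OF that] \<iota>.hom_sum \<iota>.hom_mult)
  have inter: "P * map_mat \<iota> (S p) = yrep p * P" if p: "p permutes {1..n}" for p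
  proof (rule eq_matI)
    have Sp: "S p \<in> carrier_mat d d" by (rule S.rep_carrier[OF p])
    have yp: "yrep p \<in> carrier_mat ?D ?D" by (rule rep_carrier[OF p])
    show "dim_row (P * map_mat \<iota> (S p)) = dim_row (yrep p * P)" "dim_col (P * map_mat \<iota> (S p)) = dim_col (yrep p * P)"
      using Sp yp P by auto
    fix i j assume "i < dim_row (yrep p * P)" "j < dim_col (yrep p * P)"
    then have i: "i < ?D" and j: "j < d" using yp P by auto
    define w where "w = S p *\<^sub>v unit_vec d j"
    have w: "w \<in> carrier_vec d" unfolding w_def by (rule mult_mat_vec_carrier[OF Sp]) simp
    have wj: "w $ k = S p $$ (k, j)" if "k < d" for k
      unfolding w_def by (rule mult_mat_vec_unit_vec[OF Sp that j])
    have "(P * map_mat \<iota> (S p)) $$ (i, j) = (P *\<^sub>v vec d (\<lambda>k. \<iota> (w $ k))) $ i"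
      using i j P Sp by (simp add: scalar_prod_def wj)
    also have "\<dots> = (gmat (\<lambda>q. \<iota> (\<phi> w q)) *\<^sub>v v) $ i"
      using \<iota>\<phi>[OF w] by (subst Py) simp_all
    also have "(\<lambda>q. \<iota> (\<phi> w q)) = gralg_mult n (gralg_of p) (\<lambda>q. \<iota> (F j q))"
    proof -
      have "\<phi> w = gralg_mult n (gralg_of p) (F j)"
        unfolding w_def F_def by (rule equi) (simp_all only: sym_group_carrier p unit_vec_carrier)
      then show ?thesis by (simp add: hom_gralg_mult[OF hom] hom_gralg_of[OF hom])
    qed
    also have "gmat (gralg_mult n (gralg_of p) (\<lambda>q. \<iota> (F j q))) *\<^sub>v v
        = yrep p *\<^sub>v (gmat (\<lambda>q. \<iota> (F j q)) *\<^sub>v v)"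
      unfolding gmat_mult_vec[OF v(1)] gmat_gralg_of[OF p] ..
    also have "\<dots> $ i = (yrep p * P) $$ (i, j)"
      using i j yp P by (simp add: scalar_prod_def P_def gmat_def)
    finally show "(P * map_mat \<iota> (S p)) $$ (i, j) = (yrep p * P) $$ (i, j)" .
  qed
  have onto: "\<exists>y\<in>carrier_vec d. P *\<^sub>v y = w" if w: "w \<in> carrier_vec ?D" for w
  proof -
    obtain x where x: "w = gmat x *\<^sub>v (gmat ?c *\<^sub>v v)"
      using irreducible[OF cv v(2) w] by (auto simp: orbit_def)
    define y where "y = vec d (\<lambda>j. \<Sum>s\<in>perms n. x s * \<iota> (z s $ j))"
    have "(\<Sum>j<d. y $ j * \<iota> (F j p)) = gralg_mult n x ?c p" for p
    proof -
      have "(\<Sum>j<d. y $ j * \<iota> (F j p)) = (\<Sum>j<d. \<Sum>s\<in>perms n. x s * (\<iota> (z s $ j) * \<iota> (F j p)))"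
        by (simp add: y_def sum_distrib_right mult.assoc)
      also have "\<dots> = (\<Sum>s\<in>perms n. x s * (\<Sum>j<d. \<iota> (z s $ j) * \<iota> (F j p)))"
        by (subst sum.swap) (simp add: sum_distrib_left)
      also have "\<dots> = (\<Sum>s\<in>perms n. x s * gralg_mult n (gralg_of s) ?c p)"
      proof (rule sum.cong[OF refl])
        fix s assume s: "s \<in> perms n"
        have "(\<Sum>j<d. \<iota> (z s $ j) * \<iota> (F j p)) = \<iota> (\<phi> (z s) p)"
          using fun_cong[OF \<iota>\<phi>[OF z(1)[OF s]], of p] .
        also have "\<dots> = gralg_mult n (gralg_of s) ?c p"
          by (simp add: z(2)[OF s] hom_gralg_mult[OF hom] hom_gralg_of[OF hom] hom_young_symmetrizer[OF hom])
        finally show "x s * (\<Sum>j<d. \<iota> (z s $ j) * \<iota> (F j p)) = x s * gralg_mult n (gralg_of s) ?c p" by simp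
      qed
      also have "\<dots> = gralg_mult n x ?c p" by (subst gralg_mult_expand[of n x]) (rule refl)
      finally show ?thesis .
    qed
    then have "P *\<^sub>v y = w" using x by (subst Py) (simp_all add: y_def gmat_mult_vec[OF v(1)])
    then show ?thesis by (intro bexI[of _ y]) (simp_all add: y_def)
  qed
  obtain \<kappa> where \<kappa>: "gralg_mult n ?ck ?ck = (\<lambda>p. \<kappa> * ?ck p)"
  proof -
    have "gralg_mult n ?ck (gralg_of id) = ?ck"
    proof
      fix p
      show "gralg_mult n ?ck (gralg_of id) p = ?ck p"
        by (cases "p permutes {1..n}")
          (simp_all add: mult_gralg_of[OF permutes_id] gralg_mult_outside young_symmetrizer_eq)
    qed
    then show ?thesis using young_symmetrizer_sandwich[OF T, of "gralg_of id :: _ \<Rightarrow> 'k"] that by auto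
  qed
  have \<kappa>0: "\<iota> \<kappa> \<noteq> 0"
  proof -
    obtain k where k: "k \<noteq> 0" "gralg_mult n ?c ?c = (\<lambda>p. k * ?c p)" using young_square[OF T] .
    have "\<iota> (gralg_mult n ?ck ?ck id) = gralg_mult n ?c ?c id"
      by (simp only: hom_gralg_mult[OF hom] hom_young_symmetrizer[OF hom])
    then have "\<iota> \<kappa> = k" unfolding \<kappa> k by (simp add: young_symmetrizer_id[OF T])
    then show ?thesis using k by simp
  qed
  \<comment> \<open>A dual basis up to the factor \<kappa>: F j times the symmetrizer is \<kappa> F
    j, so the combination of the vectors \<open>z s\<close> with the coefficients of F j is \<kappa>
    times the j-th unit vector. Applying \<iota> shows that the F j stay linearly independent over
    \<open>'l\<close>, where no map \<phi> is given.\<close>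
  have dual: "\<kappa> * (if i = j then 1 else 0) = (\<Sum>s\<in>perms n. F j s * z s $ i)" if "i < d" "j < d" for i j
  proof -
    have "\<phi> (vec d (\<lambda>i. \<Sum>s\<in>perms n. F j s * z s $ i)) = (\<lambda>q. \<Sum>s\<in>perms n. F j s * \<phi> (z s) q)"
      by (rule lincomb[OF finite_perms]) (rule z(1))
    also have "\<dots> = gralg_mult n (F j) ?ck"
      unfolding gralg_mult_expand[of n "F j"] by (intro ext sum.cong refl) (simp add: z(2))
    also have "\<dots> = (\<lambda>q. \<kappa> * F j q)"
      unfolding f[OF that(2)] gralg_mult_assoc \<kappa> gralg_mult_scale_right ..
    also have "\<dots> = \<phi> (\<kappa> \<cdot>\<^sub>v unit_vec d j)" by (simp add: scal F_def)
    finally have "vec d (\<lambda>i. \<Sum>s\<in>perms n. F j s * z s $ i) = \<kappa> \<cdot>\<^sub>v unit_vec d j"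
      by (rule inj[rotated 2]) simp_all
    then have "vec d (\<lambda>i. \<Sum>s\<in>perms n. F j s * z s $ i) $ i = (\<kappa> \<cdot>\<^sub>v unit_vec d j) $ i" by simp
    then show ?thesis using that by (auto simp: unit_vec_def)
  qed
  have into: "y = 0\<^sub>v d" if y: "y \<in> carrier_vec d" "P *\<^sub>v y = 0\<^sub>v ?D" for y
  proof -
    define u where "u p = (\<Sum>j<d. y $ j * \<iota> (f j p))" for p
    have Y: "(\<Sum>j<d. y $ j * \<iota> (F j p)) = gralg_mult n u ?c p" for p
    proof -
      have "gralg_mult n u ?c p = (\<Sum>j<d. y $ j * gralg_mult n (\<lambda>p. \<iota> (f j p)) ?c p)"
        unfolding u_def by (subst gralg_mult_sum_left) (rule refl)
      also have "\<dots> = (\<Sum>j<d. y $ j * \<iota> (F j p))"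
        by (rule sum.cong[OF refl]) (use fun_cong[OF \<iota>F] in simp)
      finally show ?thesis ..
    qed
    have "gmat (gralg_mult n u ?c) *\<^sub>v v = 0\<^sub>v ?D"
      using y(2) unfolding Py[OF y(1)] Y .
    then have zero: "(\<Sum>j<d. y $ j * \<iota> (F j p)) = 0" for p
      unfolding Y by (rule young_injective[OF T v])
    have "y $ i = 0" if i: "i < d" for i
    proof -
      have "\<iota> \<kappa> * y $ i = (\<Sum>j<d. y $ j * \<iota> (\<kappa> * (if i = j then 1 else 0)))"
      proof -
        have "(\<Sum>j<d. y $ j * \<iota> (\<kappa> * (if i = j then 1 else 0))) = (\<Sum>j<d. if j = i then \<iota> \<kappa> * y $ i else 0)"
          by (rule sum.cong) auto
        then show ?thesis using i by simp
      qed
      also have "\<dots> = (\<Sum>j<d. \<Sum>s\<in>perms n. y $ j * \<iota> (F j s) * \<iota> (z s $ i))"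
        by (rule sum.cong) (use dual[OF i] in \<open>simp_all add: \<iota>.hom_sum \<iota>.hom_mult sum_distrib_left mult.assoc\<close>)
      also have "\<dots> = (\<Sum>s\<in>perms n. (\<Sum>j<d. y $ j * \<iota> (F j s)) * \<iota> (z s $ i))"
        by (subst sum.swap) (simp add: sum_distrib_right)
      also have "\<dots> = 0" by (simp add: zero)
      finally show ?thesis using \<kappa>0 by simp
    qed
    then show ?thesis using y(1) by (intro eq_vecI) auto
  qed
  have "\<forall>i. i < ?D \<longrightarrow> (\<exists>y\<in>carrier_vec d. P *\<^sub>v y = unit_vec ?D i)" using onto by simp
  then obtain Y where Y: "\<And>i. i < ?D \<Longrightarrow> Y i \<in> carrier_vec d" "\<And>i. i < ?D \<Longrightarrow> P *\<^sub>v Y i = unit_vec ?D i"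
    by metis
  define Q where "Q = mat d ?D (\<lambda>(j, i). Y i $ j)"
  have Q: "Q \<in> carrier_mat d ?D" by (simp add: Q_def)
  have PQ: "P * Q = 1\<^sub>m ?D"
  proof (rule eq_matI)
    fix i j assume "i < dim_row (1\<^sub>m ?D :: 'f mat)" "j < dim_col (1\<^sub>m ?D :: 'f mat)"
    then have ij: "i < ?D" "j < ?D" by auto
    have "(P * Q) $$ (i, j) = (P *\<^sub>v Y j) $ i"
      using ij P Y(1)[OF ij(2)] by (simp add: Q_def scalar_prod_def)
    then show "(P * Q) $$ (i, j) = 1\<^sub>m ?D $$ (i, j)" using ij Y(2) by (auto simp: unit_vec_def)
  qed (use P Q in auto)
  have QP: "Q * P = 1\<^sub>m d"
  proof (rule eq_mat_if_eq_on_vecs)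
    fix y :: "'f vec" assume y: "y \<in> carrier_vec d"
    let ?w = "(Q * P) *\<^sub>v y - y"
    have QPc: "Q * P \<in> carrier_mat d d" by (rule mult_carrier_mat[OF Q P])
    have w: "?w \<in> carrier_vec d" using QPc y by auto
    have "P *\<^sub>v ?w = P *\<^sub>v ((Q * P) *\<^sub>v y) - P *\<^sub>v y"
      by (rule mult_minus_distrib_mat_vec[OF P mult_mat_vec_carrier[OF QPc y] y])
    also have "P *\<^sub>v ((Q * P) *\<^sub>v y) = (P * (Q * P)) *\<^sub>v y"
      by (rule assoc_mult_mat_vec[OF P QPc y, symmetric])
    also have "P * (Q * P) = P"
      unfolding assoc_mult_mat[OF P Q P, symmetric] PQ using P by simp
    finally have "P *\<^sub>v ?w = 0\<^sub>v ?D" using P y by auto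
    then have w0: "?w = 0\<^sub>v d" by (rule into[OF w])
    have dQP: "dim_vec ((Q * P) *\<^sub>v y) = d" using Q by simp
    have "(Q * P) *\<^sub>v y = y"
    proof (rule eq_vecI)
      fix i assume "i < dim_vec y"
      then have i: "i < d" using y by simp
      have "?w $ i = ((Q * P) *\<^sub>v y) $ i - y $ i"
        by (rule index_minus_vec(1)) (use y i in simp)
      then show "((Q * P) *\<^sub>v y) $ i = y $ i" unfolding w0 using i by simp
    qed (use dQP y in simp)
    then show "(Q * P) *\<^sub>v y = 1\<^sub>m d *\<^sub>v y" using y by simp
  qed (use mult_carrier_mat[OF Q P] in auto)
  have "(of_nat ?D :: 'f) = of_nat d" by (rule trace_mult_eq[OF P Q PQ QP])
  then have d: "d = ?D" by simp
  show ?thesis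
  proof (rule that)
    show "P \<in> carrier (GL ?D)" using P Q PQ QP unfolding d by (rule GL_memI)
    show "S \<in> hom (sym_group n) (GL ?D)" using Shom unfolding d .
  qed (rule inter)
qed

section \<open>Block diagonal matrices\<close>

text \<open>The inclusion of the i-th summand. Multiplying by it on the right selects a block of
  columns, so identities between block matrices can be checked one summand at a time.\<close>

definition block_incl :: "nat list \<Rightarrow> nat \<Rightarrow> 'a::{zero,one} mat" where
  "block_incl ds i = mat (sum_list ds) (ds ! i) (\<lambda>(a, b). if a = sum_list (take i ds) + b then 1 else 0)"

lemma block_incl_carrier [simp]: "block_incl ds i \<in> carrier_mat (sum_list ds) (ds ! i)"
  by (simp add: block_incl_def)

lemma block_offset: "i < length ds \<Longrightarrow> b < ds ! i \<Longrightarrow> sum_list (take i ds) + b < sum_list (ds :: nat list)"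
proof (induction ds arbitrary: i)
  case (Cons d ds)
  then show ?case by (cases i) auto
qed simp

lemma block_cover: "c < sum_list (ds :: nat list) \<Longrightarrow> \<exists>i<length ds. \<exists>b<ds ! i. c = sum_list (take i ds) + b"
proof (induction ds arbitrary: c)
  case (Cons d ds)
  show ?case
  proof (cases "c < d")
    case True
    then show ?thesis by (intro exI[of _ 0]) auto
  next
    case False
    then have "c - d < sum_list ds" using Cons.prems by simp
    from Cons.IH[OF this] obtain i b where "i < length ds" "b < ds ! i" "c - d = sum_list (take i ds) + b" by blast
    then show ?thesis using False by (intro exI[of _ "Suc i"]) auto
  qed
qed simp

lemma mult_block_incl_index:
  fixes X :: "'a::semiring_1 mat"
  assumes X: "X \<in> carrier_mat M (sum_list ds)" and i: "i < length ds" and r: "r < M" and b: "b < ds ! i"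
  shows "(X * block_incl ds i) $$ (r, b) = X $$ (r, sum_list (take i ds) + b)"
proof -
  have "(X * block_incl ds i) $$ (r, b)
      = (\<Sum>c<sum_list ds. X $$ (r, c) * (if c = sum_list (take i ds) + b then 1 else 0))"
    using X r b by (simp add: block_incl_def scalar_prod_def lessThan_atLeast0)
  also have "\<dots> = (\<Sum>c<sum_list ds. if c = sum_list (take i ds) + b then X $$ (r, c) else 0)"
    by (rule sum.cong) auto
  finally have "(X * block_incl ds i) $$ (r, b)
      = (\<Sum>c<sum_list ds. if c = sum_list (take i ds) + b then X $$ (r, c) else 0)" .
  then show ?thesis using block_offset[OF i b] by simp
qed

lemma eq_mat_if_eq_on_blocks:
  fixes X Y :: "'a::semiring_1 mat"
  assumes X: "X \<in> carrier_mat M (sum_list ds)" and Y: "Y \<in> carrier_mat M (sum_list ds)"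
    and eq: "\<And>i. i < length ds \<Longrightarrow> X * block_incl ds i = Y * block_incl ds i"
  shows "X = Y"
proof (rule eq_matI)
  fix r c assume "r < dim_row Y" "c < dim_col Y"
  then have r: "r < M" and c: "c < sum_list ds" using Y by auto
  obtain i b where i: "i < length ds" "b < ds ! i" "c = sum_list (take i ds) + b" using block_cover[OF c] by blast
  show "X $$ (r, c) = Y $$ (r, c)"
    using mult_block_incl_index[OF X i(1) r i(2)] mult_block_incl_index[OF Y i(1) r i(2)] eq[OF i(1)] i(3) by simp
qed (use X Y in auto)

lemma diag_block_carrier:
  assumes "list_all2 (\<lambda>A d. A \<in> carrier_mat d d) Ms ds"
  shows "diag_block_mat Ms \<in> carrier_mat (sum_list ds) (sum_list ds)"
  using assms
proof (induction Ms ds rule: list_all2_induct)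
  case (Cons A Ms d ds)
  then show ?case unfolding diag_block_mat.simps Let_def sum_list.Cons by (intro four_block_carrier_mat)
qed simp

lemma diag_block_index:
  fixes Ms :: "'a::zero mat list"
  assumes "list_all2 (\<lambda>A d. A \<in> carrier_mat d d) Ms ds" "i < length ds" "b < ds ! i" "c < sum_list ds"
  shows "diag_block_mat Ms $$ (c, sum_list (take i ds) + b) =
    (if sum_list (take i ds) \<le> c \<and> c < sum_list (take i ds) + ds ! i
     then (Ms ! i) $$ (c - sum_list (take i ds), b) else 0)"
  using assms
proof (induction Ms ds arbitrary: i c rule: list_all2_induct)
  case (Cons A Ms d ds)
  have D: "diag_block_mat Ms \<in> carrier_mat (sum_list ds) (sum_list ds)" by (rule diag_block_carrier[OF Cons.hyps(2)])
  have A: "A \<in> carrier_mat d d" using Cons.hyps(1) .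
  show ?case
  proof (cases i)
    case 0
    then show ?thesis using A D Cons.prems by (auto simp: Let_def)
  next
    case (Suc k)
    have k: "k < length ds" "b < ds ! k" using Cons.prems Suc by auto
    have off: "sum_list (take k ds) + b < sum_list ds" by (rule block_offset[OF k])
    show ?thesis
    proof (cases "c < d")
      case True
      then show ?thesis using A D Suc off by (auto simp: Let_def)
    next
      case False
      then have c: "c - d < sum_list ds" using Cons.prems by simp
      from Cons.IH[OF k c] show ?thesis
        using A D Suc off False c by (auto simp: Let_def)
    qed
  qed
qed simp

lemma diag_block_mult_incl:
  fixes Ms :: "'a::semiring_1 mat list"
  assumes Ms: "list_all2 (\<lambda>A d. A \<in> carrier_mat d d) Ms ds" and i: "i < length ds"
  shows "diag_block_mat Ms * block_incl ds i = block_incl ds i * (Ms ! i)"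
proof (rule eq_matI)
  have D: "diag_block_mat Ms \<in> carrier_mat (sum_list ds) (sum_list ds)" by (rule diag_block_carrier[OF Ms])
  have A: "Ms ! i \<in> carrier_mat (ds ! i) (ds ! i)" using list_all2_nthD2[OF Ms i] .
  show "dim_row (diag_block_mat Ms * block_incl ds i) = dim_row (block_incl ds i * (Ms ! i))"
    "dim_col (diag_block_mat Ms * block_incl ds i) = dim_col (block_incl ds i * (Ms ! i))"
    using D A by (auto simp: block_incl_def)
  fix c b assume "c < dim_row (block_incl ds i * (Ms ! i))" "b < dim_col (block_incl ds i * (Ms ! i))"
  then have c: "c < sum_list ds" and b: "b < ds ! i" using A by (auto simp: block_incl_def)
  let ?o = "sum_list (take i ds)"
  have "(block_incl ds i * (Ms ! i)) $$ (c, b) = (\<Sum>a<ds ! i. if c = ?o + a then (Ms ! i) $$ (a, b) else 0)"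
    using c b A by (auto simp: block_incl_def scalar_prod_def lessThan_atLeast0 intro!: sum.cong)
  also have "\<dots> = (\<Sum>a<ds ! i. if a = c - ?o then (if ?o \<le> c then (Ms ! i) $$ (a, b) else 0) else 0)"
    by (rule sum.cong) auto
  also have "\<dots> = (if ?o \<le> c \<and> c < ?o + ds ! i then (Ms ! i) $$ (c - ?o, b) else 0)"
    by (auto simp: sum.delta)
  finally show "(diag_block_mat Ms * block_incl ds i) $$ (c, b) = (block_incl ds i * (Ms ! i)) $$ (c, b)"
    using mult_block_incl_index[OF D i c b] diag_block_index[OF Ms i b c] by simp
qed

lemma diag_block_mat_mult:
  fixes Ms Ns :: "'a::semiring_1 mat list"
  assumes Ms: "list_all2 (\<lambda>A d. A \<in> carrier_mat d d) Ms ds" and Ns: "list_all2 (\<lambda>A d. A \<in> carrier_mat d d) Ns ds"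
  shows "diag_block_mat Ms * diag_block_mat Ns = diag_block_mat (map2 (*) Ms Ns)"
proof -
  have len: "length Ms = length ds" "length Ns = length ds" using Ms Ns by (auto dest: list_all2_lengthD)
  have MN: "list_all2 (\<lambda>A d. A \<in> carrier_mat d d) (map2 (*) Ms Ns) ds"
    using len list_all2_nthD2[OF Ms] list_all2_nthD2[OF Ns]
    by (auto simp: list_all2_conv_all_nth intro!: mult_carrier_mat)
  note c = diag_block_carrier[OF Ms] diag_block_carrier[OF Ns] diag_block_carrier[OF MN]
  show ?thesis
  proof (rule eq_mat_if_eq_on_blocks[OF mult_carrier_mat[OF c(1,2)] c(3)])
    fix i assume i: "i < length ds"
    have A: "Ms ! i \<in> carrier_mat (ds ! i) (ds ! i)" and B: "Ns ! i \<in> carrier_mat (ds ! i) (ds ! i)"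
      using list_all2_nthD2[OF Ms i] list_all2_nthD2[OF Ns i] by auto
    have "diag_block_mat Ms * diag_block_mat Ns * block_incl ds i
        = diag_block_mat Ms * (block_incl ds i * (Ns ! i))"
      unfolding assoc_mult_mat[OF c(1,2) block_incl_carrier] diag_block_mult_incl[OF Ns i] ..
    also have "\<dots> = block_incl ds i * (Ms ! i) * (Ns ! i)"
      unfolding assoc_mult_mat[OF c(1) block_incl_carrier B, symmetric] diag_block_mult_incl[OF Ms i] ..
    also have "\<dots> = block_incl ds i * (Ms ! i * Ns ! i)"
      by (rule assoc_mult_mat[OF block_incl_carrier A B])
    also have "Ms ! i * Ns ! i = map2 (*) Ms Ns ! i" using len i by simp
    also have "block_incl ds i * (map2 (*) Ms Ns ! i) = diag_block_mat (map2 (*) Ms Ns) * block_incl ds i"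
      by (rule diag_block_mult_incl[OF MN i, symmetric])
    finally show "diag_block_mat Ms * diag_block_mat Ns * block_incl ds i
      = diag_block_mat (map2 (*) Ms Ns) * block_incl ds i" .
  qed
qed

lemma diag_block_mat_one: "diag_block_mat (map (\<lambda>d. 1\<^sub>m d) ds) = (1\<^sub>m (sum_list ds) :: 'a::semiring_1 mat)"
proof -
  have Ms: "list_all2 (\<lambda>A d. A \<in> carrier_mat d d) (map (\<lambda>d. 1\<^sub>m d :: 'a mat) ds) ds"
    by (simp add: list_all2_conv_all_nth)
  show ?thesis
    by (rule eq_mat_if_eq_on_blocks[OF diag_block_carrier[OF Ms] one_carrier_mat])
      (simp add: diag_block_mult_incl[OF Ms] right_mult_one_mat[OF block_incl_carrier] left_mult_one_mat[OF block_incl_carrier])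
qed

lemma diag_block_mat_GL:
  fixes Ms :: "'a::comm_ring_1 mat list"
  assumes "list_all2 (\<lambda>A d. A \<in> carrier (GL d)) Ms ds"
  shows "diag_block_mat Ms \<in> carrier (GL (sum_list ds))"
proof -
  have len: "length Ms = length ds" using assms by (rule list_all2_lengthD)
  have "\<forall>i<length ds. \<exists>B. Ms ! i \<in> carrier_mat (ds ! i) (ds ! i) \<and> B \<in> carrier_mat (ds ! i) (ds ! i) \<and>
      Ms ! i * B = 1\<^sub>m (ds ! i) \<and> B * Ms ! i = 1\<^sub>m (ds ! i)"
    using list_all2_nthD2[OF assms] by (metis GL_memE)
  then obtain B where B: "\<And>i. i < length ds \<Longrightarrow> Ms ! i \<in> carrier_mat (ds ! i) (ds ! i) \<and>
      B i \<in> carrier_mat (ds ! i) (ds ! i) \<and> Ms ! i * B i = 1\<^sub>m (ds ! i) \<and> B i * Ms ! i = 1\<^sub>m (ds ! i)" by metis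
  define Ns where "Ns = map B [0..<length ds]"
  have M: "list_all2 (\<lambda>A d. A \<in> carrier_mat d d) Ms ds" and N: "list_all2 (\<lambda>A d. A \<in> carrier_mat d d) Ns ds"
    using B len by (auto simp: list_all2_conv_all_nth Ns_def)
  have "map2 (*) Ms Ns = map (\<lambda>d. 1\<^sub>m d) ds" "map2 (*) Ns Ms = map (\<lambda>d. 1\<^sub>m d) ds"
    using B len by (auto simp: Ns_def intro!: nth_equalityI)
  then show ?thesis
    using diag_block_carrier[OF M] diag_block_carrier[OF N] diag_block_mat_mult[OF M N]
      diag_block_mat_mult[OF N M] diag_block_mat_one[of ds]
    by (intro GL_memI[where B = "diag_block_mat Ns"]) simp_all
qed

section \<open>The orthogonal form over Laurent series\<close>

text \<open>q^d with q = e^(mh), for integers d of either sign, as signed axial distances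
  require.\<close>

definition qpow :: "'l::field_char_0 \<Rightarrow> int \<Rightarrow> 'l fls" where
  "qpow m d = fps_to_fls (fps_exp (of_int d * m))"

lemma qpow_add: "qpow m (d + e) = qpow m d * qpow m e"
  by (simp add: qpow_def distrib_right fps_exp_add_mult fls_times_fps_to_fls)

lemma qpow_0 [simp]: "qpow m 0 = 1"
  by (simp add: qpow_def)

lemma qpow_inverse: "qpow m d * qpow m (- d) = 1" "qpow m (- d) * qpow m d = 1"
  using qpow_add[of m d "- d"] qpow_add[of m "- d" d] by simp_all

lemma qpow_nonzero [simp]: "qpow m d \<noteq> 0"
  using qpow_inverse(1)[of m d] by auto

lemma qpow_eq_iff:
  assumes "m \<noteq> 0"
  shows "qpow m d = qpow m e \<longleftrightarrow> d = e"
proof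
  assume "qpow m d = qpow m e"
  then have "fps_nth (fps_exp (of_int d * m)) 1 = fps_nth (fps_exp (of_int e * m)) 1"
    by (simp add: qpow_def fps_to_fls_eq_iff)
  then show "d = e" using assms by simp
qed simp

lemma q_of_qpow: "q_of m = qpow m 1"
  by (simp add: q_of_def qpow_def)

lemma q_of_power: "q_of m ^ k = qpow m (int k)"
  by (induction k) (simp_all add: q_of_qpow qpow_add[of m 1, symmetric] add.commute)

lemma inverse_q_of: "inverse (q_of m) = qpow m (- 1)"
  using qpow_inverse(1)[of m 1] by (simp add: q_of_qpow inverse_unique)

lemma inverse_q_of_power: "inverse (q_of m) ^ k = qpow m (- int k)"
proof (induction k)
  case (Suc k)
  have "qpow m (- int (Suc k)) = qpow m (- 1) * qpow m (- int k)"
    unfolding qpow_add[symmetric] by simp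
  then show ?case using Suc by (simp add: inverse_q_of)
qed simp

definition qdiff :: "'l::field_char_0 \<Rightarrow> 'l fls" where
  "qdiff m = qpow m 1 - qpow m (- 1)"

lemma q_num_qpow: "q_num m k = (qpow m (int k) - qpow m (- int k)) / qdiff m"
  unfolding q_num_def qdiff_def q_of_power inverse_q_of_power unfolding inverse_q_of unfolding q_of_qpow ..

lemma qdiff_nonzero: "m \<noteq> 0 \<Longrightarrow> qdiff m \<noteq> 0"
  by (simp add: qdiff_def qpow_eq_iff)

text \<open>The expansion [k]_q = q^(k-1) + q^(k-3) + ... + q^(1-k). It shows that this quotient of
  Laurent series is a power series, with constant term k.\<close>

definition q_num_fps :: "'l::field_char_0 \<Rightarrow> nat \<Rightarrow> 'l fps" where
  "q_num_fps m k = (\<Sum>i<k. fps_exp (of_int (int k - 1 - 2 * int i) * m))"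

lemma q_num_fps:
  assumes "m \<noteq> 0"
  shows "fps_to_fls (q_num_fps m k) = q_num m k"
proof -
  have sum: "fps_to_fls (sum f {..<j}) = (\<Sum>i<j. fps_to_fls (f i :: 'a fps))" for f and j :: nat
    by (induction j) (simp_all add: fps_to_fls_plus)
  have tel: "qdiff m * qpow m (int k - 1 - 2 * int i) = qpow m (int k - 2 * int i) - qpow m (int k - 2 * int (Suc i))" for i
    unfolding qdiff_def left_diff_distrib qpow_add[symmetric] by (simp add: algebra_simps)
  have "fps_to_fls (q_num_fps m k) = (\<Sum>i<k. qpow m (int k - 1 - 2 * int i))"
    unfolding q_num_fps_def sum qpow_def ..
  then have "qdiff m * fps_to_fls (q_num_fps m k)
      = (\<Sum>i<k. qpow m (int k - 2 * int i) - qpow m (int k - 2 * int (Suc i)))"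
    by (simp only: sum_distrib_left tel)
  also have "\<dots> = qpow m (int k) - qpow m (- int k)"
    using sum_lessThan_telescope'[of "\<lambda>i. qpow m (int k - 2 * int i)" k] by simp
  finally show ?thesis using qdiff_nonzero[OF assms] by (simp add: q_num_qpow field_simps)
qed

lemma q_num_fps_0: "fps_nth (q_num_fps m k) 0 = of_nat k"
  by (simp add: q_num_fps_def fps_sum_nth)

locale q_form = young_form n \<alpha> rt for n \<alpha> and rt :: "nat \<Rightarrow> 'l::field_char_0" +
  fixes m :: 'l
  assumes m_nonzero: "m \<noteq> 0"
begin

text \<open>For d > 0 this is -q^(-d)/[d]_q. Written without [d]_q it also makes sense for negative
  d, where it is q^|d|/[|d|]_q, the other diagonal entry of the matrix.\<close>

definition qa :: "int \<Rightarrow> 'l fls" where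
  "qa d = - qdiff m * qpow m (- d) / (qpow m d - qpow m (- d))"

definition qb :: "int \<Rightarrow> 'l fls" where
  "qb d = (if \<bar>d\<bar> \<le> 1 then 0 else q_sqrt m rt (nat \<bar>d\<bar>) / q_num m (nat \<bar>d\<bar>))"

lemma qpow_diff_nonzero: "d \<noteq> 0 \<Longrightarrow> qpow m d - qpow m (- d) \<noteq> 0"
  using qpow_eq_iff[OF m_nonzero, of d "- d"] by simp

lemma qa_eqI: "d \<noteq> 0 \<Longrightarrow> A * (qpow m d - qpow m (- d)) = - qdiff m * qpow m (- d) \<Longrightarrow> A = qa d"
  using qpow_diff_nonzero by (simp add: qa_def field_simps)

text \<open>In the variable X = q^(2d) - 1, addition of distances becomes X + Y + X Y, which reduces
  \<open>qa_add\<close> to a computation with fractions.\<close>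

lemma qa_alt: "d \<noteq> 0 \<Longrightarrow> qa d = - qdiff m / (qpow m (2 * d) - 1)"
proof -
  assume d: "d \<noteq> 0"
  have sq: "qpow m (2 * d) = qpow m d * qpow m d" unfolding qpow_add[symmetric] by simp
  have nz: "qpow m (2 * d) - 1 \<noteq> 0" using qpow_eq_iff[OF m_nonzero, of "2 * d" 0] d by simp
  have "(- qdiff m / (qpow m (2 * d) - 1)) * (qpow m d - qpow m (- d)) = - qdiff m * qpow m (- d)"
  proof -
    have "qpow m d - qpow m (- d) = qpow m (- d) * (qpow m (2 * d) - 1)"
      unfolding sq using qpow_inverse[of m d] by (simp add: right_diff_distrib mult.assoc[symmetric])
    then show ?thesis using nz by simp
  qed
  then show ?thesis by (rule qa_eqI[OF d, symmetric])
qed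

lemma qa_neg:
  assumes d: "d \<noteq> 0"
  shows "qa (- d) = qdiff m - qa d"
proof -
  define x where "x = qpow m (2 * d)"
  have x: "x \<noteq> 0" "x - 1 \<noteq> 0" "qpow m (2 * - d) = 1 / x"
    using qpow_eq_iff[OF m_nonzero, of "2 * d" 0] d qpow_inverse[of m "2 * d"]
    by (auto simp: x_def field_simps)
  define w where "w = x - 1"
  have w: "w \<noteq> 0" "x = w + 1" using x by (auto simp: w_def)
  have "1 / x - 1 = - (w / x)" using x by (simp add: w_def field_simps)
  moreover have "qa (- d) = - qdiff m / (1 / x - 1)" using qa_alt[of "- d"] d unfolding x(3) by simp
  ultimately have e: "qa (- d) = qdiff m * x / w" by simp
  have "qa d = - qdiff m / w" using qa_alt[OF d] by (simp add: x_def w_def)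
  then show ?thesis unfolding e using w by (simp add: field_simps)
qed

lemma qa_add:
  assumes "d \<noteq> 0" "e \<noteq> 0" "d + e \<noteq> 0"
  shows "qa d * qa e = qa (d + e) * (qa d + qa e - qdiff m)"
proof -
  define x y S where "x = qpow m (2 * d)" and "y = qpow m (2 * e)" and "S = x * y - 1"
  have S: "qpow m (2 * (d + e)) - 1 = S" by (simp add: S_def x_def y_def qpow_add[symmetric] distrib_left)
  have nz: "x - 1 \<noteq> 0" "y - 1 \<noteq> 0" "S \<noteq> 0"
    using qpow_eq_iff[OF m_nonzero, of "2 * d" 0] qpow_eq_iff[OF m_nonzero, of "2 * e" 0]
      qpow_eq_iff[OF m_nonzero, of "2 * (d + e)" 0] assms S
    by (auto simp: x_def y_def)
  have "qa d + qa e - qdiff m = - qdiff m * S / ((x - 1) * (y - 1))"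
  proof -
    define X Y z where "X = x - 1" and "Y = y - 1" and "z = qdiff m"
    have "qa d = - z / X" "qa e = - z / Y"
      using qa_alt[OF assms(1)] qa_alt[OF assms(2)] by (simp_all add: x_def y_def X_def Y_def z_def)
    moreover have "(- z / X + - z / Y - z) * (X * Y) = - z * (X + Y + X * Y)"
      using nz by (simp add: X_def[symmetric] Y_def[symmetric] field_simps)
    moreover have "S = X + Y + X * Y" by (simp add: S_def X_def Y_def algebra_simps)
    ultimately have "(qa d + qa e - qdiff m) * ((x - 1) * (y - 1)) = - qdiff m * S"
      by (simp only: X_def[symmetric] Y_def[symmetric] z_def[symmetric])
    moreover have W: "(x - 1) * (y - 1) \<noteq> 0" using nz by simp
    ultimately show ?thesis by (simp only: nonzero_eq_divide_eq[OF W])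
  qed
  moreover have "qa (d + e) = - qdiff m / S" using qa_alt[OF assms(3)] S by simp
  ultimately have "qa (d + e) * (qa d + qa e - qdiff m) = qdiff m * qdiff m / ((x - 1) * (y - 1))"
    using nz by simp
  also have "\<dots> = qa d * qa e"
    using qa_alt[OF assms(1)] qa_alt[OF assms(2)] by (simp add: x_def y_def)
  finally show ?thesis ..
qed

lemma q_num_nonzero: "0 < k \<Longrightarrow> q_num m k \<noteq> 0"
  using qpow_diff_nonzero[of "int k"] qdiff_nonzero[OF m_nonzero] by (simp add: q_num_qpow)

lemma qa_q_num:
  assumes "0 < k"
  shows "qa (int k) = - qpow m (- int k) / q_num m k" "qa (- int k) = qpow m (int k) / q_num m k"
proof -
  show a: "qa (int k) = - qpow m (- int k) / q_num m k"
    using qpow_diff_nonzero[of "int k"] qdiff_nonzero[OF m_nonzero] assms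
    by (simp add: q_num_qpow qa_def)
  define X where "X = qpow m (int k) - qpow m (- int k)"
  have "qpow m (- int k) - qpow m (int k) = - X" by (simp add: X_def)
  then have "qa (- int k) = qdiff m * qpow m (int k) / X" by (simp add: qa_def)
  moreover have "q_num m k = X / qdiff m" by (simp add: q_num_qpow X_def)
  ultimately show "qa (- int k) = qpow m (int k) / q_num m k" by simp
qed

text \<open>The series [k]_q b squares to [k+1]_q [k-1]_q and has constant term \<open>rt k\<close>.
  Power series with equal squares agree up to sign, and \<open>rt k\<close> is nonzero, so the
  description in \<open>q_sqrt\<close> singles out this one.\<close>

lemma q_sqrt_eq:
  assumes k: "2 \<le> k" "k \<le> n - 1"
    and b0: "fps_nth b 0 = rt k / of_nat k"
    and bb: "fps_to_fls b * fps_to_fls b = 1 + qdiff m * qa (int k) - qa (int k) * qa (int k)"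
  shows "q_sqrt m rt k = q_num m k * fps_to_fls b"
proof -
  define f where "f = q_num_fps m k * b"
  have f: "fps_to_fls f = q_num m k * fps_to_fls b"
    by (simp add: f_def fls_times_fps_to_fls q_num_fps[OF m_nonzero])
  have f0: "fps_nth f 0 = rt k" using k b0 by (simp add: f_def q_num_fps_0)
  have rt0: "rt k \<noteq> 0"
  proof
    assume "rt k = 0"
    then have "(of_nat (k\<^sup>2 - 1) :: 'l) = 0" using rt_square[OF k] by simp
    then have "k\<^sup>2 - 1 = 0" by (simp only: of_nat_eq_0_iff)
    moreover have "2 * 2 \<le> k * k" using k by (intro mult_le_mono) auto
    ultimately show False by (simp add: power2_eq_square)
  qed
  have sq: "(fps_to_fls f)\<^sup>2 = q_num m (k + 1) * q_num m (k - 1)"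
  proof -
    define U V A B z N where "U = qpow m (int k)" and "V = qpow m (- int k)" and "A = qpow m 1"
      and "B = qpow m (- 1)" and "z = qdiff m" and "N = q_num m k"
    have UV: "U * V = 1" and AB: "A * B = 1" by (simp_all add: U_def V_def A_def B_def qpow_inverse)
    have z: "z = A - B" "z \<noteq> 0" using qdiff_nonzero[OF m_nonzero] by (auto simp: z_def A_def B_def qdiff_def)
    have N: "z * N = U - V" using z by (simp add: N_def q_num_qpow U_def V_def z_def)
    have e: "int (k + 1) = int k + 1" "- (int k + 1) = - int k + - 1"
      "int (k - 1) = int k + - 1" "- (int k + - 1) = - int k + 1" using k by auto
    have Na: "N * qa (int k) = - V"
      using qa_q_num(1)[of k] q_num_nonzero[of k] k by (simp add: N_def V_def)
    \<comment> \<open>Multiplying by the square of z = q - 1/q clears all q-numbers; what then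
      appears is (q^(k+1) - q^(-k-1)) (q^(k-1) - q^(1-k)).\<close>
    have "z * z * (N * N * (1 + z * qa (int k) - qa (int k) * qa (int k)))
        = z * z * (N * N + z * N * (N * qa (int k)) - (N * qa (int k)) * (N * qa (int k)))"
      by (simp add: algebra_simps)
    also have "\<dots> = (z * N) * (z * N) - z * z * ((z * N) * V + V * V)"
      unfolding Na by (simp add: algebra_simps)
    also have "\<dots> = U * U + V * V - 2 * (U * V) - z * z * (U * V)"
      unfolding N by (simp add: algebra_simps)
    also have "\<dots> = U * U + V * V - 2 * (U * V) - (A * A + B * B - 2 * (A * B)) * (U * V)"
      unfolding z(1) by (simp add: algebra_simps)
    also have "\<dots> = U * U * (A * B) + V * V * (A * B) - U * V * (A * A) - U * V * (B * B)"
      unfolding UV AB by simp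
    also have "\<dots> = (U * A - V * B) * (U * B - V * A)" by (simp add: algebra_simps)
    also have "U * A - V * B = z * q_num m (k + 1)"
      using z(2) unfolding q_num_qpow e qpow_add U_def V_def A_def B_def z_def by simp
    also have "U * B - V * A = z * q_num m (k - 1)"
      using z(2) unfolding q_num_qpow e qpow_add U_def V_def A_def B_def z_def by simp
    finally have "z * z * (N * N * (1 + z * qa (int k) - qa (int k) * qa (int k)))
        = z * z * (q_num m (k + 1) * q_num m (k - 1))" by (simp add: mult_ac)
    then have "N * N * (1 + z * qa (int k) - qa (int k) * qa (int k)) = q_num m (k + 1) * q_num m (k - 1)"
      using z(2) by simp
    then show ?thesis unfolding f power2_eq_square bb[symmetric, folded z_def] N_def[symmetric]
      by (simp only: mult_ac)
  qed
  have "(THE f. fps_nth f 0 = rt k \<and> (fps_to_fls f)\<^sup>2 = q_num m (k + 1) * q_num m (k - 1)) = f"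
  proof (rule the_equality)
    show "fps_nth f 0 = rt k \<and> (fps_to_fls f)\<^sup>2 = q_num m (k + 1) * q_num m (k - 1)" using f0 sq by simp
    fix g assume g: "fps_nth g 0 = rt k \<and> (fps_to_fls g)\<^sup>2 = q_num m (k + 1) * q_num m (k - 1)"
    then have "(fps_to_fls g)\<^sup>2 = (fps_to_fls f)\<^sup>2" using sq by simp
    then have "fps_to_fls (g * g) = fps_to_fls (f * f)"
      by (simp add: power2_eq_square fls_times_fps_to_fls)
    then have "g * g = f * f" by (simp add: fps_to_fls_eq_iff)
    then have "(g - f) * (g + f) = 0" by (simp add: algebra_simps)
    then have "g = f \<or> g = - f" by (auto simp: eq_neg_iff_add_eq_0)
    moreover have "g \<noteq> - f"
    proof
      assume "g = - f"
      then have "rt k = - rt k" using g f0 by simp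
      then have "rt k + rt k = 0" by (simp add: eq_neg_iff_add_eq_0)
      then have "2 * rt k = 0" by (simp only: mult_2)
      then show False using rt0 by simp
    qed
    ultimately show "g = f" by blast
  qed
  then show ?thesis unfolding q_sqrt_def using f by simp
qed

lemma qb_eq:
  assumes d: "2 \<le> \<bar>d\<bar>" "\<bar>d\<bar> < int n"
    and b0: "fps_nth b 0 = yb d"
    and bb: "fps_to_fls b * fps_to_fls b = 1 + qdiff m * qa d - qa d * qa d"
  shows "qb d = fps_to_fls b"
proof -
  define k where "k = nat \<bar>d\<bar>"
  have k: "2 \<le> k" "k \<le> n - 1" "\<bar>d\<bar> = int k" using d by (auto simp: k_def)
  have "1 + qdiff m * qa d - qa d * qa d = 1 + qdiff m * qa (int k) - qa (int k) * qa (int k)"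
  proof (cases "d = int k")
    case False
    then have dk: "d = - int k" using k by linarith
    have e: "qa d = qdiff m - qa (int k)" unfolding dk using k by (intro qa_neg) simp
    show ?thesis unfolding e by (simp add: algebra_simps)
  qed simp
  moreover have "fps_nth b 0 = rt k / of_nat k" using b0 d k by (simp add: yb_def k_def[symmetric])
  ultimately have "q_sqrt m rt k = q_num m k * fps_to_fls b"
    using bb by (intro q_sqrt_eq[OF k(1,2)]) simp_all
  then show ?thesis using d q_num_nonzero[of k] k(1) by (simp add: qb_def k_def[symmetric])
qed

end

section \<open>The involution h -> -h, the generators of R_\<alpha> and unitarity\<close>

lemma fls_eps_nth_0: "fls_nth (fls_eps f) 0 = fls_nth f 0"
  by (simp add: fls_nth_fls_eps)

lemma fls_eps_add: "fls_eps (f + g) = fls_eps f + fls_eps g"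
  by (rule fls_eqI) (simp add: fls_nth_fls_eps)

lemma fls_eps_one: "fls_eps 1 = 1"
  by (rule fls_eqI) (auto simp: fls_nth_fls_eps)

lemma fls_eps_zero: "fls_eps 0 = 0"
  by (rule fls_eqI) (simp add: fls_nth_fls_eps)

lemma fls_subdegree_eps: "fls_subdegree (fls_eps f) = fls_subdegree f"
proof (cases "f = 0")
  case False
  show ?thesis
  proof (rule fls_subdegree_eqI)
    show "fls_nth (fls_eps f) (fls_subdegree f) \<noteq> 0"
      using False by (simp add: fls_nth_fls_eps)
    show "fls_nth (fls_eps f) k = 0" if "k < fls_subdegree f" for k
      using that by (simp add: fls_nth_fls_eps)
  qed
qed (simp add: fls_eps_zero)

lemma fls_eps_mult: "fls_eps (f * g) = fls_eps f * fls_eps (g :: 'a::field fls)"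
proof (rule fls_eqI)
  fix k
  have "fls_nth (fls_eps f * fls_eps g) k
      = (\<Sum>i=fls_subdegree f..k - fls_subdegree g. fls_nth (fls_eps f) i * fls_nth (fls_eps g) (k - i))"
    unfolding fls_times_nth(2) fls_subdegree_eps ..
  also have "\<dots> = (\<Sum>i=fls_subdegree f..k - fls_subdegree g.
      (if even k then 1 else - 1) * (fls_nth f i * fls_nth g (k - i)))"
    by (rule sum.cong) (auto simp: fls_nth_fls_eps)
  also have "\<dots> = fls_nth (fls_eps (f * g)) k"
    unfolding sum_distrib_left[symmetric] fls_nth_fls_eps fls_times_nth(2) by simp
  finally show "fls_nth (fls_eps (f * g)) k = fls_nth (fls_eps f * fls_eps g) k" ..
qed

interpretation fls_eps: field_hom "fls_eps :: 'a::field fls \<Rightarrow> 'a fls"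
  by unfold_locales (simp_all add: fls_eps_zero fls_eps_one fls_eps_add fls_eps_mult)

lemma fls_eps_qpow: "fls_eps (qpow m d) = qpow m (- d)"
proof (rule fls_eqI)
  fix k
  show "fls_nth (fls_eps (qpow m d)) k = fls_nth (qpow m (- d)) k"
    by (auto simp: fls_nth_fls_eps qpow_def power_mult_distrib power_minus_even power_minus_odd even_nat_iff
        minus_one_power_iff power_minus[of "of_int d * m"])
qed

text \<open>The square root needed for the off-diagonal entries exists because the even associator
  produces it; here its existence is an assumption.\<close>

locale q_form_sqrt = q_form +
  assumes sqrt_exists: "2 \<le> k \<Longrightarrow> k \<le> n - 1 \<Longrightarrow> \<exists>b. fps_nth b 0 = yb (int k) \<and>
    fps_to_fls b * fps_to_fls b = 1 + qdiff m * qa (int k) - qa (int k) * qa (int k)"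
begin

lemma qb_square_large:
  assumes "2 \<le> \<bar>d\<bar>" "\<bar>d\<bar> < int n"
  shows "qb d * qb d = 1 + qdiff m * qa d - qa d * qa d" "fls_nth (qb d) 0 = yb d"
proof -
  define k where "k = nat \<bar>d\<bar>"
  have k: "2 \<le> k" "k \<le> n - 1" "\<bar>d\<bar> = int k" using assms by (auto simp: k_def)
  obtain b where b: "fps_nth b 0 = yb (int k)"
    "fps_to_fls b * fps_to_fls b = 1 + qdiff m * qa (int k) - qa (int k) * qa (int k)"
    using sqrt_exists[OF k(1,2)] by blast
  have qb: "qb d = fps_to_fls b"
  proof -
    have "qb (int k) = fps_to_fls b" by (rule qb_eq[OF _ _ b]) (use assms k in auto)
    then show ?thesis using k by (simp add: qb_def)
  qed
  have "yb d = yb (int k)" using k by (simp add: yb_def)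
  then show "fls_nth (qb d) 0 = yb d" using qb b by simp
  have "d = int k \<or> d = - int k" using k(3) by linarith
  then show "qb d * qb d = 1 + qdiff m * qa d - qa d * qa d"
  proof
    assume "d = - int k"
    then have e: "qa d = qdiff m - qa (int k)" using k by (simp add: qa_neg)
    show ?thesis unfolding e qb b(2) by (simp add: algebra_simps)
  qed (use b(2) qb in simp)
qed

sublocale q: orthogonal_form n \<alpha> qa qb "qdiff m"
proof
  show "qa (- d) = qdiff m - qa d" if "d \<noteq> 0" for d using qa_neg[OF that] .
  show "qa d * qa e = qa (d + e) * (qa d + qa e - qdiff m)" if "d \<noteq> 0" "e \<noteq> 0" "d + e \<noteq> 0" for d e
    using qa_add[OF that] .
  show "qb (- d) = qb d" for d by (simp add: qb_def)
  show "qb 1 = 0" by (simp add: qb_def)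
  show "qb d * qb d = 1 + qa d * (qdiff m - qa d)" if d: "d \<noteq> 0" "\<bar>d\<bar> < int n" for d
  proof (cases "2 \<le> \<bar>d\<bar>")
    case True
    then show ?thesis using qb_square_large(1) d by (simp add: algebra_simps)
  next
    case False
    then have "d = 1 \<or> d = - 1" using d by auto
    moreover have "qa 1 = - qpow m (- 1)" "qa (- 1) = qpow m 1"
      using qa_q_num[of 1] qdiff_nonzero[OF m_nonzero] by (simp_all add: q_num_qpow qdiff_def)
    ultimately show ?thesis
      using qpow_inverse[of m 1] by (auto simp: qb_def qdiff_def algebra_simps)
  qed
qed

lemma qa_one: "qa 1 = - qpow m (- 1)" "qa (- 1) = qpow m 1"
  using qa_q_num[of 1] qdiff_nonzero[OF m_nonzero] by (simp_all add: q_num_qpow qdiff_def)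

lemma axial_dist_ax: "axial_dist \<alpha> T r = nat (ax r T)"
  by (simp add: axial_dist_def ax_def ct_def algebra_simps)

lemma M_mat_entries:
  assumes "2 \<le> k"
  shows "M_mat m rt k $$ (0, 0) = qa (int k)" "M_mat m rt k $$ (1, 0) = qb (int k)"
    "M_mat m rt k $$ (0, 1) = qb (int k)" "M_mat m rt k $$ (1, 1) = qa (- int k)"
  using assms qa_q_num[of k]
  by (simp_all add: M_mat_def mat_of_rows_list_def qb_def inverse_q_of_power q_of_power)

lemma R_coeff_eq:
  assumes T: "T \<in> STD" and U: "U \<in> STD" and r: "r \<in> {1..<n}"
  shows "R_coeff m rt \<alpha> r T U = q.ocoeff r T U"
proof -
  have F: "T \<in> fillings \<alpha>" by (rule std_filling[OF T])
  have ne: "adj r \<circ> T \<noteq> T" by (rule adj_comp_neq[OF F r])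
  from T r show ?thesis
  proof (cases rule: ax_cases)
    case column
    then show ?thesis using U
      by (auto simp: R_coeff_def Let_def q.ocoeff_def qa_one q_of_qpow simp del: o_apply)
  next
    case row
    then show ?thesis using U
      by (auto simp: R_coeff_def Let_def q.ocoeff_def qa_one inverse_q_of simp del: o_apply)
  next
    case right
    define k where "k = nat (ax r T)"
    have k: "2 \<le> k" "ax r T = int k" using right by (auto simp: k_def)
    show ?thesis using right ne
      by (auto simp: R_coeff_def Let_def q.ocoeff_def axial_dist_ax M_mat_entries[OF k(1), unfolded One_nat_def] k(2)
          simp del: o_apply)
  next
    \<comment> \<open>T is now the second basis vector of the plane, so the distance is taken in the
      swapped tableau, where it is positive.\<close>
    case left
    define k where "k = nat (- ax r T)"
    have k: "2 \<le> k" "ax r T = - int k" using left by (auto simp: k_def)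
    have k': "ax r (adj r \<circ> T) = int k" using ax_adj_self[OF F r] k by simp
    have "qb (- int k) = qb (int k)" by (simp add: qb_def)
    then show ?thesis using left ne
      by (auto simp: R_coeff_def Let_def q.ocoeff_def axial_dist_ax M_mat_entries[OF k(1), unfolded One_nat_def] k(2) k'
          simp del: o_apply)
  qed
qed

lemma R_gen_eq: "r \<in> {1..<n} \<Longrightarrow> R_gen m rt \<alpha> r = q.omat r"
  unfolding R_gen_def q.omat_def
  by (rule cong_mat) (simp_all add: R_coeff_eq tableaux_list_nth)

lemma R_gen_symmetric: "r \<in> {1..<n} \<Longrightarrow> transpose_mat (q.omat r) = q.omat r"
proof (rule eq_matI)
  fix i j assume r: "r \<in> {1..<n}" and "i < dim_row (q.omat r)" "j < dim_col (q.omat r)"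
  then have ij: "i < R_dim \<alpha>" "j < R_dim \<alpha>" by (auto simp: q.omat_def)
  define T U where "T = tableaux_list \<alpha> ! i" and "U = tableaux_list \<alpha> ! j"
  have TU: "T \<in> fillings \<alpha>" "U \<in> fillings \<alpha>" using tableaux_list_nth ij std_filling by (auto simp: T_def U_def)
  have "q.ocoeff r T U = q.ocoeff r U T"
  proof (cases "T = U")
    case False
    have "U = adj r \<circ> T \<longleftrightarrow> T = adj r \<circ> U" using adj_comp_self by metis
    then show ?thesis using False ax_adj_self[OF TU(1) r] q.b_neg
      by (auto simp: q.ocoeff_def simp del: o_apply)
  qed simp
  then show "transpose_mat (q.omat r) $$ (i, j) = q.omat r $$ (i, j)"
    using ij by (simp add: q.omat_def T_def U_def)
qed (simp_all add: q.omat_def)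

lemma fls_eps_qdiff: "fls_eps (qdiff m) = - qdiff m"
  by (simp add: qdiff_def fls_eps.hom_minus fls_eps_qpow)

lemma fls_eps_qa: "d \<noteq> 0 \<Longrightarrow> fls_eps (qa d) = - qa (- d)"
proof -
  assume d: "d \<noteq> 0"
  have "fls_eps (qa d) = (qdiff m * qpow m d) / (qpow m (- d) - qpow m d)"
    by (simp add: qa_def divide_inverse fls_eps.hom_inverse fls_eps_mult fls_eps.hom_minus
        fls_eps.hom_uminus fls_eps_qpow fls_eps_qdiff)
  then show ?thesis by (simp add: qa_def)
qed

text \<open>With a = \<open>qa d\<close> and z = q - 1/q, \<open>fls_eps\<close> replaces a by z - a
  in the square 1 + z a - a^2 of \<open>qb d\<close>, which leaves it unchanged. So
  \<open>qb d\<close> is fixed up to sign, and its constant term, which \<open>fls_eps\<close>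
  fixes, is nonzero for |d| >= 2.\<close>

lemma fls_eps_qb:
  assumes d: "d \<noteq> 0" "\<bar>d\<bar> < int n"
  shows "fls_eps (qb d) = qb d"
proof (cases "2 \<le> \<bar>d\<bar>")
  case True
  note sq = qb_square_large[OF True d(2)]
  have "fls_eps (qb d) * fls_eps (qb d) = fls_eps (1 + qdiff m * qa d - qa d * qa d)"
    unfolding sq(1)[symmetric] fls_eps_mult ..
  also have "\<dots> = 1 + qdiff m * qa (- d) - qa (- d) * qa (- d)"
    by (simp add: fls_eps.hom_minus fls_eps_add fls_eps_mult fls_eps_one fls_eps_qdiff fls_eps_qa[OF d(1)])
  also have "\<dots> = qb d * qb d" unfolding sq(1) qa_neg[OF d(1)] by (simp add: algebra_simps)
  finally have "(fls_eps (qb d) - qb d) * (fls_eps (qb d) + qb d) = 0" by (simp add: algebra_simps)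
  then have "fls_eps (qb d) = qb d \<or> fls_eps (qb d) = - qb d" by (auto simp: eq_neg_iff_add_eq_0)
  moreover have "fls_eps (qb d) \<noteq> - qb d"
  proof
    assume "fls_eps (qb d) = - qb d"
    then have "fls_nth (qb d) 0 = - fls_nth (qb d) 0"
      using fls_eps_nth_0[of "qb d"] by simp
    then have "yb d + yb d = 0" using sq(2) by (simp add: eq_neg_iff_add_eq_0)
    then have "2 * yb d = 0" by (simp only: mult_2)
    then show False using yb_nonzero[OF True d(2)] by simp
  qed
  ultimately show ?thesis by blast
qed (simp add: qb_def fls_eps_zero)

text \<open>The inverse of a generator is its matrix minus z; \<open>fls_eps\<close> sends the
  diagonal entries a - z of the inverse back to a and fixes the off-diagonal ones. The matrix itself
  is symmetric.\<close>

lemma omat_unitary: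
  assumes r: "r \<in> {1..<n}"
  shows "transpose_mat (map_mat fls_eps (q.omat r - qdiff m \<cdot>\<^sub>m 1\<^sub>m (R_dim \<alpha>))) = q.omat r"
proof -
  have "map_mat fls_eps (q.omat r - qdiff m \<cdot>\<^sub>m 1\<^sub>m (R_dim \<alpha>)) = q.omat r"
  proof (rule eq_matI)
    fix i j assume "i < dim_row (q.omat r)" "j < dim_col (q.omat r)"
    then have ij: "i < R_dim \<alpha>" "j < R_dim \<alpha>" by (auto simp: q.omat_def)
    define T U where "T = tableaux_list \<alpha> ! j" and "U = tableaux_list \<alpha> ! i"
    have T: "T \<in> STD" using tableaux_list_nth ij by (auto simp: T_def)
    have d: "ax r T \<noteq> 0" "\<bar>ax r T\<bar> < int n"
      using ax_nonzero[OF T r] q.ax_range[OF std_filling[OF T] r] by auto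
    have eq: "U = T \<longleftrightarrow> i = j" using ij tableaux_list_nth_eq by (simp add: T_def U_def)
    have "fls_eps (qa (ax r T) - qdiff m) = qa (ax r T)"
      unfolding fls_eps.hom_minus fls_eps_qa[OF d(1)] fls_eps_qdiff qa_neg[OF d(1)] by simp
    then show "map_mat fls_eps (q.omat r - qdiff m \<cdot>\<^sub>m 1\<^sub>m (R_dim \<alpha>)) $$ (i, j) = q.omat r $$ (i, j)"
      using ij eq fls_eps_qb[OF d]
      by (auto simp: q.omat_def q.ocoeff_def T_def[symmetric] U_def[symmetric] fls_eps_zero simp del: o_apply)
  qed (simp_all add: q.omat_def)
  then show ?thesis using R_gen_symmetric[OF r] by simp
qed

end

text \<open>Sending b to the transposed conjugate of the inverse of \<open>H b\<close> is again a
  homomorphism, so it equals H as soon as both agree on generators. The equality is then read at the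
  inverse of b.\<close>

lemma unitary_if_gens_unitary:
  fixes H :: "braid_word set \<Rightarrow> 'l::field_char_0 fls mat"
  assumes H: "H \<in> hom (braid_group n) (GL N)"
    and gen: "\<And>r. r \<in> {1..<n} \<Longrightarrow>
      transpose_mat (map_mat fls_eps (inv\<^bsub>GL N\<^esub> (H (braid_gen n r)))) = H (braid_gen n r)"
    and b: "b \<in> carrier (braid_group n)"
  shows "H b \<in> U_eps N"
proof -
  interpret G: group "GL N :: 'l fls mat monoid" by (rule GL_group)
  interpret B: group "braid_group n" by (rule group_braid_group)
  interpret H: group_hom "braid_group n" "GL N" H
    using H by (simp add: group_hom_def group_hom_axioms_def G.group_axioms B.group_axioms)
  have GLc: "A \<in> carrier (GL N) \<Longrightarrow> A \<in> carrier_mat N N" for A :: "'l fls mat" by (rule GL_carrier_mat)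
  let ?d = "\<lambda>A :: 'l fls mat. transpose_mat (map_mat fls_eps A)"
  have d_mult: "?d (A * B) = ?d B * ?d A" if "A \<in> carrier_mat N N" "B \<in> carrier_mat N N" for A B
    using that by (simp add: fls_eps.mat_hom_mult[OF that] transpose_mult[of _ N N _ N])
  have d_GL: "?d A \<in> carrier (GL N)" if GA: "A \<in> carrier (GL N)" for A
  proof -
    obtain A' where A': "A \<in> carrier_mat N N" "A' \<in> carrier_mat N N" "A * A' = 1\<^sub>m N" "A' * A = 1\<^sub>m N"
      using GL_memE[OF GA] .
    have one: "?d (1\<^sub>m N) = 1\<^sub>m N" by (simp add: fls_eps.mat_hom_one)
    show ?thesis
      using A' d_mult[OF A'(1,2)] d_mult[OF A'(2,1)] one
      by (intro GL_memI[where B = "?d A'"]) auto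
  qed
  define H2 where "H2 b = ?d (inv\<^bsub>GL N\<^esub> (H b))" for b
  have H2: "H2 \<in> hom (braid_group n) (GL N)"
  proof (rule homI)
    show "H2 x \<in> carrier (GL N)" if "x \<in> carrier (braid_group n)" for x
      unfolding H2_def using that by (intro d_GL G.inv_closed) simp
    fix x y assume xy: "x \<in> carrier (braid_group n)" "y \<in> carrier (braid_group n)"
    have "inv\<^bsub>GL N\<^esub> (H (x \<otimes>\<^bsub>braid_group n\<^esub> y)) = inv\<^bsub>GL N\<^esub> (H y) * inv\<^bsub>GL N\<^esub> (H x)"
      using xy G.inv_mult_group[of "H x" "H y"] by (simp add: GL_mult)
    then show "H2 (x \<otimes>\<^bsub>braid_group n\<^esub> y) = H2 x \<otimes>\<^bsub>GL N\<^esub> H2 y"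
      unfolding H2_def GL_mult using xy by (simp add: d_mult GLc)
  qed
  have eq: "H b = H2 b" if "b \<in> carrier (braid_group n)" for b
    by (rule hom_braid_group_eqI[OF G.group_axioms H H2 _ that]) (simp add: H2_def gen)
  have "H (inv\<^bsub>braid_group n\<^esub> b) = H2 (inv\<^bsub>braid_group n\<^esub> b)" using b by (intro eq) simp
  then have "inv\<^bsub>GL N\<^esub> (H b) = ?d (H b)" using b by (simp add: H2_def)
  then show ?thesis using b by (simp add: U_eps_def)
qed

section \<open>Invariant planes\<close>

text \<open>The columns of X give the images of v and w. Independence is deliberately not demanded:
  w may be 0, which covers a tableau whose swap is not standard.\<close>

definition acts_on :: "'r::comm_ring_1 vec \<Rightarrow> 'r vec \<Rightarrow> 'r mat \<Rightarrow> 'r m2 \<Rightarrow> bool" where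
  "acts_on v w A X \<longleftrightarrow> A *\<^sub>v v = m11 X \<cdot>\<^sub>v v + m21 X \<cdot>\<^sub>v w \<and> A *\<^sub>v w = m12 X \<cdot>\<^sub>v v + m22 X \<cdot>\<^sub>v w"

definition m2_map :: "('a \<Rightarrow> 'b) \<Rightarrow> 'a m2 \<Rightarrow> 'b m2" where
  "m2_map f X = M2 (f (m11 X)) (f (m12 X)) (f (m21 X)) (f (m22 X))"

lemma mult_mat_vec_comb:
  fixes A :: "'r::comm_ring_1 mat"
  assumes "A \<in> carrier_mat M N" "v \<in> carrier_vec N" "w \<in> carrier_vec N"
  shows "A *\<^sub>v (c \<cdot>\<^sub>v v + d \<cdot>\<^sub>v w) = c \<cdot>\<^sub>v (A *\<^sub>v v) + d \<cdot>\<^sub>v (A *\<^sub>v w)"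
proof (rule eq_vecI)
  fix i assume "i < dim_vec (c \<cdot>\<^sub>v (A *\<^sub>v v) + d \<cdot>\<^sub>v (A *\<^sub>v w))"
  then show "(A *\<^sub>v (c \<cdot>\<^sub>v v + d \<cdot>\<^sub>v w)) $ i = (c \<cdot>\<^sub>v (A *\<^sub>v v) + d \<cdot>\<^sub>v (A *\<^sub>v w)) $ i"
    using assms by (simp add: scalar_prod_def sum.distrib distrib_left sum_distrib_left mult_ac)
qed (use assms in auto)

lemma acts_on_intertwine:
  assumes A: "A \<in> carrier_mat N N" and B: "B \<in> carrier_mat D D" and V: "V \<in> carrier_mat N D"
    and eq: "A * V = V * B" and v: "v \<in> carrier_vec D" "w \<in> carrier_vec D" and act: "acts_on v w B X"
  shows "acts_on (V *\<^sub>v v) (V *\<^sub>v w) A X"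
proof -
  have "A *\<^sub>v (V *\<^sub>v u) = V *\<^sub>v (B *\<^sub>v u)" if "u \<in> carrier_vec D" for u
    using eq by (simp add: assoc_mult_mat_vec[OF A V that, symmetric] assoc_mult_mat_vec[OF V B that, symmetric])
  then show ?thesis using act v by (simp add: acts_on_def mult_mat_vec_comb[OF V v])
qed

locale vec_pair =
  fixes N :: nat and v w :: "'r::comm_ring_1 vec"
  assumes v: "v \<in> carrier_vec N" and w: "w \<in> carrier_vec N"
begin

lemma acts_on_iff:
  assumes "A \<in> carrier_mat N N"
  shows "acts_on v w A X \<longleftrightarrow> (\<forall>a<N. (A *\<^sub>v v) $ a = m11 X * v $ a + m21 X * w $ a
    \<and> (A *\<^sub>v w) $ a = m12 X * v $ a + m22 X * w $ a)"
  using assms v w by (auto simp: acts_on_def vec_eq_iff)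

lemma acts_on_one: "acts_on v w (1\<^sub>m N) 1"
  using v w by (simp add: acts_on_iff[OF one_carrier_mat] one_m2_def)

lemma acts_on_mult:
  assumes A: "A \<in> carrier_mat N N" and B: "B \<in> carrier_mat N N"
    and "acts_on v w A X" "acts_on v w B Y"
  shows "acts_on v w (A * B) (X * Y)"
proof -
  have comb: "c \<cdot>\<^sub>v (p \<cdot>\<^sub>v v + q \<cdot>\<^sub>v w) + d \<cdot>\<^sub>v (p' \<cdot>\<^sub>v v + q' \<cdot>\<^sub>v w) = (p * c + p' * d) \<cdot>\<^sub>v v + (q * c + q' * d) \<cdot>\<^sub>v w"
    for c d p q p' q'
    using v w by (intro eq_vecI) (auto simp: algebra_simps)
  show ?thesis using assms(3,4) unfolding acts_on_def
    by (simp add: assoc_mult_mat_vec[OF A B v] assoc_mult_mat_vec[OF A B w] mult_mat_vec_comb[OF A v w] comb times_m2_def)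
qed

lemma acts_on_power:
  assumes A: "A \<in> carrier_mat N N" and act: "acts_on v w A X"
  shows "acts_on v w (A ^\<^sub>m d) (X ^ d)"
proof (induction d)
  case 0
  then show ?case using A acts_on_one by simp
next
  case (Suc d)
  then show ?case using acts_on_mult[OF pow_carrier_mat[OF A] A Suc act] by (simp add: power_Suc2 del: power_Suc)
qed

lemma word_carrier:
  assumes "A \<in> carrier_mat N N" "B \<in> carrier_mat N N"
  shows "foldr (*) (map (sel_xy A B) u) (1\<^sub>m N) \<in> carrier_mat N N"
proof (induction u)
  case (Cons a u)
  have "sel_xy A B a \<in> carrier_mat N N" using assms by (cases a) auto
  then show ?case using Cons by simp
qed simp

lemma acts_on_word:
  assumes AB: "A \<in> carrier_mat N N" "B \<in> carrier_mat N N" and act: "acts_on v w A X" "acts_on v w B Y"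
  shows "acts_on v w (foldr (*) (map (sel_xy A B) u) (1\<^sub>m N)) (prod_list (map (sel_xy X Y) u))"
proof (induction u)
  case Nil
  then show ?case using acts_on_one by simp
next
  case (Cons a u)
  have "sel_xy A B a \<in> carrier_mat N N" "acts_on v w (sel_xy A B a) (sel_xy X Y a)"
    using AB act by (cases a; simp)+
  then show ?case using acts_on_mult[OF _ word_carrier[OF AB] _ Cons] by simp
qed

lemma acts_on_scale:
  assumes A: "A \<in> carrier_mat N N" and act: "acts_on v w A X"
  shows "acts_on v w (k \<cdot>\<^sub>m A) (m2_scalar k * X)"
proof -
  have A': "k \<cdot>\<^sub>m A \<in> carrier_mat N N" using A by simp
  show ?thesis
    using act unfolding acts_on_iff[OF A'] acts_on_iff[OF A] m2_scalar_mult_sel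
    using A v w by (auto simp: scalar_prod_def sum_distrib_left[symmetric] mult.assoc algebra_simps)
qed

lemma acts_on_sum:
  assumes M: "\<And>s. s \<in> S \<Longrightarrow> M s \<in> carrier_mat N N" and act: "\<And>s. s \<in> S \<Longrightarrow> acts_on v w (M s) (X s)"
  shows "acts_on v w (mat N N (\<lambda>(a, b). \<Sum>s\<in>S. c s * M s $$ (a, b))) (\<Sum>s\<in>S. m2_scalar (c s) * X s)"
proof -
  have e: "(mat N N (\<lambda>(a, b). \<Sum>s\<in>S. c s * M s $$ (a, b)) *\<^sub>v u) $ a = (\<Sum>s\<in>S. c s * (M s *\<^sub>v u) $ a)"
    if u: "u \<in> carrier_vec N" "a < N" for u a
  proof -
    have "(mat N N (\<lambda>(a, b). \<Sum>s\<in>S. c s * M s $$ (a, b)) *\<^sub>v u) $ a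
        = (\<Sum>b<N. \<Sum>s\<in>S. c s * M s $$ (a, b) * u $ b)"
      using u by (simp add: scalar_prod_def sum_distrib_right lessThan_atLeast0)
    also have "\<dots> = (\<Sum>s\<in>S. \<Sum>b<N. c s * M s $$ (a, b) * u $ b)" by (rule sum.swap)
    also have "\<dots> = (\<Sum>s\<in>S. c s * (M s *\<^sub>v u) $ a)"
    proof (rule sum.cong[OF refl])
      fix s assume "s \<in> S"
      then have "M s \<in> carrier_mat N N" by (rule M)
      then show "(\<Sum>b<N. c s * M s $$ (a, b) * u $ b) = c s * (M s *\<^sub>v u) $ a"
        using u by (simp add: scalar_prod_def sum_distrib_left mult.assoc lessThan_atLeast0)
    qed
    finally show ?thesis .
  qed
  have a: "(M s *\<^sub>v v) $ a = m11 (X s) * v $ a + m21 (X s) * w $ a"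
    "(M s *\<^sub>v w) $ a = m12 (X s) * v $ a + m22 (X s) * w $ a" if "s \<in> S" "a < N" for s a
    using act[OF that(1)] that(2) unfolding acts_on_iff[OF M[OF that(1)]] by blast+
  show ?thesis
    unfolding acts_on_iff[OF mat_carrier]
    by (simp add: e v w a m2_scalar_mult_sel m2_sel_sum sum.distrib distrib_left sum_distrib_left mult_ac del: index_mult_mat_vec)
qed

end

interpretation fls_const: field_hom "fls_const :: 'a::field \<Rightarrow> 'a fls"
  by unfold_locales (simp_all add: fls_plus_const)

text \<open>The vectors do not depend on h, so the statements for the single coefficients assemble
  into one over Laurent series.\<close>

lemma (in vec_pair) acts_on_series:
  assumes C: "\<And>d. C d \<in> carrier_mat N N" and act: "\<And>d. acts_on v w (C d) (fps_nth G d)"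
  shows "acts_on (map_vec fls_const v) (map_vec fls_const w)
    (mat N N (\<lambda>(a, b). fps_to_fls (Abs_fps (\<lambda>d. C d $$ (a, b))))) (m2_map fps_to_fls (m2_series G))"
proof -
  interpret l: vec_pair N "map_vec fls_const v" "map_vec fls_const w"
    using v w by unfold_locales simp_all
  let ?C = "mat N N (\<lambda>(a, b). fps_to_fls (Abs_fps (\<lambda>d. C d $$ (a, b))))"
  have hom_sum: "fps_to_fls (sum f {..<j}) = (\<Sum>i<j. fps_to_fls (f i :: 'r fps))" for f and j :: nat
    by (induction j) (simp_all add: fps_to_fls_plus)
  have e: "(?C *\<^sub>v map_vec fls_const u) $ a = fps_to_fls (Abs_fps (\<lambda>d. (C d *\<^sub>v u) $ a))"
    if u: "u \<in> carrier_vec N" "a < N" for u a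
  proof -
    have "(?C *\<^sub>v map_vec fls_const u) $ a
        = (\<Sum>b<N. fps_to_fls (Abs_fps (\<lambda>d. C d $$ (a, b)) * fps_const (u $ b)))"
      using u by (simp add: scalar_prod_def lessThan_atLeast0 fls_times_fps_to_fls)
    also have "\<dots> = fps_to_fls (\<Sum>b<N. Abs_fps (\<lambda>d. C d $$ (a, b)) * fps_const (u $ b))"
      by (rule hom_sum[symmetric])
    also have "(\<Sum>b<N. Abs_fps (\<lambda>d. C d $$ (a, b)) * fps_const (u $ b)) = Abs_fps (\<lambda>d. (C d *\<^sub>v u) $ a)"
    proof (rule fps_ext)
      fix d
      show "fps_nth (\<Sum>b<N. Abs_fps (\<lambda>d. C d $$ (a, b)) * fps_const (u $ b)) d = fps_nth (Abs_fps (\<lambda>d. (C d *\<^sub>v u) $ a)) d"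
        using u C[of d] by (simp add: fps_sum_nth scalar_prod_def lessThan_atLeast0)
    qed
    finally show ?thesis .
  qed
  have a: "(C d *\<^sub>v v) $ a = m11 (fps_nth G d) * v $ a + m21 (fps_nth G d) * w $ a"
    "(C d *\<^sub>v w) $ a = m12 (fps_nth G d) * v $ a + m22 (fps_nth G d) * w $ a" if "a < N" for d a
    using act[of d] that unfolding acts_on_iff[OF C] by blast+
  have s: "fps_to_fls (Abs_fps (\<lambda>d. f d * x + g d * y)) = fps_to_fls (Abs_fps f) * fls_const x + fps_to_fls (Abs_fps g) * fls_const y"
    for f g :: "nat \<Rightarrow> 'r" and x y
  proof -
    have "Abs_fps (\<lambda>d. f d * x + g d * y) = Abs_fps f * fps_const x + Abs_fps g * fps_const y"
      by (rule fps_ext) simp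
    then show ?thesis by (simp add: fls_times_fps_to_fls)
  qed
  show ?thesis
    unfolding l.acts_on_iff[OF mat_carrier]
    using v w by (simp add: e a s m2_map_def m2_series_def del: index_mult_mat_vec)
qed

section \<open>Phi-hat on an invariant plane\<close>

context even_associator
begin

definition lift :: "'k fps \<Rightarrow> 'l fls" where
  "lift f = fps_to_fls (Abs_fps (\<lambda>d. \<iota> (fps_nth f d)))"

lemma base_change_lift: "base_change \<iota> = map_mat lift"
  by (simp add: base_change_def lift_def[abs_def])

sublocale lift: inj_comm_ring_hom lift
proof
  show "lift 0 = 0" "lift 1 = 1"
    by (auto simp: lift_def fps_eq_iff)
  show "lift (f + g) = lift f + lift g" for f g
    unfolding lift_def fps_to_fls_plus[symmetric] fps_to_fls_eq_iff
    by (rule fps_ext) (simp add: \<iota>.hom_add)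
  show "lift (f * g) = lift f * lift g" for f g
    unfolding lift_def fls_times_fps_to_fls[symmetric] fps_to_fls_eq_iff
    by (rule fps_ext) (simp add: fps_mult_nth \<iota>.hom_mult \<iota>.hom_sum)
  show "f = 0" if "lift f = 0" for f
    using that by (simp add: lift_def fps_eq_iff)
qed

lemma map_word:
  assumes "A \<in> carrier_mat N N" "B \<in> carrier_mat N N"
  shows "map_mat \<iota> (foldr (*) (map (sel_xy A B) u) (1\<^sub>m N))
    = foldr (*) (map (sel_xy (map_mat \<iota> A) (map_mat \<iota> B)) u) (1\<^sub>m N)"
proof (induction u)
  case (Cons a u)
  interpret vec_pair N "0\<^sub>v N :: 'k vec" "0\<^sub>v N" by unfold_locales simp_all
  have s: "sel_xy A B a \<in> carrier_mat N N" using assms by (cases a) auto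
  have m: "map_mat \<iota> (sel_xy A B a) = sel_xy (map_mat \<iota> A) (map_mat \<iota> B) a" by (cases a) auto
  show ?case using Cons by (simp add: \<iota>.mat_hom_mult[OF s word_carrier[OF assms]] m)
qed (simp add: \<iota>.mat_hom_one)

lemma acts_on_subst:
  assumes "vec_pair N v w" and AB: "A \<in> carrier_mat N N" "B \<in> carrier_mat N N"
    and act: "acts_on v w (map_mat \<iota> A) X" "acts_on v w (map_mat \<iota> B) Y"
  shows "acts_on (map_vec fls_const v) (map_vec fls_const w)
    (base_change \<iota> (subst_mat_h N \<Phi> A B)) (m2_map fps_to_fls (m2_series (two.ev \<Phi> X Y)))"
proof -
  interpret vec_pair N v w by fact
  let ?A = "map_mat \<iota> A" and ?B = "map_mat \<iota> B"
  have AB': "?A \<in> carrier_mat N N" "?B \<in> carrier_mat N N" using AB by simp_all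
  define C where "C d = mat N N (\<lambda>(a, b). \<Sum>u | length u = d. \<iota> (ncs_coeff \<Phi> u) *
    foldr (*) (map (sel_xy ?A ?B) u) (1\<^sub>m N) $$ (a, b))" for d
  have e: "foldr (*) (map (sel_xy ?A ?B) u) (1\<^sub>m N) $$ (a, b) = \<iota> (foldr (*) (map (sel_xy A B) u) (1\<^sub>m N) $$ (a, b))"
    if "a < N" "b < N" for u a b
    using that word_carrier[OF AB, of u] map_word[OF AB, of u, symmetric]
    by (metis carrier_matD index_map_mat(1))
  have "base_change \<iota> (subst_mat_h N \<Phi> A B) = mat N N (\<lambda>(a, b). fps_to_fls (Abs_fps (\<lambda>d. C d $$ (a, b))))"
    by (rule eq_matI) (simp_all add: base_change_def subst_mat_h_def C_def e \<iota>.hom_sum \<iota>.hom_mult)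
  moreover have "acts_on v w (C d) (fps_nth (two.ev \<Phi> X Y) d)" for d
    unfolding C_def two.ev_def fps_nth_Abs_fps
    by (rule acts_on_sum[OF word_carrier[OF AB'] acts_on_word[OF AB' act]])
  moreover have "C d \<in> carrier_mat N N" for d by (simp add: C_def)
  ultimately show ?thesis using acts_on_series[of C "two.ev \<Phi> X Y"] by simp
qed

lemma acts_on_exp:
  assumes "vec_pair N v w" and A: "A \<in> carrier_mat N N" and act: "acts_on v w (map_mat \<iota> A) X"
  shows "acts_on (map_vec fls_const v) (map_vec fls_const w)
    (base_change \<iota> (exp_mat_h N (c \<cdot>\<^sub>m A))) (m2_map fps_to_fls (m2_series (two.ex (m2_scalar (\<iota> c) * X))))"
proof -
  interpret vec_pair N v w by fact
  let ?A = "\<iota> c \<cdot>\<^sub>m map_mat \<iota> A"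
  have A': "?A \<in> carrier_mat N N" using A by simp
  have A'': "map_mat \<iota> A \<in> carrier_mat N N" using A by simp
  have act': "acts_on v w ?A (m2_scalar (\<iota> c) * X)" by (rule acts_on_scale[OF A'' act])
  \<comment> \<open>The sum over the single index d gives the coefficient the shape that
    \<open>acts_on_sum\<close> expects.\<close>
  define C where "C d = mat N N (\<lambda>(a, b). \<Sum>i\<in>{d}. \<iota> (1 / fact d) * (?A ^\<^sub>m i) $$ (a, b))" for d
  have pw: "?A ^\<^sub>m d = map_mat \<iota> ((c \<cdot>\<^sub>m A) ^\<^sub>m d)" for d
  proof -
    have "?A = map_mat \<iota> (c \<cdot>\<^sub>m A)" by (rule eq_matI) (simp_all add: \<iota>.hom_mult)
    then show ?thesis using \<iota>.mat_hom_pow[of "c \<cdot>\<^sub>m A" N d] A by simp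
  qed
  have "base_change \<iota> (exp_mat_h N (c \<cdot>\<^sub>m A)) = mat N N (\<lambda>(a, b). fps_to_fls (Abs_fps (\<lambda>d. C d $$ (a, b))))"
  proof (rule eq_matI)
    fix a b assume "a < dim_row (mat N N (\<lambda>(a, b). fps_to_fls (Abs_fps (\<lambda>d. C d $$ (a, b)))))"
      "b < dim_col (mat N N (\<lambda>(a, b). fps_to_fls (Abs_fps (\<lambda>d. C d $$ (a, b)))))"
    then have ab: "a < N" "b < N" by auto
    have "C d $$ (a, b) = \<iota> (((c \<cdot>\<^sub>m A) ^\<^sub>m d) $$ (a, b) / fact d)" for d
      using ab pow_carrier_mat[of "c \<cdot>\<^sub>m A" N d] A
      by (simp add: C_def pw \<iota>.hom_mult[symmetric] del: \<iota>.hom_div)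
    then show "base_change \<iota> (exp_mat_h N (c \<cdot>\<^sub>m A)) $$ (a, b)
        = mat N N (\<lambda>(a, b). fps_to_fls (Abs_fps (\<lambda>d. C d $$ (a, b)))) $$ (a, b)"
      using ab by (simp add: base_change_def exp_mat_h_def)
  qed (simp_all add: base_change_def exp_mat_h_def)
  moreover have "acts_on v w (C d) (fps_nth (two.ex (m2_scalar (\<iota> c) * X)) d)" for d
    using acts_on_sum[of "{d}" "\<lambda>i. ?A ^\<^sub>m i" "\<lambda>i. (m2_scalar (\<iota> c) * X) ^ i" "\<lambda>_. \<iota> (1 / fact d)"]
      acts_on_power[OF A' act'] pow_carrier_mat[OF A']
    by (simp add: C_def two.ex_def)
  moreover have "C d \<in> carrier_mat N N" for d by (simp add: C_def)
  ultimately show ?thesis using acts_on_series[of C "two.ex (m2_scalar (\<iota> c) * X)"] by simp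
qed

lemma acts_on_const:
  assumes "vec_pair N v w" and A: "A \<in> carrier_mat N N" and act: "acts_on v w (map_mat \<iota> A) X"
  shows "acts_on (map_vec fls_const v) (map_vec fls_const w)
    (base_change \<iota> (map_mat fps_const A)) (m2_map fps_to_fls (m2_series (fps_const X)))"
proof -
  interpret vec_pair N v w by fact
  have "base_change \<iota> (map_mat fps_const A) = map_mat fls_const (map_mat \<iota> A)"
  proof (rule eq_matI)
    have "Abs_fps (\<lambda>d. \<iota> (fps_nth (fps_const k) d)) = fps_const (\<iota> k)" for k
      by (rule fps_ext) simp
    then show "base_change \<iota> (map_mat fps_const A) $$ (a, b) = map_mat fls_const (map_mat \<iota> A) $$ (a, b)"
      if "a < dim_row (map_mat fls_const (map_mat \<iota> A))" "b < dim_col (map_mat fls_const (map_mat \<iota> A))" for a b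
      using that by (simp add: base_change_def)
  qed (simp_all add: base_change_def)
  moreover have A': "map_mat \<iota> A \<in> carrier_mat N N" using A by simp
  moreover have "map_vec fls_const (k \<cdot>\<^sub>v v + l \<cdot>\<^sub>v w) = fls_const k \<cdot>\<^sub>v map_vec fls_const v + fls_const l \<cdot>\<^sub>v map_vec fls_const w" for k l
    using v w by (intro eq_vecI) (auto simp: fls_const.hom_add)
  ultimately show ?thesis
    using act unfolding acts_on_def
    by (simp add: fls_const.mult_mat_vec_hom[OF A' v, symmetric] fls_const.mult_mat_vec_hom[OF A' w, symmetric]
        m2_map_def m2_series_const m2_const_def)
qed

lemma m2_map_series_mult:
  "m2_map fps_to_fls (m2_series (F * G)) = m2_map fps_to_fls (m2_series F) * m2_map fps_to_fls (m2_series (G :: 'l m2 fps))"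
  unfolding m2_series_mult by (simp add: m2_map_def times_m2_def fls_times_fps_to_fls)

lemma acts_on_Phi_hat:
  assumes vw: "vec_pair N v w" and c: "T \<in> carrier_mat N N" "Y \<in> carrier_mat N N" "S \<in> carrier_mat N N"
    and act: "acts_on v w (map_mat \<iota> T) A" "acts_on v w (map_mat \<iota> Y) B" "acts_on v w (map_mat \<iota> S) s"
  shows "acts_on (map_vec fls_const v) (map_vec fls_const w)
    (base_change \<iota> (subst_mat_h N \<Phi> T Y * map_mat fps_const S * exp_mat_h N ((lam / 2) \<cdot>\<^sub>m T) * subst_mat_h N \<Phi> Y T))
    (m2_map fps_to_fls (m2_series (braid_matrix s A B)))"
proof -
  interpret vec_pair N v w by fact
  interpret l: vec_pair N "map_vec fls_const v" "map_vec fls_const w"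
    using v w by unfold_locales simp_all
  have carr: "subst_mat_h N \<Phi> P Q \<in> carrier_mat N N" "exp_mat_h N P \<in> carrier_mat N N"
    "map_mat fps_const S \<in> carrier_mat N N" for P Q
    using c by (simp_all add: subst_mat_h_def exp_mat_h_def)
  have bc: "X \<in> carrier_mat N N \<Longrightarrow> base_change \<iota> X \<in> carrier_mat N N" for X
    by (simp add: base_change_def)
  note act' = acts_on_subst[OF vw c(1,2) act(1,2)] acts_on_const[OF vw c(3) act(3)]
    acts_on_exp[OF vw c(1) act(1), of "lam / 2"] acts_on_subst[OF vw c(2,1) act(2,1)]
  have mult: "acts_on (map_vec fls_const v) (map_vec fls_const w) (base_change \<iota> (P * Q)) (m2_map fps_to_fls (m2_series (F * G)))"
    if "P \<in> carrier_mat N N" "Q \<in> carrier_mat N N"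
      "acts_on (map_vec fls_const v) (map_vec fls_const w) (base_change \<iota> P) (m2_map fps_to_fls (m2_series F))"
      "acts_on (map_vec fls_const v) (map_vec fls_const w) (base_change \<iota> Q) (m2_map fps_to_fls (m2_series G))"
    for P Q F G
    using l.acts_on_mult[OF bc[OF that(1)] bc[OF that(2)] that(3,4)]
    unfolding m2_map_series_mult base_change_lift lift.mat_hom_mult[OF that(1,2)] .
  show ?thesis
    unfolding braid_matrix_def
    by (intro mult act' carr mult_carrier_mat[of _ N N _ N])
qed

end

context sn_rep
begin

lemma gmat_jm:
  assumes r: "r \<le> n"
  shows "gmat (jm r) = mat N N (\<lambda>(a, b). \<Sum>i=1..<r. \<rho> (Transposition.transpose i r) $$ (a, b))"
proof (rule eq_matI)
  let ?t = "\<lambda>i. Transposition.transpose i r"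
  fix a b assume "a < dim_row (mat N N (\<lambda>(a, b). \<Sum>i=1..<r. \<rho> (?t i) $$ (a, b)))"
    "b < dim_col (mat N N (\<lambda>(a, b). \<Sum>i=1..<r. \<rho> (?t i) $$ (a, b)))"
  then have ab: "a < N" "b < N" by auto
  have inj: "inj_on ?t {1..<r}"
    by (rule inj_onI) (metis transpose_apply_second)
  have sub: "?t ` {1..<r} \<subseteq> perms n"
    using r by (auto intro!: permutes_swap_id)
  have "(\<Sum>p\<in>perms n. jm r p * \<rho> p $$ (a, b)) = (\<Sum>p\<in>?t ` {1..<r}. \<rho> p $$ (a, b))"
    by (rule sum.mono_neutral_cong_right[OF finite_perms sub]) (auto simp: jm_def)
  also have "\<dots> = (\<Sum>i=1..<r. \<rho> (?t i) $$ (a, b))"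
    unfolding sum.reindex[OF inj] comp_def ..
  finally show "gmat (jm r) $$ (a, b) = mat N N (\<lambda>(a, b). \<Sum>i=1..<r. \<rho> (?t i) $$ (a, b)) $$ (a, b)"
    using ab by (simp add: gmat_def)
qed (simp_all add: gmat_def)

lemma gmat_intertwine:
  assumes "sn_rep n D \<sigma>" and V: "V \<in> carrier_mat N D"
    and eq: "\<And>p. p permutes {1..n} \<Longrightarrow> \<rho> p * V = V * \<sigma> p"
  shows "gmat x * V = V * sn_rep.gmat n D \<sigma> x"
proof (rule eq_matI)
  interpret \<sigma>: sn_rep n D \<sigma> by fact
  fix i j assume "i < dim_row (V * \<sigma>.gmat x)" "j < dim_col (V * \<sigma>.gmat x)"
  then have ij: "i < N" "j < D" using V by (auto simp: \<sigma>.gmat_def)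
  have "(gmat x * V) $$ (i, j) = (\<Sum>k<N. \<Sum>p\<in>perms n. x p * \<rho> p $$ (i, k) * V $$ (k, j))"
    using ij V by (simp add: gmat_def scalar_prod_def sum_distrib_right lessThan_atLeast0)
  also have "\<dots> = (\<Sum>p\<in>perms n. \<Sum>k<N. x p * \<rho> p $$ (i, k) * V $$ (k, j))" by (rule sum.swap)
  also have "\<dots> = (\<Sum>p\<in>perms n. \<Sum>k<D. V $$ (i, k) * (x p * \<sigma> p $$ (k, j)))"
  proof (rule sum.cong[OF refl])
    fix p assume "p \<in> perms n"
    then have p: "p permutes {1..n}" by simp
    have "(\<rho> p * V) $$ (i, j) = (V * \<sigma> p) $$ (i, j)" by (simp only: eq[OF p])
    then have "x p * (\<Sum>k<N. \<rho> p $$ (i, k) * V $$ (k, j)) = x p * (\<Sum>k<D. V $$ (i, k) * \<sigma> p $$ (k, j))"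
      using rep_carrier[OF p] \<sigma>.rep_carrier[OF p] V ij by (simp add: scalar_prod_def lessThan_atLeast0)
    then show "(\<Sum>k<N. x p * \<rho> p $$ (i, k) * V $$ (k, j)) = (\<Sum>k<D. V $$ (i, k) * (x p * \<sigma> p $$ (k, j)))"
      by (simp add: sum_distrib_left mult_ac)
  qed
  also have "\<dots> = (\<Sum>k<D. \<Sum>p\<in>perms n. V $$ (i, k) * (x p * \<sigma> p $$ (k, j)))" by (rule sum.swap)
  also have "\<dots> = (V * \<sigma>.gmat x) $$ (i, j)"
    using ij V by (simp add: \<sigma>.gmat_def scalar_prod_def sum_distrib_left lessThan_atLeast0)
  finally show "(gmat x * V) $$ (i, j) = (V * \<sigma>.gmat x) $$ (i, j)" .
next
  interpret \<sigma>: sn_rep n D \<sigma> by fact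
  show "dim_row (gmat x * V) = dim_row (V * \<sigma>.gmat x)" "dim_col (gmat x * V) = dim_col (V * \<sigma>.gmat x)"
    using V by (auto simp: gmat_def \<sigma>.gmat_def)
qed

lemma sn_rep_map:
  assumes "field_hom \<iota>"
  shows "sn_rep n N (\<lambda>p. map_mat \<iota> (\<rho> p))"
proof
  interpret \<iota>: field_hom \<iota> by fact
  show "(\<lambda>p. map_mat \<iota> (\<rho> p)) \<in> hom (sym_group n) (GL N)"
  proof (rule homI)
    fix p assume "p \<in> carrier (sym_group n)"
    then have "p permutes {1..n}" by (simp only: sym_group_carrier)
    then show "map_mat \<iota> (\<rho> p) \<in> carrier (GL N)"
      by (intro GL_map_hom \<iota>.comm_ring_hom_axioms rep_GL)
  next
    fix p q assume "p \<in> carrier (sym_group n)" "q \<in> carrier (sym_group n)"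
    then have pq: "p permutes {1..n}" "q permutes {1..n}" by (simp_all only: sym_group_carrier)
    show "map_mat \<iota> (\<rho> (p \<otimes>\<^bsub>sym_group n\<^esub> q)) = map_mat \<iota> (\<rho> p) \<otimes>\<^bsub>GL N\<^esub> map_mat \<iota> (\<rho> q)"
      unfolding sym_group_mult GL_mult rep_comp[OF pq]
      by (rule \<iota>.mat_hom_mult[OF rep_carrier[OF pq(1)] rep_carrier[OF pq(2)]])
  qed
qed

end

context orthogonal_form
begin

text \<open>If the swap is not standard, its vector and the entry \<open>b\<close> both vanish, and
  the second relation reads 0 = 0; so the two-by-two description holds for every standard T.\<close>

lemma acts_on_omat:
  assumes T: "T \<in> STD" and r: "r \<in> {1..<n}"
  shows "acts_on (tab_vec T) (tab_vec (adj r \<circ> T)) (omat r)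
    (M2 (a (ax r T)) (b (ax r T)) (b (ax r T)) (a (- ax r T)))"
proof -
  have "omat r *\<^sub>v tab_vec (adj r \<circ> T) = b (ax r T) \<cdot>\<^sub>v tab_vec T + a (- ax r T) \<cdot>\<^sub>v tab_vec (adj r \<circ> T)"
  proof (cases "adj r \<circ> T \<in> STD")
    case True
    have s: "adj r \<circ> (adj r \<circ> T) = T" by (rule adj_comp_self)
    show ?thesis
      unfolding omat_tab_vec[OF True r] ax_adj_self[OF std_filling[OF T] r] b_neg s
      by (rule comm_add_vec[of _ "R_dim \<alpha>"]) simp_all
  next
    case False
    show ?thesis
      unfolding tab_vec_nonstd[OF False] b_nonstd[OF T r False]
      by (rule eq_vecI) (auto simp: omat_def scalar_prod_def tab_vec_def tvec_def)
  qed
  then show ?thesis by (simp add: acts_on_def omat_tab_vec[OF T r] del: o_apply)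
qed

end

text \<open>In the swapped tableau r occupies the box that r+1 has in T, whence the second
  eigenvalue.\<close>

lemma (in young_form) acts_on_jm:
  assumes T: "T \<in> STD" and r: "r \<in> {1..<n}"
  shows "acts_on (tab_vec T) (tab_vec (adj r \<circ> T)) (gmat (jm r)) (M2 (of_int (ct T r)) 0 0 (of_int (ct T (Suc r))))"
proof -
  have j: "gmat (jm r) *\<^sub>v tab_vec U = of_int (ct U r) \<cdot>\<^sub>v tab_vec U" for U
  proof -
    have "gmat (jm r) *\<^sub>v tab_vec U = tvec (\<lambda>V. of_int (ct V r) * (if V = U then 1 else 0))"
      unfolding tab_vec_def by (rule jucys_murphy) (use r in auto)
    also have "\<dots> = of_int (ct U r) \<cdot>\<^sub>v tab_vec U"
      unfolding tab_vec_def tvec_smult by (rule tvec_cong) auto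
    finally show ?thesis .
  qed
  have c: "ct (adj r \<circ> T) r = ct T (Suc r)"
  proof -
    have "r \<in> {1..n}" using r by auto
    then show ?thesis by (simp add: ct_adj[OF std_filling[OF T] r] del: o_apply)
  qed
  have z: "v = v + 0 \<cdot>\<^sub>v w" "w = 0 \<cdot>\<^sub>v v + w" if "v \<in> carrier_vec D" "w \<in> carrier_vec D" for v w :: "'f vec" and D
    using that by auto
  show ?thesis
    unfolding acts_on_def j c m2.sel
    by (intro conjI z[of _ "R_dim \<alpha>"]) simp_all
qed

section \<open>The orthogonal form of a shape carried to R_\<alpha> by Phi-hat\<close>

locale associator_form = young_form n \<alpha> rt + A: even_associator \<Phi> lam \<iota>
  for n \<alpha> and rt :: "nat \<Rightarrow> 'l::field_char_0" and \<Phi> :: "(xy, 'k::field_char_0) ncs" and lam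
    and \<iota> :: "'k \<Rightarrow> 'l" +
  assumes lam_nonzero: "lam \<noteq> 0"
begin

sublocale q_form n \<alpha> rt "\<iota> lam"
  by unfold_locales (simp add: lam_nonzero)

definition plane_mat :: "int \<Rightarrow> 'l m2" where
  "plane_mat d = M2 (ya d) (yb d) (yb d) (ya (- d))"

text \<open>\<open>braid_matrix_plane\<close> with p = -1/d and B twice the contents: its condition
  p (2 x - 2 y) = -2 is x - y = d. Then u and u' are q^d and q^(-d), and the linear equation for the
  first diagonal entry is the one that defines \<open>qa d\<close>.\<close>

lemma plane_series:
  assumes d: "d \<noteq> 0" "\<bar>d\<bar> < int n" and xy: "x - y = d"
  obtains a b e where
    "m2_series (A.braid_matrix (plane_mat d) (m2_scalar 2 * plane_mat d)
      (m2_scalar 2 * M2 (of_int x) 0 0 (of_int y))) = M2 a b b e"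
    "fps_to_fls a = qa d" "fps_nth b 0 = yb d"
    "fps_to_fls b * fps_to_fls b = 1 + qdiff (\<iota> lam) * qa d - qa d * qa d"
proof -
  have neg: "ya (- d) = - ya d" by (simp add: ya_def)
  have "ya d * ya d + yb d * yb d = 1" using yb_square[OF d] by (simp add: ya_def)
  moreover have diff: "2 * of_int x - 2 * of_int y = (2 * of_int d :: 'l)" "2 * of_int y - 2 * of_int x = (- 2 * of_int d :: 'l)"
    unfolding xy[symmetric] by (simp_all add: algebra_simps)
  moreover have "ya d * (2 * of_int x - 2 * of_int y) = - 2" unfolding diff using d by (simp add: ya_def)
  ultimately obtain a b e where s: "m2_series (A.braid_matrix (M2 (ya d) (yb d) (yb d) (- ya d))
      (m2_scalar 2 * M2 (ya d) (yb d) (yb d) (- ya d)) (M2 (2 * of_int x) 0 0 (2 * of_int y))) = M2 a b b e"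
    and a: "a * (fps_exp (A.\<mu> / 2 * (2 * of_int x - 2 * of_int y)) - fps_exp (A.\<mu> / 2 * (2 * of_int y - 2 * of_int x)))
      = - (fps_exp A.\<mu> - fps_exp (- A.\<mu>)) * fps_exp (A.\<mu> / 2 * (2 * of_int y - 2 * of_int x))"
    and b: "a * a + b * b = (fps_exp A.\<mu> - fps_exp (- A.\<mu>)) * a + 1" "fps_nth b 0 = yb d"
    using A.braid_matrix_plane[of "ya d" "yb d" "2 * of_int x" "2 * of_int y"] by metis
  have z: "fps_to_fls (fps_exp A.\<mu> - fps_exp (- A.\<mu>)) = qdiff (\<iota> lam)"
    by (simp add: qdiff_def qpow_def)
  have u: "fps_to_fls (fps_exp (A.\<mu> / 2 * (2 * of_int d))) = qpow (\<iota> lam) d"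
    "fps_to_fls (fps_exp (A.\<mu> / 2 * (- 2 * of_int d))) = qpow (\<iota> lam) (- d)"
    by (simp_all add: qpow_def mult.commute)
  have qa: "fps_to_fls a = qa d"
  proof (rule qa_eqI[OF d(1)])
    show "fps_to_fls a * (qpow (\<iota> lam) d - qpow (\<iota> lam) (- d)) = - qdiff (\<iota> lam) * qpow (\<iota> lam) (- d)"
      using arg_cong[OF a, of fps_to_fls]
      unfolding diff fls_times_fps_to_fls fps_to_fls_minus[of "fps_exp (A.\<mu> / 2 * (2 * of_int d))"] fps_to_fls_uminus z u .
  qed
  have "qa d * qa d + fps_to_fls b * fps_to_fls b = qdiff (\<iota> lam) * qa d + 1"
    using arg_cong[OF b(1), of fps_to_fls]
    unfolding fps_to_fls_plus fls_times_fps_to_fls z qa by simp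
  then have bb: "fps_to_fls b * fps_to_fls b = 1 + qdiff (\<iota> lam) * qa d - qa d * qa d"
    by (simp add: algebra_simps)
  show thesis
    by (rule that[OF _ qa b(2) bb]) (use s in \<open>simp add: plane_mat_def neg m2_scalar_mult\<close>)
qed

sublocale q_form_sqrt n \<alpha> rt "\<iota> lam"
proof
  fix k assume k: "2 \<le> k" "k \<le> n - 1"
  \<comment> \<open>The contents k and 0 give a plane at distance k whether or not it occurs in the
    shape, so the off-diagonal entry supplies the square root for every k in the range.\<close>
  obtain b where "fps_nth b 0 = yb (int k)"
    "fps_to_fls b * fps_to_fls b = 1 + qdiff (\<iota> lam) * qa (int k) - qa (int k) * qa (int k)"
    by (rule plane_series[of "int k" "int k" 0]) (use k in auto)
  then show "\<exists>b. fps_nth b 0 = yb (int k) \<and>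
    fps_to_fls b * fps_to_fls b = 1 + qdiff (\<iota> lam) * qa (int k) - qa (int k) * qa (int k)" by blast
qed

lemma map_tab_vec: "map_vec fls_const (tab_vec T :: 'l vec) = tab_vec T"
  by (auto simp: tab_vec_def tvec_def)

text \<open>An intertwiner V that is constant in h maps the plane of T and its swap to vectors on
  which s_r, t_(r,r+1) and Y_r act by two-by-two matrices, so Phi-hat acts there by
  \<open>braid_matrix\<close>. V need not be invertible; it will be the inclusion of one
  summand.\<close>

lemma Phi_hat_intertwine:
  assumes rep: "sn_rep n N \<rho>0" and V: "V \<in> carrier_mat N (R_dim \<alpha>)"
    and inter: "\<And>p. p permutes {1..n} \<Longrightarrow> map_mat \<iota> (\<rho>0 p) * V = V * yrep p"
    and r: "r \<in> {1..<n}"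
  shows "base_change \<iota> (Phi_hat_gen \<Phi> lam N (inf_hecke_rep N \<rho>0) r) * map_mat fls_const V
    = map_mat fls_const V * R_gen (\<iota> lam) rt \<alpha> r"
proof -
  interpret \<rho>0: sn_rep n N \<rho>0 by fact
  interpret \<rho>: sn_rep n N "\<lambda>p. map_mat \<iota> (\<rho>0 p)" by (rule \<rho>0.sn_rep_map[OF A.hom])
  let ?D = "R_dim \<alpha>"
  let ?S = "\<rho>0 (adj r)"
  define t where "t i j = (if i = j then 0\<^sub>m N N else 2 \<cdot>\<^sub>m \<rho>0 (Transposition.transpose i j))" for i j
  define Y where "Y = Y_mat N t r"
  define F where "F = Phi_hat_gen \<Phi> lam N (inf_hecke_rep N \<rho>0) r"
  have two: "\<iota> 2 = 2" using A.\<iota>.hom_add[of 1 1] by simp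
  have s: "adj r permutes {1..n}" by (rule adj_permutes[OF r])
  have S: "?S \<in> carrier_mat N N" by (rule \<rho>0.rep_carrier[OF s])
  have T: "t r (Suc r) = 2 \<cdot>\<^sub>m ?S" by (simp add: t_def)
  have Yc: "Y \<in> carrier_mat N N" by (simp add: Y_def Y_mat_def)
  have F: "F = subst_mat_h N \<Phi> (2 \<cdot>\<^sub>m ?S) Y * map_mat fps_const ?S * exp_mat_h N ((lam / 2) \<cdot>\<^sub>m (2 \<cdot>\<^sub>m ?S))
      * subst_mat_h N \<Phi> Y (2 \<cdot>\<^sub>m ?S)"
  proof -
    have e: "inf_hecke_rep N \<rho>0 = (\<rho>0, t)" by (simp add: inf_hecke_rep_def t_def[abs_def])
    show ?thesis unfolding F_def e Phi_hat_gen_def prod.case Suc_eq_plus1[symmetric] T Y_def ..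
  qed
  have Fc: "F \<in> carrier_mat N N" unfolding F by (rule carrier_matI) (auto simp: subst_mat_h_def)
  have mT: "map_mat \<iota> (2 \<cdot>\<^sub>m ?S) = 2 \<cdot>\<^sub>m map_mat \<iota> ?S"
    by (rule eq_matI) (simp_all add: A.\<iota>.hom_mult two)
  have mY: "map_mat \<iota> Y = 2 \<cdot>\<^sub>m \<rho>.gmat (jm r)"
  proof (rule eq_matI)
    fix i j assume "i < dim_row (2 \<cdot>\<^sub>m \<rho>.gmat (jm r))" "j < dim_col (2 \<cdot>\<^sub>m \<rho>.gmat (jm r))"
    then have ij: "i < N" "j < N" by (auto simp: \<rho>.gmat_def)
    have c: "\<rho>0 (Transposition.transpose k r) \<in> carrier_mat N N" if "k \<in> {1..<r}" for k
      using that r by (intro \<rho>0.rep_carrier permutes_swap_id) auto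
    have e: "\<iota> ((2 \<cdot>\<^sub>m \<rho>0 (Transposition.transpose k r)) $$ (i, j))
        = 2 * map_mat \<iota> (\<rho>0 (Transposition.transpose k r)) $$ (i, j)" if "k \<in> {1..<r}" for k
      using ij carrier_matD[OF c[OF that]] by (simp add: A.\<iota>.hom_mult two)
    have "r \<le> n" using r by auto
    then show "map_mat \<iota> Y $$ (i, j) = (2 \<cdot>\<^sub>m \<rho>.gmat (jm r)) $$ (i, j)"
      using ij by (auto simp: \<rho>.gmat_jm Y_def Y_mat_def t_def A.\<iota>.hom_sum sum_distrib_left intro!: sum.cong e)
  qed (simp_all add: \<rho>.gmat_def Y_def Y_mat_def)
  have Sm: "map_mat \<iota> ?S \<in> carrier_mat N N" using S by simp
  have yc: "yrep p \<in> carrier_mat ?D ?D" if "p permutes {1..n}" for p by (rule rep_carrier[OF that])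
  have bF: "base_change \<iota> F \<in> carrier_mat N N" using Fc by (simp add: base_change_def)
  have lV: "map_mat fls_const V \<in> carrier_mat N ?D" using V by simp
  have "base_change \<iota> F * map_mat fls_const V = map_mat fls_const V * q.omat r"
  proof (rule eq_mat_if_eq_on_tab_vec)
    show "base_change \<iota> F * map_mat fls_const V \<in> carrier_mat N ?D" by (rule mult_carrier_mat[OF bF lV])
    show "map_mat fls_const V * q.omat r \<in> carrier_mat N ?D" by (rule mult_carrier_mat[OF lV q.omat_carrier])
    fix T assume T: "T \<in> STD"
    let ?d = "ax r T" and ?T = "adj r \<circ> T"
    let ?v = "V *\<^sub>v (tab_vec T :: 'l vec)" and ?w = "V *\<^sub>v (tab_vec ?T :: 'l vec)"
    have d: "?d \<noteq> 0" "\<bar>?d\<bar> < int n"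
      using ax_nonzero[OF T r] ax_range[OF std_filling[OF T] r] by auto
    interpret vw: vec_pair N ?v ?w using V by unfold_locales simp_all
    have aS: "acts_on ?v ?w (map_mat \<iota> ?S) (plane_mat ?d)"
      by (rule acts_on_intertwine[OF Sm yc[OF s] V inter[OF s]])
        (simp_all add: yrep_adj[OF r] acts_on_omat[OF T r] plane_mat_def del: o_apply)
    have aT: "acts_on ?v ?w (map_mat \<iota> (2 \<cdot>\<^sub>m ?S)) (m2_scalar 2 * plane_mat ?d)"
      unfolding mT by (rule vw.acts_on_scale[OF Sm aS])
    have "\<rho>.gmat (jm r) * V = V * gmat (jm r)"
      by (rule \<rho>.gmat_intertwine[OF sn_rep_axioms V inter])
    then have aY: "acts_on ?v ?w (map_mat \<iota> Y) (m2_scalar 2 * M2 (of_int (ct T r)) 0 0 (of_int (ct T (Suc r))))"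
      unfolding mY
      by (rule vw.acts_on_scale[OF \<rho>.gmat_carrier acts_on_intertwine[OF \<rho>.gmat_carrier gmat_carrier V _
            tab_vec_carrier tab_vec_carrier acts_on_jm[OF T r]]])
    obtain a b e where s: "m2_series (A.braid_matrix (plane_mat ?d) (m2_scalar 2 * plane_mat ?d)
        (m2_scalar 2 * M2 (of_int (ct T r)) 0 0 (of_int (ct T (Suc r))))) = M2 a b b e"
      and a: "fps_to_fls a = qa ?d" and b: "fps_nth b 0 = yb ?d"
      "fps_to_fls b * fps_to_fls b = 1 + qdiff (\<iota> lam) * qa ?d - qa ?d * qa ?d"
      by (rule plane_series[OF d]) (simp add: ax_def)
    have lv: "map_vec fls_const ?v = map_mat fls_const V *\<^sub>v tab_vec T"
      "map_vec fls_const ?w = map_mat fls_const V *\<^sub>v tab_vec ?T"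
      unfolding fls_const.mult_mat_vec_hom[OF V tab_vec_carrier] map_tab_vec by (rule refl)+
    have T2: "2 \<cdot>\<^sub>m ?S \<in> carrier_mat N N" using S by simp
    have "acts_on (map_vec fls_const ?v) (map_vec fls_const ?w) (base_change \<iota> F) (m2_map fps_to_fls (M2 a b b e))"
      unfolding F s[symmetric] by (rule A.acts_on_Phi_hat[OF vw.vec_pair_axioms T2 Yc S aT aY aS])
    then have "base_change \<iota> F *\<^sub>v (map_mat fls_const V *\<^sub>v tab_vec T)
        = qa ?d \<cdot>\<^sub>v (map_mat fls_const V *\<^sub>v tab_vec T) + fps_to_fls b \<cdot>\<^sub>v (map_mat fls_const V *\<^sub>v tab_vec ?T)"
      unfolding acts_on_def lv m2_map_def m2.sel a by blast
    \<comment> \<open>At distance 1 or -1 the swap is not standard and its vector is 0, so both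
      coefficients give 0; otherwise \<open>qb_eq\<close> identifies b.\<close>
    also have "fps_to_fls b \<cdot>\<^sub>v (map_mat fls_const V *\<^sub>v tab_vec ?T) = qb ?d \<cdot>\<^sub>v (map_mat fls_const V *\<^sub>v tab_vec ?T)"
    proof (cases "2 \<le> \<bar>?d\<bar>")
      case True
      then show ?thesis using qb_eq[OF True d(2) b] by simp
    next
      case False
      have "?T \<notin> STD"
        using T r by (cases rule: ax_cases) (use False in auto)
      then have "(tab_vec ?T :: 'l fls vec) = 0\<^sub>v ?D" by (rule tab_vec_nonstd)
      then show ?thesis using lV by (intro eq_vecI) (auto simp: scalar_prod_def)
    qed
    also have "qa ?d \<cdot>\<^sub>v (map_mat fls_const V *\<^sub>v tab_vec T) + \<dots> = map_mat fls_const V *\<^sub>v (q.omat r *\<^sub>v tab_vec T)"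
      unfolding q.omat_tab_vec[OF T r] by (rule mult_mat_vec_comb[OF lV tab_vec_carrier tab_vec_carrier, symmetric])
    finally show "(base_change \<iota> F * map_mat fls_const V) *\<^sub>v tab_vec T = (map_mat fls_const V * q.omat r) *\<^sub>v tab_vec T"
      unfolding assoc_mult_mat_vec[OF bF lV tab_vec_carrier] assoc_mult_mat_vec[OF lV q.omat_carrier tab_vec_carrier] .
  qed
  then show ?thesis unfolding F_def R_gen_eq[OF r] .
qed

end

section \<open>Assembling the blocks\<close>

lemma braid_images_braid_gen: "braid_images (braid_group n) n (braid_gen n)"
proof -
  interpret group "braid_group n" by (rule group_braid_group)
  show ?thesis
  proof
    fix i assume i: "i \<in> {1..<n}"
    then show "braid_gen n i \<in> carrier (braid_group n)"
      by (auto simp: braid_gen_def braid_group_carrier braid_words_def)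
  next
    fix i j assume ij: "i \<in> {1..<n}" "j \<in> {1..<n}" "i + 2 \<le> j"
    have w: "[(i, True)] \<in> braid_words n" "[(j, True)] \<in> braid_words n"
      "[(i, True), (j, True)] \<in> braid_words n" using ij by (auto simp: braid_words_def)
    show "braid_gen n i \<otimes>\<^bsub>braid_group n\<^esub> braid_gen n j = braid_gen n j \<otimes>\<^bsub>braid_group n\<^esub> braid_gen n i"
      unfolding braid_gen_def braid_mult_class[OF w(1,2)] braid_mult_class[OF w(2,1)]
      using braid_far[OF ij] braid_class_eq_iff[OF w(3)] by simp
  next
    fix i assume i: "i \<in> {1..<n}" "i + 1 \<in> {1..<n}"
    have w: "[(i, True)] \<in> braid_words n" "[(i + 1, True)] \<in> braid_words n"
      "[(i, True), (i + 1, True), (i, True)] \<in> braid_words n"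
      "[(i, True), (i + 1, True)] \<in> braid_words n" "[(i + 1, True), (i, True)] \<in> braid_words n"
      using i by (auto simp: braid_words_def)
    show "braid_gen n i \<otimes>\<^bsub>braid_group n\<^esub> braid_gen n (i + 1) \<otimes>\<^bsub>braid_group n\<^esub> braid_gen n i
      = braid_gen n (i + 1) \<otimes>\<^bsub>braid_group n\<^esub> braid_gen n i \<otimes>\<^bsub>braid_group n\<^esub> braid_gen n (i + 1)"
      unfolding braid_gen_def
      using braid_adjacent[OF i] braid_class_eq_iff[OF w(3)] w
      by (simp add: braid_mult_class del: braid_words_def)
  qed
qed

lemma GL_mult_closed:
  "A \<in> carrier (GL N) \<Longrightarrow> B \<in> carrier (GL N) \<Longrightarrow> A * B \<in> carrier (GL N :: 'a::comm_ring_1 mat monoid)"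
  using monoid.m_closed[OF group.is_monoid[OF GL_group]] by (metis GL_mult)

lemma direct_sum_hom:
  fixes Rs :: "('g \<Rightarrow> 'a::comm_ring_1 mat) list"
  assumes "list_all2 (\<lambda>R d. R \<in> hom G (GL d)) Rs ds"
  shows "direct_sum_rep Rs \<in> hom G (GL (sum_list ds))"
proof (rule homI)
  have GL: "list_all2 (\<lambda>A d. A \<in> carrier (GL d)) (map (\<lambda>R. R g) Rs) ds" if "g \<in> carrier G" for g
    using assms that by (auto simp: list_all2_conv_all_nth hom_def)
  have C: "list_all2 (\<lambda>A d. A \<in> carrier_mat d d) (map (\<lambda>R. R g) Rs) ds" if "g \<in> carrier G" for g
    by (rule list_all2_mono[OF GL[OF that]]) (rule GL_carrier_mat)
  show "direct_sum_rep Rs g \<in> carrier (GL (sum_list ds))" if "g \<in> carrier G" for g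
    unfolding direct_sum_rep_def by (rule diag_block_mat_GL[OF GL[OF that]])
  show "direct_sum_rep Rs (g \<otimes>\<^bsub>G\<^esub> h) = direct_sum_rep Rs g \<otimes>\<^bsub>GL (sum_list ds)\<^esub> direct_sum_rep Rs h"
    if gh: "g \<in> carrier G" "h \<in> carrier G" for g h
  proof -
    have "map (\<lambda>R. R (g \<otimes>\<^bsub>G\<^esub> h)) Rs = map2 (*) (map (\<lambda>R. R g) Rs) (map (\<lambda>R. R h) Rs)"
    proof (rule nth_equalityI)
      fix i assume "i < length (map (\<lambda>R. R (g \<otimes>\<^bsub>G\<^esub> h)) Rs)"
      then have i: "i < length Rs" by simp
      have "Rs ! i \<in> hom G (GL (ds ! i))" using list_all2_nthD[OF assms i] .
      then have "(Rs ! i) (g \<otimes>\<^bsub>G\<^esub> h) = (Rs ! i) g * (Rs ! i) h"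
        using gh by (simp add: hom_def GL_mult)
      then show "map (\<lambda>R. R (g \<otimes>\<^bsub>G\<^esub> h)) Rs ! i = map2 (*) (map (\<lambda>R. R g) Rs) (map (\<lambda>R. R h) Rs) ! i"
        using i by simp
    qed simp
    then show ?thesis
      unfolding direct_sum_rep_def GL_mult diag_block_mat_mult[OF C[OF gh(1)] C[OF gh(2)]] by simp
  qed
qed

lemma conjugate_hom:
  fixes H :: "'g \<Rightarrow> 'a::comm_ring_1 mat"
  assumes H: "H \<in> hom G (GL N)" and P: "P \<in> carrier_mat N N" and Q: "Q \<in> carrier_mat N N"
    and PQ: "P * Q = 1\<^sub>m N" "Q * P = 1\<^sub>m N"
  shows "(\<lambda>g. Q * H g * P) \<in> hom G (GL N)"
proof (rule homI)
  have GL: "P \<in> carrier (GL N)" "Q \<in> carrier (GL N)"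
    using GL_memI[OF P Q PQ] GL_memI[OF Q P PQ(2,1)] .
  have HGL: "H g \<in> carrier (GL N)" if "g \<in> carrier G" for g using H that by (auto simp: hom_def)
  show "Q * H g * P \<in> carrier (GL N)" if "g \<in> carrier G" for g
    by (intro GL_mult_closed GL HGL that)
  fix g h assume gh: "g \<in> carrier G" "h \<in> carrier G"
  have c: "H g \<in> carrier_mat N N" "H h \<in> carrier_mat N N" using HGL gh GL_carrier_mat by blast+
  have "(Q * H g * P) * (Q * H h * P) = Q * H g * (P * Q) * H h * P"
    using P Q c by (simp add: assoc_mult_mat[of _ N N _ N _ N])
  also have "\<dots> = Q * (H g * H h) * P"
    unfolding PQ(1) using Q c by (simp add: assoc_mult_mat[of _ N N _ N _ N] right_mult_one_mat[of _ N N] P)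
  finally show "Q * H (g \<otimes>\<^bsub>G\<^esub> h) * P = (Q * H g * P) \<otimes>\<^bsub>GL N\<^esub> (Q * H h * P)"
    using H gh by (simp add: hom_def GL_mult)
qed

lemma map_block_incl: "semiring_hom h \<Longrightarrow> map_mat h (block_incl ds i) = block_incl ds i"
proof -
  assume "semiring_hom h"
  then interpret h: semiring_hom h .
  show ?thesis by (rule eq_matI) (auto simp: block_incl_def)
qed

lemma Phi_hat_gen_carrier: "Phi_hat_gen \<Phi> lam N S i \<in> carrier_mat N N"
proof -
  obtain \<rho> t where S: "S = (\<rho>, t)" by force
  show ?thesis unfolding S Phi_hat_gen_def prod.case by (rule carrier_matI) (simp_all add: subst_mat_h_def)
qed

lemma (in even_associator) lift_exp: "lift (fps_exp lam - fps_exp (- lam)) = qdiff \<mu>"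
proof -
  have e: "lift (fps_exp c) = fps_to_fls (fps_exp (\<iota> c))" for c
  proof -
    have "\<iota> (c ^ d / fact d) = \<iota> c ^ d / fact d" for d
      using hom_fact_inverse[of d] \<iota>.hom_mult[of "c ^ d" "1 / fact d"] by (simp add: \<iota>.hom_power)
    then show ?thesis by (simp add: lift_def fps_eq_iff)
  qed
  show ?thesis unfolding lift.hom_minus e by (simp add: qdiff_def qpow_def \<iota>.hom_uminus)
qed

text \<open>For each summand, the block of columns \<open>W i\<close> of the inverse of the given
  isomorphism, followed by the inverse of the isomorphism from \<open>irrep_intertwiner\<close>, is
  an intertwiner \<open>V i\<close> from the orthogonal form into \<rho>0.
  \<open>Phi_hat_intertwine\<close> applies to each, and side by side the \<open>V i\<close> form
  the invertible matrix Q.\<close>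

lemma (in even_associator) Phi_hat_block_conjugation:
  fixes rt :: "nat \<Rightarrow> 'l" and Ss :: "((nat \<Rightarrow> nat) \<Rightarrow> 'k mat) list"
  assumes lam: "lam \<noteq> 0"
    and rt: "\<And>d. 2 \<le> d \<Longrightarrow> d \<le> n - 1 \<Longrightarrow> (rt d)\<^sup>2 = of_nat (d\<^sup>2 - 1)"
    and rep: "\<rho>0 \<in> hom (sym_group n) (GL N)"
    and part: "\<And>\<alpha>. \<alpha> \<in> set \<alpha>s \<Longrightarrow> is_partition n \<alpha>"
    and irr: "list_all2 (is_irrep_of n) \<alpha>s Ss"
    and iso: "rep_iso (sym_group n) N \<rho>0 (direct_sum_rep Ss)"
  obtains P Q where "N = sum_list (map R_dim \<alpha>s)" "P \<in> carrier_mat N N" "Q \<in> carrier_mat N N"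
    "P * Q = 1\<^sub>m N" "Q * P = 1\<^sub>m N"
    "\<And>r. r \<in> {1..<n} \<Longrightarrow> base_change \<iota> (Phi_hat_gen \<Phi> lam N (inf_hecke_rep N \<rho>0) r) * Q
      = Q * diag_block_mat (map (\<lambda>\<alpha>. R_gen (\<iota> lam) rt \<alpha> r) \<alpha>s)"
proof -
  define ds where "ds = map R_dim \<alpha>s"
  define M where "M = sum_list ds"
  have len: "length ds = length \<alpha>s" "length Ss = length \<alpha>s" using irr by (auto simp: ds_def dest: list_all2_lengthD)
  have dsi: "ds ! i = R_dim (\<alpha>s ! i)" if "i < length \<alpha>s" for i using that by (simp add: ds_def)
  interpret \<rho>0: sn_rep n N \<rho>0 by unfold_locales (rule rep)
  have AF: "associator_form n (\<alpha>s ! i) rt \<Phi> lam \<iota>" if "i < length \<alpha>s" for i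
    by unfold_locales (use part that rt lam in auto)
  have "\<exists>P. P \<in> carrier (GL (ds ! i)) \<and> Ss ! i \<in> hom (sym_group n) (GL (ds ! i)) \<and>
      (\<forall>p. p permutes {1..n} \<longrightarrow> P * map_mat \<iota> ((Ss ! i) p) = young_form.yrep n (\<alpha>s ! i) rt p * P)"
    if i: "i < length \<alpha>s" for i
  proof -
    interpret associator_form n "\<alpha>s ! i" rt \<Phi> lam \<iota> by (rule AF[OF i])
    obtain P where "P \<in> carrier (GL (R_dim (\<alpha>s ! i)))" "Ss ! i \<in> hom (sym_group n) (GL (R_dim (\<alpha>s ! i)))"
      "\<And>p. p permutes {1..n} \<Longrightarrow> P * map_mat \<iota> ((Ss ! i) p) = yrep p * P"
      by (rule irrep_intertwiner[OF hom list_all2_nthD[OF irr i]]) blast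
    then show ?thesis unfolding dsi[OF i] by blast
  qed
  then obtain Pi where Pi: "\<And>i. i < length \<alpha>s \<Longrightarrow> Pi i \<in> carrier (GL (ds ! i))"
    "\<And>i. i < length \<alpha>s \<Longrightarrow> Ss ! i \<in> hom (sym_group n) (GL (ds ! i))"
    "\<And>i p. i < length \<alpha>s \<Longrightarrow> p permutes {1..n} \<Longrightarrow>
      Pi i * map_mat \<iota> ((Ss ! i) p) = young_form.yrep n (\<alpha>s ! i) rt p * Pi i" by metis
  have "\<exists>Q. Pi i \<in> carrier_mat (ds ! i) (ds ! i) \<and> Q \<in> carrier_mat (ds ! i) (ds ! i) \<and> Pi i * Q = 1\<^sub>m (ds ! i) \<and> Q * Pi i = 1\<^sub>m (ds ! i)"
    if "i < length \<alpha>s" for i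
    using GL_memE[OF Pi(1)[OF that]] by blast
  then obtain Qi where Pic: "\<And>i. i < length \<alpha>s \<Longrightarrow> Pi i \<in> carrier_mat (ds ! i) (ds ! i)"
    and Qi: "\<And>i. i < length \<alpha>s \<Longrightarrow> Qi i \<in> carrier_mat (ds ! i) (ds ! i)"
      "\<And>i. i < length \<alpha>s \<Longrightarrow> Pi i * Qi i = 1\<^sub>m (ds ! i)" "\<And>i. i < length \<alpha>s \<Longrightarrow> Qi i * Pi i = 1\<^sub>m (ds ! i)"
    by metis
  obtain P0 where "P0 \<in> carrier (GL N)"
    and P0: "\<And>g. g \<in> carrier (sym_group n) \<Longrightarrow> P0 * \<rho>0 g = direct_sum_rep Ss g * P0"
    using iso unfolding rep_iso_def by blast
  then obtain Q0 where PQ0: "P0 \<in> carrier_mat N N" "Q0 \<in> carrier_mat N N" "P0 * Q0 = 1\<^sub>m N" "Q0 * P0 = 1\<^sub>m N"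
    using GL_memE by blast
  have Shom: "list_all2 (\<lambda>R d. R \<in> hom (sym_group n) (GL d)) Ss ds"
    using Pi(2) len by (simp add: list_all2_conv_all_nth)
  have Sc: "list_all2 (\<lambda>A d. A \<in> carrier_mat d d) (map (\<lambda>S. S g) Ss) ds" if "g \<in> carrier (sym_group n)" for g
    using Shom that by (auto simp: list_all2_conv_all_nth hom_def Pi_def intro!: GL_carrier_mat)
  have idc: "id \<in> carrier (sym_group n)" by (simp only: sym_group_carrier permutes_id)
  have dc: "direct_sum_rep Ss g \<in> carrier_mat M M" if "g \<in> carrier (sym_group n)" for g
    unfolding direct_sum_rep_def M_def by (rule diag_block_carrier[OF Sc[OF that]])
  \<comment> \<open>The two sizes are compared through the number of rows in the intertwining
    relation at \<open>id\<close>.\<close>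
  have NM: "N = M"
  proof -
    have "dim_row (P0 * \<rho>0 id) = dim_row (direct_sum_rep Ss id * P0)" by (simp only: P0[OF idc])
    then show ?thesis using PQ0(1) dc[OF idc] by simp
  qed
  define W :: "nat \<Rightarrow> 'k mat" where "W i = Q0 * block_incl ds i" for i
  have bi: "block_incl ds i \<in> carrier_mat N (ds ! i)" for i
    unfolding NM M_def by (rule block_incl_carrier)
  have Wc: "W i \<in> carrier_mat N (ds ! i)" for i unfolding W_def by (rule mult_carrier_mat[OF PQ0(2) bi])
  define V where "V i = map_mat \<iota> (W i) * Qi i" for i
  have mW: "map_mat \<iota> (W i) \<in> carrier_mat N (ds ! i)" for i using Wc by simp
  have Vc: "V i \<in> carrier_mat N (ds ! i)" if "i < length \<alpha>s" for i
    unfolding V_def by (rule mult_carrier_mat[OF mW Qi(1)[OF that]])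
  have inter: "map_mat \<iota> (\<rho>0 p) * V i = V i * young_form.yrep n (\<alpha>s ! i) rt p"
    if i: "i < length \<alpha>s" and p: "p permutes {1..n}" for i p
  proof -
    let ?d = "ds ! i" and ?S = "(Ss ! i) p" and ?y = "young_form.yrep n (\<alpha>s ! i) rt p"
    interpret associator_form n "\<alpha>s ! i" rt \<Phi> lam \<iota> by (rule AF[OF i])
    have pc: "p \<in> carrier (sym_group n)" using p by (simp only: sym_group_carrier)
    have c: "\<rho>0 p \<in> carrier_mat N N" by (rule \<rho>0.rep_carrier[OF p])
    have d: "direct_sum_rep Ss p \<in> carrier_mat N N" unfolding NM by (rule dc[OF pc])
    have S: "?S \<in> carrier_mat ?d ?d" using list_all2_nthD2[OF Sc[OF pc], of i] i len by simp
    have mS: "map_mat \<iota> ?S \<in> carrier_mat ?d ?d" using S by simp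
    have y: "?y \<in> carrier_mat ?d ?d" unfolding dsi[OF i] by (rule rep_carrier[OF p])
    have "\<rho>0 p * Q0 = Q0 * P0 * \<rho>0 p * Q0" unfolding PQ0(4) using c by simp
    also have "\<dots> = Q0 * (P0 * \<rho>0 p) * Q0" using c PQ0(1,2) by (simp add: assoc_mult_mat[of _ N N _ N _ N])
    also have "\<dots> = Q0 * direct_sum_rep Ss p * (P0 * Q0)"
      unfolding P0[OF pc] using PQ0(1,2) d by (simp add: assoc_mult_mat[of _ N N _ N _ N])
    finally have "\<rho>0 p * Q0 = Q0 * direct_sum_rep Ss p"
      unfolding PQ0(3) using PQ0(2) d by (simp add: right_mult_one_mat[of _ N N])
    then have "\<rho>0 p * W i = Q0 * (direct_sum_rep Ss p * block_incl ds i)"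
      unfolding W_def assoc_mult_mat[OF c PQ0(2) bi, symmetric] assoc_mult_mat[OF PQ0(2) d bi, symmetric] by simp
    also have "direct_sum_rep Ss p * block_incl ds i = block_incl ds i * ?S"
      unfolding direct_sum_rep_def using diag_block_mult_incl[OF Sc[OF pc], of i] i len by simp
    also have "Q0 * (block_incl ds i * ?S) = W i * ?S"
      unfolding W_def assoc_mult_mat[OF PQ0(2) bi S] ..
    finally have "map_mat \<iota> (\<rho>0 p) * map_mat \<iota> (W i) = map_mat \<iota> (W i) * map_mat \<iota> ?S"
      unfolding \<iota>.mat_hom_mult[OF c Wc, symmetric] \<iota>.mat_hom_mult[OF Wc S, symmetric] by simp
    moreover have "map_mat \<iota> ?S * Qi i = Qi i * ?y"
    proof -
      have "map_mat \<iota> ?S * Qi i = (Qi i * Pi i) * map_mat \<iota> ?S * Qi i"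
        unfolding Qi(3)[OF i] using mS by simp
      also have "\<dots> = Qi i * (Pi i * map_mat \<iota> ?S) * Qi i"
        using mS Qi(1)[OF i] Pic[OF i] by (simp add: assoc_mult_mat[of _ ?d ?d _ ?d _ ?d])
      also have "\<dots> = Qi i * ?y * (Pi i * Qi i)"
        unfolding Pi(3)[OF i p] using y Qi(1)[OF i] Pic[OF i] by (simp add: assoc_mult_mat[of _ ?d ?d _ ?d _ ?d])
      also have "\<dots> = Qi i * ?y"
        unfolding Qi(2)[OF i] by (rule right_mult_one_mat[OF mult_carrier_mat[OF Qi(1)[OF i] y]])
      finally show ?thesis .
    qed
    moreover have "map_mat \<iota> (\<rho>0 p) \<in> carrier_mat N N" using c by simp
    ultimately show ?thesis
      unfolding V_def assoc_mult_mat[OF mW Qi(1)[OF i] y]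
      by (simp add: assoc_mult_mat[OF mW mS Qi(1)[OF i]] assoc_mult_mat[OF _ mW Qi(1)[OF i], symmetric])
  qed
  define F where "F r = Phi_hat_gen \<Phi> lam N (inf_hecke_rep N \<rho>0) r" for r
  define D where "D r = diag_block_mat (map (\<lambda>\<alpha>. R_gen (\<iota> lam) rt \<alpha> r) \<alpha>s)" for r
  have FV: "base_change \<iota> (F r) * map_mat fls_const (V i) = map_mat fls_const (V i) * R_gen (\<iota> lam) rt (\<alpha>s ! i) r"
    if i: "i < length \<alpha>s" and r: "r \<in> {1..<n}" for i r
  proof -
    interpret associator_form n "\<alpha>s ! i" rt \<Phi> lam \<iota> by (rule AF[OF i])
    show ?thesis unfolding F_def
      by (rule Phi_hat_intertwine[OF \<rho>0.sn_rep_axioms Vc[OF i, unfolded dsi[OF i]] inter[OF i] r])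
  qed
  define Qd where "Qd = map (\<lambda>i. map_mat fls_const (Qi i)) [0..<length \<alpha>s]"
  have QdGL: "list_all2 (\<lambda>A d. A \<in> carrier (GL d)) Qd ds"
    using GL_memI[OF Qi(1) Pic Qi(3,2)] len
    by (simp add: list_all2_conv_all_nth Qd_def GL_map_hom[OF fls_const.comm_ring_hom_axioms])
  have Qdc: "list_all2 (\<lambda>A d. A \<in> carrier_mat d d) Qd ds"
    by (rule list_all2_mono[OF QdGL]) (rule GL_carrier_mat)
  let ?Q0 = "map_mat fls_const (map_mat \<iota> Q0)"
  define Q where "Q = ?Q0 * diag_block_mat Qd"
  have Q0GL: "?Q0 \<in> carrier (GL N)"
    by (intro GL_map_hom fls_const.comm_ring_hom_axioms \<iota>.comm_ring_hom_axioms GL_memI[OF PQ0(2,1,4,3)])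
  have QdN: "diag_block_mat Qd \<in> carrier (GL N)" unfolding NM M_def by (rule diag_block_mat_GL[OF QdGL])
  have QGL: "Q \<in> carrier (GL N)" unfolding Q_def by (rule GL_mult_closed[OF Q0GL QdN])
  have QB: "Q * block_incl ds i = map_mat fls_const (V i)" if i: "i < length \<alpha>s" for i
  proof -
    have Q0c: "?Q0 \<in> carrier_mat N N" and mQ0: "map_mat \<iota> Q0 \<in> carrier_mat N N" using PQ0(2) by simp_all
    have bl: "(block_incl ds i :: 'l mat) \<in> carrier_mat N (ds ! i)" "(block_incl ds i :: 'l fls mat) \<in> carrier_mat N (ds ! i)"
      unfolding NM M_def by simp_all
    have mQ: "map_mat fls_const (Qi i) \<in> carrier_mat (ds ! i) (ds ! i)" using Qi(1)[OF i] by simp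
    have "Q * block_incl ds i = ?Q0 * (diag_block_mat Qd * block_incl ds i)"
      unfolding Q_def by (rule assoc_mult_mat[OF Q0c GL_carrier_mat[OF QdN] bl(2)])
    also have "diag_block_mat Qd * block_incl ds i = block_incl ds i * map_mat fls_const (Qi i)"
      using diag_block_mult_incl[OF Qdc, of i] i len by (simp add: Qd_def)
    also have "?Q0 * (block_incl ds i * map_mat fls_const (Qi i)) = ?Q0 * block_incl ds i * map_mat fls_const (Qi i)"
      by (rule assoc_mult_mat[OF Q0c bl(2) mQ, symmetric])
    also have "?Q0 * block_incl ds i = map_mat fls_const (map_mat \<iota> (W i))"
      unfolding W_def \<iota>.mat_hom_mult[OF PQ0(2) bi] map_block_incl[OF \<iota>.semiring_hom_axioms]
        fls_const.mat_hom_mult[OF mQ0 bl(1)] map_block_incl[OF fls_const.semiring_hom_axioms] ..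
    also have "\<dots> * map_mat fls_const (Qi i) = map_mat fls_const (V i)"
      unfolding V_def by (rule fls_const.mat_hom_mult[OF mW Qi(1)[OF i], symmetric])
    finally show ?thesis .
  qed
  obtain P where P: "Q \<in> carrier_mat N N" "P \<in> carrier_mat N N" "Q * P = 1\<^sub>m N" "P * Q = 1\<^sub>m N"
    using GL_memE[OF QGL] .
  have "base_change \<iota> (F r) * Q = Q * D r" if r: "r \<in> {1..<n}" for r
  proof -
    have Fc: "base_change \<iota> (F r) \<in> carrier_mat N N"
      unfolding F_def base_change_def using Phi_hat_gen_carrier by simp
    have Rc: "list_all2 (\<lambda>A d. A \<in> carrier_mat d d) (map (\<lambda>\<alpha>. R_gen (\<iota> lam) rt \<alpha> r) \<alpha>s) ds"
      by (simp add: list_all2_conv_all_nth ds_def R_gen_def)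
    have Dc: "D r \<in> carrier_mat N N" unfolding D_def NM M_def by (rule diag_block_carrier[OF Rc])
    have bl: "(block_incl ds i :: 'l fls mat) \<in> carrier_mat N (ds ! i)" for i
      unfolding NM M_def by simp
    show ?thesis
    proof (rule eq_mat_if_eq_on_blocks[where ds = ds and M = N])
      show "base_change \<iota> (F r) * Q \<in> carrier_mat N (sum_list ds)" "Q * D r \<in> carrier_mat N (sum_list ds)"
        using mult_carrier_mat[OF Fc P(1)] mult_carrier_mat[OF P(1) Dc] by (simp_all add: NM M_def)
      fix i assume "i < length ds"
      then have i: "i < length \<alpha>s" by (simp add: len)
      let ?R = "R_gen (\<iota> lam) rt (\<alpha>s ! i) r"
      have R: "?R \<in> carrier_mat (ds ! i) (ds ! i)" by (simp add: dsi[OF i] R_gen_def)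
      have "base_change \<iota> (F r) * Q * block_incl ds i = base_change \<iota> (F r) * map_mat fls_const (V i)"
        unfolding assoc_mult_mat[OF Fc P(1) bl] QB[OF i] ..
      also have "\<dots> = Q * block_incl ds i * ?R" unfolding FV[OF i r] QB[OF i] ..
      also have "\<dots> = Q * (block_incl ds i * ?R)" by (rule assoc_mult_mat[OF P(1) bl R])
      also have "block_incl ds i * ?R = D r * block_incl ds i"
        unfolding D_def using diag_block_mult_incl[OF Rc, of i] i len by simp
      also have "Q * (D r * block_incl ds i) = Q * D r * block_incl ds i"
        by (rule assoc_mult_mat[OF P(1) Dc bl, symmetric])
      finally show "base_change \<iota> (F r) * Q * block_incl ds i = Q * D r * block_incl ds i" .
    qed
  qed
  then show thesis
    using that[of P Q] P NM unfolding M_def ds_def F_def D_def by blast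
qed

lemma (in associator_form) R_hom:
  obtains H where "H \<in> hom (braid_group n) (GL (R_dim \<alpha>))"
    "\<And>r. r \<in> {1..<n} \<Longrightarrow> H (braid_gen n r) = R_gen (\<iota> lam) rt \<alpha> r"
    "H ` carrier (braid_group n) \<subseteq> U_eps (R_dim \<alpha>)"
proof -
  interpret B: braid_images "GL (R_dim \<alpha>)" n q.omat by (rule q.omat_braid_images)
  have gen: "B.braid_hom (braid_gen n r) = q.omat r" if "r \<in> {1..<n}" for r by (rule B.braid_hom_gen[OF that])
  show thesis
  proof (rule that)
    show "B.braid_hom \<in> hom (braid_group n) (GL (R_dim \<alpha>))" by (rule B.braid_hom_hom)
    show "B.braid_hom (braid_gen n r) = R_gen (\<iota> lam) rt \<alpha> r" if "r \<in> {1..<n}" for r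
      unfolding gen[OF that] R_gen_eq[OF that] ..
    have "B.braid_hom b \<in> U_eps (R_dim \<alpha>)" if b: "b \<in> carrier (braid_group n)" for b
    proof (rule unitary_if_gens_unitary[OF B.braid_hom_hom _ b])
      fix r assume r: "r \<in> {1..<n}"
      have c: "q.omat r - qdiff (\<iota> lam) \<cdot>\<^sub>m 1\<^sub>m (R_dim \<alpha>) \<in> carrier_mat (R_dim \<alpha>) (R_dim \<alpha>)"
        by (intro minus_carrier_mat smult_carrier_mat one_carrier_mat)
      have i: "inv\<^bsub>GL (R_dim \<alpha>)\<^esub> (q.omat r) = q.omat r - qdiff (\<iota> lam) \<cdot>\<^sub>m 1\<^sub>m (R_dim \<alpha>)"
        by (rule GL_inv_eqI[OF q.omat_carrier c q.omat_inverse[OF r]])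
      show "transpose_mat (map_mat fls_eps (inv\<^bsub>GL (R_dim \<alpha>)\<^esub> (B.braid_hom (braid_gen n r)))) = B.braid_hom (braid_gen n r)"
        unfolding gen[OF r] i by (rule omat_unitary[OF r])
    qed
    then show "B.braid_hom ` carrier (braid_group n) \<subseteq> U_eps (R_dim \<alpha>)" by blast
  qed
qed

theorem mainTheorem2:
  fixes \<Phi> :: "(xy, 'k::field_char_0) ncs"
    and lam :: 'k
    and \<iota> :: "'k \<Rightarrow> 'l::field_char_0"
    and rt :: "nat \<Rightarrow> 'l"
    and n N :: nat
    and \<rho>0 :: "(nat \<Rightarrow> nat) \<Rightarrow> 'k mat"
    and \<alpha>s :: "nat list list"
    and Ss :: "((nat \<Rightarrow> nat) \<Rightarrow> 'k mat) list"
  assumes "n \<ge> 2"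
    and "lam \<noteq> 0"
    and "\<Phi> \<in> Ass lam"
    and "even_series \<Phi>"
    and "field_hom \<iota>"
    and "\<And>d. 2 \<le> d \<Longrightarrow> d \<le> n - 1 \<Longrightarrow> (rt d)\<^sup>2 = of_nat (d\<^sup>2 - 1)"
    and "\<rho>0 \<in> hom (sym_group n) (GL N)"
    and "\<And>\<alpha>. \<alpha> \<in> set \<alpha>s \<Longrightarrow> is_partition n \<alpha>"
    and "list_all2 (is_irrep_of n) \<alpha>s Ss"
    and "rep_iso (sym_group n) N \<rho>0 (direct_sum_rep Ss)"
  shows "\<exists>F R.
      F \<in> hom (braid_group n) (GL N)
    \<and> (\<forall>i\<in>{1..n-1}. F (braid_gen n i) = Phi_hat_gen \<Phi> lam N (inf_hecke_rep N \<rho>0) i)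
    \<and> (\<forall>\<alpha>\<in>set \<alpha>s. R \<alpha> \<in> hom (braid_group n) (GL (R_dim \<alpha>))
        \<and> (\<forall>r\<in>{1..n-1}. R \<alpha> (braid_gen n r) = R_gen (\<iota> lam) rt \<alpha> r))
    \<and> rep_iso (braid_group n) N (\<lambda>b. base_change \<iota> (F b)) (direct_sum_rep (map R \<alpha>s))
    \<and> ((\<exists>(j :: 'k \<Rightarrow> real) (j' :: 'l \<Rightarrow> real).
          field_hom j \<and> field_hom j' \<and> (\<forall>a. j' (\<iota> a) = j a)
          \<and> (\<forall>d. 2 \<le> d \<longrightarrow> d \<le> n - 1 \<longrightarrow> j' (rt d) > 0))
        \<longrightarrow> (\<forall>\<alpha>\<in>set \<alpha>s. R \<alpha> ` carrier (braid_group n) \<subseteq> U_eps (R_dim \<alpha>)))"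
proof -
  note lam = assms(2) and hom = assms(5) and rt = assms(6) and part = assms(8)
  interpret A: even_associator \<Phi> lam \<iota> by (rule even_associator.intro[OF assms(3,4,5)])
  define ds where "ds = map R_dim \<alpha>s"
  define X where "X r = Phi_hat_gen \<Phi> lam N (inf_hecke_rep N \<rho>0) r" for r
  let ?z = "fps_exp lam - fps_exp (- lam)"
  have AF: "associator_form n \<alpha> rt \<Phi> lam \<iota>" if "\<alpha> \<in> set \<alpha>s" for \<alpha>
    by (intro associator_form.intro A.even_associator_axioms associator_form_axioms.intro lam)
      (unfold_locales, use part that rt in auto)
  have "\<exists>H. H \<in> hom (braid_group n) (GL (R_dim \<alpha>)) \<and> (\<forall>r\<in>{1..<n}. H (braid_gen n r) = R_gen (\<iota> lam) rt \<alpha> r)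
      \<and> H ` carrier (braid_group n) \<subseteq> U_eps (R_dim \<alpha>)" if "\<alpha> \<in> set \<alpha>s" for \<alpha>
    using associator_form.R_hom[OF AF[OF that]] by metis
  then obtain R where R: "\<And>\<alpha>. \<alpha> \<in> set \<alpha>s \<Longrightarrow> R \<alpha> \<in> hom (braid_group n) (GL (R_dim \<alpha>))"
    "\<And>\<alpha> r. \<alpha> \<in> set \<alpha>s \<Longrightarrow> r \<in> {1..<n} \<Longrightarrow> R \<alpha> (braid_gen n r) = R_gen (\<iota> lam) rt \<alpha> r"
    "\<And>\<alpha>. \<alpha> \<in> set \<alpha>s \<Longrightarrow> R \<alpha> ` carrier (braid_group n) \<subseteq> U_eps (R_dim \<alpha>)"
    by metis
  obtain P Q where N: "N = sum_list ds" and P: "P \<in> carrier_mat N N" and Q: "Q \<in> carrier_mat N N"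
    and PQ: "P * Q = 1\<^sub>m N" "Q * P = 1\<^sub>m N"
    and conj: "\<And>r. r \<in> {1..<n} \<Longrightarrow> base_change \<iota> (X r) * Q = Q * diag_block_mat (map (\<lambda>\<alpha>. R_gen (\<iota> lam) rt \<alpha> r) \<alpha>s)"
    using A.Phi_hat_block_conjugation[OF lam rt assms(7) part assms(9,10)] unfolding ds_def X_def by metis
  define D where "D = direct_sum_rep (map R \<alpha>s)"
  have Dhom: "D \<in> hom (braid_group n) (GL N)"
    unfolding D_def N by (rule direct_sum_hom) (simp add: list_all2_conv_all_nth ds_def R(1))
  have Dgen: "D (braid_gen n r) = diag_block_mat (map (\<lambda>\<alpha>. R_gen (\<iota> lam) rt \<alpha> r) \<alpha>s)" if "r \<in> {1..<n}" for r
  proof -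
    have "map (\<lambda>H. H (braid_gen n r)) (map R \<alpha>s) = map (\<lambda>\<alpha>. R_gen (\<iota> lam) rt \<alpha> r) \<alpha>s"
      using R(2) that by simp
    then show ?thesis unfolding D_def direct_sum_rep_def by (rule arg_cong)
  qed
  interpret B: braid_images "braid_group n" n "braid_gen n" by (rule braid_images_braid_gen)
  \<comment> \<open>Over k'((h)) a homomorphism with the required values on generators is at hand:
    the direct sum D, conjugated. What remains is to descend it to k[[h]].\<close>
  define K where "K b = Q * D b * P" for b
  have Khom: "K \<in> hom (braid_group n) (GL N)"
    unfolding K_def by (rule conjugate_hom[OF Dhom P Q PQ])
  have Dc: "D b \<in> carrier_mat N N" if "b \<in> carrier (braid_group n)" for b
    using Dhom that GL_carrier_mat unfolding hom_def by blast
  have Xc: "X r \<in> carrier_mat N N" for r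
    unfolding X_def by (rule Phi_hat_gen_carrier)
  have bX: "base_change \<iota> (X r) \<in> carrier_mat N N" for r using Xc by (simp add: base_change_def)
  have KX: "K (braid_gen n r) = base_change \<iota> (X r)" if r: "r \<in> {1..<n}" for r
  proof -
    have "K (braid_gen n r) = base_change \<iota> (X r) * Q * P" unfolding K_def Dgen[OF r] conj[OF r] ..
    also have "\<dots> = base_change \<iota> (X r)"
      unfolding assoc_mult_mat[OF bX Q P] PQ(2) by (rule right_mult_one_mat[OF bX])
    finally show ?thesis .
  qed
  have Kmult: "K (x \<otimes>\<^bsub>braid_group n\<^esub> y) = K x * K y"
    if "x \<in> carrier (braid_group n)" "y \<in> carrier (braid_group n)" for x y
    using Khom that by (simp add: hom_def GL_mult)
  have inj: "A = B" if "base_change \<iota> A = base_change \<iota> B" for A B :: "'k fps mat"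
    using that unfolding A.base_change_lift by (rule A.lift.mat_hom_inj)
  have bmult: "base_change \<iota> (A * B) = base_change \<iota> A * base_change \<iota> B"
    if "A \<in> carrier_mat N N" "B \<in> carrier_mat N N" for A B
    unfolding A.base_change_lift by (rule A.lift.mat_hom_mult[OF that])
  \<comment> \<open>Each block satisfies the Hecke relation with one and the same coefficient q -
    1/q, hence so does the direct sum.\<close>
  have DD: "D (braid_gen n r) * D (braid_gen n r) = qdiff (\<iota> lam) \<cdot>\<^sub>m D (braid_gen n r) + 1\<^sub>m N" if r: "r \<in> {1..<n}" for r
  proof (rule eq_mat_if_eq_on_blocks[where ds = ds and M = N])
    let ?D = "D (braid_gen n r)" and ?q = "qdiff (\<iota> lam)"
    have c: "?D \<in> carrier_mat N N" by (rule Dc[OF B.X_closed[OF r]])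
    show "?D * ?D \<in> carrier_mat N (sum_list ds)" "?q \<cdot>\<^sub>m ?D + 1\<^sub>m N \<in> carrier_mat N (sum_list ds)"
      using c mult_carrier_mat[OF c c] by (simp_all add: N)
    fix i assume "i < length ds"
    then have i: "i < length \<alpha>s" by (simp add: ds_def)
    then have mem: "\<alpha>s ! i \<in> set \<alpha>s" and dsi: "ds ! i = R_dim (\<alpha>s ! i)" by (simp_all add: ds_def)
    interpret associator_form n "\<alpha>s ! i" rt \<Phi> lam \<iota> by (rule AF[OF mem])
    let ?B = "block_incl ds i" and ?R = "q.omat r"
    have Rc: "list_all2 (\<lambda>A d. A \<in> carrier_mat d d) (map (\<lambda>\<alpha>. R_gen (\<iota> lam) rt \<alpha> r) \<alpha>s) ds"
      by (simp add: list_all2_conv_all_nth ds_def R_gen_def)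
    have DB: "?D * ?B = ?B * ?R"
      unfolding Dgen[OF r] R_gen_eq[OF r, symmetric]
      using diag_block_mult_incl[OF Rc, of i] i by (simp add: ds_def)
    have Bc: "?B \<in> carrier_mat N (ds ! i)" unfolding N by simp
    have R: "?R \<in> carrier_mat (ds ! i) (ds ! i)" unfolding dsi by simp
    have qR: "?q \<cdot>\<^sub>m ?R \<in> carrier_mat (ds ! i) (ds ! i)" using R by simp
    have "?D * ?D * ?B = ?D * ?B * ?R"
      unfolding assoc_mult_mat[OF c c Bc] DB assoc_mult_mat[OF c Bc R, symmetric] ..
    also have "\<dots> = ?B * (?R * ?R)" unfolding DB by (rule assoc_mult_mat[OF Bc R R])
    also have "\<dots> = ?B * (?q \<cdot>\<^sub>m ?R) + ?B * 1\<^sub>m (ds ! i)"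
      unfolding q.omat_square[OF r] dsi[symmetric] by (rule mult_add_distrib_mat[OF Bc qR one_carrier_mat])
    also have "\<dots> = ?q \<cdot>\<^sub>m (?D * ?B) + 1\<^sub>m N * ?B"
      unfolding mult_smult_distrib[OF Bc R] DB right_mult_one_mat[OF Bc] left_mult_one_mat[OF Bc] ..
    also have "\<dots> = (?q \<cdot>\<^sub>m ?D + 1\<^sub>m N) * ?B"
      unfolding mult_smult_assoc_mat[OF c Bc, symmetric]
      by (rule add_mult_distrib_mat[OF smult_carrier_mat[OF c] one_carrier_mat Bc, symmetric])
    finally show "?D * ?D * ?B = (?q \<cdot>\<^sub>m ?D + 1\<^sub>m N) * ?B" .
  qed
  \<comment> \<open>The coefficient q - 1/q comes from k[[h]], so the relation descends along the
    injective base change. It yields an inverse with entries in k[[h]], which invertibility over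
    k'((h)) alone would not give.\<close>
  have XX: "X r * X r = ?z \<cdot>\<^sub>m X r + 1\<^sub>m N" if r: "r \<in> {1..<n}" for r
  proof (rule inj)
    let ?D = "D (braid_gen n r)" and ?q = "qdiff (\<iota> lam)"
    have c: "?D \<in> carrier_mat N N" by (rule Dc[OF B.X_closed[OF r]])
    have QD: "Q * ?D \<in> carrier_mat N N" by (rule mult_carrier_mat[OF Q c])
    have "base_change \<iota> (X r * X r) = Q * ?D * P * (Q * ?D * P)"
      unfolding bmult[OF Xc Xc] KX[OF r, symmetric] K_def ..
    also have "\<dots> = Q * ?D * (P * Q) * (?D * P)"
      using P Q c QD by (simp add: assoc_mult_mat[of _ N N _ N _ N])
    also have "\<dots> = Q * (?D * ?D) * P"
      unfolding PQ(1) right_mult_one_mat[OF QD] using P Q c by (simp add: assoc_mult_mat[of _ N N _ N _ N])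
    also have "\<dots> = Q * (?q \<cdot>\<^sub>m ?D) * P + Q * 1\<^sub>m N * P"
      unfolding DD[OF r] mult_add_distrib_mat[OF Q smult_carrier_mat[OF c] one_carrier_mat]
      by (rule add_mult_distrib_mat[of _ N N]) (use P Q c in auto)
    also have "\<dots> = ?q \<cdot>\<^sub>m (Q * ?D * P) + 1\<^sub>m N"
      unfolding mult_smult_distrib[OF Q c] mult_smult_assoc_mat[OF QD P] right_mult_one_mat[OF Q] PQ(2) ..
    also have "Q * ?D * P = base_change \<iota> (X r)" unfolding KX[OF r, symmetric] K_def ..
    also have "?q \<cdot>\<^sub>m base_change \<iota> (X r) + 1\<^sub>m N = base_change \<iota> (?z \<cdot>\<^sub>m X r + 1\<^sub>m N)"
      unfolding A.base_change_lift A.lift_exp[symmetric]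
      by (rule eq_matI) (use Xc[of r] in \<open>auto simp: A.lift.hom_add A.lift.hom_mult\<close>)
    finally show "base_change \<iota> (X r * X r) = base_change \<iota> (?z \<cdot>\<^sub>m X r + 1\<^sub>m N)" .
  qed
  have GLX: "X r \<in> carrier (GL N)" if "r \<in> {1..<n}" for r
    by (rule quadratic_GL[OF Xc XX[OF that]])
  interpret F: braid_images "GL N" n X
  proof -
    interpret G: group "GL N :: 'k fps mat monoid" by (rule GL_group)
    show "braid_images (GL N) n X"
    proof
      fix i assume "i \<in> {1..<n}"
      then show "X i \<in> carrier (GL N)" by (rule GLX)
    next
      fix i j assume ij: "i \<in> {1..<n}" "j \<in> {1..<n}" "i + 2 \<le> j"
      \<comment> \<open>The relation holds for the values of the homomorphism K and is pulled back
        by injectivity of the base change.\<close>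
      have "base_change \<iota> (X i * X j) = base_change \<iota> (X j * X i)"
        unfolding bmult[OF Xc Xc] KX[OF ij(1), symmetric] KX[OF ij(2), symmetric]
          Kmult[OF B.X_closed[OF ij(1)] B.X_closed[OF ij(2)], symmetric]
          Kmult[OF B.X_closed[OF ij(2)] B.X_closed[OF ij(1)], symmetric] B.X_far[OF ij] ..
      then show "X i \<otimes>\<^bsub>GL N\<^esub> X j = X j \<otimes>\<^bsub>GL N\<^esub> X i" unfolding GL_mult by (rule inj)
    next
      fix i assume i: "i \<in> {1..<n}" "i + 1 \<in> {1..<n}"
      have "base_change \<iota> (X i * X (i + 1) * X i) = base_change \<iota> (X (i + 1) * X i * X (i + 1))"
        unfolding bmult[OF mult_carrier_mat[OF Xc Xc] Xc] bmult[OF Xc Xc] KX[OF i(1), symmetric] KX[OF i(2), symmetric]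
        using B.X_adjacent[OF i] B.X_closed[OF i(1)] B.X_closed[OF i(2)] by (simp only: Kmult[symmetric] B.m_closed)
      then show "X i \<otimes>\<^bsub>GL N\<^esub> X (i + 1) \<otimes>\<^bsub>GL N\<^esub> X i = X (i + 1) \<otimes>\<^bsub>GL N\<^esub> X i \<otimes>\<^bsub>GL N\<^esub> X (i + 1)"
        unfolding GL_mult by (rule inj)
    qed
  qed
  have ranges: "{1..n - 1} = {1..<n}" using assms(1) by auto
  have bF: "(\<lambda>b. base_change \<iota> (F.braid_hom b)) \<in> hom (braid_group n) (GL N)"
  proof (rule homI)
    have FGL: "F.braid_hom b \<in> carrier (GL N)" if "b \<in> carrier (braid_group n)" for b
      using F.braid_hom_hom that by (auto simp: hom_def)
    show "base_change \<iota> (F.braid_hom b) \<in> carrier (GL N)" if "b \<in> carrier (braid_group n)" for b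
      unfolding A.base_change_lift by (rule GL_map_hom[OF A.lift.comm_ring_hom_axioms FGL[OF that]])
    show "base_change \<iota> (F.braid_hom (x \<otimes>\<^bsub>braid_group n\<^esub> y))
        = base_change \<iota> (F.braid_hom x) \<otimes>\<^bsub>GL N\<^esub> base_change \<iota> (F.braid_hom y)"
      if "x \<in> carrier (braid_group n)" "y \<in> carrier (braid_group n)" for x y
      unfolding GL_mult bmult[OF GL_carrier_mat[OF FGL[OF that(1)]] GL_carrier_mat[OF FGL[OF that(2)]], symmetric]
      using F.braid_hom_hom that by (simp add: hom_def GL_mult)
  qed
  have FK: "base_change \<iota> (F.braid_hom b) = K b" if "b \<in> carrier (braid_group n)" for b
    by (rule hom_braid_group_eqI[OF GL_group bF Khom _ that]) (simp only: F.braid_hom_gen KX)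
  have iso: "rep_iso (braid_group n) N (\<lambda>b. base_change \<iota> (F.braid_hom b)) (direct_sum_rep (map R \<alpha>s))"
    unfolding rep_iso_def D_def[symmetric]
  proof (intro bexI[of _ P] ballI GL_memI[OF P Q PQ])
    fix b assume b: "b \<in> carrier (braid_group n)"
    have "P * (Q * D b * P) = P * Q * (D b * P)"
      using P Q Dc[OF b] by (simp add: assoc_mult_mat[of _ N N _ N _ N])
    also have "\<dots> = D b * P" unfolding PQ(1) by (rule left_mult_one_mat[OF mult_carrier_mat[OF Dc[OF b] P]])
    finally show "P * base_change \<iota> (F.braid_hom b) = D b * P" unfolding FK[OF b] K_def .
  qed
  show ?thesis
    unfolding ranges
  proof (intro exI[of _ F.braid_hom] exI[of _ R] conjI ballI impI)
    show "F.braid_hom \<in> hom (braid_group n) (GL N)" by (rule F.braid_hom_hom)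
    show "F.braid_hom (braid_gen n i) = Phi_hat_gen \<Phi> lam N (inf_hecke_rep N \<rho>0) i" if "i \<in> {1..<n}" for i
      unfolding F.braid_hom_gen[OF that] X_def ..
    show "rep_iso (braid_group n) N (\<lambda>b. base_change \<iota> (F.braid_hom b)) (direct_sum_rep (map R \<alpha>s))"
      by (rule iso)
  qed (use R in blast)+
qed

end
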